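(* Suppose that: (i) there exist a nondecreasing sequence $a_n=o(n)$ and some $\eta'\in\mathcal H$ such that $e_n:=a_n\max_{1\le i\le n}\|\Delta_{\eta',i}-\Delta_{\eta_0,i}\|_{\rm F}^2\to0$, and $\max_{1\le i\le n}\|\Delta_{\eta_1,i}-\Delta_{\eta_2,i}\|_{\rm F}^2\le a_n d_{B,n}^2(\eta_1,\eta_2)$ for all $\eta_1,\eta_2\in\mathcal H$; (ii) $\bar\epsilon_n>0$ is a sequence with $a_n\bar\epsilon_n^2\to0$, $n\bar\epsilon_n^2\to\infty$ and $\log\Pi(\eta\in\mathcal H:d_n(\eta,\eta_0)\le\bar\epsilon_n)\gtrsim -n\bar\epsilon_n^2$; (iii) $\|\theta_0\|_\infty\lesssim\lambda^{-1}\log p$; (iv) $1\lesssim\min_{1\le i\le n}\rho_{\min}(\Delta_{\eta_0,i})\le\max_{1\le i\le n}\rho_{\max}(\Delta_{\eta_0,i})\lesssim1$; (v) for $s_\star=s_0\vee(n\bar\epsilon_n^2/\log p)$, a sufficiently large constant $B>0$, and some sequences $\gamma_n$ and $\epsilon_n\ge\sqrt{s_\star\log(p\vee\overline m\vee\gamma_n)/n}$ with $\epsilon_n^2/\overline m\to0$, there exists a subset $\mathcal H_n\subset\mathcal H$ such that $$\min_{1\le i\le n}\inf_{\eta\in\mathcal H_n}\rho_{\min}(\Delta_{\eta,i})\ge\frac1{\gamma_n},\quad \log N\Big(\frac1{6\overline m\gamma_nn^{3/2}},\mathcal H_n,d_n\Big)\lesssim n\epsilon_n^2,\quad e^{Bs_\star\log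 p}\,\Pi(\mathcal H\setminus\mathcal H_n)\to0.$$ Then there exists a constant $K_2$ such that $$\mathbb E_0\Pi\left((\theta,\eta):R_n(p_{\theta,\eta},p_0)>K_2\epsilon_n^2\,\big|\,Y^{(n)}\right)\to0.$$
   Context: All quantities may depend on $n$; limits are as $n\to\infty$. $a\vee b=\max(a,b)$. $a_n\lesssim b_n$ (or $b_n\gtrsim a_n$) means $a_n\le Cb_n$ for a constant $C>0$ independent of $n$. A condition holding "for a sufficiently large constant" means with a constant exceeding a threshold that depends only on the constants in the remaining assumptions, not on $n$. Model: independent $Y_i\in\mathbb R^{m_i}$, $1\le m_i\le\overline m$, $i=1,\dots,n$, with $Y_i=X_i\theta+\xi_{\eta,i}+\varepsilon_i$, $\varepsilon_i\sim{\rm N}_{m_i}(0,\Delta_{\eta,i})$ independent, where $X_i\in\mathbb R^{m_i\times p}$ is fixed, $p>n$, $\theta\in\Theta=\mathbb R^p$, $\eta$ is a (possibly infinite-dimensional) nuisance parameter in a set $\mathbb H$, $\xi_{\eta,i}\in\mathbb R^{m_i}$, and $\Delta_{\eta,i}$ is an $m_i\times m_i$ positive definite matrix. $Y^{(n)}=(Y_1^T,\dots,Y_n^T)^T$, $X=(X_1^T,\dots,X_n^T)^T$. $p_{\theta,\eta}=\prod_ip_{\theta,\eta,i}$ is the joint density, with $p_{\theta,\eta,i}$ the density of $Y_i$. The true parameters are $\theta_0\in\Theta$, $\eta_0\in\mathbb H$; $p_0=p_{\theta_0,\eta_0}$ and $\mathbb E_0$ is expectation under $p_0$. $S_\theta=\{j:\theta_j\ne0\}$,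 $s_\theta=|S_\theta|$, $s_0=s_{\theta_0}$; for $S\subset\{1,\dots,p\}$, $s=|S|$ and $\theta_S=(\theta_j)_{j\in S}$. $\rho_{\min},\rho_{\max}$ are extreme eigenvalues, $\|\cdot\|_{\rm F}$ the Frobenius norm, $\|X\|_\ast=\max_j\|X_{\cdot j}\|_2$. For product densities $f=\prod_{i=1}^nf_i$, $g=\prod_{i=1}^ng_i$, the average R\'enyi divergence of order $1/2$ is $R_n(f,g)=-n^{-1}\sum_{i=1}^n\log\int\sqrt{f_ig_i}$. $d_n^2=d_{A,n}^2+d_{B,n}^2$ with $d_{A,n}^2(\eta_1,\eta_2)=n^{-1}\sum_{i=1}^n\|\xi_{\eta_1,i}-\xi_{\eta_2,i}\|_2^2$ and $d_{B,n}^2(\eta_1,\eta_2)=n^{-1}\sum_{i=1}^n\|\Delta_{\eta_1,i}-\Delta_{\eta_2,i}\|_{\rm F}^2$. $N(\epsilon,\mathcal F,d)$ is the $\epsilon$-covering number. Prior: $\theta$ and $\eta$ are a priori independent; $\eta$ has a prior on a subset $\mathcal H\subset\mathbb H$. For $\theta$: draw $s$ from $\pi_p$ on $\{0,\dots,p\}$, $S$ uniformly among subsets of size $s$, $\theta_S$ from density $g_S(\theta_S)=\prod_{j\in S}\frac\lambda2e^{-\lambda|\theta_j|}$, and set $\theta_{S^c}=0$. For constants $A_1,\dots,A_4>0$, $A_1p^{-A_3}\pi_p(s-1)\le\pi_p(s)\le A_2p^{-A_4}\pi_p(s-1)$ for $s=1,\dots,p$; for constants $L_1,L_2,L_3>0$,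 $\|X\|_\ast/(L_1p^{L_2})\le\lambda\le L_3\|X\|_\ast/\sqrt n$. $\Pi(\cdot\,|\,Y^{(n)})$ is the posterior. *)

theory Defs
  imports
    "HOL-Probability.Probability"
    "HOL-Library.Extended_Nat"
    "HOL-Library.Landau_Symbols"
    "Jordan_Normal_Form.Spectral_Radius"
    "Jordan_Normal_Form.Gauss_Jordan_Elimination"
begin

text \<open>
  Block sizes, the number of predictors and the number of observations vary, so vectors and matrices
  are those of \<^theory>\<open>Jordan_Normal_Form.Matrix\<close>; all indices are 0-based. Where a measurable space
  of vectors is needed (observations, regression coefficients), a vector of length \<open>k\<close> is a function
  on \<open>{..<k}\<close>.
\<close>

no_notation vec_nth (infixl "$" 90)
hide_const (open) Determinants.det

definition norm2_vec :: "real vec \<Rightarrow> real" where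
  "norm2_vec v = sqrt (v \<bullet> v)"

definition frob_norm :: "real mat \<Rightarrow> real" where
  "frob_norm A = sqrt (\<Sum>k<dim_row A. \<Sum>l<dim_col A. (A $$ (k, l))\<^sup>2)"

definition pos_def_mat :: "nat \<Rightarrow> real mat \<Rightarrow> bool" where
  "pos_def_mat k A \<longleftrightarrow>
     A \<in> carrier_mat k k \<and> transpose_mat A = A \<and>
     (\<forall>v\<in>carrier_vec k. v \<noteq> 0\<^sub>v k \<longrightarrow> 0 < v \<bullet> (A *\<^sub>v v))"

text \<open>Only used for symmetric matrices of positive size, whose spectrum is finite and nonempty and,
  over the reals, contains all eigenvalues.\<close>

definition rho_min :: "real mat \<Rightarrow> real" where
  "rho_min A = Min (spectrum A)"

definition rho_max :: "real mat \<Rightarrow> real" where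
  "rho_max A = Max (spectrum A)"

definition mvn_density :: "nat \<Rightarrow> real vec \<Rightarrow> real mat \<Rightarrow> real vec \<Rightarrow> real" where
  "mvn_density k \<mu> D y =
     (2 * pi) powr (- real k / 2) * Determinant.det D powr (- 1 / 2) *
     exp (- ((y - \<mu>) \<bullet> (the (mat_inverse D) *\<^sub>v (y - \<mu>))) / 2)"

definition avg_renyi ::
  "nat \<Rightarrow> (nat \<Rightarrow> 'a measure) \<Rightarrow> (nat \<Rightarrow> 'a \<Rightarrow> real) \<Rightarrow> (nat \<Rightarrow> 'a \<Rightarrow> real) \<Rightarrow> real" where
  "avg_renyi n \<mu> f g = - (\<Sum>i<n. ln (\<integral>y. sqrt (f i y * g i y) \<partial>\<mu> i)) / real n"

text \<open>Least number of closed balls of radius \<open>r\<close>, with centres in the ambient set \<open>U\<close>, covering \<open>F\<close>;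
  it is \<open>\<infinity>\<close> if no finite cover exists.\<close>

definition covering_number :: "'a set \<Rightarrow> real \<Rightarrow> 'a set \<Rightarrow> ('a \<Rightarrow> 'a \<Rightarrow> real) \<Rightarrow> enat" where
  "covering_number U r F d =
     (INF C \<in> {C. finite C \<and> C \<subseteq> U \<and> F \<subseteq> (\<Union>c\<in>C. {x. d c x \<le> r})}. enat (card C))"

text \<open>One element of this type holds everything that belongs to one sample size \<open>n = nobs M\<close>; an
  asymptotic statement concerns a sequence of such elements. The field \<open>nuis\<close> is the nuisance
  parameter set, whereas the set carrying the nuisance prior is the space of \<open>eta_prior\<close>.\<close>

record 'h model =
  nobs :: nat
  npred :: nat
  bsize :: "nat \<Rightarrow> nat"
  bmax :: nat
  design :: "nat \<Rightarrow> real mat"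
  nuis :: "'h set"
  xi :: "'h \<Rightarrow> nat \<Rightarrow> real vec"
  Delta :: "'h \<Rightarrow> nat \<Rightarrow> real mat"
  theta0 :: "nat \<Rightarrow> real"
  eta0 :: 'h
  size_prior :: "nat pmf"
  rate :: real
  eta_prior :: "'h measure"

text \<open>The measurability clauses make the likelihood jointly measurable, so that Bayes' formula
  defines the posterior.\<close>

definition valid_model :: "'h model \<Rightarrow> bool" where
  "valid_model M \<longleftrightarrow>
     nobs M < npred M \<and>
     (\<forall>i<nobs M. 1 \<le> bsize M i \<and> bsize M i \<le> bmax M \<and>
        design M i \<in> carrier_mat (bsize M i) (npred M) \<and>
        (\<forall>\<eta>\<in>nuis M. xi M \<eta> i \<in> carrier_vec (bsize M i) \<and> pos_def_mat (bsize M i) (Delta M \<eta> i))) \<and>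
     eta0 M \<in> nuis M \<and>
     set_pmf (size_prior M) \<subseteq> {..npred M} \<and>
     0 < rate M \<and>
     prob_space (eta_prior M) \<and>
     space (eta_prior M) \<subseteq> nuis M \<and>
     (\<forall>i<nobs M. \<forall>k<bsize M i.
        (\<lambda>\<eta>. xi M \<eta> i $ k) \<in> borel_measurable (eta_prior M) \<and>
        (\<forall>l<bsize M i. (\<lambda>\<eta>. Delta M \<eta> i $$ (k, l)) \<in> borel_measurable (eta_prior M)))"

text \<open>Largest Euclidean norm of a column of the vertically stacked design matrix.\<close>

definition design_norm :: "'h model \<Rightarrow> real" where
  "design_norm M =
     Max ((\<lambda>j. sqrt (\<Sum>i<nobs M. \<Sum>k<bsize M i. (design M i $$ (k, j))\<^sup>2)) ` {..<npred M})"

definition sparsity :: "'h model \<Rightarrow> (nat \<Rightarrow> real) \<Rightarrow> nat" where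
  "sparsity M \<theta> = card {j. j < npred M \<and> \<theta> j \<noteq> 0}"

definition dA :: "'h model \<Rightarrow> 'h \<Rightarrow> 'h \<Rightarrow> real" where
  "dA M \<eta>1 \<eta>2 = sqrt ((\<Sum>i<nobs M. (norm2_vec (xi M \<eta>1 i - xi M \<eta>2 i))\<^sup>2) / real (nobs M))"

definition dB :: "'h model \<Rightarrow> 'h \<Rightarrow> 'h \<Rightarrow> real" where
  "dB M \<eta>1 \<eta>2 = sqrt ((\<Sum>i<nobs M. (frob_norm (Delta M \<eta>1 i - Delta M \<eta>2 i))\<^sup>2) / real (nobs M))"

definition dn :: "'h model \<Rightarrow> 'h \<Rightarrow> 'h \<Rightarrow> real" where
  "dn M \<eta>1 \<eta>2 = sqrt ((dA M \<eta>1 \<eta>2)\<^sup>2 + (dB M \<eta>1 \<eta>2)\<^sup>2)"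

definition max_Delta_dist2 :: "'h model \<Rightarrow> 'h \<Rightarrow> 'h \<Rightarrow> real" where
  "max_Delta_dist2 M \<eta>1 \<eta>2 = Max ((\<lambda>i. (frob_norm (Delta M \<eta>1 i - Delta M \<eta>2 i))\<^sup>2) ` {..<nobs M})"

definition block_base :: "'h model \<Rightarrow> nat \<Rightarrow> (nat \<Rightarrow> real) measure" where
  "block_base M i = Pi\<^sub>M {..<bsize M i} (\<lambda>_. lborel)"

definition block_density :: "'h model \<Rightarrow> (nat \<Rightarrow> real) \<times> 'h \<Rightarrow> nat \<Rightarrow> (nat \<Rightarrow> real) \<Rightarrow> real" where
  "block_density M = (\<lambda>(\<theta>, \<eta>) i y.
     mvn_density (bsize M i) (design M i *\<^sub>v vec (npred M) \<theta> + xi M \<eta> i) (Delta M \<eta> i)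
       (vec (bsize M i) y))"

definition joint_density :: "'h model \<Rightarrow> (nat \<Rightarrow> real) \<times> 'h \<Rightarrow> (nat \<Rightarrow> nat \<Rightarrow> real) \<Rightarrow> real" where
  "joint_density M z Y = (\<Prod>i<nobs M. block_density M z i (Y i))"

definition data_dist :: "'h model \<Rightarrow> (nat \<Rightarrow> real) \<times> 'h \<Rightarrow> (nat \<Rightarrow> nat \<Rightarrow> real) measure" where
  "data_dist M z =
     density (Pi\<^sub>M {..<nobs M} (block_base M)) (\<lambda>Y. ennreal (joint_density M z Y))"

definition renyi_div :: "'h model \<Rightarrow> (nat \<Rightarrow> real) \<times> 'h \<Rightarrow> (nat \<Rightarrow> real) \<times> 'h \<Rightarrow> real" where
  "renyi_div M z z' = avg_renyi (nobs M) (block_base M) (block_density M z) (block_density M z')"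

definition slab_measure :: "nat \<Rightarrow> real \<Rightarrow> nat set \<Rightarrow> (nat \<Rightarrow> real) measure" where
  "slab_measure p r S =
     distr (density (Pi\<^sub>M S (\<lambda>_. lborel)) (\<lambda>t. ennreal (\<Prod>j\<in>S. r / 2 * exp (- r * \<bar>t j\<bar>))))
       (Pi\<^sub>M {..<p} (\<lambda>_. borel))
       (\<lambda>t. \<lambda>j\<in>{..<p}. if j \<in> S then t j else 0)"

definition support_prior :: "'h model \<Rightarrow> nat set pmf" where
  "support_prior M =
     bind_pmf (size_prior M) (\<lambda>s. pmf_of_set {S. S \<subseteq> {..<npred M} \<and> card S = s})"

text \<open>The intersection only makes the kernel a probability measure for every argument: the support
  prior is concentrated on subsets of \<open>{..<npred M}\<close>.\<close>

definition theta_prior :: "'h model \<Rightarrow> (nat \<Rightarrow> real) measure" where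
  "theta_prior M =
     Giry_Monad.bind (measure_pmf (support_prior M))
       (\<lambda>S. slab_measure (npred M) (rate M) (S \<inter> {..<npred M}))"

definition prior :: "'h model \<Rightarrow> ((nat \<Rightarrow> real) \<times> 'h) measure" where
  "prior M = theta_prior M \<Otimes>\<^sub>M eta_prior M"

definition posterior :: "'h model \<Rightarrow> (nat \<Rightarrow> nat \<Rightarrow> real) \<Rightarrow> ((nat \<Rightarrow> real) \<times> 'h) measure" where
  "posterior M Y =
     density (prior M)
       (\<lambda>z. ennreal (joint_density M z Y) / (\<integral>\<^sup>+z'. ennreal (joint_density M z' Y) \<partial>prior M))"

definition expected_posterior :: "'h model \<Rightarrow> ((nat \<Rightarrow> real) \<times> 'h) set \<Rightarrow> ennreal" where
  "expected_posterior M A =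
     (\<integral>\<^sup>+Y. emeasure (posterior M Y) A \<partial>data_dist M (theta0 M, eta0 M))"

definition s_star :: "'h model \<Rightarrow> real \<Rightarrow> real" where
  "s_star M e = max (real (sparsity M (theta0 M))) (real (nobs M) * e\<^sup>2 / ln (real (npred M)))"

end

theory Submission
  imports Defs "HOL-Real_Asymp.Real_Asymp"
begin

text \<open>
  No test functions are constructed. The posterior mass of a set is a quotient \<open>N / D\<close> of integrated
  likelihoods and is at most 1.

  The denominator is controlled by \<open>V\<close>, the integral of \<open>p\<^sub>0\<^sup>2 / D\<close>. Restricting the prior to
  a neighbourhood of the truth and applying Cauchy--Schwarz to \<open>p\<close> and \<open>1 / p\<close> bounds \<open>V\<close> by the
  reciprocal prior mass of the neighbourhood times the largest \<open>\<chi>\<^sup>2\<close>-type integral of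
  \<open>p\<^sub>0\<^sup>2 / p\<close> on it; for Gaussian blocks the latter is of second order in the perturbations of
  mean and covariance, by the Hadamard-type inequality \<open>det P \<le> det P\<^sub>0 exp (tr (P\<^sub>0\<^sup>-\<^sup>1 P) - k)\<close>.
  Hence \<open>V\<close> is at most \<open>exp (c s\<^sub>\<star> log p)\<close>.

  Outside a sieve of sparse, bounded coefficients the prior mass beats this bound. The sieve is cut
  into \<open>exp (O (n \<epsilon>\<^sub>n\<^sup>2))\<close> cells so small that all densities of a cell lie below one
  slightly tempered Gaussian \<open>u\<close> centred at a member \<open>q\<close> of the cell, with \<open>u\<^sup>2 / q\<close> of bounded
  integral. Splitting according to the sizes of \<open>D / p\<^sub>0\<close> and \<open>u / q\<close> bounds the expectation of
  \<open>min 1 (u / D)\<close> by \<open>V\<close>, the affinity of \<open>p\<^sub>0\<close> and \<open>q\<close>, and the integral of \<open>u\<^sup>2 / q\<close>, each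
  with a free weight. The affinity is \<open>exp (- n R\<^sub>n)\<close>, which pays for all cells once the
  constant in front of \<open>\<epsilon>\<^sub>n\<^sup>2\<close> is large.
\<close>

section \<open>Positive definite matrices\<close>

text \<open>A ratio of normal densities is unbounded in the data as soon as the covariances differ,
  so closeness of parameters alone does not bound a cell. Tempering by 1 - 2\<beta> gives a uniform
  bound at the price of a factor exp(O(\<beta> n mbar)). This forces \<beta> of order 1/(n mbar) and
  explains the covering radius: passing from the average in \<open>dn\<close> to a single block
  costs sqrt n, \<beta> costs n mbar, and \<gamma> enters because only relative errors of
  covariances matter. V is the mean of p0 / D under the truth. Using it instead of a lower bound for
  D on a likely event makes every estimate an expectation, with no exceptional event to carry along.
  The block size may grow, so no constant may depend on it: operator norms are read off quadratic
  forms, and only the perturbation itself is measured in Frobenius norm. The true \<eta>0 may lie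
  outside the space of the prior, so covariances near the truth are compared through \<eta>'. The
  centre of a covering ball need not satisfy the eigenvalue or Renyi conditions; a member of the
  cell does.\<close>

no_notation Inner_Product.inner (infix "\<bullet>" 70)

section \<open>Cholesky factorisation\<close>

lemma scalar_prod_mat_vec_sum:
  fixes A :: "real mat"
  assumes "A \<in> carrier_mat m k" "u \<in> carrier_vec m" "v \<in> carrier_vec k"
  shows "u \<bullet> (A *\<^sub>v v) = (\<Sum>i<m. \<Sum>j<k. u $ i * A $$ (i,j) * v $ j)"
proof -
  have "u \<bullet> (A *\<^sub>v v) = (\<Sum>i<m. u $ i * (\<Sum>j<k. A $$ (i,j) * v $ j))"
    using assms by (auto simp: scalar_prod_def lessThan_atLeast0 intro!: sum.cong)
  then show ?thesis by (simp add: sum_distrib_left mult.assoc)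
qed

text \<open>Induction over the Schur complement of the last diagonal entry; plain coefficient
  functions spare the change of dimension of matrices. The orientation A = L^T L with L lower
  triangular is deliberate: row i of L involves only coordinates up to i, the shape that the
  triangular substitution in Gaussian integrals needs.\<close>

lemma cholesky_fun:
  fixes A :: "nat \<Rightarrow> nat \<Rightarrow> real"
  assumes "\<And>i j. i < k \<Longrightarrow> j < k \<Longrightarrow> A i j = A j i"
    and "\<And>v. \<exists>i<k. v i \<noteq> 0 \<Longrightarrow> 0 < (\<Sum>i<k. \<Sum>j<k. v i * A i j * v j)"
  shows "\<exists>L. (\<forall>i j. i < j \<longrightarrow> L i j = 0) \<and> (\<forall>i<k. 0 < L i i) \<and>
    (\<forall>i<k. \<forall>j<k. A i j = (\<Sum>l<k. L l i * L l j))"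
  using assms
proof (induction k arbitrary: A)
  case 0
  show ?case by (rule exI[of _ "\<lambda>_ _. 0"]) simp
next
  case (Suc k)
  define a where "a = A k k"
  have a: "a > 0"
    using Suc.prems(2)[of "\<lambda>i. of_bool (i = k)"] by (simp add: a_def of_bool_def if_distrib cong: if_cong)
  define b where "b i = A i k / sqrt a" for i
  have sym: "A i j = A j i" if "i \<le> k" "j \<le> k" for i j using Suc.prems(1) that by auto
  have "\<exists>L. (\<forall>i j. i < j \<longrightarrow> L i j = 0) \<and> (\<forall>i<k. 0 < L i i) \<and>
    (\<forall>i<k. \<forall>j<k. A i j - b i * b j = (\<Sum>l<k. L l i * L l j))"
  proof (rule Suc.IH)
    show "A i j - b i * b j = A j i - b j * b i" if "i < k" "j < k" for i j
      using sym[of i j] that by simp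
    fix v :: "nat \<Rightarrow> real" assume v: "\<exists>i<k. v i \<noteq> 0"
    define s where "s = (\<Sum>j<k. A j k * v j)"
    \<comment> \<open>The last coordinate -s/a minimises the form of A over all extensions of v, and
      the minimum is the Schur complement form at v.\<close>
    define w where "w i = (if i < k then v i else - s / a)" for i
    have "\<exists>i<Suc k. w i \<noteq> 0" using v by (auto simp: w_def intro: less_SucI)
    from Suc.prems(2)[of w, OF this]
    have "0 < (\<Sum>i<k. (\<Sum>j<k. v i * A i j * v j) + v i * A i k * (- s / a))
         + ((\<Sum>j<k. (- s / a) * A k j * v j) + (- s / a) * a * (- s / a))"
      by (simp add: w_def a_def)
    also have "(\<Sum>j<k. (- s / a) * A k j * v j) = (- s / a) * s"
      unfolding s_def sum_distrib_left by (intro sum.cong) (auto simp: sym)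
    also have "(\<Sum>i<k. (\<Sum>j<k. v i * A i j * v j) + v i * A i k * (- s / a))
        = (\<Sum>i<k. \<Sum>j<k. v i * A i j * v j) + (- s / a) * s"
      unfolding sum.distrib s_def sum_distrib_left by (simp add: algebra_simps)
    finally have 1: "s\<^sup>2 / a < (\<Sum>i<k. \<Sum>j<k. v i * A i j * v j)"
      using a by (simp add: power2_eq_square)
    have "(\<Sum>j<k. b j * v j) = s / sqrt a"
      unfolding s_def b_def sum_divide_distrib by simp
    then have "(\<Sum>j<k. b j * v j) * (\<Sum>j<k. b j * v j) = s\<^sup>2 / a"
      using a by (simp add: power2_eq_square)
    then have "(\<Sum>i<k. \<Sum>j<k. v i * (b i * b j) * v j) = s\<^sup>2 / a"
      unfolding sum_product by (simp add: mult_ac)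
    with 1 show "0 < (\<Sum>i<k. \<Sum>j<k. v i * (A i j - b i * b j) * v j)"
      by (simp add: right_diff_distrib left_diff_distrib sum_subtractf)
  qed
  then obtain L where L: "\<And>i j. i < j \<Longrightarrow> L i j = 0" "\<And>i. i < k \<Longrightarrow> 0 < L i i"
    "\<And>i j. i < k \<Longrightarrow> j < k \<Longrightarrow> A i j - b i * b j = (\<Sum>l<k. L l i * L l j)" by blast
  define L' where "L' l i = (if l < k \<and> i < k then L l i else if l = k \<and> i < k then b i
     else if l = k \<and> i = k then sqrt a else 0)" for l i
  show ?case
  proof (intro exI[of _ L'] conjI allI impI)
    show "L' i j = 0" if "i < j" for i j using that L(1) by (auto simp: L'_def)
    show "0 < L' i i" if "i < Suc k" for i using that L(2) a by (auto simp: L'_def)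
    fix i j assume "i < Suc k" "j < Suc k"
    then consider "i < k" "j < k" | "i < k" "j = k" | "i = k" "j < k" | "i = k" "j = k" by linarith
    then show "A i j = (\<Sum>l<Suc k. L' l i * L' l j)"
    proof cases
      case 1 then show ?thesis using L(3)[of i j] by (simp add: L'_def)
    next
      case 2 then show ?thesis using a by (simp add: L'_def b_def)
    next
      case 3 then show ?thesis using a sym[of k j] by (simp add: L'_def b_def)
    next
      case 4 then show ?thesis using a by (simp add: L'_def a_def)
    qed
  qed
qed

lemma pos_def_matD:
  assumes "pos_def_mat k A"
  shows "A \<in> carrier_mat k k" "transpose_mat A = A"
    "\<And>v. v \<in> carrier_vec k \<Longrightarrow> v \<noteq> 0\<^sub>v k \<Longrightarrow> 0 < v \<bullet> (A *\<^sub>v v)"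
    "\<And>v. v \<in> carrier_vec k \<Longrightarrow> 0 \<le> v \<bullet> (A *\<^sub>v v)"
    "dim_row A = k" "dim_col A = k"
proof -
  show *: "A \<in> carrier_mat k k" "transpose_mat A = A"
    "\<And>v. v \<in> carrier_vec k \<Longrightarrow> v \<noteq> 0\<^sub>v k \<Longrightarrow> 0 < v \<bullet> (A *\<^sub>v v)"
    "dim_row A = k" "dim_col A = k"
    using assms by (auto simp: pos_def_mat_def)
  fix v :: "real vec" assume v: "v \<in> carrier_vec k"
  show "0 \<le> v \<bullet> (A *\<^sub>v v)"
  proof (cases "v = 0\<^sub>v k")
    case True
    then have "v \<bullet> (A *\<^sub>v v) = 0"
      using *(1) by (auto intro!: scalar_prod_left_zero)
    then show ?thesis by simp
  qed (use *(3)[OF v] in simp)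
qed

lemma cholesky:
  assumes "pos_def_mat k A"
  obtains L where "L \<in> carrier_mat k k" "A = transpose_mat L * L"
    "\<And>i j. i < j \<Longrightarrow> j < k \<Longrightarrow> L $$ (i,j) = 0" "\<And>i. i < k \<Longrightarrow> 0 < L $$ (i,i)"
proof -
  note A = pos_def_matD[OF assms]
  have "\<exists>L. (\<forall>i j. i < j \<longrightarrow> L i j = 0) \<and> (\<forall>i<k. 0 < L i i) \<and>
    (\<forall>i<k. \<forall>j<k. A $$ (i,j) = (\<Sum>l<k. L l i * L l j))"
  proof (rule cholesky_fun)
    show "A $$ (i,j) = A $$ (j,i)" if "i < k" "j < k" for i j
      using A(1,2) that by (metis carrier_matD index_transpose_mat(1))
    fix v :: "nat \<Rightarrow> real" assume "\<exists>i<k. v i \<noteq> 0"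
    then have "vec k v \<noteq> 0\<^sub>v k" by (metis index_vec index_zero_vec(1))
    from A(3)[OF _ this] show "0 < (\<Sum>i<k. \<Sum>j<k. v i * A $$ (i, j) * v j)"
      by (simp add: scalar_prod_mat_vec_sum[OF A(1)])
  qed
  then obtain L where L: "\<And>i j. i < j \<Longrightarrow> L i j = 0" "\<And>i. i < k \<Longrightarrow> 0 < L i i"
    "\<And>i j. i < k \<Longrightarrow> j < k \<Longrightarrow> A $$ (i,j) = (\<Sum>l<k. L l i * L l j)" by blast
  show ?thesis
  proof (rule that[of "mat k k (\<lambda>(i,j). L i j)"])
    show "A = transpose_mat (mat k k (\<lambda>(i,j). L i j)) * mat k k (\<lambda>(i,j). L i j)"
      using A(1) L(3)
      by (intro eq_matI) (auto simp: scalar_prod_def lessThan_atLeast0)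
  qed (use L in auto)
qed

lemma transpose_scalar_prod:
  fixes M :: "real mat"
  assumes "M \<in> carrier_mat m k" "u \<in> carrier_vec k" "w \<in> carrier_vec m"
  shows "u \<bullet> (transpose_mat M *\<^sub>v w) = (M *\<^sub>v u) \<bullet> w"
proof -
  have "(M *\<^sub>v u) \<bullet> w = w \<bullet> (M *\<^sub>v u)" using assms by (intro comm_scalar_prod) auto
  also have "\<dots> = (\<Sum>i<m. \<Sum>j<k. w $ i * M $$ (i,j) * u $ j)"
    by (rule scalar_prod_mat_vec_sum) fact+
  also have "\<dots> = (\<Sum>j<k. \<Sum>i<m. w $ i * M $$ (i,j) * u $ j)"
    by (rule sum.swap)
  also have "\<dots> = u \<bullet> (transpose_mat M *\<^sub>v w)"
    using assms by (subst scalar_prod_mat_vec_sum[of _ k m]) (auto intro!: sum.cong)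
  finally show ?thesis ..
qed

lemma scalar_prod_self_nonneg: "0 \<le> v \<bullet> (v :: real vec)"
  by (simp add: scalar_prod_def sum_nonneg)

lemma scalar_prod_self_eq_0: "v \<in> carrier_vec k \<Longrightarrow> v \<bullet> v = (0::real) \<longleftrightarrow> v = 0\<^sub>v k"
  unfolding scalar_prod_def by (subst sum_nonneg_eq_0_iff) (auto intro!: eq_vecI)

lemma scalar_prod_self_sum: "v \<in> carrier_vec k \<Longrightarrow> v \<bullet> v = (\<Sum>i<k. (v $ i :: real)\<^sup>2)"
  by (simp add: scalar_prod_def lessThan_atLeast0 power2_eq_square)

lemma gram_form:
  fixes L :: "real mat"
  assumes "L \<in> carrier_mat k k" "v \<in> carrier_vec k"
  shows "v \<bullet> ((transpose_mat L * L) *\<^sub>v v) = (L *\<^sub>v v) \<bullet> (L *\<^sub>v v)"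
  using assms by (subst assoc_mult_mat_vec[of _ k k]) (auto intro!: transpose_scalar_prod)

lemma det_gram:
  fixes L :: "real mat"
  assumes "L \<in> carrier_mat k k" "\<And>i j. i < j \<Longrightarrow> j < k \<Longrightarrow> L $$ (i,j) = 0"
  shows "det (transpose_mat L * L) = (\<Prod>i<k. L $$ (i,i))\<^sup>2"
proof -
  have "det L = (\<Prod>i<k. L $$ (i,i))"
    using assms by (subst det_lower_triangular[OF assms(2) assms(1)])
       (auto simp: diag_mat_def prod.list_conv_set_nth lessThan_atLeast0)
  then show ?thesis
    using assms(1) by (simp add: det_mult[of _ k] det_transpose[of _ k] power2_eq_square)
qed

lemma det_pos_def: assumes "pos_def_mat k A" shows "0 < det A"
proof -
  obtain L where L: "L \<in> carrier_mat k k" "A = transpose_mat L * L"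
    "\<And>i j. i < j \<Longrightarrow> j < k \<Longrightarrow> L $$ (i,j) = 0" "\<And>i. i < k \<Longrightarrow> 0 < L $$ (i,i)"
    using cholesky[OF assms] by metis
  have "0 < (\<Prod>i<k. L $$ (i,i))" using L(4) by (intro prod_pos) auto
  then have "0 < (\<Prod>i<k. L $$ (i,i))\<^sup>2" by (rule zero_less_power)
  then show ?thesis using det_gram[OF L(1,3)] L(2) by metis
qed

section \<open>Inverses and the order of quadratic forms\<close>

lemma mat_inverse_obtain:
  fixes A :: "real mat"
  assumes "A \<in> carrier_mat k k" "det A \<noteq> 0"
  obtains B where "mat_inverse A = Some B" "A * B = 1\<^sub>m k" "B * A = 1\<^sub>m k" "B \<in> carrier_mat k k"
proof -
  have "mat_inverse A \<noteq> None"
    using mat_inverse(1)[OF assms(1), of "()"] det_non_zero_imp_unit[OF assms, of "()"] by blast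
  then show ?thesis using mat_inverse(2)[OF assms(1)] that by blast
qed

definition minv :: "real mat \<Rightarrow> real mat" where "minv A = the (mat_inverse A)"

text \<open>Symmetry comes from inserting A A^-1 = 1 to the right of the transposed inverse,
  positivity from substituting v = A w.\<close>

lemma pos_def_minv:
  assumes "pos_def_mat k A"
  shows "minv A \<in> carrier_mat k k" "A * minv A = 1\<^sub>m k" "minv A * A = 1\<^sub>m k" "pos_def_mat k (minv A)"
    "det (minv A) = 1 / det A"
    "\<And>v. v \<in> carrier_vec k \<Longrightarrow> A *\<^sub>v (minv A *\<^sub>v v) = v"
    "\<And>v. v \<in> carrier_vec k \<Longrightarrow> minv A *\<^sub>v (A *\<^sub>v v) = v"
proof -
  note A = pos_def_matD[OF assms]
  have d: "det A \<noteq> 0" using det_pos_def[OF assms] by simp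
  show c: "minv A \<in> carrier_mat k k" "A * minv A = 1\<^sub>m k" "minv A * A = 1\<^sub>m k"
    using mat_inverse_obtain[OF A(1) d] unfolding minv_def by (metis option.sel)+
  have "det A * det (minv A) = 1"
    using det_mult[OF A(1) c(1)] c(2) by simp
  then show "det (minv A) = 1 / det A" using d by (simp add: field_simps)
  show 1: "A *\<^sub>v (minv A *\<^sub>v v) = v" if "v \<in> carrier_vec k" for v
    using assoc_mult_mat_vec[OF A(1) c(1) that] c(2) that by simp
  show "minv A *\<^sub>v (A *\<^sub>v v) = v" if "v \<in> carrier_vec k" for v
    using assoc_mult_mat_vec[OF c(1) A(1) that] c(3) that by simp
  have "transpose_mat (minv A) = transpose_mat (minv A) * (A * minv A)" using c by simp
  also have "\<dots> = (transpose_mat (minv A) * A) * minv A" using c A(1) by (intro assoc_mult_mat[symmetric]) auto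
  also have "transpose_mat (minv A) * A = transpose_mat (A * minv A)"
    using transpose_mult[OF A(1) c(1)] A(2) by simp
  finally have "transpose_mat (minv A) = minv A" using c by simp
  moreover have "0 < v \<bullet> (minv A *\<^sub>v v)" if "v \<in> carrier_vec k" "v \<noteq> 0\<^sub>v k" for v
  proof -
    define w where "w = minv A *\<^sub>v v"
    have w: "w \<in> carrier_vec k" using c that by (auto simp: w_def)
    have v: "v = A *\<^sub>v w" using 1 that by (simp add: w_def)
    have "w \<noteq> 0\<^sub>v k" using v that(2) A(1) by auto
    then have "0 < w \<bullet> (A *\<^sub>v w)" using A(3) w by blast
    then show ?thesis unfolding w_def[symmetric] v[symmetric] using comm_scalar_prod[OF w that(1)] by metis
  qed
  ultimately show "pos_def_mat k (minv A)" using c by (simp add: pos_def_mat_def)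
qed

lemma scalar_prod_symmetric_mat:
  fixes A :: "real mat"
  assumes "A \<in> carrier_mat k k" "transpose_mat A = A" "u \<in> carrier_vec k" "v \<in> carrier_vec k"
  shows "u \<bullet> (A *\<^sub>v v) = v \<bullet> (A *\<^sub>v u)"
  using transpose_scalar_prod[OF assms(1,3,4)] comm_scalar_prod[of "A *\<^sub>v u" k v] assms by simp

lemma form_add:
  fixes A :: "real mat"
  assumes "A \<in> carrier_mat k k" "transpose_mat A = A" "u \<in> carrier_vec k" "v \<in> carrier_vec k"
  shows "(u + t \<cdot>\<^sub>v v) \<bullet> (A *\<^sub>v (u + t \<cdot>\<^sub>v v)) = u \<bullet> (A *\<^sub>v u) + 2 * t * (u \<bullet> (A *\<^sub>v v)) + t\<^sup>2 * (v \<bullet> (A *\<^sub>v v))"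
proof -
  have "A *\<^sub>v (u + t \<cdot>\<^sub>v v) = A *\<^sub>v u + t \<cdot>\<^sub>v (A *\<^sub>v v)"
    using assms by (subst mult_add_distrib_mat_vec[of _ k k]) (auto simp: mult_mat_vec)
  moreover have "A *\<^sub>v u \<in> carrier_vec k" "A *\<^sub>v v \<in> carrier_vec k" using assms by auto
  ultimately show ?thesis using assms(3,4) scalar_prod_symmetric_mat[OF assms]
    by (simp add: add_scalar_prod_distrib[of _ k] scalar_prod_add_distrib[of _ k] power2_eq_square algebra_simps)
qed

text \<open>Inversion reverses the order of forms, without square roots or simultaneous
  diagonalisation: with x = A^-1 v and w = B^-1 v, nonnegativity of the form of A at x - w/c,
  combined with the hypothesis at w, is already the claim.\<close>

lemma inverse_antitone:
  assumes A: "pos_def_mat k A" and B: "pos_def_mat k B" and c: "0 < c"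
    and le: "\<And>v. v \<in> carrier_vec k \<Longrightarrow> v \<bullet> (A *\<^sub>v v) \<le> c * (v \<bullet> (B *\<^sub>v v))"
    and v: "v \<in> carrier_vec k"
  shows "v \<bullet> (minv B *\<^sub>v v) \<le> c * (v \<bullet> (minv A *\<^sub>v v))"
proof -
  note A' = pos_def_matD[OF A] pos_def_minv[OF A]
  note B' = pos_def_matD[OF B] pos_def_minv[OF B]
  define x where "x = minv A *\<^sub>v v"
  define w where "w = minv B *\<^sub>v v"
  have [simp]: "x \<in> carrier_vec k" "w \<in> carrier_vec k"
    using A'(7) B'(7) v by (auto simp: x_def w_def)
  have Ax: "A *\<^sub>v x = v" "B *\<^sub>v w = v" using A'(12) B'(12) v by (auto simp: x_def w_def)
  have "0 \<le> (x + (- 1 / c) \<cdot>\<^sub>v w) \<bullet> (A *\<^sub>v (x + (- 1 / c) \<cdot>\<^sub>v w))" by (rule A'(4)) auto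
  also have "\<dots> = x \<bullet> v + 2 * (- 1 / c) * (w \<bullet> v) + (- 1 / c)\<^sup>2 * (w \<bullet> (A *\<^sub>v w))"
    using scalar_prod_symmetric_mat[OF A'(1,2), of x w] by (subst form_add[OF A'(1,2)]) (simp_all add: Ax)
  also have "\<dots> \<le> x \<bullet> v + 2 * (- 1 / c) * (w \<bullet> v) + (- 1 / c)\<^sup>2 * (c * (w \<bullet> v))"
    using le[of w] by (intro add_left_mono mult_left_mono) (auto simp: Ax)
  also have "\<dots> = x \<bullet> v - (w \<bullet> v) / c" using c by (simp add: power2_eq_square field_simps)
  finally have "w \<bullet> v \<le> c * (x \<bullet> v)" using c by (simp add: field_simps)
  then show ?thesis using comm_scalar_prod[of x k v] comm_scalar_prod[of w k v] v
    by (simp add: x_def[symmetric] w_def[symmetric])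
qed

lemma scalar_prod_Cauchy_Schwarz:
  fixes u v :: "real vec"
  assumes "u \<in> carrier_vec k" "v \<in> carrier_vec k"
  shows "(u \<bullet> v)\<^sup>2 \<le> (u \<bullet> u) * (v \<bullet> v)"
proof -
  have "u \<bullet> v = (\<Sum>i<k. u $ i * v $ i)"
    using assms by (simp add: scalar_prod_def lessThan_atLeast0)
  then show ?thesis using Cauchy_Schwarz_ineq_sum[of "\<lambda>i. u $ i" "\<lambda>i. v $ i" "{..<k}"] assms
    by (simp add: scalar_prod_self_sum)
qed

section \<open>Frobenius norms\<close>

lemma frob_norm_nonneg: "0 \<le> frob_norm A"
  by (simp add: frob_norm_def sum_nonneg)

lemma frob_norm_sq:
  "A \<in> carrier_mat m k \<Longrightarrow> (frob_norm A)\<^sup>2 = (\<Sum>i<m. \<Sum>j<k. (A $$ (i,j))\<^sup>2)"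
  by (simp add: frob_norm_def sum_nonneg)

lemma frob_norm_mult_vec:
  assumes "A \<in> carrier_mat m k" "v \<in> carrier_vec k"
  shows "(A *\<^sub>v v) \<bullet> (A *\<^sub>v v) \<le> (frob_norm A)\<^sup>2 * (v \<bullet> v)"
proof -
  have "(A *\<^sub>v v) \<bullet> (A *\<^sub>v v) = (\<Sum>i<m. (\<Sum>j<k. A $$ (i,j) * v $ j)\<^sup>2)"
    using assms by (subst scalar_prod_self_sum[of _ m])
      (auto simp: scalar_prod_def lessThan_atLeast0 intro!: sum.cong)
  also have "\<dots> \<le> (\<Sum>i<m. (\<Sum>j<k. (A $$ (i,j))\<^sup>2) * (\<Sum>j<k. (v $ j)\<^sup>2))"
    by (intro sum_mono Cauchy_Schwarz_ineq_sum)
  also have "\<dots> = (frob_norm A)\<^sup>2 * (v \<bullet> v)"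
    using assms by (simp add: frob_norm_sq scalar_prod_self_sum sum_distrib_right)
  finally show ?thesis .
qed

lemma abs_form_le_frob:
  assumes "A \<in> carrier_mat k k" "v \<in> carrier_vec k"
  shows "\<bar>v \<bullet> (A *\<^sub>v v)\<bar> \<le> frob_norm A * (v \<bullet> v)"
proof -
  have "(v \<bullet> (A *\<^sub>v v))\<^sup>2 \<le> (v \<bullet> v) * ((A *\<^sub>v v) \<bullet> (A *\<^sub>v v))"
    using assms by (intro scalar_prod_Cauchy_Schwarz[of _ k]) auto
  also have "\<dots> \<le> (v \<bullet> v) * ((frob_norm A)\<^sup>2 * (v \<bullet> v))"
    by (intro mult_left_mono frob_norm_mult_vec[OF assms] scalar_prod_self_nonneg)
  also have "\<dots> = (frob_norm A * (v \<bullet> v))\<^sup>2" by (simp add: power2_eq_square)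
  finally show ?thesis
    using frob_norm_nonneg[of A] scalar_prod_self_nonneg[of v] abs_le_square_iff[of "v \<bullet> (A *\<^sub>v v)" "frob_norm A * (v \<bullet> v)"]
    by simp
qed

lemma form_minus:
  fixes A B :: "real mat"
  assumes "A \<in> carrier_mat k k" "B \<in> carrier_mat k k" "v \<in> carrier_vec k"
  shows "v \<bullet> ((A - B) *\<^sub>v v) = v \<bullet> (A *\<^sub>v v) - v \<bullet> (B *\<^sub>v v)"
proof -
  have "(A - B) *\<^sub>v v = A *\<^sub>v v - B *\<^sub>v v"
    using assms by (simp add: minus_mult_distrib_mat_vec)
  then show ?thesis using assms by (simp add: scalar_prod_minus_distrib[of _ k])
qed

lemma smult_mat_mult_vec:
  fixes A :: "real mat"
  assumes "A \<in> carrier_mat m k" "v \<in> carrier_vec k"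
  shows "(c \<cdot>\<^sub>m A) *\<^sub>v v = c \<cdot>\<^sub>v (A *\<^sub>v v)"
  using assms by (intro eq_vecI) (auto simp: scalar_prod_def sum_distrib_left mult.assoc)

lemma form_smult:
  fixes A :: "real mat"
  assumes "A \<in> carrier_mat k k" "v \<in> carrier_vec k"
  shows "v \<bullet> ((c \<cdot>\<^sub>m A) *\<^sub>v v) = c * (v \<bullet> (A *\<^sub>v v))"
  using assms by (simp add: smult_mat_mult_vec[of _ k k])

section \<open>Extreme eigenvalues and quadratic forms\<close>

lemma pos_def_of_psd_nonsingular:
  assumes A: "A \<in> carrier_mat k k" "transpose_mat A = A"
    and psd: "\<And>v. v \<in> carrier_vec k \<Longrightarrow> 0 \<le> v \<bullet> (A *\<^sub>v v)"
    and det: "det A \<noteq> 0"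
  shows "pos_def_mat k A"
  unfolding pos_def_mat_def
proof (intro conjI ballI impI A)
  fix v :: "real vec" assume v: "v \<in> carrier_vec k" "v \<noteq> 0\<^sub>v k"
  show "0 < v \<bullet> (A *\<^sub>v v)"
  proof (rule ccontr)
    assume "\<not> 0 < v \<bullet> (A *\<^sub>v v)"
    then have 0: "v \<bullet> (A *\<^sub>v v) = 0" using psd[OF v(1)] by simp
    \<comment> \<open>A zero of a semidefinite form lies in the kernel: moving from v by t A v
      changes the form to first order by 2 t |A v|^2, so a small negative t would make it
      negative.\<close>
    define u where "u = A *\<^sub>v v"
    have u: "u \<in> carrier_vec k" using A v by (auto simp: u_def)
    define q where "q = u \<bullet> (A *\<^sub>v u)"
    have uv: "v \<bullet> (A *\<^sub>v u) = u \<bullet> u"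
      using scalar_prod_symmetric_mat[OF A v(1) u] by (simp add: u_def)
    have q: "0 \<le> 2 * t * (u \<bullet> u) + t\<^sup>2 * q" for t
      using psd[of "v + t \<cdot>\<^sub>v u"] u v(1) form_add[OF A v(1) u, of t] 0 uv by (simp add: q_def)
    have "u \<bullet> u = 0"
    proof (rule ccontr)
      assume "u \<bullet> u \<noteq> 0"
      then have p: "0 < u \<bullet> u" using scalar_prod_self_nonneg[of u] by simp
      have q0: "0 \<le> q" using psd[OF u] by (simp add: q_def)
      define t where "t = - (u \<bullet> u) / (q + 1)"
      have t: "t < 0" using p q0 by (simp add: t_def divide_neg_pos)
      have "- t * q \<le> u \<bullet> u"
        using p q0 by (simp add: t_def pos_divide_le_eq algebra_simps)
      then have "0 < 2 * (u \<bullet> u) + t * q" using p by simp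
      then have "t * (2 * (u \<bullet> u) + t * q) < 0" using t by (rule mult_neg_pos[rotated])
      then show False using q[of t] by (simp add: power2_eq_square algebra_simps)
    qed
    then have "u = 0\<^sub>v k" using scalar_prod_self_eq_0[OF u] by simp
    then show False using det det_0_iff_vec_prod_zero[OF A(1)] v u_def by auto
  qed
qed

text \<open>Stands in for compactness of the unit sphere. With A = L^T L and J = L^-1 one has v = J
  (L v), and |L v|^2 is the form of A, so the Frobenius norm of J yields an explicit
  constant.\<close>

lemma pos_def_coercive:
  assumes "pos_def_mat k A"
  shows "\<exists>c>0. \<forall>v\<in>carrier_vec k. c * (v \<bullet> v) \<le> v \<bullet> (A *\<^sub>v v)"
proof -
  obtain L where L: "L \<in> carrier_mat k k" "A = transpose_mat L * L"
    "\<And>i j. i < j \<Longrightarrow> j < k \<Longrightarrow> L $$ (i,j) = 0" "\<And>i. i < k \<Longrightarrow> 0 < L $$ (i,i)"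
    using cholesky[OF assms] by metis
  have "det L \<noteq> 0"
    using det_pos_def[OF assms] L(1,2) det_mult[of "transpose_mat L" k L] by auto
  then obtain J where J: "J * L = 1\<^sub>m k" "J \<in> carrier_mat k k"
    using mat_inverse_obtain[OF L(1)] by metis
  \<comment> \<open>The summand 1 keeps c positive also for k = 0, where J has norm 0 and 1/0 is
    0.\<close>
  define c where "c = 1 / ((frob_norm J)\<^sup>2 + 1)"
  show ?thesis
  proof (intro exI[of _ c] conjI ballI)
    show "0 < c" by (simp add: c_def add_nonneg_pos)
    fix v :: "real vec" assume v: "v \<in> carrier_vec k"
    have "v = J *\<^sub>v (L *\<^sub>v v)" using assoc_mult_mat_vec[OF J(2) L(1) v] J(1) v by simp
    then have "v \<bullet> v = (J *\<^sub>v (L *\<^sub>v v)) \<bullet> (J *\<^sub>v (L *\<^sub>v v))" by metis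
    also have "\<dots> \<le> (frob_norm J)\<^sup>2 * ((L *\<^sub>v v) \<bullet> (L *\<^sub>v v))"
      using L(1) J v by (intro frob_norm_mult_vec[of _ k k]) auto
    also have "(L *\<^sub>v v) \<bullet> (L *\<^sub>v v) = v \<bullet> (A *\<^sub>v v)"
      using gram_form[OF L(1) v] L(2) by simp
    finally have "v \<bullet> v \<le> ((frob_norm J)\<^sup>2 + 1) * (v \<bullet> (A *\<^sub>v v))"
      using pos_def_matD(4)[OF assms v] by (simp add: algebra_simps)
    then show "c * (v \<bullet> v) \<le> v \<bullet> (A *\<^sub>v v)"
      using add_nonneg_pos[of "(frob_norm J)\<^sup>2" 1] by (simp add: c_def pos_divide_le_eq mult.commute)
  qed
qed

text \<open>Links the spectrum, through which \<open>rho_min\<close> is defined, to quadratic forms.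
  With m the infimum of the form on the unit sphere, A - m I is semidefinite. Were it nonsingular,
  it would be definite, hence coercive, and the infimum could be raised; so it is singular, and a
  kernel vector is an eigenvector for m.\<close>

lemma symmetric_min_eigenvalue:
  fixes A :: "real mat"
  assumes A: "A \<in> carrier_mat k k" "transpose_mat A = A" and k: "0 < k"
  shows "\<exists>m\<in>spectrum A. \<forall>v\<in>carrier_vec k. m * (v \<bullet> v) \<le> v \<bullet> (A *\<^sub>v v)"
proof -
  define S where "S = (\<lambda>v. v \<bullet> (A *\<^sub>v v)) ` {v \<in> carrier_vec k. v \<bullet> v = 1}"
  have "unit_vec k 0 \<bullet> unit_vec k 0 = (1::real)" using k by (simp add: scalar_prod_left_unit)
  then have ne: "S \<noteq> {}" by (auto simp: S_def intro!: exI[of _ "unit_vec k 0"])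
  have bdd: "bdd_below S"
    using abs_form_le_frob[OF A(1)] unfolding S_def
    by (intro bdd_belowI[of _ "- frob_norm A"]) (fastforce simp: abs_le_iff)
  define m where "m = Inf S"
  have m_le: "m * (v \<bullet> v) \<le> v \<bullet> (A *\<^sub>v v)" if v: "v \<in> carrier_vec k" for v
  proof (cases "v = 0\<^sub>v k")
    case True
    then show ?thesis using A(1) by simp
  next
    case False
    then have p: "0 < v \<bullet> v" using scalar_prod_self_nonneg[of v] scalar_prod_self_eq_0[OF v] by linarith
    define w where "w = (1 / sqrt (v \<bullet> v)) \<cdot>\<^sub>v v"
    have w: "w \<in> carrier_vec k" "w \<bullet> w = 1" using v p by (auto simp: w_def)
    have "m \<le> w \<bullet> (A *\<^sub>v w)"
      unfolding m_def using bdd w by (intro cInf_lower) (auto simp: S_def)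
    also have "w \<bullet> (A *\<^sub>v w) = (v \<bullet> (A *\<^sub>v v)) / (v \<bullet> v)"
      using A(1) v p by (simp add: w_def mult_mat_vec)
    finally show ?thesis using p by (simp add: field_simps)
  qed
  define P where "P = A - m \<cdot>\<^sub>m 1\<^sub>m k"
  have P: "P \<in> carrier_mat k k"
    unfolding P_def by (intro minus_carrier_mat smult_carrier_mat one_carrier_mat)
  have form: "v \<bullet> (P *\<^sub>v v) = v \<bullet> (A *\<^sub>v v) - m * (v \<bullet> v)" if "v \<in> carrier_vec k" for v
    unfolding P_def using that A(1) form_smult[of "1\<^sub>m k" k v m] by (subst form_minus[of _ k]) auto
  have Psym: "transpose_mat P = P"
  proof (rule eq_matI)
    fix i j assume "i < dim_row P" "j < dim_col P"
    then show "transpose_mat P $$ (i,j) = P $$ (i,j)"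
      using A P index_transpose_mat(1)[of j A i] by (auto simp: P_def)
  qed (use P in auto)
  have "det P = 0"
  proof (rule ccontr)
    assume "det P \<noteq> 0"
    then have "pos_def_mat k P"
      using form m_le by (intro pos_def_of_psd_nonsingular P Psym) auto
    then obtain c where c: "c > 0" "\<And>v. v \<in> carrier_vec k \<Longrightarrow> c * (v \<bullet> v) \<le> v \<bullet> (P *\<^sub>v v)"
      using pos_def_coercive by blast
    have "m + c \<le> Inf S"
    proof (rule cInf_greatest[OF ne])
      fix x assume "x \<in> S"
      then obtain v where v: "v \<in> carrier_vec k" "v \<bullet> v = 1" "x = v \<bullet> (A *\<^sub>v v)" by (auto simp: S_def)
      then show "m + c \<le> x" using c(2)[OF v(1)] form[OF v(1)] by simp
    qed
    then show False using c(1) by (simp add: m_def)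
  qed
  then obtain v where v: "v \<in> carrier_vec k" "v \<noteq> 0\<^sub>v k" "P *\<^sub>v v = 0\<^sub>v k"
    using det_0_iff_vec_prod_zero[OF P] by auto
  have "P *\<^sub>v v = A *\<^sub>v v - m \<cdot>\<^sub>v v"
    using A v(1) by (simp add: P_def minus_mult_distrib_mat_vec smult_mat_mult_vec[of _ k k])
  have "A *\<^sub>v v = m \<cdot>\<^sub>v v"
  proof (rule eq_vecI)
    fix i assume "i < dim_vec (m \<cdot>\<^sub>v v)"
    then have "(A *\<^sub>v v - m \<cdot>\<^sub>v v) $ i = 0" using v \<open>P *\<^sub>v v = A *\<^sub>v v - m \<cdot>\<^sub>v v\<close> by auto
    then show "(A *\<^sub>v v) $ i = (m \<cdot>\<^sub>v v) $ i"
      using \<open>i < dim_vec (m \<cdot>\<^sub>v v)\<close> A v(1) by simp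
  qed (use A v in auto)
  then have "m \<in> spectrum A"
    using v A by (auto simp: spectrum_def eigenvalue_def eigenvector_def)
  then show ?thesis using m_le by blast
qed

lemma rho_min_le_form:
  assumes A: "A \<in> carrier_mat k k" "transpose_mat A = A" and k: "0 < k" and v: "v \<in> carrier_vec k"
  shows "rho_min A * (v \<bullet> v) \<le> v \<bullet> (A *\<^sub>v v)"
proof -
  obtain m where m: "m \<in> spectrum A" "m * (v \<bullet> v) \<le> v \<bullet> (A *\<^sub>v v)"
    using symmetric_min_eigenvalue[OF A k] v by blast
  have "rho_min A \<le> m"
    unfolding rho_min_def using m(1) card_finite_spectrum(1)[OF A(1)] by simp
  then show ?thesis using m(2) mult_right_mono[OF _ scalar_prod_self_nonneg[of v]] by fastforce
qed

text \<open>Obtained from the smallest eigenvalue of -A, whose negative lies in the spectrum of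
  A.\<close>

lemma form_le_rho_max:
  assumes A: "A \<in> carrier_mat k k" "transpose_mat A = A" and k: "0 < k" and v: "v \<in> carrier_vec k"
  shows "v \<bullet> (A *\<^sub>v v) \<le> rho_max A * (v \<bullet> v)"
proof -
  have tr: "transpose_mat (- A) = - A"
  proof (rule eq_matI)
    fix i j assume "i < dim_row (- A)" "j < dim_col (- A)"
    then show "transpose_mat (- A) $$ (i,j) = (- A) $$ (i,j)"
      using A index_transpose_mat(1)[of j A i] by auto
  qed (use A in auto)
  obtain m where m: "m \<in> spectrum (- A)" "m * (v \<bullet> v) \<le> v \<bullet> (- A *\<^sub>v v)"
    using symmetric_min_eigenvalue[of "- A" k] A tr k v by auto
  then obtain x where x: "x \<in> carrier_vec k" "x \<noteq> 0\<^sub>v k" "- A *\<^sub>v x = m \<cdot>\<^sub>v x"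
    using A(1) by (auto simp: spectrum_def eigenvalue_def eigenvector_def)
  have "A *\<^sub>v x = (- m) \<cdot>\<^sub>v x"
  proof (rule eq_vecI)
    fix i assume i: "i < dim_vec (- m \<cdot>\<^sub>v x)"
    have "(- A *\<^sub>v x) $ i = - (A *\<^sub>v x) $ i"
      using i A(1) x(1) by (simp add: uminus_mult_mat_vec)
    then show "(A *\<^sub>v x) $ i = (- m \<cdot>\<^sub>v x) $ i" using x i by simp
  qed (use A x in auto)
  then have "- m \<in> spectrum A"
    using x A by (auto simp: spectrum_def eigenvalue_def eigenvector_def)
  then have "- m \<le> rho_max A"
    unfolding rho_max_def using card_finite_spectrum(1)[OF A(1)] by simp
  then have "- m * (v \<bullet> v) \<le> rho_max A * (v \<bullet> v)"
    by (rule mult_right_mono) (rule scalar_prod_self_nonneg)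
  moreover have "v \<bullet> (- A *\<^sub>v v) = - (v \<bullet> (A *\<^sub>v v))"
    using A(1) v by (simp add: uminus_mult_mat_vec)
  ultimately show ?thesis using m(2) by simp
qed

text \<open>Turns a bound on the form into a bound on the operator norm: the form of M is
  nonnegative at v - M v / c, and bounding it at v and at M v leaves the claim.\<close>

lemma psd_mult_vec_le:
  fixes M :: "real mat"
  assumes M: "M \<in> carrier_mat k k" "transpose_mat M = M" and c: "0 < c"
    and psd: "\<And>v. v \<in> carrier_vec k \<Longrightarrow> 0 \<le> v \<bullet> (M *\<^sub>v v)"
    and le: "\<And>v. v \<in> carrier_vec k \<Longrightarrow> v \<bullet> (M *\<^sub>v v) \<le> c * (v \<bullet> v)"
    and v: "v \<in> carrier_vec k"
  shows "(M *\<^sub>v v) \<bullet> (M *\<^sub>v v) \<le> c\<^sup>2 * (v \<bullet> v)"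
proof -
  define u where "u = M *\<^sub>v v"
  have u: "u \<in> carrier_vec k" using M v by (auto simp: u_def)
  have "0 \<le> (v + (- 1 / c) \<cdot>\<^sub>v u) \<bullet> (M *\<^sub>v (v + (- 1 / c) \<cdot>\<^sub>v u))"
    using u v by (intro psd) auto
  also have "\<dots> = v \<bullet> (M *\<^sub>v v) + 2 * (- 1 / c) * (v \<bullet> (M *\<^sub>v u)) + (- 1 / c)\<^sup>2 * (u \<bullet> (M *\<^sub>v u))"
    by (rule form_add[OF M v u])
  also have "v \<bullet> (M *\<^sub>v u) = u \<bullet> u" using scalar_prod_symmetric_mat[OF M v u] by (simp add: u_def)
  also have "v \<bullet> (M *\<^sub>v v) + 2 * (- 1 / c) * (u \<bullet> u) + (- 1 / c)\<^sup>2 * (u \<bullet> (M *\<^sub>v u))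
     \<le> c * (v \<bullet> v) + 2 * (- 1 / c) * (u \<bullet> u) + (- 1 / c)\<^sup>2 * (c * (u \<bullet> u))"
    using mult_left_mono[OF le[OF u], of "(- 1 / c)\<^sup>2"] le[OF v] by simp
  also have "\<dots> = c * (v \<bullet> v) - (u \<bullet> u) / c" using c by (simp add: field_simps power2_eq_square)
  finally show ?thesis using c by (simp add: u_def field_simps power2_eq_square)
qed

section \<open>Traces and determinants\<close>

definition mtrace :: "real mat \<Rightarrow> real" where
  "mtrace A = (\<Sum>i<dim_row A. A $$ (i,i))"

lemma mtrace_mult:
  "A \<in> carrier_mat m k \<Longrightarrow> B \<in> carrier_mat k m \<Longrightarrow> mtrace (A * B) = (\<Sum>i<m. \<Sum>j<k. A $$ (i,j) * B $$ (j,i))"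
  by (simp add: mtrace_def scalar_prod_def lessThan_atLeast0)

lemma mtrace_comm:
  assumes "A \<in> carrier_mat m k" "B \<in> carrier_mat k m"
  shows "mtrace (A * B) = mtrace (B * A)"
  unfolding mtrace_mult[OF assms] mtrace_mult[OF assms(2,1)]
  by (subst sum.swap) (simp add: mult.commute)

lemma mtrace_add: "A \<in> carrier_mat k k \<Longrightarrow> B \<in> carrier_mat k k \<Longrightarrow> mtrace (A + B) = mtrace A + mtrace B"
  by (simp add: mtrace_def sum.distrib)

lemma mtrace_smult: "A \<in> carrier_mat k k \<Longrightarrow> mtrace (c \<cdot>\<^sub>m A) = c * mtrace A"
  by (simp add: mtrace_def sum_distrib_left)

lemma mtrace_one: "mtrace (1\<^sub>m k) = real k"
  by (simp add: mtrace_def)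

lemma frob_norm_sq_cols:
  assumes "B \<in> carrier_mat m k"
  shows "(frob_norm B)\<^sup>2 = (\<Sum>j<k. col B j \<bullet> col B j)"
  unfolding frob_norm_sq[OF assms] using assms
  by (subst sum.swap) (auto simp: scalar_prod_self_sum[of _ m] intro!: sum.cong)

text \<open>Acts column by column. Using the operator norm of M rather than its Frobenius norm
  avoids a factor that grows with the block size.\<close>

lemma frob_norm_mult_le:
  assumes M: "M \<in> carrier_mat k k" and B: "B \<in> carrier_mat k k" and c: "0 \<le> c"
    and op: "\<And>v. v \<in> carrier_vec k \<Longrightarrow> (M *\<^sub>v v) \<bullet> (M *\<^sub>v v) \<le> c\<^sup>2 * (v \<bullet> v)"
  shows "frob_norm (M * B) \<le> c * frob_norm B"
proof (rule power2_le_imp_le)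
  have "(frob_norm (M * B))\<^sup>2 = (\<Sum>j<k. (M *\<^sub>v col B j) \<bullet> (M *\<^sub>v col B j))"
    using M B by (subst frob_norm_sq_cols[of _ k k]) (auto simp: col_mult2 mult_mat_vec_def intro!: sum.cong)
  also have "\<dots> \<le> (\<Sum>j<k. c\<^sup>2 * (col B j \<bullet> col B j))"
    using B by (intro sum_mono op) auto
  also have "\<dots> = (c * frob_norm B)\<^sup>2"
    by (simp add: frob_norm_sq_cols[OF B] power_mult_distrib sum_distrib_left)
  finally show "(frob_norm (M * B))\<^sup>2 \<le> (c * frob_norm B)\<^sup>2" .
  show "0 \<le> c * frob_norm B" using c frob_norm_nonneg by simp
qed

lemma mtrace_mult_le:
  assumes A: "A \<in> carrier_mat k k" and B: "B \<in> carrier_mat k k"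
  shows "mtrace (A * B) \<le> frob_norm A * frob_norm B"
proof -
  have "mtrace (A * B) = (\<Sum>p\<in>{..<k}\<times>{..<k}. A $$ p * B $$ (snd p, fst p))"
    unfolding mtrace_mult[OF assms] by (simp add: sum.cartesian_product case_prod_beta)
  moreover have "(\<Sum>p\<in>{..<k}\<times>{..<k}. A $$ p * B $$ (snd p, fst p))\<^sup>2
    \<le> (\<Sum>p\<in>{..<k}\<times>{..<k}. (A $$ p)\<^sup>2) * (\<Sum>p\<in>{..<k}\<times>{..<k}. (B $$ (snd p, fst p))\<^sup>2)"
    by (rule Cauchy_Schwarz_ineq_sum)
  moreover have "(\<Sum>p\<in>{..<k}\<times>{..<k}. (A $$ p)\<^sup>2) = (frob_norm A)\<^sup>2"
    unfolding frob_norm_sq[OF A] by (simp add: sum.cartesian_product case_prod_beta)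
  moreover have "(\<Sum>p\<in>{..<k}\<times>{..<k}. (B $$ (snd p, fst p))\<^sup>2) = (frob_norm B)\<^sup>2"
    unfolding frob_norm_sq[OF B] by (subst sum.swap) (simp add: sum.cartesian_product case_prod_beta)
  ultimately have "(mtrace (A * B))\<^sup>2 \<le> (frob_norm A * frob_norm B)\<^sup>2"
    by (simp add: power_mult_distrib)
  then show ?thesis
    using frob_norm_nonneg[of A] frob_norm_nonneg[of B] by (meson mult_nonneg_nonneg power2_le_imp_le)
qed

lemma minv_unique:
  assumes "pos_def_mat k A" "B \<in> carrier_mat k k" "A * B = 1\<^sub>m k"
  shows "minv A = B"
proof -
  note A = pos_def_matD[OF assms(1)] pos_def_minv[OF assms(1)]
  have "minv A = minv A * (A * B)" using A assms(3) by simp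
  also have "\<dots> = (minv A * A) * B" using A assms(2) by (intro assoc_mult_mat[symmetric]) auto
  also have "\<dots> = B" using A assms(2) by simp
  finally show ?thesis .
qed

lemma minv_minv: "pos_def_mat k A \<Longrightarrow> minv (minv A) = A"
  using minv_unique[of k "minv A" A] pos_def_minv pos_def_matD(1) by metis

lemma pos_def_one: "pos_def_mat k (1\<^sub>m k)"
proof -
  have "0 < v \<bullet> v" if "v \<in> carrier_vec k" "v \<noteq> 0\<^sub>v k" for v :: "real vec"
    using scalar_prod_self_nonneg[of v] scalar_prod_self_eq_0[OF that(1)] that(2) by linarith
  then show ?thesis by (auto simp: pos_def_mat_def)
qed

lemma minv_one: "minv (1\<^sub>m k) = 1\<^sub>m k"
  using minv_unique[OF pos_def_one, of "1\<^sub>m k" k] by simp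

text \<open>The diagonal entry M_ii is the squared length of column i of the Cholesky factor, hence
  at least L_ii^2, and x \<le> exp(x - 1) turns the product of these entries into the exponential of
  the trace.\<close>

lemma hadamard_exp:
  assumes "pos_def_mat k M"
  shows "det M \<le> exp (mtrace M - real k)"
proof -
  obtain L where L: "L \<in> carrier_mat k k" "M = transpose_mat L * L"
    "\<And>i j. i < j \<Longrightarrow> j < k \<Longrightarrow> L $$ (i,j) = 0" "\<And>i. i < k \<Longrightarrow> 0 < L $$ (i,i)"
    using cholesky[OF assms] by metis
  have "det M = (\<Prod>i<k. (L $$ (i,i))\<^sup>2)"
    using L(2) det_gram[OF L(1,3)] by (simp add: prod_power_distrib)
  also have "\<dots> \<le> (\<Prod>i<k. exp (M $$ (i,i) - 1))"
  proof (rule prod_mono)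
    fix i assume i: "i \<in> {..<k}"
    have "M $$ (i,i) = (\<Sum>l<k. (L $$ (l,i))\<^sup>2)"
      using i L(1) unfolding L(2) by (simp add: scalar_prod_def lessThan_atLeast0 power2_eq_square)
    also have "\<dots> \<ge> (L $$ (i,i))\<^sup>2" using i by (intro member_le_sum) auto
    finally show "0 \<le> (L $$ (i,i))\<^sup>2 \<and> (L $$ (i,i))\<^sup>2 \<le> exp (M $$ (i,i) - 1)"
      using exp_ge_add_one_self[of "M $$ (i,i) - 1"] zero_le_power2[of "L $$ (i,i)"] by linarith
  qed
  also have "\<dots> = exp (mtrace M - real k)"
    using pos_def_matD(5)[OF assms] by (simp add: exp_sum[symmetric] mtrace_def sum_subtractf)
  finally show ?thesis .
qed

text \<open>Congruence by J = L^-1, where P0 = L^T L, reduces P0 to the identity: J^T P J has trace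
  tr(P0^-1 P), because P0^-1 = J J^T, and determinant det P / det P0.\<close>

lemma det_le_exp_trace:
  assumes P: "pos_def_mat k P" and P0: "pos_def_mat k P0"
  shows "det P \<le> det P0 * exp (mtrace (minv P0 * P) - real k)"
proof -
  note P' = pos_def_matD[OF P]
  obtain L where L: "L \<in> carrier_mat k k" "P0 = transpose_mat L * L"
    using cholesky[OF P0] by metis
  have detL: "det P0 = (det L)\<^sup>2"
    using L by (simp add: det_mult[of _ k] det_transpose[of _ k] power2_eq_square)
  then have L0: "det L \<noteq> 0" using det_pos_def[OF P0] by auto
  obtain J where J: "J * L = 1\<^sub>m k" "L * J = 1\<^sub>m k" "J \<in> carrier_mat k k"
    using mat_inverse_obtain[OF L(1) L0] by metis
  have detJ: "det J * det L = 1"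
    using det_mult[OF J(3) L(1)] J(1) by simp
  have inv: "minv P0 = J * transpose_mat J"
  proof (rule minv_unique[OF P0])
    have JT: "transpose_mat L * transpose_mat J = 1\<^sub>m k"
      using transpose_mult[OF J(3) L(1)] J(1) by simp
    have "P0 * (J * transpose_mat J) = transpose_mat L * (L * (J * transpose_mat J))"
      unfolding L(2) using L(1) J(3) by (intro assoc_mult_mat[of _ k k _ k _ k]) auto
    also have "L * (J * transpose_mat J) = (L * J) * transpose_mat J"
      using L(1) J(3) by (intro assoc_mult_mat[symmetric, of _ k k _ k _ k]) auto
    also have "\<dots> = transpose_mat J" using J by simp
    finally show "P0 * (J * transpose_mat J) = 1\<^sub>m k" using JT by simp
  qed (use J in auto)
  define M where "M = transpose_mat J * (P * J)"
  have M: "M \<in> carrier_mat k k" using J P'(1) by (simp add: M_def)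
  have form: "v \<bullet> (M *\<^sub>v v) = (J *\<^sub>v v) \<bullet> (P *\<^sub>v (J *\<^sub>v v))" if v: "v \<in> carrier_vec k" for v
  proof -
    have "M *\<^sub>v v = transpose_mat J *\<^sub>v ((P * J) *\<^sub>v v)"
      unfolding M_def using J P'(1) v by (intro assoc_mult_mat_vec[of _ k k _ k]) auto
    also have "(P * J) *\<^sub>v v = P *\<^sub>v (J *\<^sub>v v)"
      using J P'(1) v by (intro assoc_mult_mat_vec[of _ k k _ k]) auto
    finally show ?thesis using J P'(1) v by (simp add: transpose_scalar_prod[of _ k k])
  qed
  have "pos_def_mat k M"
    unfolding pos_def_mat_def
  proof (intro conjI ballI impI M)
    have "transpose_mat M = transpose_mat (P * J) * transpose_mat (transpose_mat J)"
      unfolding M_def using J P'(1) by (intro transpose_mult[of _ k k _ k]) auto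
    also have "\<dots> = transpose_mat J * P * J"
      using J P'(1,2) transpose_mult[of P k k J k] by simp
    also have "\<dots> = M" unfolding M_def using J P'(1) by (intro assoc_mult_mat[of _ k k _ k _ k]) auto
    finally show "transpose_mat M = M" .
    fix v :: "real vec" assume v: "v \<in> carrier_vec k" "v \<noteq> 0\<^sub>v k"
    have "L *\<^sub>v (J *\<^sub>v v) = v" using assoc_mult_mat_vec[OF L(1) J(3) v(1)] J(2) v(1) by simp
    moreover have "L *\<^sub>v 0\<^sub>v k = 0\<^sub>v k" using L(1) by (intro eq_vecI) auto
    ultimately have "J *\<^sub>v v \<noteq> 0\<^sub>v k" using v(2) by auto
    then show "0 < v \<bullet> (M *\<^sub>v v)" unfolding form[OF v(1)] using J v(1) by (intro P'(3)) auto
  qed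
  from hadamard_exp[OF this] have 1: "det M \<le> exp (mtrace M - real k)" .
  have "mtrace M = mtrace ((P * J) * transpose_mat J)"
    unfolding M_def using J P'(1) by (intro mtrace_comm) auto
  also have "(P * J) * transpose_mat J = P * minv P0"
    unfolding inv using J P'(1) by (intro assoc_mult_mat[of _ k k _ k _ k]) auto
  also have "mtrace \<dots> = mtrace (minv P0 * P)"
    using pos_def_minv(1)[OF P0] P'(1) by (intro mtrace_comm) auto
  finally have 2: "mtrace M = mtrace (minv P0 * P)" .
  have "det M = det J * (det P * det J)"
    unfolding M_def using J P'(1) by (simp add: det_mult[of _ k] det_transpose[of _ k])
  then have "det P0 * det M
      = det P * (det J * det L)\<^sup>2"
    unfolding detL by (simp add: power2_eq_square)
  then have "det P = det P0 * det M" using detJ by simp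
  then show ?thesis using 1 2 det_pos_def[OF P0] by simp
qed

section \<open>Small perturbations of a covariance\<close>

lemma form_le_frob_diff:
  assumes "S \<in> carrier_mat k k" "T \<in> carrier_mat k k" "v \<in> carrier_vec k"
  shows "\<bar>v \<bullet> (T *\<^sub>v v) - v \<bullet> (S *\<^sub>v v)\<bar> \<le> frob_norm (T - S) * (v \<bullet> v)"
  using abs_form_le_frob[of "T - S" k v] form_minus[of T k S v] assms minus_carrier_mat[of S k k T] by simp

lemma minv_le_of_ge:
  assumes S: "pos_def_mat k S" and c: "0 < c"
    and ge: "\<And>v. v \<in> carrier_vec k \<Longrightarrow> c * (v \<bullet> v) \<le> v \<bullet> (S *\<^sub>v v)"
    and v: "v \<in> carrier_vec k"
  shows "v \<bullet> (minv S *\<^sub>v v) \<le> (1 / c) * (v \<bullet> v)"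
proof -
  have "v \<bullet> (minv S *\<^sub>v v) \<le> (1 / c) * (v \<bullet> (minv (1\<^sub>m k) *\<^sub>v v))"
    using c ge by (intro inverse_antitone[OF pos_def_one S _ _ v]) (auto simp: field_simps)
  then show ?thesis using v by (simp add: minv_one)
qed

text \<open>S plays the covariance of a true block, T a nearby one. The radius c/4 makes T at least
  (3/4) S, so T^-1 is at most (4/3) S^-1. A factor below 2 is what keeps p0^2 / p integrable; 4/3
  leaves explicit margins.\<close>

locale perturbed_cov =
  fixes k :: nat and S T :: "real mat" and c C :: real
  assumes S: "pos_def_mat k S" and T: "pos_def_mat k T" and c: "0 < c" and C: "0 < C"
    and ge: "\<And>v. v \<in> carrier_vec k \<Longrightarrow> c * (v \<bullet> v) \<le> v \<bullet> (S *\<^sub>v v)"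
    and le: "\<And>v. v \<in> carrier_vec k \<Longrightarrow> v \<bullet> (S *\<^sub>v v) \<le> C * (v \<bullet> v)"
    and near: "frob_norm (T - S) \<le> c / 4"
begin

definition "A0 = minv S"
definition "A = minv T"
text \<open>Precision matrix of p0^2 / p: twice the precision of the true density minus that of the
  other.\<close>

definition "Q = 2 \<cdot>\<^sub>m A0 - A"
definition "D = T - S"

lemma S_le_T: "v \<in> carrier_vec k \<Longrightarrow> v \<bullet> (S *\<^sub>v v) \<le> (4/3) * (v \<bullet> (T *\<^sub>v v))"
proof -
  assume v: "v \<in> carrier_vec k"
  have "frob_norm (T - S) * (v \<bullet> v) \<le> c / 4 * (v \<bullet> v)"
    by (intro mult_right_mono near scalar_prod_self_nonneg)
  then show ?thesis
    using form_le_frob_diff[OF pos_def_matD(1)[OF S] pos_def_matD(1)[OF T] v] ge[OF v] by linarith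
qed

lemma carrier [simp]: "A0 \<in> carrier_mat k k" "A \<in> carrier_mat k k" "Q \<in> carrier_mat k k" "D \<in> carrier_mat k k"
  "S \<in> carrier_mat k k" "T \<in> carrier_mat k k"
proof -
  show 1: "A0 \<in> carrier_mat k k" "A \<in> carrier_mat k k" "S \<in> carrier_mat k k" "T \<in> carrier_mat k k"
    unfolding A0_def A_def using pos_def_minv(1) S T pos_def_matD(1) by auto
  show "Q \<in> carrier_mat k k" "D \<in> carrier_mat k k"
    unfolding Q_def D_def using 1 by (auto intro!: minus_carrier_mat)
qed

lemma A_le_A0: "v \<in> carrier_vec k \<Longrightarrow> v \<bullet> (A *\<^sub>v v) \<le> (4/3) * (v \<bullet> (A0 *\<^sub>v v))"
  unfolding A0_def A_def by (intro inverse_antitone[OF S T] S_le_T) auto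

lemma A0_le: "v \<in> carrier_vec k \<Longrightarrow> v \<bullet> (A0 *\<^sub>v v) \<le> (1/c) * (v \<bullet> v)"
  unfolding A0_def by (rule minv_le_of_ge[OF S c ge])

lemma A_le: "v \<in> carrier_vec k \<Longrightarrow> v \<bullet> (A *\<^sub>v v) \<le> (4/(3*c)) * (v \<bullet> v)"
  using A_le_A0[of v] A0_le[of v] by (simp add: field_simps)

lemma form_Q: "v \<in> carrier_vec k \<Longrightarrow> v \<bullet> (Q *\<^sub>v v) = 2 * (v \<bullet> (A0 *\<^sub>v v)) - v \<bullet> (A *\<^sub>v v)"
  unfolding Q_def by (subst form_minus[of _ k]) (auto simp: form_smult[of _ k])

lemma A0_le_Q: "v \<in> carrier_vec k \<Longrightarrow> v \<bullet> (A0 *\<^sub>v v) \<le> (3/2) * (v \<bullet> (Q *\<^sub>v v))"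
  using A_le_A0[of v] by (simp add: form_Q)

lemma pd: "pos_def_mat k A0" "pos_def_mat k A"
  unfolding A0_def A_def using pos_def_minv(4) S T by auto

lemma pd_Q: "pos_def_mat k Q"
  unfolding pos_def_mat_def
proof (intro conjI ballI impI)
  show "transpose_mat Q = Q"
  proof (rule eq_matI)
    fix i j assume "i < dim_row Q" "j < dim_col Q"
    then have ij: "i < k" "j < k" using carrier(3) by auto
    have "A0 $$ (j,i) = A0 $$ (i,j)" "A $$ (j,i) = A $$ (i,j)"
      using pos_def_matD(2)[OF pd(1)] pos_def_matD(2)[OF pd(2)] index_transpose_mat(1)[of j A0 i]
        index_transpose_mat(1)[of j A i] ij carrier(1,2) by auto
    then show "transpose_mat Q $$ (i,j) = Q $$ (i,j)"
      using ij carrier_matD[OF carrier(1)] carrier_matD[OF carrier(2)] by (simp add: Q_def)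
  qed (use carrier_matD[OF carrier(3)] in auto)
  fix v :: "real vec" assume v: "v \<in> carrier_vec k" "v \<noteq> 0\<^sub>v k"
  show "0 < v \<bullet> (Q *\<^sub>v v)"
    using A0_le_Q[OF v(1)] pos_def_matD(3)[OF pd(1) v] by linarith
qed simp

lemma Q_inv_le: "v \<in> carrier_vec k \<Longrightarrow> v \<bullet> (minv Q *\<^sub>v v) \<le> (3*C/2) * (v \<bullet> v)"
proof -
  assume v: "v \<in> carrier_vec k"
  have "v \<bullet> (minv Q *\<^sub>v v) \<le> (3/2) * (v \<bullet> (minv A0 *\<^sub>v v))"
    by (intro inverse_antitone[OF pd(1) pd_Q _ A0_le_Q v]) auto
  also have "minv A0 = S" unfolding A0_def by (rule minv_minv[OF S])
  finally show ?thesis using le[OF v] by simp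
qed

lemma mult_A0: "v \<in> carrier_vec k \<Longrightarrow> (A0 *\<^sub>v v) \<bullet> (A0 *\<^sub>v v) \<le> (1/c)\<^sup>2 * (v \<bullet> v)"
  using c by (intro psd_mult_vec_le[of _ k] A0_le pos_def_matD[OF pd(1)]) auto

lemma mult_A: "v \<in> carrier_vec k \<Longrightarrow> (A *\<^sub>v v) \<bullet> (A *\<^sub>v v) \<le> (4/(3*c))\<^sup>2 * (v \<bullet> v)"
  using c by (intro psd_mult_vec_le[of _ k] A_le pos_def_matD[OF pd(2)]) auto

lemma mult_R: "v \<in> carrier_vec k \<Longrightarrow> (minv Q *\<^sub>v v) \<bullet> (minv Q *\<^sub>v v) \<le> (3*C/2)\<^sup>2 * (v \<bullet> v)"
  using C pos_def_minv(4)[OF pd_Q] by (intro psd_mult_vec_le[of _ k] Q_inv_le pos_def_matD[OF pos_def_minv(4)[OF pd_Q]]) auto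

text \<open>The two traces stem from two uses of the determinant inequality. To first order in D
  they are k + tr(A0 D) and k - tr(A0 D), so the linear terms cancel; the identity exhibits the
  exact remainder, in which D occurs twice.\<close>

lemma trace_identity:
  "mtrace (A0 * T) + mtrace (minv Q * A0) - 2 * real k = 2 * mtrace ((A0 * D) * (A * (minv Q * (A0 * D))))"
proof -
  define R where "R = minv Q"
  define U where "U = A0 * (D * A)"
  note ass = assoc_mult_mat[of _ k k _ k _ k]
  note [simp] = mult_carrier_mat[of _ k k _ k] left_mult_one_mat[of _ k k] smult_carrier_mat[of _ k k]
  have R [simp]: "R \<in> carrier_mat k k" and U [simp]: "U \<in> carrier_mat k k"
    using pos_def_minv(1)[OF pd_Q] by (auto simp: R_def U_def intro!: mult_carrier_mat[of _ k k])
  have A0T: "A0 * T = 1\<^sub>m k + A0 * D"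
  proof -
    have "T = S + D" using carrier_matD[OF carrier(5)] carrier_matD[OF carrier(6)] unfolding D_def by (intro eq_matI) auto
    then have "A0 * T = A0 * (S + D)" by simp
    also have "\<dots> = A0 * S + A0 * D" by (rule mult_add_distrib_mat[of _ k k _ k]) auto
    finally show ?thesis using pos_def_minv(3)[OF S] by (simp add: A0_def)
  qed
  have "D * A = T * A - S * A"
    unfolding D_def by (intro minus_mult_distrib_mat[of _ k k _ _ k]) auto
  then have "U = A0 * (T * A) - A0 * (S * A)"
    unfolding U_def by simp (intro mult_minus_distrib_mat[of _ k k _ k] mult_carrier_mat[of _ k k _ k]; simp)
  also have "A0 * (S * A) = A"
    using pos_def_minv(3)[OF S] by (subst assoc_mult_mat[symmetric, of _ k k _ k _ k]) (auto simp: A0_def[symmetric] left_mult_one_mat[of A k k])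
  also have "A0 * (T * A) = A0"
    using pos_def_minv(2)[OF T] by (simp add: A_def[symmetric] right_mult_one_mat[of A0 k k])
  finally have U': "U = A0 - A" .
  have RQ: "R * Q = 1\<^sub>m k" "Q * R = 1\<^sub>m k" using pos_def_minv(2,3)[OF pd_Q] by (auto simp: R_def)
  \<comment> \<open>The two splittings of Q express tr(R A0) through tr(R U), and then tr(R U)
    through tr(A0 D) up to a term with a second D.\<close>
  have Q1: "Q = A0 + U" unfolding U' Q_def using carrier_matD[OF carrier(1)] carrier_matD[OF carrier(2)] by (intro eq_matI) auto
  have Q2: "Q = A + 2 \<cdot>\<^sub>m U" unfolding U' Q_def using carrier_matD[OF carrier(1)] carrier_matD[OF carrier(2)] by (intro eq_matI) auto
  have "R * A0 + R * U = 1\<^sub>m k" using RQ(1) unfolding Q1 by (subst mult_add_distrib_mat[symmetric, of _ k k _ k]) auto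
  then have 1: "mtrace (R * A0) + mtrace (R * U) = real k"
    using mtrace_add[of "R * A0" k "R * U"] mtrace_one[of k] by simp
  have "A * R + (2 \<cdot>\<^sub>m U) * R = 1\<^sub>m k"
    using RQ(2) unfolding Q2 by (subst add_mult_distrib_mat[symmetric, of _ k k _ _ k]) auto
  then have "(A * R + (2 \<cdot>\<^sub>m U) * R) * (A0 * D) = A0 * D" by simp
  then have "A * R * (A0 * D) + (2 \<cdot>\<^sub>m U) * R * (A0 * D) = A0 * D"
    by (subst (asm) add_mult_distrib_mat[of _ k k _ _ k]) auto
  then have 2: "mtrace (A * R * (A0 * D)) + mtrace ((2 \<cdot>\<^sub>m U) * R * (A0 * D)) = mtrace (A0 * D)"
    using mtrace_add[of "A * R * (A0 * D)" k "(2 \<cdot>\<^sub>m U) * R * (A0 * D)"] by simp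
  have "(2 \<cdot>\<^sub>m U) * R * (A0 * D) = 2 \<cdot>\<^sub>m (U * R * (A0 * D))"
    by (simp add: mult_smult_assoc_mat[of _ k k _ k])
  then have 3: "mtrace ((2 \<cdot>\<^sub>m U) * R * (A0 * D)) = 2 * mtrace (U * R * (A0 * D))"
    using mtrace_smult[of "U * R * (A0 * D)" k 2] by simp
  have "mtrace (R * U) = mtrace (R * (A0 * D) * A)"
    unfolding U_def by (simp add: ass)
  also have "\<dots> = mtrace (A * (R * (A0 * D)))" by (rule mtrace_comm[of _ k k]) auto
  also have "A * (R * (A0 * D)) = A * R * (A0 * D)" by (simp add: ass)
  finally have 4: "mtrace (R * U) = mtrace (A * R * (A0 * D))" .
  have "U * R * (A0 * D) = (A0 * D) * (A * (R * (A0 * D)))"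
    unfolding U_def by (simp add: ass)
  moreover have "mtrace (A0 * T) = real k + mtrace (A0 * D)"
    unfolding A0T using mtrace_add[of "1\<^sub>m k" k "A0 * D"] mtrace_one by simp
  ultimately show ?thesis using 1 2 3 4 by (simp add: R_def[symmetric])
qed

text \<open>The ratio factors as (det T / det S) (det A0 / det Q), each factor being at most the
  exponential of a trace. In the remainder of \<open>trace_identity\<close> the operator norms 1/c
  (twice), 4/(3c) and 3C/2 multiply to 2C/c^3, which the identity doubles.\<close>

lemma det_ratio_bound:
  "(det A0)\<^sup>2 / (det A * det Q) \<le> exp (4 * C / c^3 * (frob_norm D)\<^sup>2)"
proof -
  have p: "0 < det A0" "0 < det A" "0 < det Q" "0 < det S" "0 < det T"
    using det_pos_def pd pd_Q S T by auto
  have "det T \<le> det S * exp (mtrace (A0 * T) - real k)"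
    unfolding A0_def by (rule det_le_exp_trace[OF T S])
  then have 1: "det A0 / det A \<le> exp (mtrace (A0 * T) - real k)"
    using p(4,5) pos_def_minv(5)[OF S] pos_def_minv(5)[OF T]
    by (simp add: A0_def A_def pos_divide_le_eq mult.commute)
  have "det A0 \<le> det Q * exp (mtrace (minv Q * A0) - real k)"
    by (rule det_le_exp_trace[OF pd(1) pd_Q])
  then have 2: "det A0 / det Q \<le> exp (mtrace (minv Q * A0) - real k)"
    using p by (simp add: field_simps)
  have "(det A0)\<^sup>2 / (det A * det Q)
      = (det A0 / det A) * (det A0 / det Q)"
    by (simp add: power2_eq_square)
  also have "\<dots> \<le> exp (mtrace (A0 * T) - real k) * exp (mtrace (minv Q * A0) - real k)"
    using p by (intro mult_mono 1 2) auto
  also have "\<dots> = exp (2 * mtrace ((A0 * D) * (A * (minv Q * (A0 * D)))))"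
    unfolding exp_add[symmetric] trace_identity[symmetric] by (simp add: algebra_simps)
  also have "mtrace ((A0 * D) * (A * (minv Q * (A0 * D)))) \<le> 2 * C / c^3 * (frob_norm D)\<^sup>2"
  proof -
    have R: "minv Q \<in> carrier_mat k k" using pos_def_minv(1)[OF pd_Q] .
    have "mtrace ((A0 * D) * (A * (minv Q * (A0 * D)))) \<le> frob_norm (A0 * D) * frob_norm (A * (minv Q * (A0 * D)))"
      using R by (intro mtrace_mult_le[of _ k] mult_carrier_mat[of _ k k _ k]) auto
    also have "\<dots> \<le> frob_norm (A0 * D) * (4/(3*c) * ((3*C/2) * frob_norm (A0 * D)))"
    proof (intro mult_left_mono frob_norm_nonneg)
      have "frob_norm (A * (minv Q * (A0 * D))) \<le> 4/(3*c) * frob_norm (minv Q * (A0 * D))"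
        using R c by (intro frob_norm_mult_le[of _ k] mult_A mult_carrier_mat[of _ k k _ k]) auto
      also have "\<dots> \<le> 4/(3*c) * ((3*C/2) * frob_norm (A0 * D))"
        using R c C by (intro mult_left_mono frob_norm_mult_le[of _ k] mult_R mult_carrier_mat[of _ k k _ k]) auto
      finally show "frob_norm (A * (minv Q * (A0 * D))) \<le> 4/(3*c) * ((3*C/2) * frob_norm (A0 * D))" .
    qed
    also have "\<dots> = (2 * C / c) * (frob_norm (A0 * D))\<^sup>2" by (simp add: power2_eq_square)
    also have "\<dots> \<le> (2 * C / c) * ((1/c) * frob_norm D)\<^sup>2"
      using c C by (intro mult_left_mono power_mono frob_norm_mult_le[of _ k] mult_A0 frob_norm_nonneg) auto
    also have "\<dots> = 2 * C / c^3 * (frob_norm D)\<^sup>2"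
      by (simp add: power2_eq_square power3_eq_cube)
    finally show ?thesis .
  qed
  finally show ?thesis by (simp add: mult.assoc)
qed

end

section \<open>Gaussian integrals\<close>

lemma borel_measurable_coordinate:
  "j \<in> I \<Longrightarrow> (\<lambda>x. x j) \<in> borel_measurable (Pi\<^sub>M I (\<lambda>_. lborel :: real measure))"
  using measurable_component_singleton[of j I "\<lambda>_. lborel :: real measure"] by simp

text \<open>The triangular substitution is carried out on plain coefficient functions: the last row is the
  only one that involves the last coordinate, so the coordinates are integrated out from the last one.\<close>

lemma nn_integral_triangular:
  fixes L :: "nat \<Rightarrow> nat \<Rightarrow> real" and g :: "nat \<Rightarrow> real \<Rightarrow> ennreal" and b :: "nat \<Rightarrow> real"
  assumes g: "\<And>i. i < k \<Longrightarrow> g i \<in> borel_measurable borel" and L: "\<And>i. i < k \<Longrightarrow> 0 < L i i"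
  shows "(\<integral>\<^sup>+y. (\<Prod>i<k. g i ((\<Sum>j\<le>i. L i j * y j) + b i)) \<partial>Pi\<^sub>M {..<k} (\<lambda>_. lborel))
     = (\<Prod>i<k. ennreal (1 / L i i) * (\<integral>\<^sup>+x. g i x \<partial>lborel))"
  using assms
proof (induction k)
  case 0
  show ?case by (simp add: PiM_empty)
next
  case (Suc k)
  interpret product_sigma_finite "\<lambda>_::nat. lborel :: real measure" by standard
  have gk: "g k \<in> borel_measurable borel" using Suc.prems(1) by simp
  have Lk: "0 < L k k" using Suc.prems(2) by simp
  have m: "(\<lambda>y. g i ((\<Sum>j\<le>i. L i j * y j) + b i)) \<in> borel_measurable (Pi\<^sub>M (insert k {..<k}) (\<lambda>_. lborel))"
    if i: "i < Suc k" for i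
  proof (rule measurable_compose[OF _ Suc.prems(1)[OF i]])
    show "(\<lambda>y. (\<Sum>j\<le>i. L i j * y j) + b i) \<in> borel_measurable (Pi\<^sub>M (insert k {..<k}) (\<lambda>_. lborel))"
      using i by (intro borel_measurable_add borel_measurable_sum borel_measurable_times) 
        (auto intro!: borel_measurable_coordinate simp: less_Suc_eq_le)
  qed
  have "(\<integral>\<^sup>+y. (\<Prod>i<Suc k. g i ((\<Sum>j\<le>i. L i j * y j) + b i)) \<partial>Pi\<^sub>M {..<Suc k} (\<lambda>_. lborel))
    = (\<integral>\<^sup>+x. \<integral>\<^sup>+t. (\<Prod>i<Suc k. g i ((\<Sum>j\<le>i. L i j * (x(k := t)) j) + b i)) \<partial>lborel \<partial>Pi\<^sub>M {..<k} (\<lambda>_. lborel))"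
    unfolding lessThan_Suc using m
    by (intro product_nn_integral_insert) (auto simp del: prod.insert simp: lessThan_Suc[symmetric] intro!: borel_measurable_prod_ennreal)
  also have "\<dots> = (\<integral>\<^sup>+x. (\<Prod>i<k. g i ((\<Sum>j\<le>i. L i j * x j) + b i)) *
        (ennreal (1 / L k k) * (\<integral>\<^sup>+t. g k t \<partial>lborel)) \<partial>Pi\<^sub>M {..<k} (\<lambda>_. lborel))"
  proof (rule nn_integral_cong)
    fix x :: "nat \<Rightarrow> real"
    \<comment> \<open>With the earlier coordinates fixed, they only shift the last integral; an
      affine substitution removes c and leaves the factor \<open>1 / L k k\<close>.\<close>
    define c where "c = (\<Sum>j<k. L k j * x j) + b k"
    have "(\<Prod>i<Suc k. g i ((\<Sum>j\<le>i. L i j * (x(k := t)) j) + b i))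
       = (\<Prod>i<k. g i ((\<Sum>j\<le>i. L i j * x j) + b i)) * g k (c + L k k * t)" for t
    proof -
      have "(\<Sum>j\<le>k. L k j * (x(k := t)) j) + b k = c + L k k * t"
        unfolding c_def by (subst lessThan_Suc_atMost[symmetric]) simp
      moreover have "(\<Prod>i<k. g i ((\<Sum>j\<le>i. L i j * (x(k := t)) j) + b i)) = (\<Prod>i<k. g i ((\<Sum>j\<le>i. L i j * x j) + b i))"
        by (intro prod.cong refl arg_cong[of _ _ "g _"] arg_cong2[of _ _ _ _ "(+)"] sum.cong) auto
      ultimately show ?thesis by simp
    qed
    then have "(\<integral>\<^sup>+t. (\<Prod>i<Suc k. g i ((\<Sum>j\<le>i. L i j * (x(k := t)) j) + b i)) \<partial>lborel)
       = (\<Prod>i<k. g i ((\<Sum>j\<le>i. L i j * x j) + b i)) * (\<integral>\<^sup>+t. g k (c + L k k * t) \<partial>lborel)"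
      using gk by (simp only:) (intro nn_integral_cmult, auto)
    also have "(\<integral>\<^sup>+t. g k (c + L k k * t) \<partial>lborel) = ennreal (1 / L k k) * (\<integral>\<^sup>+t. g k t \<partial>lborel)"
      using nn_integral_real_affine[OF gk, of "L k k" c] Lk
      by (simp add: mult.assoc[symmetric] ennreal_mult[symmetric])
    finally show "(\<integral>\<^sup>+t. (\<Prod>i<Suc k. g i ((\<Sum>j\<le>i. L i j * (x(k := t)) j) + b i)) \<partial>lborel)
       = (\<Prod>i<k. g i ((\<Sum>j\<le>i. L i j * x j) + b i)) * (ennreal (1 / L k k) * (\<integral>\<^sup>+t. g k t \<partial>lborel))" .
  qed
  also have "\<dots> = (\<integral>\<^sup>+x. (\<Prod>i<k. g i ((\<Sum>j\<le>i. L i j * x j) + b i)) \<partial>Pi\<^sub>M {..<k} (\<lambda>_. lborel)) *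
        (ennreal (1 / L k k) * (\<integral>\<^sup>+t. g k t \<partial>lborel))"
  proof (intro nn_integral_multc borel_measurable_prod_ennreal)
    fix i assume i: "i \<in> {..<k}"
    show "(\<lambda>y. g i ((\<Sum>j\<le>i. L i j * y j) + b i)) \<in> borel_measurable (Pi\<^sub>M {..<k} (\<lambda>_. lborel))"
    proof (rule measurable_compose[OF _ Suc.prems(1)[of i]])
      show "(\<lambda>y. (\<Sum>j\<le>i. L i j * y j) + b i) \<in> borel_measurable (Pi\<^sub>M {..<k} (\<lambda>_. lborel))"
        using i by (intro borel_measurable_add borel_measurable_sum borel_measurable_times)
          (auto intro!: borel_measurable_coordinate)
    qed (use Suc.prems(1) i in auto)
  qed
  also have "(\<integral>\<^sup>+x. (\<Prod>i<k. g i ((\<Sum>j\<le>i. L i j * x j) + b i)) \<partial>Pi\<^sub>M {..<k} (\<lambda>_. lborel))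
     = (\<Prod>i<k. ennreal (1 / L i i) * (\<integral>\<^sup>+x. g i x \<partial>lborel))"
    using Suc.prems by (intro Suc.IH) auto
  finally show ?case by simp
qed

lemma nn_integral_std_gauss: "(\<integral>\<^sup>+x. ennreal (exp (- x\<^sup>2 / 2)) \<partial>lborel) = ennreal (sqrt (2 * pi))"
proof -
  have "(\<integral>\<^sup>+x. ennreal (exp (- x\<^sup>2 / 2)) \<partial>lborel)
     = (\<integral>\<^sup>+x. ennreal (sqrt (2 * pi)) * ennreal (std_normal_density x) \<partial>lborel)"
    by (intro nn_integral_cong) (simp add: std_normal_density_def ennreal_mult[symmetric])
  also have "\<dots> = ennreal (sqrt (2 * pi)) * (\<integral>\<^sup>+x. ennreal (std_normal_density x) \<partial>lborel)"
    by (rule nn_integral_cmult) auto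
  also have "(\<integral>\<^sup>+x. ennreal (std_normal_density x) \<partial>lborel) = 1"
    by (subst nn_integral_eq_integral) (auto simp: integrable_normal_moment integral_normal_density)
  finally show ?thesis by simp
qed

text \<open>In the coordinates L (y - \<mu>) the form is a sum of squares; det A is the squared
  product of the diagonal of L, so the Jacobian factors combine to det A to the power -1/2.\<close>

lemma gaussian_integral:
  assumes A: "pos_def_mat k A" and \<mu>: "\<mu> \<in> carrier_vec k"
  shows "(\<integral>\<^sup>+y. ennreal (exp (- ((vec k y - \<mu>) \<bullet> (A *\<^sub>v (vec k y - \<mu>))) / 2)) \<partial>Pi\<^sub>M {..<k} (\<lambda>_. lborel))
    = ennreal ((2 * pi) powr (real k / 2) * det A powr (- 1 / 2))"
proof -
  obtain L where L: "L \<in> carrier_mat k k" "A = transpose_mat L * L"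
    "\<And>i j. i < j \<Longrightarrow> j < k \<Longrightarrow> L $$ (i,j) = 0" "\<And>i. i < k \<Longrightarrow> 0 < L $$ (i,i)"
    using cholesky[OF A] by metis
  define b where "b i = - (\<Sum>j<k. L $$ (i,j) * \<mu> $ j)" for i
  define g :: "real \<Rightarrow> ennreal" where "g x = ennreal (exp (- x\<^sup>2 / 2))" for x
  have eq: "ennreal (exp (- ((vec k y - \<mu>) \<bullet> (A *\<^sub>v (vec k y - \<mu>))) / 2))
     = (\<Prod>i<k. g ((\<Sum>j\<le>i. L $$ (i,j) * y j) + b i))" for y
  proof -
    define v where "v = vec k y - \<mu>"
    have v: "v \<in> carrier_vec k" using \<mu> by (simp add: v_def)
    have "v \<bullet> (A *\<^sub>v v) = (\<Sum>i<k. ((L *\<^sub>v v) $ i)\<^sup>2)"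
      using L(1,2) v gram_form[OF L(1) v] by (subst scalar_prod_self_sum[symmetric]) auto
    also have "\<dots> = (\<Sum>i<k. ((\<Sum>j\<le>i. L $$ (i,j) * y j) + b i)\<^sup>2)"
    proof (intro sum.cong refl arg_cong[of _ _ "\<lambda>x. x\<^sup>2"])
      fix i assume i: "i \<in> {..<k}"
      have "(L *\<^sub>v v) $ i = (\<Sum>j<k. L $$ (i,j) * y j) + b i"
        using i L(1) \<mu> by (simp add: v_def b_def scalar_prod_def lessThan_atLeast0 right_diff_distrib sum_subtractf)
      also have "(\<Sum>j<k. L $$ (i,j) * y j) = (\<Sum>j\<le>i. L $$ (i,j) * y j)"
        using i L(3) by (intro sum.mono_neutral_right) auto
      finally show "(L *\<^sub>v v) $ i = (\<Sum>j\<le>i. L $$ (i,j) * y j) + b i" .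
    qed
    finally have "exp (- (v \<bullet> (A *\<^sub>v v)) / 2) = (\<Prod>i<k. exp (- ((\<Sum>j\<le>i. L $$ (i,j) * y j) + b i)\<^sup>2 / 2))"
      by (simp add: exp_sum[symmetric] sum_negf sum_divide_distrib)
    then show ?thesis by (simp add: g_def v_def prod_ennreal)
  qed
  have "(\<integral>\<^sup>+y. ennreal (exp (- ((vec k y - \<mu>) \<bullet> (A *\<^sub>v (vec k y - \<mu>))) / 2)) \<partial>Pi\<^sub>M {..<k} (\<lambda>_. lborel))
     = (\<Prod>i<k. ennreal (1 / L $$ (i,i)) * (\<integral>\<^sup>+x. g x \<partial>lborel))"
    unfolding eq using L(4) by (intro nn_integral_triangular) (auto simp: g_def)
  also have "\<dots> = (\<Prod>i<k. ennreal (1 / L $$ (i,i) * sqrt (2 * pi)))"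
    unfolding g_def nn_integral_std_gauss using L(4) by (intro prod.cong refl ennreal_mult[symmetric]) (auto intro: less_imp_le)
  also have "\<dots> = ennreal (\<Prod>i<k. 1 / L $$ (i,i) * sqrt (2 * pi))"
    using L(4) by (intro prod_ennreal) (auto intro!: mult_nonneg_nonneg less_imp_le)
  also have "(\<Prod>i<k. 1 / L $$ (i,i) * sqrt (2 * pi)) = sqrt (2 * pi) ^ k / (\<Prod>i<k. L $$ (i,i))"
    by (simp add: prod.distrib prod_dividef)
  also have "sqrt (2 * pi) ^ k = (2 * pi) powr (real k / 2)"
    by (simp add: powr_half_sqrt[symmetric] powr_power)
  also have "(\<Prod>i<k. L $$ (i,i)) = det A powr (1 / 2)"
  proof -
    have "0 < (\<Prod>i<k. L $$ (i,i))" using L(4) by (intro prod_pos) auto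
    then show ?thesis using det_gram[OF L(1,3)] L(2) by (simp add: powr_half_sqrt)
  qed
  also have "(2 * pi) powr (real k / 2) / det A powr (1 / 2)
      = (2 * pi) powr (real k / 2) * det A powr (- 1 / 2)"
    by (simp add: powr_minus field_simps)
  finally show ?thesis .
qed

section \<open>Normal densities: measurability and scaling\<close>

definition inv_form :: "real mat \<Rightarrow> real vec \<Rightarrow> real" where
  "inv_form D v = v \<bullet> (minv D *\<^sub>v v)"

lemma mvn_density_eq:
  "mvn_density k \<mu> D y = (2 * pi) powr (- real k / 2) * det D powr (- 1 / 2) * exp (- inv_form D (y - \<mu>) / 2)"
  by (simp add: mvn_density_def inv_form_def minv_def)

lemma mvn_density_pos: "pos_def_mat k D \<Longrightarrow> 0 < mvn_density k \<mu> D y"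
  using det_pos_def[of k D] by (simp add: mvn_density_eq)

lemma inv_form_nonneg: "pos_def_mat k D \<Longrightarrow> v \<in> carrier_vec k \<Longrightarrow> 0 \<le> inv_form D v"
  unfolding inv_form_def by (intro pos_def_matD(4)[OF pos_def_minv(4)])

lemma borel_measurable_det:
  fixes D :: "'a \<Rightarrow> real mat"
  assumes "\<And>z. z \<in> space N \<Longrightarrow> D z \<in> carrier_mat k k"
    and "\<And>i j. i < k \<Longrightarrow> j < k \<Longrightarrow> (\<lambda>z. D z $$ (i,j)) \<in> borel_measurable N"
  shows "(\<lambda>z. det (D z)) \<in> borel_measurable N"
proof -
  have "(\<lambda>z. \<Sum>p | p permutes {0..<k}. of_int (sign p) * (\<Prod>i = 0..<k. D z $$ (i, p i))) \<in> borel_measurable N"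
    using assms(2) by (intro borel_measurable_sum borel_measurable_times borel_measurable_prod borel_measurable_const)
      (auto simp: permutes_in_image)
  then show ?thesis
    by (rule measurable_cong[THEN iffD1, rotated]) (simp add: Determinant.det_def carrier_matD[OF assms(1)])
qed

text \<open>Cramer's rule. \<open>mat_inverse\<close> is given by an elimination procedure whose
  dependence on the entries is not visibly measurable; a quotient of determinants is.\<close>

lemma minv_entry:
  assumes D: "pos_def_mat k D" and ij: "i < k" "j < k"
  shows "minv D $$ (i,j) = (- 1) ^ (j + i) * det (mat_delete D j i) / det D"
proof -
  note C = pos_def_matD(1)[OF D]
  have d: "det D \<noteq> 0" using det_pos_def[OF D] by simp
  have "minv D = (1 / det D) \<cdot>\<^sub>m adj_mat D"
  proof (rule minv_unique[OF D])
    have "D * ((1 / det D) \<cdot>\<^sub>m adj_mat D) = (1 / det D) \<cdot>\<^sub>m (det D \<cdot>\<^sub>m 1\<^sub>m k)"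
      using adj_mat[OF C] by (simp add: mult_smult_distrib[OF C])
    also have "\<dots> = 1\<^sub>m k" using d by (intro eq_matI) auto
    finally show "D * ((1 / det D) \<cdot>\<^sub>m adj_mat D) = 1\<^sub>m k" .
  qed (use adj_mat[OF C] in simp)
  then show ?thesis using ij C by (simp add: adj_mat_def cofactor_def)
qed

lemma borel_measurable_minv_entry:
  fixes D :: "'a \<Rightarrow> real mat"
  assumes D: "\<And>z. z \<in> space N \<Longrightarrow> pos_def_mat k (D z)"
    and m: "\<And>i j. i < k \<Longrightarrow> j < k \<Longrightarrow> (\<lambda>z. D z $$ (i,j)) \<in> borel_measurable N"
    and ij: "i < k" "j < k"
  shows "(\<lambda>z. minv (D z) $$ (i,j)) \<in> borel_measurable N"
proof -
  note C = pos_def_matD(1)[OF D]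
  have "(\<lambda>z. det (mat_delete (D z) j i)) \<in> borel_measurable N"
  proof (rule borel_measurable_det[of _ _ "k - 1"])
    show "mat_delete (D z) j i \<in> carrier_mat (k - 1) (k - 1)" if "z \<in> space N" for z
      using C[OF that] by (auto simp: mat_delete_def)
    fix a b assume ab: "a < k - 1" "b < k - 1"
    have "(\<lambda>z. D z $$ (if a < j then a else Suc a, if b < i then b else Suc b)) \<in> borel_measurable N"
      using ab by (intro m) auto
    then show "(\<lambda>z. mat_delete (D z) j i $$ (a,b)) \<in> borel_measurable N"
      by (rule measurable_cong[THEN iffD1, rotated]) (use ab in \<open>simp add: mat_delete_def carrier_matD[OF C]\<close>)
  qed
  moreover have "(\<lambda>z. det (D z)) \<in> borel_measurable N"
    using C m by (rule borel_measurable_det)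
  ultimately have "(\<lambda>z. (- 1) ^ (j + i) * det (mat_delete (D z) j i) / det (D z)) \<in> borel_measurable N"
    by measurable
  then show ?thesis
    by (rule measurable_cong[THEN iffD1, rotated]) (simp add: minv_entry[OF D ij])
qed

lemma borel_measurable_mvn_density:
  fixes D :: "'a \<Rightarrow> real mat" and m y :: "'a \<Rightarrow> real vec"
  assumes D: "\<And>z. z \<in> space N \<Longrightarrow> pos_def_mat k (D z)"
    and mD: "\<And>i j. i < k \<Longrightarrow> j < k \<Longrightarrow> (\<lambda>z. D z $$ (i,j)) \<in> borel_measurable N"
    and m: "\<And>z. z \<in> space N \<Longrightarrow> m z \<in> carrier_vec k" "\<And>i. i < k \<Longrightarrow> (\<lambda>z. m z $ i) \<in> borel_measurable N"
    and y: "\<And>z. z \<in> space N \<Longrightarrow> y z \<in> carrier_vec k" "\<And>i. i < k \<Longrightarrow> (\<lambda>z. y z $ i) \<in> borel_measurable N"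
  shows "(\<lambda>z. mvn_density k (m z) (D z) (y z)) \<in> borel_measurable N"
    and "(\<lambda>z. inv_form (D z) (y z - m z)) \<in> borel_measurable N"
proof -
  have "(\<lambda>z. \<Sum>i<k. \<Sum>j<k. (y z $ i - m z $ i) * minv (D z) $$ (i,j) * (y z $ j - m z $ j)) \<in> borel_measurable N"
    using borel_measurable_minv_entry[OF D mD] m(2) y(2)
    by (intro borel_measurable_sum borel_measurable_times borel_measurable_diff) auto
  then show 1: "(\<lambda>z. inv_form (D z) (y z - m z)) \<in> borel_measurable N"
  proof (rule measurable_cong[THEN iffD1, rotated])
    fix z assume z: "z \<in> space N"
    show "(\<Sum>i<k. \<Sum>j<k. (y z $ i - m z $ i) * minv (D z) $$ (i,j) * (y z $ j - m z $ j)) = inv_form (D z) (y z - m z)"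
      unfolding inv_form_def using m(1)[OF z] y(1)[OF z]
      by (subst scalar_prod_mat_vec_sum[OF pos_def_minv(1)[OF D[OF z]]]) auto
  qed
  have "(\<lambda>z. det (D z)) \<in> borel_measurable N"
    using pos_def_matD(1)[OF D] mD by (rule borel_measurable_det)
  with 1 show "(\<lambda>z. mvn_density k (m z) (D z) (y z)) \<in> borel_measurable N"
    unfolding mvn_density_eq by measurable
qed

lemma borel_measurable_mvn_density_vec:
  assumes "pos_def_mat k D" "\<mu> \<in> carrier_vec k"
  shows "(\<lambda>y. mvn_density k \<mu> D (vec k y)) \<in> borel_measurable (Pi\<^sub>M {..<k} (\<lambda>_. lborel))"
    and "(\<lambda>y. inv_form D (vec k y - \<mu>)) \<in> borel_measurable (Pi\<^sub>M {..<k} (\<lambda>_. lborel))"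
proof -
  have "(\<lambda>y. vec k y $ i) \<in> borel_measurable (Pi\<^sub>M {..<k} (\<lambda>_. lborel))" if "i < k" for i
    using borel_measurable_coordinate[of i "{..<k}"] that by simp
  then show "(\<lambda>y. mvn_density k \<mu> D (vec k y)) \<in> borel_measurable (Pi\<^sub>M {..<k} (\<lambda>_. lborel))"
    "(\<lambda>y. inv_form D (vec k y - \<mu>)) \<in> borel_measurable (Pi\<^sub>M {..<k} (\<lambda>_. lborel))"
    using borel_measurable_mvn_density[of "Pi\<^sub>M {..<k} (\<lambda>_. lborel)" k "\<lambda>_. D" "\<lambda>_. \<mu>" "vec k"] assms by auto
qed

lemma det_smult_mat: "A \<in> carrier_mat k k \<Longrightarrow> det (c \<cdot>\<^sub>m A) = c ^ k * det (A :: real mat)"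
  using det_smult[of c A] by auto

lemma pos_def_smult:
  assumes "pos_def_mat k A" "0 < c"
  shows "pos_def_mat k (c \<cdot>\<^sub>m A)"
proof -
  note A = pos_def_matD[OF assms(1)]
  have "transpose_mat (c \<cdot>\<^sub>m A) = c \<cdot>\<^sub>m transpose_mat A" by (intro eq_matI) auto
  then show ?thesis using A assms(2) by (auto simp: pos_def_mat_def form_smult[of _ k])
qed

text \<open>The exponent is scaled while the normalising constant is kept: t = 1 gives total mass
  one, and t = 1 - 4\<beta> the integral of the squared tempered density over the untempered
  one.\<close>

lemma gaussian_integral_scaled:
  assumes D: "pos_def_mat k D" and \<mu>: "\<mu> \<in> carrier_vec k" and t: "0 < t"
  shows "(\<integral>\<^sup>+y. ennreal ((2 * pi) powr (- real k / 2) * det D powr (- 1 / 2) * exp (- t * inv_form D (vec k y - \<mu>) / 2)) \<partial>Pi\<^sub>M {..<k} (\<lambda>_. lborel))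
    = ennreal (t powr (- real k / 2))"
proof -
  note I = pos_def_minv[OF D]
  have d: "0 < det D" by (rule det_pos_def[OF D])
  have pd: "pos_def_mat k (t \<cdot>\<^sub>m minv D)" by (rule pos_def_smult[OF I(4) t])
  have "(\<integral>\<^sup>+y. ennreal ((2 * pi) powr (- real k / 2) * det D powr (- 1 / 2) * exp (- t * inv_form D (vec k y - \<mu>) / 2)) \<partial>Pi\<^sub>M {..<k} (\<lambda>_. lborel))
     = (\<integral>\<^sup>+y. ennreal ((2 * pi) powr (- real k / 2) * det D powr (- 1 / 2)) *
         ennreal (exp (- t * inv_form D (vec k y - \<mu>) / 2)) \<partial>Pi\<^sub>M {..<k} (\<lambda>_. lborel))"
    by (simp add: ennreal_mult)
  also have "\<dots> = ennreal ((2 * pi) powr (- real k / 2) * det D powr (- 1 / 2)) *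
      (\<integral>\<^sup>+y. ennreal (exp (- t * inv_form D (vec k y - \<mu>) / 2)) \<partial>Pi\<^sub>M {..<k} (\<lambda>_. lborel))"
    by (intro nn_integral_cmult measurable_compose[OF borel_measurable_mvn_density_vec(2)[OF D \<mu>], of "\<lambda>x. ennreal (exp (- t * x / 2))"]) measurable
  also have "(\<integral>\<^sup>+y. ennreal (exp (- t * inv_form D (vec k y - \<mu>) / 2)) \<partial>Pi\<^sub>M {..<k} (\<lambda>_. lborel))
     = ennreal ((2 * pi) powr (real k / 2) * det (t \<cdot>\<^sub>m minv D) powr (- 1 / 2))"
    using \<mu> I(1) by (subst gaussian_integral[OF pd \<mu>, symmetric]) (simp add: inv_form_def form_smult[of _ k])
  also have "det (t \<cdot>\<^sub>m minv D) = t powr real k / det D"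
    using I(1,5) t by (simp add: det_smult_mat powr_realpow)
  also have "ennreal ((2 * pi) powr (- real k / 2) * det D powr (- 1 / 2)) *
     ennreal ((2 * pi) powr (real k / 2) * (t powr real k / det D) powr (- 1 / 2))
     = ennreal (((2 * pi) powr (- real k / 2) * (2 * pi) powr (real k / 2)) *
        (det D powr (- 1 / 2) * (t powr real k / det D) powr (- 1 / 2)))"
    by (simp add: ennreal_mult[symmetric] mult_ac)
  also have "(2 * pi) powr (- real k / 2) * (2 * pi) powr (real k / 2) = 1"
    by (simp add: powr_add[symmetric])
  also have "det D powr (- 1 / 2) * (t powr real k / det D) powr (- 1 / 2) = t powr (- real k / 2)"
    using d t by (simp add: powr_mult[symmetric] powr_powr)
  finally show ?thesis by simp
qed

lemma mvn_density_integral: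
  assumes "pos_def_mat k D" "\<mu> \<in> carrier_vec k"
  shows "(\<integral>\<^sup>+y. ennreal (mvn_density k \<mu> D (vec k y)) \<partial>Pi\<^sub>M {..<k} (\<lambda>_. lborel)) = 1"
  using gaussian_integral_scaled[OF assms, of 1] by (simp add: mvn_density_eq)

text \<open>Gaussian integrals decrease when the form increases, and they are a constant times
  det^(-1/2); comparing integrands pointwise therefore compares determinants.\<close>

lemma det_mono:
  assumes S: "pos_def_mat k S" and T: "pos_def_mat k T" and c: "0 < c"
    and le: "\<And>v. v \<in> carrier_vec k \<Longrightarrow> v \<bullet> (T *\<^sub>v v) \<le> c * (v \<bullet> (S *\<^sub>v v))"
  shows "det T \<le> c ^ k * det S"
proof -
  have pd: "pos_def_mat k (c \<cdot>\<^sub>m S)" by (rule pos_def_smult[OF S c])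
  have d: "0 < det T" "0 < det (c \<cdot>\<^sub>m S)" by (rule det_pos_def[OF T], rule det_pos_def[OF pd])
  have "ennreal ((2 * pi) powr (real k / 2) * det (c \<cdot>\<^sub>m S) powr (- 1 / 2))
     \<le> ennreal ((2 * pi) powr (real k / 2) * det T powr (- 1 / 2))"
    unfolding gaussian_integral[OF pd zero_carrier_vec, symmetric] gaussian_integral[OF T zero_carrier_vec, symmetric]
    using le pos_def_matD(1)[OF S] by (intro nn_integral_mono) (auto simp: form_smult[of _ k])
  then have "det (c \<cdot>\<^sub>m S) powr (- 1 / 2) \<le> det T powr (- 1 / 2)"
    by (subst (asm) ennreal_le_iff) (auto simp del: det_smult)
  then have "det T \<le> det (c \<cdot>\<^sub>m S)"
    using d powr_less_mono2_neg[of "-1/2" "det (c \<cdot>\<^sub>m S)" "det T"] by force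
  then show ?thesis by (simp only: det_smult_mat[OF pos_def_matD(1)[OF S]])
qed


section \<open>The integral of p0^2 / p for one block\<close>

context perturbed_cov
begin

text \<open>Weight of the squared mean shift h. With b = A h, completing the square leaves half of b
  Q^-1 b + h A h, where Q^-1 is at most 3C/2 and A at most 4/(3c).\<close>

definition "K\<chi> = (3*C/2) * (4/(3*c))\<^sup>2 / 2 + (4/(3*c)) / 2"

text \<open>Completing the square shows p0^2 / p to be an unnormalised Gaussian with precision Q and
  centre \<mu> - e, times exp(R/2). Its mass splits into a determinant ratio, of second order in D,
  and exp(R/2), where R is quadratic in the mean shift.\<close>

lemma chi_square_bound:
  assumes \<mu>: "\<mu> \<in> carrier_vec k" and \<nu>: "\<nu> \<in> carrier_vec k"
  shows "(\<integral>\<^sup>+y. ennreal ((mvn_density k \<mu> S (vec k y))\<^sup>2 / mvn_density k \<nu> T (vec k y)) \<partial>Pi\<^sub>M {..<k} (\<lambda>_. lborel))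
    \<le> ennreal (exp (2 * C / c^3 * (frob_norm D)\<^sup>2 + K\<chi> * ((\<nu> - \<mu>) \<bullet> (\<nu> - \<mu>))))"
proof -
  define h where "h = \<nu> - \<mu>"
  define b where "b = A *\<^sub>v h"
  define e where "e = minv Q *\<^sub>v b"
  have h [simp]: "h \<in> carrier_vec k" using \<mu> \<nu> by (simp add: h_def)
  have b [simp]: "b \<in> carrier_vec k" by (auto simp: b_def intro!: mult_mat_vec_carrier[of _ k k])
  have e [simp]: "e \<in> carrier_vec k"
    using pos_def_minv(1)[OF pd_Q] by (auto simp: e_def intro!: mult_mat_vec_carrier[of _ k k])
  have Qe: "Q *\<^sub>v e = b" unfolding e_def by (rule pos_def_minv(6)[OF pd_Q b])
  define R where "R = e \<bullet> b + h \<bullet> b"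
  have R: "R / 2 \<le> K\<chi> * (h \<bullet> h)"
  proof -
    have "e \<bullet> b = b \<bullet> (minv Q *\<^sub>v b)" unfolding e_def[symmetric] by (rule comm_scalar_prod[OF e b])
    also have "\<dots> \<le> (3*C/2) * (b \<bullet> b)" by (rule Q_inv_le) simp
    also have "\<dots> \<le> (3*C/2) * ((4/(3*c))\<^sup>2 * (h \<bullet> h))"
      using C unfolding b_def by (intro mult_left_mono mult_A) auto
    finally have "e \<bullet> b \<le> (3*C/2) * ((4/(3*c))\<^sup>2 * (h \<bullet> h))" .
    moreover have "h \<bullet> b \<le> (4/(3*c)) * (h \<bullet> h)" unfolding b_def by (rule A_le) simp
    ultimately show ?thesis by (simp add: R_def K\<chi>_def algebra_simps)
  qed
  define Z where "Z = (2 * pi) powr (- real k / 2) * det S powr (- 1) * det T powr (1 / 2)"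
  have ds: "0 < det S" "0 < det T" "0 < det Q"
    by (rule det_pos_def[OF S], rule det_pos_def[OF T], rule det_pos_def[OF pd_Q])
  have quot: "(mvn_density k \<mu> S (vec k y))\<^sup>2 / mvn_density k \<nu> T (vec k y)
     = Z * exp (R / 2) * exp (- ((vec k y - (\<mu> - e)) \<bullet> (Q *\<^sub>v (vec k y - (\<mu> - e)))) / 2)" for y
  proof -
    define x where "x = vec k y - \<mu>"
    have x [simp]: "x \<in> carrier_vec k" using \<mu> by (simp add: x_def)
    have 1: "vec k y - \<nu> = x + (- 1) \<cdot>\<^sub>v h" using \<mu> \<nu> by (intro eq_vecI) (auto simp: x_def h_def)
    have 2: "vec k y - (\<mu> - e) = x + 1 \<cdot>\<^sub>v e" using \<mu> by (intro eq_vecI) (auto simp: x_def carrier_vecD[OF e])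
    note sy = pos_def_matD(2)[OF pd(2)] pos_def_matD(2)[OF pd_Q]
    have "inv_form T (vec k y - \<nu>) = x \<bullet> (A *\<^sub>v x) - 2 * (x \<bullet> b) + h \<bullet> b"
      unfolding inv_form_def A_def[symmetric] 1 using sy by (subst form_add[of _ k]) (auto simp: b_def)
    moreover have "inv_form S (vec k y - \<mu>) = x \<bullet> (A0 *\<^sub>v x)"
      unfolding inv_form_def A0_def[symmetric] x_def[symmetric] ..
    moreover have "(vec k y - (\<mu> - e)) \<bullet> (Q *\<^sub>v (vec k y - (\<mu> - e))) = x \<bullet> (Q *\<^sub>v x) + 2 * (x \<bullet> b) + e \<bullet> b"
      unfolding 2 using sy by (subst form_add[of _ k]) (auto simp: Qe)
    ultimately have "- inv_form S (vec k y - \<mu>) + inv_form T (vec k y - \<nu>) / 2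
       = R / 2 - ((vec k y - (\<mu> - e)) \<bullet> (Q *\<^sub>v (vec k y - (\<mu> - e)))) / 2"
      by (simp add: form_Q R_def field_simps)
    then have ex: "exp (- inv_form S (vec k y - \<mu>)) / exp (- inv_form T (vec k y - \<nu>) / 2)
       = exp (R / 2) * exp (- ((vec k y - (\<mu> - e)) \<bullet> (Q *\<^sub>v (vec k y - (\<mu> - e)))) / 2)"
      by (simp add: exp_diff[symmetric] exp_add[symmetric])
    have sq: "(exp (- inv_form S (vec k y - \<mu>) / 2))\<^sup>2 = exp (- inv_form S (vec k y - \<mu>))"
      by (simp add: power2_eq_square exp_add[symmetric])
    have "Z = ((2 * pi) powr (- real k / 2) * det S powr (- 1 / 2))\<^sup>2 /
        ((2 * pi) powr (- real k / 2) * det T powr (- 1 / 2))"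
      using ds by (simp add: Z_def power2_eq_square powr_add[symmetric] powr_minus field_simps)
    then have "Z * (exp (- inv_form S (vec k y - \<mu>)) / exp (- inv_form T (vec k y - \<nu>) / 2))
      = (mvn_density k \<mu> S (vec k y))\<^sup>2 / mvn_density k \<nu> T (vec k y)"
      unfolding mvn_density_eq power_mult_distrib[of _ "exp _"] sq by simp
    then show ?thesis unfolding ex by (simp add: mult.assoc)
  qed
  have Z0: "0 \<le> Z" by (simp add: Z_def)
  have m: "(\<lambda>y. (vec k y - (\<mu> - e)) \<bullet> (Q *\<^sub>v (vec k y - (\<mu> - e)))) \<in> borel_measurable (Pi\<^sub>M {..<k} (\<lambda>_. lborel))"
    using borel_measurable_mvn_density_vec(2)[OF pos_def_minv(4)[OF pd_Q], of "\<mu> - e"] \<mu>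
    by (simp add: inv_form_def minv_minv[OF pd_Q])
  have "(\<integral>\<^sup>+y. ennreal ((mvn_density k \<mu> S (vec k y))\<^sup>2 / mvn_density k \<nu> T (vec k y)) \<partial>Pi\<^sub>M {..<k} (\<lambda>_. lborel))
    = (\<integral>\<^sup>+y. ennreal (Z * exp (R / 2)) * ennreal (exp (- ((vec k y - (\<mu> - e)) \<bullet> (Q *\<^sub>v (vec k y - (\<mu> - e)))) / 2)) \<partial>Pi\<^sub>M {..<k} (\<lambda>_. lborel))"
    unfolding quot using Z0 by (simp add: ennreal_mult)
  also have "\<dots> = ennreal (Z * exp (R / 2)) *
      (\<integral>\<^sup>+y. ennreal (exp (- ((vec k y - (\<mu> - e)) \<bullet> (Q *\<^sub>v (vec k y - (\<mu> - e)))) / 2)) \<partial>Pi\<^sub>M {..<k} (\<lambda>_. lborel))"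
    by (intro nn_integral_cmult measurable_compose[OF m, of "\<lambda>x. ennreal (exp (- x / 2))"]) measurable
  also have "\<dots> = ennreal (Z * exp (R / 2)) * ennreal ((2 * pi) powr (real k / 2) * det Q powr (- 1 / 2))"
    using \<mu> by (subst gaussian_integral[OF pd_Q]) auto
  also have "\<dots> = ennreal (exp (R / 2) * (Z * (2 * pi) powr (real k / 2) * det Q powr (- 1 / 2)))"
    using Z0 by (simp add: ennreal_mult[symmetric] mult_ac)
  also have "Z * (2 * pi) powr (real k / 2) * det Q powr (- 1 / 2)
      = sqrt ((det A0)\<^sup>2 / (det A * det Q))"
  proof -
    have "(2 * pi) powr (- real k / 2) * (2 * pi) powr (real k / 2) = 1" by (simp add: powr_add[symmetric])
    then have "Z * (2 * pi) powr (real k / 2) * det Q powr (- 1 / 2)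
      = det S powr (- 1) * det T powr (1 / 2) * det Q powr (- 1 / 2)"
      by (simp add: Z_def mult_ac)
    also have "\<dots> = sqrt (det T) / (det S * sqrt (det Q))"
      using ds by (simp add: powr_minus powr_half_sqrt[symmetric] field_simps)
    also have "\<dots> = sqrt ((det A0)\<^sup>2 / (det A * det Q))"
      unfolding A0_def A_def pos_def_minv(5)[OF S] pos_def_minv(5)[OF T]
      using ds by (simp add: real_sqrt_divide real_sqrt_mult power_divide)
    finally show ?thesis .
  qed
  also have "ennreal (exp (R / 2) * sqrt ((det A0)\<^sup>2 / (det A * det Q)))
    \<le> ennreal (exp (K\<chi> * (h \<bullet> h)) * exp (2 * C / c^3 * (frob_norm D)\<^sup>2))"
  proof (intro ennreal_leI mult_mono)
    have "sqrt ((det A0)\<^sup>2 / (det A * det Q)) \<le> sqrt (exp (4 * C / c^3 * (frob_norm D)\<^sup>2))"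
      using det_ratio_bound by (rule real_sqrt_le_mono)
    also have "\<dots> = exp (2 * C / c^3 * (frob_norm D)\<^sup>2)"
      by (rule real_sqrt_unique) (simp_all add: power2_eq_square exp_add[symmetric])
    finally show "sqrt ((det A0)\<^sup>2 / (det A * det Q)) \<le> exp (2 * C / c^3 * (frob_norm D)\<^sup>2)" .
  qed (use R det_pos_def[OF pd(2)] ds in auto)
  finally show ?thesis by (simp add: h_def exp_add[symmetric] add.commute)
qed

end

section \<open>Tempered Gaussian majorants\<close>

definition tilted_density :: "real \<Rightarrow> nat \<Rightarrow> real vec \<Rightarrow> real mat \<Rightarrow> real vec \<Rightarrow> real" where
  "tilted_density \<beta> k \<nu> T y =
    (2 * pi) powr (- real k / 2) * det T powr (- 1 / 2) * exp (- (1 - 2 * \<beta>) * inv_form T (y - \<nu>) / 2)"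

lemma tilted_density_pos: "pos_def_mat k T \<Longrightarrow> 0 < tilted_density \<beta> k \<nu> T y"
  using det_pos_def[of k T] by (simp add: tilted_density_def)

text \<open>Two losses in the exponent: moving the mean costs a fraction \<beta> by Young's
  inequality, plus a term of order |h|^2 / \<beta> that is free of y; changing the covariance
  divides by 1 + \<beta>. Together the factor stays at least 1 - 2\<beta>. The normalising constants
  differ by at most exp(\<beta> k / 2). Only \<gamma> |T - S| matters, since 1/\<gamma> bounds both
  forms from below.\<close>

lemma mvn_density_le_tilted:
  assumes S: "pos_def_mat k S" and T: "pos_def_mat k T" and \<gamma>: "0 < \<gamma>" and \<beta>: "0 < \<beta>"
    and geS: "\<And>v. v \<in> carrier_vec k \<Longrightarrow> v \<bullet> v \<le> \<gamma> * (v \<bullet> (S *\<^sub>v v))"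
    and geT: "\<And>v. v \<in> carrier_vec k \<Longrightarrow> v \<bullet> v \<le> \<gamma> * (v \<bullet> (T *\<^sub>v v))"
    and near: "\<gamma> * frob_norm (T - S) \<le> \<beta>"
    and \<mu>: "\<mu> \<in> carrier_vec k" and \<nu>: "\<nu> \<in> carrier_vec k" and y: "y \<in> carrier_vec k"
  shows "mvn_density k \<mu> S y \<le>
    exp (\<beta> * real k / 2 + \<gamma> * ((\<nu> - \<mu>) \<bullet> (\<nu> - \<mu>)) / (2 * \<beta>)) * tilted_density \<beta> k \<nu> T y"
proof -
  have fr: "frob_norm (T - S) * (v \<bullet> v) \<le> \<beta> * (v \<bullet> (S *\<^sub>v v))" if v: "v \<in> carrier_vec k" for v
  proof -
    have "frob_norm (T - S) * (v \<bullet> v) \<le> frob_norm (T - S) * (\<gamma> * (v \<bullet> (S *\<^sub>v v)))"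
      by (intro mult_left_mono geS v frob_norm_nonneg)
    also have "\<dots> = (\<gamma> * frob_norm (T - S)) * (v \<bullet> (S *\<^sub>v v))" by simp
    also have "\<dots> \<le> \<beta> * (v \<bullet> (S *\<^sub>v v))" by (intro mult_right_mono near pos_def_matD(4)[OF S v])
    finally show ?thesis .
  qed
  have TS: "v \<bullet> (T *\<^sub>v v) \<le> (1 + \<beta>) * (v \<bullet> (S *\<^sub>v v))" if v: "v \<in> carrier_vec k" for v
    using form_le_frob_diff[OF pos_def_matD(1)[OF S] pos_def_matD(1)[OF T] v] fr[OF v] by (simp add: algebra_simps)
  have ST: "v \<bullet> (S *\<^sub>v v) \<le> (1 + \<beta>) * (v \<bullet> (T *\<^sub>v v))" if v: "v \<in> carrier_vec k" for v
  proof -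
    have "frob_norm (T - S) * (v \<bullet> v) \<le> frob_norm (T - S) * (\<gamma> * (v \<bullet> (T *\<^sub>v v)))"
      by (intro mult_left_mono geT v frob_norm_nonneg)
    also have "\<dots> = (\<gamma> * frob_norm (T - S)) * (v \<bullet> (T *\<^sub>v v))" by simp
    also have "\<dots> \<le> \<beta> * (v \<bullet> (T *\<^sub>v v))" by (intro mult_right_mono near pos_def_matD(4)[OF T v])
    finally show ?thesis
      using form_le_frob_diff[OF pos_def_matD(1)[OF S] pos_def_matD(1)[OF T] v] by (simp add: algebra_simps)
  qed
  have dS: "0 < det S" and dT: "0 < det T"
    by (rule det_pos_def[OF S], rule det_pos_def[OF T])
  have det: "det S powr (- 1 / 2) \<le> exp (\<beta> * real k / 2) * det T powr (- 1 / 2)"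
  proof -
    have "det T \<le> (1 + \<beta>) ^ k * det S"
      using \<beta> by (intro det_mono[OF S T _ TS]) auto
    also have "\<dots> \<le> exp \<beta> ^ k * det S"
      using \<beta> dS by (intro mult_right_mono power_mono) auto
    finally have "exp (- (\<beta> * real k)) * det T \<le> det S"
      by (simp add: exp_minus exp_of_nat_mult[symmetric] field_simps)
    then have "det S powr (- 1 / 2) \<le> (exp (- (\<beta> * real k)) * det T) powr (- 1 / 2)"
      using dT dS by (intro powr_mono2') auto
    also have "\<dots> = exp (\<beta> * real k / 2) * det T powr (- 1 / 2)"
      using dT by (simp add: powr_mult) (simp add: powr_def)
    finally show ?thesis .
  qed
  define a where "a = y - \<nu>"
  define h where "h = \<nu> - \<mu>"
  define P where "P = minv T"
  have [simp]: "a \<in> carrier_vec k" "h \<in> carrier_vec k" using y \<nu> \<mu> by (auto simp: a_def h_def)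
  note P = pos_def_minv(4)[OF T, folded P_def]
  have ya: "y - \<mu> = a + 1 \<cdot>\<^sub>v h" using y \<nu> \<mu> by (intro eq_vecI) (auto simp: a_def h_def)
  define q where "q = inv_form T a"
  have q0: "0 \<le> q" unfolding q_def by (rule inv_form_nonneg[OF T]) simp
  have qa: "q = a \<bullet> (P *\<^sub>v a)" by (simp add: q_def inv_form_def P_def)
  have hPh: "h \<bullet> (P *\<^sub>v h) \<le> \<gamma> * (h \<bullet> h)"
    using minv_le_of_ge[OF T, of "1 / \<gamma>" h] geT \<gamma> by (simp add: P_def field_simps)
  have hPh0: "0 \<le> h \<bullet> (P *\<^sub>v h)" by (rule pos_def_matD(4)[OF P]) simp
  have 1: "(1 - \<beta>) * q - \<gamma> * (h \<bullet> h) / \<beta> \<le> inv_form T (y - \<mu>)"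
  proof -
    \<comment> \<open>Young's inequality for the cross term, written as nonnegativity of the form at
      h + \<beta> a and then divided by \<beta>.\<close>
    have "0 \<le> (h + \<beta> \<cdot>\<^sub>v a) \<bullet> (P *\<^sub>v (h + \<beta> \<cdot>\<^sub>v a))" by (rule pos_def_matD(4)[OF P]) simp
    also have "\<dots> = h \<bullet> (P *\<^sub>v h) + 2 * \<beta> * (h \<bullet> (P *\<^sub>v a)) + \<beta>\<^sup>2 * q"
      unfolding qa by (rule form_add[OF pos_def_matD(1,2)[OF P]]) auto
    finally have "0 \<le> (h \<bullet> (P *\<^sub>v h) + 2 * \<beta> * (h \<bullet> (P *\<^sub>v a)) + \<beta>\<^sup>2 * q) / \<beta>" using \<beta> by simp
    then have "- (\<beta> * q) - (h \<bullet> (P *\<^sub>v h)) / \<beta> \<le> 2 * (h \<bullet> (P *\<^sub>v a))"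
      using \<beta> by (simp add: add_divide_distrib power2_eq_square)
    moreover have "inv_form T (y - \<mu>) = q + 2 * (h \<bullet> (P *\<^sub>v a)) + h \<bullet> (P *\<^sub>v h)"
      unfolding inv_form_def P_def[symmetric] ya qa
      by (subst form_add[OF pos_def_matD(1,2)[OF P]]) (auto simp: scalar_prod_symmetric_mat[OF pos_def_matD(1,2)[OF P], of h a])
    moreover have "(h \<bullet> (P *\<^sub>v h)) / \<beta> \<le> \<gamma> * (h \<bullet> h) / \<beta>" using hPh \<beta> by (simp add: divide_right_mono)
    ultimately show ?thesis using hPh0 by (simp add: algebra_simps)
  qed
  have 2: "inv_form T (y - \<mu>) \<le> (1 + \<beta>) * inv_form S (y - \<mu>)"
    unfolding inv_form_def using \<beta> y \<mu> by (intro inverse_antitone[OF S T _ ST]) auto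
  have "(1 - 2 * \<beta>) * q - \<gamma> * (h \<bullet> h) / \<beta> \<le> inv_form S (y - \<mu>)"
  proof -
    define g where "g = \<gamma> * (h \<bullet> h) / \<beta>"
    have g0: "0 \<le> g" using \<gamma> \<beta> scalar_prod_self_nonneg[of h] by (simp add: g_def)
    \<comment> \<open>The product (1 + \<beta>)(1 - 2\<beta>) is 1 - \<beta> - 2\<beta>^2, at most 1
      - \<beta>.\<close>
    have "(1 + \<beta>) * ((1 - 2 * \<beta>) * q - g) \<le> (1 - \<beta>) * q - g"
      using \<beta> q0 g0 mult_nonneg_nonneg[of "\<beta> * \<beta>" q] mult_nonneg_nonneg[of \<beta> g] by (simp add: algebra_simps)
    also have "\<dots> \<le> (1 + \<beta>) * inv_form S (y - \<mu>)" using 1 2 by (simp add: g_def)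
    finally show ?thesis using \<beta> by (simp add: g_def)
  qed
  then have "exp (- inv_form S (y - \<mu>) / 2) \<le> exp (\<gamma> * (h \<bullet> h) / (2 * \<beta>)) * exp (- (1 - 2 * \<beta>) * q / 2)"
    unfolding exp_add[symmetric] by (simp add: field_simps)
  then have "det S powr (- 1 / 2) * exp (- inv_form S (y - \<mu>) / 2)
     \<le> (exp (\<beta> * real k / 2) * det T powr (- 1 / 2)) * (exp (\<gamma> * (h \<bullet> h) / (2 * \<beta>)) * exp (- (1 - 2 * \<beta>) * q / 2))"
    using det by (intro mult_mono) auto
  then have "(2 * pi) powr (- real k / 2) * (det S powr (- 1 / 2) * exp (- inv_form S (y - \<mu>) / 2))
     \<le> (2 * pi) powr (- real k / 2) * ((exp (\<beta> * real k / 2) * det T powr (- 1 / 2)) * (exp (\<gamma> * (h \<bullet> h) / (2 * \<beta>)) * exp (- (1 - 2 * \<beta>) * q / 2)))"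
    by (rule mult_left_mono) simp
  then show ?thesis
    unfolding mvn_density_eq tilted_density_def exp_add h_def q_def a_def by (simp only: mult_ac)
qed

lemma tilted_ratio_integral:
  assumes T: "pos_def_mat k T" and \<nu>: "\<nu> \<in> carrier_vec k" and \<beta>: "0 < \<beta>" "\<beta> \<le> 1 / 8"
  shows "(\<integral>\<^sup>+y. ennreal ((tilted_density \<beta> k \<nu> T (vec k y))\<^sup>2 / mvn_density k \<nu> T (vec k y)) \<partial>Pi\<^sub>M {..<k} (\<lambda>_. lborel))
    \<le> ennreal (exp (4 * \<beta> * real k))"
proof -
  have dT: "0 < det T" by (rule det_pos_def[OF T])
  have "(tilted_density \<beta> k \<nu> T (vec k y))\<^sup>2 / mvn_density k \<nu> T (vec k y)
     = (2 * pi) powr (- real k / 2) * det T powr (- 1 / 2) * exp (- (1 - 4 * \<beta>) * inv_form T (vec k y - \<nu>) / 2)" for y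
  proof -
    define Z where "Z = (2 * pi) powr (- real k / 2) * det T powr (- 1 / 2)"
    define q where "q = inv_form T (vec k y - \<nu>)"
    have Z: "Z > 0" using dT by (simp add: Z_def)
    have "(Z * exp (- (1 - 2 * \<beta>) * q / 2))\<^sup>2 = (Z * exp (- (1 - 4 * \<beta>) * q / 2)) * (Z * exp (- q / 2))"
      by (simp add: power2_eq_square exp_add[symmetric] field_simps)
    then have "(Z * exp (- (1 - 2 * \<beta>) * q / 2))\<^sup>2 / (Z * exp (- q / 2)) = Z * exp (- (1 - 4 * \<beta>) * q / 2)"
      using Z by simp
    then show ?thesis unfolding tilted_density_def mvn_density_eq Z_def q_def .
  qed
  then have "(\<integral>\<^sup>+y. ennreal ((tilted_density \<beta> k \<nu> T (vec k y))\<^sup>2 / mvn_density k \<nu> T (vec k y)) \<partial>Pi\<^sub>M {..<k} (\<lambda>_. lborel))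
     = ennreal ((1 - 4 * \<beta>) powr (- real k / 2))"
    using gaussian_integral_scaled[OF T \<nu>, of "1 - 4 * \<beta>"] \<beta> by simp
  also have "\<dots> \<le> ennreal (exp (4 * \<beta> * real k))"
  proof (rule ennreal_leI)
    \<comment> \<open>The product is 1 + 4\<beta> - 32\<beta>^2, which is at least 1 because \<beta>
      is at most 1/8.\<close>
    have "1 \<le> (1 - 4 * \<beta>) * (1 + 8 * \<beta>)" using \<beta> mult_left_mono[OF \<beta>(2), of \<beta>] by (simp add: algebra_simps)
    also have "\<dots> \<le> (1 - 4 * \<beta>) * exp (8 * \<beta>)" using \<beta> by (intro mult_left_mono) auto
    finally have "exp (- (8 * \<beta>)) \<le> 1 - 4 * \<beta>" by (simp add: exp_minus field_simps)
    then have "(1 - 4 * \<beta>) powr (- real k / 2) \<le> exp (- (8 * \<beta>)) powr (- real k / 2)"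
      by (intro powr_mono2') auto
    also have "\<dots> = exp (4 * \<beta> * real k)" by (simp add: powr_def)
    finally show "(1 - 4 * \<beta>) powr (- real k / 2) \<le> exp (4 * \<beta> * real k)" .
  qed
  finally show ?thesis .
qed

lemma borel_measurable_tilted_density_vec:
  assumes "pos_def_mat k T" "\<nu> \<in> carrier_vec k"
  shows "(\<lambda>y. tilted_density \<beta> k \<nu> T (vec k y)) \<in> borel_measurable (Pi\<^sub>M {..<k} (\<lambda>_. lborel))"
  unfolding tilted_density_def
  by (rule measurable_compose[OF borel_measurable_mvn_density_vec(2)[OF assms],
     of "\<lambda>x. (2 * pi) powr (- real k / 2) * det T powr (- 1 / 2) * exp (- (1 - 2 * \<beta>) * x / 2)"]) measurable

section \<open>Posterior mass under a dominated model\<close>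

text \<open>The truth \<open>p0\<close> is a function of its own rather than a member of the family,
  because \<eta>0 need not lie in the space that carries the prior.\<close>

locale dominated_bayes = prob_space P + base: sigma_finite_measure N
  for P :: "'z measure" and N :: "'y measure" +
  fixes p :: "'z \<Rightarrow> 'y \<Rightarrow> real" and p0 :: "'y \<Rightarrow> real"
  assumes p_meas: "(\<lambda>x. p (fst x) (snd x)) \<in> borel_measurable (P \<Otimes>\<^sub>M N)"
    and p0_meas [measurable]: "p0 \<in> borel_measurable N"
    and p_pos: "\<And>z y. z \<in> space P \<Longrightarrow> y \<in> space N \<Longrightarrow> 0 < p z y"
    and p0_pos: "\<And>y. y \<in> space N \<Longrightarrow> 0 < p0 y"
    and p_int: "\<And>z. z \<in> space P \<Longrightarrow> (\<integral>\<^sup>+y. ennreal (p z y) \<partial>N) \<le> 1"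
begin

sublocale pair_sigma_finite P N ..

lemma p_meas1 [measurable]: "(\<lambda>(z, y). p z y) \<in> borel_measurable (P \<Otimes>\<^sub>M N)"
  using p_meas by (simp add: case_prod_beta')

text \<open>In the overview D is \<open>evid\<close>, N is \<open>mass A\<close> and V is
  \<open>inv_evid\<close>. Extended nonnegative values let the bounds be stated before anything is
  known to be finite.\<close>

definition evid :: "'y \<Rightarrow> ennreal" where "evid y = (\<integral>\<^sup>+z. ennreal (p z y) \<partial>P)"

definition mass :: "'z set \<Rightarrow> 'y \<Rightarrow> ennreal" where "mass A y = (\<integral>\<^sup>+z. ennreal (p z y) * indicator A z \<partial>P)"

definition post_mass :: "'z set \<Rightarrow> ennreal" where
  "post_mass A = (\<integral>\<^sup>+y. ennreal (p0 y) * (mass A y / evid y) \<partial>N)"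

definition inv_evid :: ennreal where
  "inv_evid = (\<integral>\<^sup>+y. ennreal ((p0 y)\<^sup>2) / evid y \<partial>N)"

lemma evid_meas [measurable]: "evid \<in> borel_measurable N"
  unfolding evid_def by measurable

lemma mass_meas [measurable]:
  assumes [measurable]: "A \<in> sets P"
  shows "mass A \<in> borel_measurable N"
  unfolding mass_def by measurable

lemma mass_le_evid: "mass A y \<le> evid y"
  unfolding mass_def evid_def by (intro nn_integral_mono) (auto simp: indicator_def)

lemma p_sec [measurable]: "y \<in> space N \<Longrightarrow> (\<lambda>z. p z y) \<in> borel_measurable P"
  using measurable_compose[OF measurable_Pair2'[of y N P] p_meas1] by simp

lemma evid_pos: assumes y: "y \<in> space N" shows "0 < evid y"
proof (rule ccontr)
  assume "\<not> 0 < evid y"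
  then have "AE z in P. ennreal (p z y) = 0"
    using y unfolding evid_def by (subst (asm) zero_less_iff_neq_zero, subst (asm) nn_integral_0_iff_AE) auto
  then have "AE z in P. False" by (rule AE_mp) (auto intro!: AE_I2 simp: ennreal_eq_0_iff dest: p_pos[OF _ y])
  then show False using AE_False by simp
qed

text \<open>Cauchy--Schwarz for \<open>1 = \<surd>p \<cdot> (1 / \<surd>p)\<close> on \<open>B\<close>.\<close>

lemma evid_Cauchy_Schwarz:
  assumes B: "B \<in> sets P" and y: "y \<in> space N" and pos: "0 < prob B"
  shows "1 / evid y \<le> (\<integral>\<^sup>+z. ennreal (1 / p z y) * indicator B z \<partial>P) / ennreal ((prob B)\<^sup>2)"
proof -
  define I where "I = (\<integral>\<^sup>+z. ennreal (1 / p z y) * indicator B z \<partial>P)"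
  \<comment> \<open>Linear form of Cauchy--Schwarz: t p + 1/(t p) is at least 2 on B. It avoids
    square roots of possibly infinite integrals, and t is chosen afterwards.\<close>
  have key: "ennreal (2 * prob B) \<le> ennreal t * evid y + ennreal (1 / t) * I" if t: "0 < t" for t
  proof -
    have "ennreal (2 * prob B) = (\<integral>\<^sup>+z. 2 * indicator B z \<partial>P)"
      using B by (simp add: nn_integral_cmult_indicator emeasure_eq_measure ennreal_mult)
    also have "\<dots> \<le> (\<integral>\<^sup>+z. ennreal t * ennreal (p z y) + ennreal (1 / t) * (ennreal (1 / p z y) * indicator B z) \<partial>P)"
    proof (rule nn_integral_mono)
      fix z assume z: "z \<in> space P"
      define x where "x = t * p z y"
      have x: "0 < x" using t p_pos[OF z y] by (simp add: x_def)
      have "0 \<le> (x - 1)\<^sup>2 / x" using x by simp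
      also have "(x - 1)\<^sup>2 / x = x + 1 / x - 2" using x by (simp add: power2_eq_square field_simps)
      finally have "ennreal 2 \<le> ennreal (x + 1 / x)" by (intro ennreal_leI) simp
      also have "\<dots> = ennreal t * ennreal (p z y) + ennreal (1 / t) * ennreal (1 / p z y)"
        using t p_pos[OF z y] by (simp add: x_def ennreal_mult[symmetric] ennreal_plus[symmetric] del: ennreal_plus)
      finally show "2 * indicator B z \<le> ennreal t * ennreal (p z y) + ennreal (1 / t) * (ennreal (1 / p z y) * indicator B z)"
        by (auto simp: indicator_def)
    qed
    also have "\<dots> = ennreal t * evid y + ennreal (1 / t) * I"
      using y B unfolding evid_def I_def by (simp add: nn_integral_add nn_integral_cmult)
    finally show ?thesis .
  qed
  show ?thesis
  proof (cases "evid y = \<infinity> \<or> I = \<infinity>")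
    case True
    then show ?thesis using pos unfolding I_def[symmetric] by (auto simp: ennreal_top_divide divide_ennreal_def ennreal_top_mult ennreal_mult_eq_top_iff)
  next
    case False
    define d where "d = enn2real (evid y)"
    define i where "i = enn2real I"
    have e: "evid y = ennreal d" "I = ennreal i" using False by (auto simp: d_def i_def less_top)
    have d: "0 < d" using evid_pos[OF y] e(1) by (simp add: ennreal_less_zero_iff)
    have i: "0 \<le> i" by (simp add: i_def)
    \<comment> \<open>This t makes the first term on the right equal to \<open>prob B\<close>,
      leaving \<open>prob B \<le> i * d / prob B\<close>.\<close>
    define t where "t = prob B / d"
    have t: "0 < t" using pos d by (simp add: t_def)
    have "ennreal (2 * prob B) \<le> ennreal (t * d + 1 / t * i)"
      using key[OF t] t d i unfolding e by (simp add: ennreal_mult[symmetric] ennreal_plus[symmetric] del: ennreal_plus)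
    then have "2 * prob B \<le> t * d + 1 / t * i"
      using t d i by (subst (asm) ennreal_le_iff) auto
    then have "prob B \<le> i * d / prob B" using d pos by (simp add: t_def field_simps)
    then have "(prob B)\<^sup>2 \<le> i * d" using pos by (simp add: field_simps power2_eq_square)
    then have "1 / d \<le> i / (prob B)\<^sup>2" using d pos by (simp add: field_simps)
    then have "ennreal (1 / d) \<le> ennreal (i / (prob B)\<^sup>2)" by (rule ennreal_leI)
    then show ?thesis unfolding I_def[symmetric] e using d i pos
      by (simp add: divide_ennreal[symmetric])
  qed
qed

text \<open>The factor \<open>prob B\<close> is lost twice in \<open>evid_Cauchy_Schwarz\<close> and
  regained once: after exchanging the integrals, the integral of p0^2 / p, at most V, is averaged
  over B.\<close>

lemma inv_evid_le:
  assumes B: "B \<in> sets P" and pos: "0 < prob B" and V: "0 \<le> V"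
    and le: "\<And>z. z \<in> B \<Longrightarrow> (\<integral>\<^sup>+y. ennreal ((p0 y)\<^sup>2 / p z y) \<partial>N) \<le> ennreal V"
  shows "inv_evid \<le> ennreal (V / prob B)"
proof -
  note [measurable] = B
  have "inv_evid \<le> (\<integral>\<^sup>+y. (\<integral>\<^sup>+z. ennreal ((p0 y)\<^sup>2 / p z y) * indicator B z \<partial>P) / ennreal ((prob B)\<^sup>2) \<partial>N)"
    unfolding inv_evid_def
  proof (rule nn_integral_mono)
    fix y assume y: "y \<in> space N"
    have "ennreal ((p0 y)\<^sup>2) / evid y = ennreal ((p0 y)\<^sup>2) * (1 / evid y)"
      by (simp add: divide_ennreal_def)
    also have "\<dots> \<le> ennreal ((p0 y)\<^sup>2) * ((\<integral>\<^sup>+z. ennreal (1 / p z y) * indicator B z \<partial>P) / ennreal ((prob B)\<^sup>2))"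
      by (intro mult_left_mono evid_Cauchy_Schwarz[OF B y pos]) simp
    also have "\<dots> = (ennreal ((p0 y)\<^sup>2) * (\<integral>\<^sup>+z. ennreal (1 / p z y) * indicator B z \<partial>P)) / ennreal ((prob B)\<^sup>2)"
      by (simp add: ennreal_times_divide)
    also have "ennreal ((p0 y)\<^sup>2) * (\<integral>\<^sup>+z. ennreal (1 / p z y) * indicator B z \<partial>P)
      = (\<integral>\<^sup>+z. ennreal ((p0 y)\<^sup>2) * (ennreal (1 / p z y) * indicator B z) \<partial>P)"
      using y B by (intro nn_integral_cmult[symmetric]) auto
    also have "\<dots> = (\<integral>\<^sup>+z. ennreal ((p0 y)\<^sup>2 / p z y) * indicator B z \<partial>P)"
      using p_pos[OF _ y] by (intro nn_integral_cong) (simp add: mult.assoc[symmetric] ennreal_mult''[symmetric] less_imp_le)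
    finally show "ennreal ((p0 y)\<^sup>2) / evid y \<le> (\<integral>\<^sup>+z. ennreal ((p0 y)\<^sup>2 / p z y) * indicator B z \<partial>P) / ennreal ((prob B)\<^sup>2)" .
  qed
  also have "\<dots> = (\<integral>\<^sup>+y. (\<integral>\<^sup>+z. ennreal ((p0 y)\<^sup>2 / p z y) * indicator B z \<partial>P) \<partial>N) / ennreal ((prob B)\<^sup>2)"
    using B by (intro nn_integral_divide) measurable
  also have "(\<integral>\<^sup>+y. (\<integral>\<^sup>+z. ennreal ((p0 y)\<^sup>2 / p z y) * indicator B z \<partial>P) \<partial>N)
     = (\<integral>\<^sup>+z. (\<integral>\<^sup>+y. ennreal ((p0 y)\<^sup>2 / p z y) * indicator B z \<partial>N) \<partial>P)"
    using B by (intro Fubini') measurable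
  also have "\<dots> \<le> (\<integral>\<^sup>+z. ennreal V * indicator B z \<partial>P)"
  proof (rule nn_integral_mono)
    fix z assume "z \<in> space P"
    show "(\<integral>\<^sup>+y. ennreal ((p0 y)\<^sup>2 / p z y) * indicator B z \<partial>N) \<le> ennreal V * indicator B z"
      using le[of z] by (cases "z \<in> B") auto
  qed
  also have "\<dots> = ennreal (V * prob B)"
    using B V by (simp add: nn_integral_cmult_indicator emeasure_eq_measure ennreal_mult)
  finally have "inv_evid \<le> ennreal (V * prob B) / ennreal ((prob B)\<^sup>2)"
    by (simp add: divide_right_mono_ennreal)
  also have "\<dots> = ennreal (V / prob B)"
    using pos V by (simp add: divide_ennreal power2_eq_square)
  finally show ?thesis .
qed

section \<open>Expected posterior mass of a set\<close>

lemma mass_integral_le: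
  assumes A: "A \<in> sets P"
  shows "(\<integral>\<^sup>+y. mass A y \<partial>N) \<le> emeasure P A"
proof -
  note [measurable] = A
  have "(\<integral>\<^sup>+y. mass A y \<partial>N) = (\<integral>\<^sup>+z. (\<integral>\<^sup>+y. ennreal (p z y) * indicator A z \<partial>N) \<partial>P)"
    unfolding mass_def using A by (intro Fubini') measurable
  also have "\<dots> \<le> (\<integral>\<^sup>+z. indicator A z \<partial>P)"
    by (intro nn_integral_mono) (auto simp: indicator_def p_int)
  finally show ?thesis using A by simp
qed

text \<open>Serves sets of small prior mass. Where D \<le> \<tau> p0, the posterior mass is at most
  1, hence at most \<tau> p0 / D. Elsewhere p0 / D is below 1/\<tau>, and \<open>mass A\<close>
  integrates to at most the prior mass.\<close>

lemma post_mass_le_prior: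
  assumes A: "A \<in> sets P" and \<tau>: "0 < \<tau>"
  shows "post_mass A \<le> ennreal \<tau> * inv_evid + emeasure P A / ennreal \<tau>"
proof -
  have "post_mass A \<le> (\<integral>\<^sup>+y. ennreal \<tau> * (ennreal ((p0 y)\<^sup>2) / evid y) + mass A y / ennreal \<tau> \<partial>N)"
    unfolding post_mass_def
  proof (rule nn_integral_mono)
    fix y assume y: "y \<in> space N"
    show "ennreal (p0 y) * (mass A y / evid y) \<le> ennreal \<tau> * (ennreal ((p0 y)\<^sup>2) / evid y) + mass A y / ennreal \<tau>"
    proof (cases "evid y = \<infinity>")
      \<comment> \<open>An infinite denominator makes the quotient 0 in
        \<open>ennreal\<close>.\<close>
      case True
      then show ?thesis by (simp add: divide_ennreal_def)
    next
      case False
      define d where "d = enn2real (evid y)"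
      have e: "evid y = ennreal d" using False by (auto simp: d_def less_top)
      have d: "0 < d" using evid_pos[OF y] e by (simp add: ennreal_less_zero_iff)
      have "mass A y \<noteq> \<infinity>" using mass_le_evid[of A y] False by (auto simp: top_unique)
      then obtain m where m: "mass A y = ennreal m" "0 \<le> m" by (cases "mass A y") auto
      have md: "m \<le> d" using mass_le_evid[of A y] m d unfolding e by (simp add: ennreal_le_iff)
      define a where "a = p0 y"
      have a: "0 < a" using p0_pos[OF y] by (simp add: a_def)
      have "a * (m / d) \<le> \<tau> * (a\<^sup>2 / d) + m / \<tau>"
      proof (cases "d \<le> \<tau> * a")
        case True
        have "a * m \<le> a * (\<tau> * a)" using True md a by (intro mult_left_mono) auto
        then have "a * m / d \<le> a * (\<tau> * a) / d" using d by (intro divide_right_mono) auto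
        then show ?thesis using m(2) \<tau> by (simp add: power2_eq_square mult_ac add_increasing2)
      next
        case False
        have "m * (\<tau> * a) \<le> m * d" using False m(2) by (intro mult_left_mono) auto
        then have "a * (m / d) \<le> m / \<tau>" using \<tau> d by (simp add: field_simps)
        then show ?thesis using \<tau> d by (simp add: add_increasing)
      qed
      then have "ennreal (a * (m / d)) \<le> ennreal (\<tau> * (a\<^sup>2 / d) + m / \<tau>)" by (rule ennreal_leI)
      then show ?thesis using a m(2) d \<tau> unfolding e m(1) a_def[symmetric]
        by (simp add: divide_ennreal ennreal_mult[symmetric] ennreal_plus[symmetric] del: ennreal_plus)
    qed
  qed
  also have "\<dots> = ennreal \<tau> * inv_evid + (\<integral>\<^sup>+y. mass A y \<partial>N) / ennreal \<tau>"
    unfolding inv_evid_def using A by (simp add: nn_integral_add nn_integral_cmult nn_integral_divide)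
  also have "\<dots> \<le> ennreal \<tau> * inv_evid + emeasure P A / ennreal \<tau>"
    by (intro add_left_mono divide_right_mono_ennreal mass_integral_le A)
  finally show ?thesis .
qed

text \<open>Three regimes. If d \<le> \<tau> a, the minimum is bounded by 1. Otherwise the left side
  is at most a and at most u/\<tau>: for u \<le> \<sigma> q their geometric mean brings in the
  affinity, and for larger u one has u \<le> u^2 / (\<sigma> q).\<close>

lemma bracket_pointwise:
  fixes a u q d \<sigma> \<tau> :: real
  assumes "0 < a" "0 \<le> u" "0 < q" "0 < d" "0 < \<sigma>" "0 < \<tau>"
  shows "a * min 1 (u / d) \<le> \<tau> * (a\<^sup>2 / d) + sqrt (\<sigma> / \<tau>) * sqrt (a * q) + (u\<^sup>2 / q) / (\<sigma> * \<tau>)"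
proof -
  have t1: "0 \<le> \<tau> * (a\<^sup>2 / d)" and t2: "0 \<le> sqrt (\<sigma> / \<tau>) * sqrt (a * q)" and t3: "0 \<le> (u\<^sup>2 / q) / (\<sigma> * \<tau>)"
    using assms by auto
  show ?thesis
  proof (cases "d \<le> \<tau> * a")
    case True
    have "a * min 1 (u / d) \<le> a * 1" using assms by (intro mult_left_mono) auto
    also have "\<dots> \<le> a * (\<tau> * a / d)" using True assms by (intro mult_left_mono) auto
    finally show ?thesis using t2 t3 by (simp add: power2_eq_square mult_ac)
  next
    case False
    have ut: "a * min 1 (u / d) \<le> u / \<tau>"
    proof -
      have "a * min 1 (u / d) \<le> a * (u / d)" using assms by (intro mult_left_mono) auto
      also have "\<dots> \<le> u / \<tau>"
        using False assms mult_left_mono[of "\<tau> * a" d u] by (simp add: field_simps)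
      finally show ?thesis .
    qed
    have a1: "a * min 1 (u / d) \<le> a" using mult_left_mono[of "min 1 (u / d)" 1 a] assms by simp
    have nn: "0 \<le> a * min 1 (u / d)" using assms by simp
    show ?thesis
    proof (cases "u \<le> \<sigma> * q")
      case True
      have "(a * min 1 (u / d))\<^sup>2 \<le> a * (u / \<tau>)"
        unfolding power2_eq_square using a1 ut nn assms by (intro mult_mono) auto
      also have "\<dots> \<le> a * (\<sigma> * q / \<tau>)" using True assms by (intro mult_left_mono divide_right_mono) auto
      also have "\<dots> = (sqrt (\<sigma> / \<tau>) * sqrt (a * q))\<^sup>2" using assms by (simp add: power_mult_distrib)
      finally have "a * min 1 (u / d) \<le> sqrt (\<sigma> / \<tau>) * sqrt (a * q)" using t2 by (rule power2_le_imp_le)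
      then show ?thesis using t1 t3 by linarith
    next
      case False
      have "u * (\<sigma> * q) \<le> u * u" using False assms by (intro mult_left_mono) auto
      then have "u / \<tau> \<le> (u\<^sup>2 / q) / (\<sigma> * \<tau>)" using assms by (simp add: field_simps power2_eq_square)
      then show ?thesis using ut t1 t2 by linarith
    qed
  qed
qed

text \<open>Truncation at 1 is subadditive, so it can be applied cell by cell, and each cell keeps
  the bound 1 that \<open>bracket_pointwise\<close> needs where D is small.\<close>

lemma post_mass_le_brackets:
  assumes A: "A \<in> sets P" and J: "finite J" and \<sigma>: "0 < \<sigma>" and \<tau>: "0 < \<tau>"
    and u_meas: "\<And>j. j \<in> J \<Longrightarrow> u j \<in> borel_measurable N"
    and q_meas: "\<And>j. j \<in> J \<Longrightarrow> q j \<in> borel_measurable N"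
    and u_nn: "\<And>j y. j \<in> J \<Longrightarrow> y \<in> space N \<Longrightarrow> (0::real) \<le> u j y"
    and q_pos: "\<And>j y. j \<in> J \<Longrightarrow> y \<in> space N \<Longrightarrow> (0::real) < q j y"
    and cover: "\<And>z y. z \<in> A \<Longrightarrow> y \<in> space N \<Longrightarrow> \<exists>j\<in>J. p z y \<le> u j y"
    and r: "\<And>j. j \<in> J \<Longrightarrow> (\<integral>\<^sup>+y. ennreal (sqrt (p0 y * q j y)) \<partial>N) \<le> r"
    and w: "\<And>j. j \<in> J \<Longrightarrow> (\<integral>\<^sup>+y. ennreal ((u j y)\<^sup>2 / q j y) \<partial>N) \<le> w"
  shows "post_mass A \<le> of_nat (card J) * (ennreal \<tau> * inv_evid + ennreal (sqrt (\<sigma> / \<tau>)) * r + ennreal (1 / (\<sigma> * \<tau>)) * w)"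
proof -
  note [measurable] = u_meas q_meas
  define F where "F j y = ennreal \<tau> * (ennreal ((p0 y)\<^sup>2) / evid y) + ennreal (sqrt (\<sigma> / \<tau>)) * ennreal (sqrt (p0 y * q j y))
     + ennreal (1 / (\<sigma> * \<tau>)) * ennreal ((u j y)\<^sup>2 / q j y)" for j y
  have "post_mass A \<le> (\<integral>\<^sup>+y. (\<Sum>j\<in>J. F j y) \<partial>N)"
    unfolding post_mass_def
  proof (rule nn_integral_mono)
    fix y assume y: "y \<in> space N"
    show "ennreal (p0 y) * (mass A y / evid y) \<le> (\<Sum>j\<in>J. F j y)"
    proof (cases "evid y = \<infinity>")
      case True
      then show ?thesis by (simp add: divide_ennreal_def)
    next
      case False
      define d where "d = enn2real (evid y)"
      have e: "evid y = ennreal d" using False by (auto simp: d_def less_top)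
      have d: "0 < d" using evid_pos[OF y] e by (simp add: ennreal_less_zero_iff)
      have "mass A y \<noteq> \<infinity>" using mass_le_evid[of A y] False by (auto simp: top_unique)
      then obtain m where m: "mass A y = ennreal m" "0 \<le> m" by (cases "mass A y") auto
      have md: "m \<le> d" using mass_le_evid[of A y] m d unfolding e by (simp add: ennreal_le_iff)
      define a where "a = p0 y"
      have a: "0 < a" using p0_pos[OF y] by (simp add: a_def)
      have un: "0 \<le> u j y" if "j \<in> J" for j using u_nn[OF that y] .
      \<comment> \<open>The prior weights of the cells are given up: the prior has mass one, so the
        integral over A is at most the sum of the majorants.\<close>
      have "mass A y \<le> (\<integral>\<^sup>+z. ennreal (\<Sum>j\<in>J. u j y) \<partial>P)"
        unfolding mass_def
      proof (rule nn_integral_mono)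
        fix z
        show "ennreal (p z y) * indicator A z \<le> ennreal (\<Sum>j\<in>J. u j y)"
        proof (cases "z \<in> A")
          case True
          then obtain j where j: "j \<in> J" "p z y \<le> u j y" using cover y by blast
          have "u j y \<le> (\<Sum>j\<in>J. u j y)" using J j un by (intro member_le_sum) auto
          then show ?thesis using j True by (auto intro!: ennreal_leI)
        qed simp
      qed
      also have "\<dots> = ennreal (\<Sum>j\<in>J. u j y)" by (simp add: emeasure_space_1)
      finally have ms: "m \<le> (\<Sum>j\<in>J. u j y)"
        unfolding m(1) using un by (subst (asm) ennreal_le_iff) (auto intro: sum_nonneg)
      \<comment> \<open>If one majorant reaches D, its summand alone is 1; otherwise no truncation
        takes place.\<close>
      have "m / d \<le> (\<Sum>j\<in>J. min 1 (u j y / d))"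
      proof (cases "\<exists>j\<in>J. d \<le> u j y")
        case True
        then obtain j where j: "j \<in> J" "d \<le> u j y" by blast
        have "m / d \<le> min 1 (u j y / d)" using j md d by simp
        also have "\<dots> \<le> (\<Sum>j\<in>J. min 1 (u j y / d))"
          using J j un d by (intro member_le_sum) auto
        finally show ?thesis .
      next
        case False
        then have "(\<Sum>j\<in>J. min 1 (u j y / d)) = (\<Sum>j\<in>J. u j y / d)"
          using d by (intro sum.cong refl) (auto simp: min_def not_le)
        then show ?thesis using ms d by (simp add: sum_divide_distrib[symmetric] divide_right_mono)
      qed
      then have "a * (m / d) \<le> a * (\<Sum>j\<in>J. min 1 (u j y / d))" using a by (intro mult_left_mono) auto
      also have "\<dots> = (\<Sum>j\<in>J. a * min 1 (u j y / d))" by (rule sum_distrib_left)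
      also have "\<dots> \<le> (\<Sum>j\<in>J. \<tau> * (a\<^sup>2 / d) + sqrt (\<sigma> / \<tau>) * sqrt (a * q j y) + ((u j y)\<^sup>2 / q j y) / (\<sigma> * \<tau>))"
        using a d \<sigma> \<tau> un q_pos[OF _ y] by (intro sum_mono bracket_pointwise) auto
      finally have "ennreal (a * (m / d)) \<le> ennreal (\<Sum>j\<in>J. \<tau> * (a\<^sup>2 / d) + sqrt (\<sigma> / \<tau>) * sqrt (a * q j y) + ((u j y)\<^sup>2 / q j y) / (\<sigma> * \<tau>))"
        by (rule ennreal_leI)
      also have "\<dots> = (\<Sum>j\<in>J. ennreal (\<tau> * (a\<^sup>2 / d) + sqrt (\<sigma> / \<tau>) * sqrt (a * q j y) + ((u j y)\<^sup>2 / q j y) / (\<sigma> * \<tau>)))"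
        using a d \<sigma> \<tau> un q_pos[OF _ y] by (intro sum_ennreal[symmetric] add_nonneg_nonneg mult_nonneg_nonneg divide_nonneg_nonneg) (auto intro: less_imp_le)
      also have "\<dots> = (\<Sum>j\<in>J. F j y)"
      proof (intro sum.cong refl)
        fix j assume j: "j \<in> J"
        have q: "0 < q j y" using q_pos[OF j y] .
        show "ennreal (\<tau> * (a\<^sup>2 / d) + sqrt (\<sigma> / \<tau>) * sqrt (a * q j y) + ((u j y)\<^sup>2 / q j y) / (\<sigma> * \<tau>)) = F j y"
          unfolding F_def e a_def[symmetric] using a d \<sigma> \<tau> q
          by (simp add: divide_ennreal ennreal_mult[symmetric] ennreal_plus[symmetric] mult_ac del: ennreal_plus)
      qed
      also have "ennreal (a * (m / d)) = ennreal a * (ennreal m / ennreal d)"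
        using a m(2) d by (simp add: divide_ennreal ennreal_mult[symmetric])
      finally show ?thesis unfolding e m(1) a_def[symmetric] .
    qed
  qed
  also have "\<dots> = (\<Sum>j\<in>J. (\<integral>\<^sup>+y. F j y \<partial>N))"
    unfolding F_def by (intro nn_integral_sum) measurable
  also have "\<dots> \<le> (\<Sum>j\<in>J. ennreal \<tau> * inv_evid + ennreal (sqrt (\<sigma> / \<tau>)) * r + ennreal (1 / (\<sigma> * \<tau>)) * w)"
  proof (rule sum_mono)
    fix j assume j: "j \<in> J"
    have "(\<integral>\<^sup>+y. F j y \<partial>N) = ennreal \<tau> * inv_evid + ennreal (sqrt (\<sigma> / \<tau>)) * (\<integral>\<^sup>+y. ennreal (sqrt (p0 y * q j y)) \<partial>N)
        + ennreal (1 / (\<sigma> * \<tau>)) * (\<integral>\<^sup>+y. ennreal ((u j y)\<^sup>2 / q j y) \<partial>N)"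
      unfolding F_def inv_evid_def using j by (simp add: nn_integral_add nn_integral_cmult)
    also have "\<dots> \<le> ennreal \<tau> * inv_evid + ennreal (sqrt (\<sigma> / \<tau>)) * r + ennreal (1 / (\<sigma> * \<tau>)) * w"
      by (intro add_mono mult_left_mono r[OF j] w[OF j] order_refl) auto
    finally show "(\<integral>\<^sup>+y. F j y \<partial>N) \<le> ennreal \<tau> * inv_evid + ennreal (sqrt (\<sigma> / \<tau>)) * r + ennreal (1 / (\<sigma> * \<tau>)) * w" .
  qed
  also have "\<dots> = of_nat (card J) * (ennreal \<tau> * inv_evid + ennreal (sqrt (\<sigma> / \<tau>)) * r + ennreal (1 / (\<sigma> * \<tau>)) * w)"
    by simp
  finally show ?thesis .
qed

lemma post_mass_split:
  assumes A: "A \<in> sets P" and G: "G \<in> sets P"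
  shows "post_mass A \<le> post_mass (A \<inter> G) + post_mass (space P - G)"
proof -
  note [measurable] = A G
  have "post_mass A \<le> (\<integral>\<^sup>+y. ennreal (p0 y) * (mass (A \<inter> G) y / evid y) + ennreal (p0 y) * (mass (space P - G) y / evid y) \<partial>N)"
    unfolding post_mass_def
  proof (rule nn_integral_mono)
    fix y assume y: "y \<in> space N"
    have "mass A y \<le> (\<integral>\<^sup>+z. ennreal (p z y) * indicator (A \<inter> G) z + ennreal (p z y) * indicator (space P - G) z \<partial>P)"
      unfolding mass_def by (intro nn_integral_mono) (auto simp: indicator_def)
    also have "\<dots> = mass (A \<inter> G) y + mass (space P - G) y"
      unfolding mass_def using A G y by (intro nn_integral_add) auto
    finally have "mass A y / evid y \<le> (mass (A \<inter> G) y + mass (space P - G) y) / evid y"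
      by (rule divide_right_mono_ennreal)
    then have "ennreal (p0 y) * (mass A y / evid y) \<le> ennreal (p0 y) * ((mass (A \<inter> G) y + mass (space P - G) y) / evid y)"
      by (rule mult_left_mono) simp
    then show "ennreal (p0 y) * (mass A y / evid y) \<le> ennreal (p0 y) * (mass (A \<inter> G) y / evid y) + ennreal (p0 y) * (mass (space P - G) y / evid y)"
      by (simp add: add_divide_distrib_ennreal distrib_left)
  qed
  also have "\<dots> = post_mass (A \<inter> G) + post_mass (space P - G)"
    unfolding post_mass_def using A G by (intro nn_integral_add) measurable
  finally show ?thesis .
qed

end

section \<open>The prior on the regression coefficients\<close>

definition laplace :: "real \<Rightarrow> real \<Rightarrow> real" where "laplace r x = r / 2 * exp (- r * \<bar>x\<bar>)"

lemma laplace_nonneg: "0 < r \<Longrightarrow> 0 \<le> laplace r x"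
  by (simp add: laplace_def)

lemma borel_measurable_laplace [measurable]: "laplace r \<in> borel_measurable borel"
  unfolding laplace_def[abs_def] by measurable

text \<open>An equal mixture of an exponential density and its reflection, except at the single
  point 0 where both contribute.\<close>

lemma laplace_integral:
  assumes r: "0 < r"
  shows "(\<integral>\<^sup>+x. ennreal (laplace r x) \<partial>lborel) = 1"
proof -
  interpret prob_space "density lborel (exponential_density r)" by (rule prob_space_exponential_density[OF r])
  have 1: "(\<integral>\<^sup>+x. ennreal (exponential_density r x) \<partial>lborel) = 1"
    using emeasure_space_1 by (simp add: emeasure_density)
  have 2: "(\<integral>\<^sup>+x. ennreal (exponential_density r (- x)) \<partial>lborel) = 1"
    using nn_integral_real_affine[of "\<lambda>x. ennreal (exponential_density r x)" "-1" 0] 1 by simp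
  have "(\<integral>\<^sup>+x. ennreal (laplace r x) \<partial>lborel)
     = (\<integral>\<^sup>+x. ennreal (1/2) * ennreal (exponential_density r x) + ennreal (1/2) * ennreal (exponential_density r (- x)) \<partial>lborel)"
  proof (rule nn_integral_cong_AE)
    have "AE x in lborel. x \<noteq> (0::real)" by (rule AE_lborel_singleton)
    then show "AE x in lborel. ennreal (laplace r x) = ennreal (1/2) * ennreal (exponential_density r x) + ennreal (1/2) * ennreal (exponential_density r (- x))"
    proof (eventually_elim)
      fix x :: real assume "x \<noteq> 0"
      then have "laplace r x = 1/2 * exponential_density r x + 1/2 * exponential_density r (- x)"
        by (cases "x < 0") (auto simp: laplace_def exponential_density_def mult.commute)
      then show "ennreal (laplace r x) = ennreal (1/2) * ennreal (exponential_density r x) + ennreal (1/2) * ennreal (exponential_density r (- x))"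
        using exponential_density_nonneg[OF r]
        by (simp only: ennreal_plus[OF mult_nonneg_nonneg mult_nonneg_nonneg] ennreal_mult)
    qed
  qed
  also have "\<dots> = ennreal (1/2) * 1 + ennreal (1/2) * 1"
    by (simp add: nn_integral_add nn_integral_cmult 1 2)
  also have "\<dots> = ennreal (1/2) + ennreal (1/2)" by (simp only: mult_1_right)
  also have "\<dots> = ennreal (1/2 + 1/2)" by (rule ennreal_plus[symmetric]) auto
  also have "\<dots> = 1" by simp
  finally show ?thesis .
qed

text \<open>Tilting by half the rate gives twice a Laplace density of half the rate. The moment
  feeds the Chernoff bound for the slab.\<close>

lemma laplace_exp_moment:
  assumes r: "0 < r"
  shows "(\<integral>\<^sup>+x. ennreal (laplace r x * exp (r * \<bar>x\<bar> / 2)) \<partial>lborel) = 2"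
proof -
  have "laplace r x * exp (r * \<bar>x\<bar> / 2) = 2 * laplace (r / 2) x" for x
    by (simp add: laplace_def exp_add[symmetric])
  then have "(\<integral>\<^sup>+x. ennreal (laplace r x * exp (r * \<bar>x\<bar> / 2)) \<partial>lborel) = (\<integral>\<^sup>+x. 2 * ennreal (laplace (r/2) x) \<partial>lborel)"
    using r by (simp add: ennreal_mult laplace_nonneg)
  also have "\<dots> = 2" using r by (simp add: nn_integral_cmult laplace_integral)
  finally show ?thesis .
qed

section \<open>Slab measures\<close>

definition zero_extend :: "nat \<Rightarrow> nat set \<Rightarrow> (nat \<Rightarrow> real) \<Rightarrow> nat \<Rightarrow> real" where
  "zero_extend p S t = (\<lambda>j\<in>{..<p}. if j \<in> S then t j else 0)"

lemma zero_extend_measurable: "zero_extend p S \<in> measurable (Pi\<^sub>M S (\<lambda>_. lborel)) (Pi\<^sub>M {..<p} (\<lambda>_. borel))"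
  unfolding zero_extend_def
proof (rule measurable_restrict)
  fix j show "(\<lambda>t. if j \<in> S then t j else 0) \<in> borel_measurable (Pi\<^sub>M S (\<lambda>_. lborel))"
    using measurable_component_singleton[of j S "\<lambda>_. lborel :: real measure"] by (cases "j \<in> S") auto
qed

lemma slab_measure_eq:
  "slab_measure p r S = distr (density (Pi\<^sub>M S (\<lambda>_. lborel)) (\<lambda>t. ennreal (\<Prod>j\<in>S. laplace r (t j)))) (Pi\<^sub>M {..<p} (\<lambda>_. borel)) (zero_extend p S)"
  unfolding slab_measure_def zero_extend_def laplace_def ..

lemma sets_slab [simp]: "sets (slab_measure p r S) = sets (Pi\<^sub>M {..<p} (\<lambda>_. borel))"
  by (simp add: slab_measure_def)

lemma space_slab [simp]: "space (slab_measure p r S) = space (Pi\<^sub>M {..<p} (\<lambda>_. borel))"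
  by (simp add: slab_measure_def)

lemma borel_measurable_prod_coordinates:
  fixes g :: "nat \<Rightarrow> real \<Rightarrow> ennreal"
  assumes "\<And>j. j \<in> S \<Longrightarrow> g j \<in> borel_measurable borel"
  shows "(\<lambda>t. \<Prod>j\<in>S. g j (t j)) \<in> borel_measurable (Pi\<^sub>M S (\<lambda>_. lborel))"
proof (rule borel_measurable_prod_ennreal)
  fix j assume j: "j \<in> S"
  have "(\<lambda>t. t j) \<in> measurable (Pi\<^sub>M S (\<lambda>_. lborel)) (borel :: real measure)"
    using measurable_component_singleton[OF j, of "\<lambda>_. lborel :: real measure"] by simp
  then show "(\<lambda>t. g j (t j)) \<in> borel_measurable (Pi\<^sub>M S (\<lambda>_. lborel))"
    using assms[OF j] by (rule measurable_compose)
qed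

lemma emeasure_slab:
  assumes r: "0 < r" and A: "A \<in> sets (Pi\<^sub>M {..<p} (\<lambda>_. borel))"
  shows "emeasure (slab_measure p r S) A =
    (\<integral>\<^sup>+t. (\<Prod>j\<in>S. ennreal (laplace r (t j))) * indicator A (zero_extend p S t) \<partial>Pi\<^sub>M S (\<lambda>_. lborel))"
proof -
  have m: "(\<lambda>t. ennreal (\<Prod>j\<in>S. laplace r (t j))) \<in> borel_measurable (Pi\<^sub>M S (\<lambda>_. lborel))"
    using borel_measurable_prod_coordinates[of S "\<lambda>_ x. ennreal (laplace r x)"] r by (simp add: prod_ennreal laplace_nonneg)
  have e: "zero_extend p S \<in> measurable (density (Pi\<^sub>M S (\<lambda>_. lborel)) (\<lambda>t. ennreal (\<Prod>j\<in>S. laplace r (t j)))) (Pi\<^sub>M {..<p} (\<lambda>_. borel))"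
    using zero_extend_measurable by simp
  have "zero_extend p S -` A \<inter> space (Pi\<^sub>M S (\<lambda>_. lborel :: real measure)) \<in> sets (Pi\<^sub>M S (\<lambda>_. lborel))"
    using zero_extend_measurable A by (rule measurable_sets)
  then have "emeasure (slab_measure p r S) A = (\<integral>\<^sup>+t. ennreal (\<Prod>j\<in>S. laplace r (t j)) *
      indicator (zero_extend p S -` A \<inter> space (Pi\<^sub>M S (\<lambda>_. lborel :: real measure))) t \<partial>Pi\<^sub>M S (\<lambda>_. lborel))"
    unfolding slab_measure_eq using m A e by (simp add: emeasure_distr emeasure_density)
  also have "\<dots> = (\<integral>\<^sup>+t. (\<Prod>j\<in>S. ennreal (laplace r (t j))) * indicator A (zero_extend p S t) \<partial>Pi\<^sub>M S (\<lambda>_. lborel))"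
    using r by (intro nn_integral_cong) (auto simp: prod_ennreal laplace_nonneg indicator_def)
  finally show ?thesis .
qed

lemma nn_integral_prod_coordinates:
  fixes g :: "nat \<Rightarrow> real \<Rightarrow> ennreal"
  assumes "finite S" "\<And>j. j \<in> S \<Longrightarrow> g j \<in> borel_measurable borel"
  shows "(\<integral>\<^sup>+t. (\<Prod>j\<in>S. g j (t j)) \<partial>Pi\<^sub>M S (\<lambda>_. lborel)) = (\<Prod>j\<in>S. \<integral>\<^sup>+x. g j x \<partial>lborel)"
proof -
  interpret product_sigma_finite "\<lambda>_::nat. lborel :: real measure" by standard
  show ?thesis using assms by (intro product_nn_integral_prod) auto
qed

lemma prob_space_slab:
  assumes r: "0 < r" and S: "finite S"
  shows "prob_space (slab_measure p r S)"
proof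
  have "emeasure (slab_measure p r S) (space (slab_measure p r S)) =
    (\<integral>\<^sup>+t. (\<Prod>j\<in>S. ennreal (laplace r (t j))) \<partial>Pi\<^sub>M S (\<lambda>_. lborel))"
    unfolding space_slab
    by (subst emeasure_slab[OF r]) (auto intro!: nn_integral_cong simp: indicator_def zero_extend_def space_PiM)
  also have "\<dots> = (\<Prod>j\<in>S. \<integral>\<^sup>+x. ennreal (laplace r x) \<partial>lborel)"
    using S by (intro nn_integral_prod_coordinates) auto
  also have "\<dots> = 1" by (simp add: laplace_integral[OF r])
  finally show "emeasure (slab_measure p r S) (space (slab_measure p r S)) = 1" .
qed

lemma sets_coordinatewise:
  fixes Q :: "nat \<Rightarrow> real \<Rightarrow> bool"
  assumes "\<And>j. j < p \<Longrightarrow> {x. Q j x} \<in> sets borel"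
  shows "{\<theta> \<in> space (Pi\<^sub>M {..<p} (\<lambda>_. borel)). \<forall>j<p. Q j (\<theta> j)} \<in> sets (Pi\<^sub>M {..<p} (\<lambda>_. borel))"
    and "{\<theta> \<in> space (Pi\<^sub>M {..<p} (\<lambda>_. borel)). \<exists>j<p. Q j (\<theta> j)} \<in> sets (Pi\<^sub>M {..<p} (\<lambda>_. borel))"
proof -
  let ?B = "Pi\<^sub>M {..<p} (\<lambda>_. borel :: real measure)"
  have *: "{\<theta> \<in> space ?B. Q j (\<theta> j)} \<in> sets ?B" if "j \<in> {..<p}" for j
    using measurable_sets[OF measurable_component_singleton[OF that], of "{x. Q j x}" "\<lambda>_. borel"] assms[of j] that
    by (simp add: vimage_def Int_def conj_commute)
  have "{\<theta> \<in> space ?B. \<forall>j\<in>{..<p}. Q j (\<theta> j)} \<in> sets ?B"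
    by (rule sets.sets_Collect_finite_All) (rule *, assumption, simp)
  moreover have "{\<theta> \<in> space ?B. \<exists>j\<in>{..<p}. Q j (\<theta> j)} \<in> sets ?B"
    by (rule sets.sets_Collect_finite_Ex) (rule *, assumption, simp)
  ultimately show "{\<theta> \<in> space ?B. \<forall>j<p. Q j (\<theta> j)} \<in> sets ?B" "{\<theta> \<in> space ?B. \<exists>j<p. Q j (\<theta> j)} \<in> sets ?B"
    by (simp_all only: Ball_def Bex_def lessThan_iff)
qed

lemma sets_box:
  fixes p :: nat and \<theta>0 :: "nat \<Rightarrow> real"
  shows "{\<theta> \<in> space (Pi\<^sub>M {..<p} (\<lambda>_. borel)). (\<forall>j<p. \<theta>0 j \<noteq> 0 \<longrightarrow> \<bar>\<theta> j - \<theta>0 j\<bar> \<le> \<delta>) \<and> (\<forall>j<p. \<theta>0 j = 0 \<longrightarrow> \<theta> j = (0::real))}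
    \<in> sets (Pi\<^sub>M {..<p} (\<lambda>_. borel))"
proof -
  have "{\<theta> \<in> space (Pi\<^sub>M {..<p} (\<lambda>_. borel)). \<forall>j<p. (\<theta>0 j \<noteq> 0 \<longrightarrow> \<bar>\<theta> j - \<theta>0 j\<bar> \<le> \<delta>) \<and> (\<theta>0 j = 0 \<longrightarrow> \<theta> j = (0::real))}
    \<in> sets (Pi\<^sub>M {..<p} (\<lambda>_. borel))"
    by (rule sets_coordinatewise(1)[where Q = "\<lambda>j x. (\<theta>0 j \<noteq> 0 \<longrightarrow> \<bar>x - \<theta>0 j\<bar> \<le> \<delta>) \<and> (\<theta>0 j = 0 \<longrightarrow> x = 0)"]) measurable
  then show ?thesis by (simp only: all_conj_distrib imp_conjR)
qed

text \<open>Union bound over the coordinates. For a coordinate in S, Markov's inequality with weight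
  exp(r |t j| / 2), whose moment is 2; a coordinate outside S is identically 0 and never exceeds
  R.\<close>

lemma slab_tail:
  assumes r: "0 < r" and S: "finite S" and R: "0 \<le> R"
  shows "emeasure (slab_measure p r S) {\<theta> \<in> space (Pi\<^sub>M {..<p} (\<lambda>_. borel)). \<exists>j<p. R < \<bar>\<theta> j\<bar>} \<le> ennreal (real p * (2 * exp (- r * R / 2)))"
proof -
  interpret prob_space "slab_measure p r S" by (rule prob_space_slab[OF r S])
  let ?B = "Pi\<^sub>M {..<p} (\<lambda>_. borel :: real measure)"
  define A where "A j = {\<theta> \<in> space ?B. R < \<bar>\<theta> j\<bar>}" for j
  have A: "A j \<in> sets ?B" if "j < p" for j
  proof -
    have [measurable]: "(\<lambda>\<theta>. \<theta> j) \<in> borel_measurable ?B"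
      using that by (intro measurable_component_singleton) auto
    show ?thesis unfolding A_def by measurable
  qed
  have one: "emeasure (slab_measure p r S) (A j) \<le> ennreal (2 * exp (- r * R / 2))" if j: "j < p" for j
  proof (cases "j \<in> S")
    case False
    have "zero_extend p S t \<notin> A j" for t using False j R by (simp add: zero_extend_def A_def)
    then have "emeasure (slab_measure p r S) (A j) = 0" by (simp add: emeasure_slab[OF r A[OF j]])
    then show ?thesis by simp
  next
    case True
    define g :: "nat \<Rightarrow> real \<Rightarrow> ennreal" where
      "g i x = (if i = j then ennreal (laplace r x * exp (r * \<bar>x\<bar> / 2)) else ennreal (laplace r x))" for i x
    have g [measurable]: "g i \<in> borel_measurable borel" for i unfolding g_def[abs_def] by measurable
    have "emeasure (slab_measure p r S) (A j) \<le> (\<integral>\<^sup>+t. ennreal (exp (- r * R / 2)) * (\<Prod>i\<in>S. g i (t i)) \<partial>Pi\<^sub>M S (\<lambda>_. lborel))"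
      unfolding emeasure_slab[OF r A[OF j]]
    proof (rule nn_integral_mono)
      fix t
      show "(\<Prod>i\<in>S. ennreal (laplace r (t i))) * indicator (A j) (zero_extend p S t) \<le> ennreal (exp (- r * R / 2)) * (\<Prod>i\<in>S. g i (t i))"
      proof (cases "zero_extend p S t \<in> A j")
        case t: True
        then have "R < \<bar>t j\<bar>" using j True by (simp add: A_def zero_extend_def)
        then have "1 \<le> exp (- r * R / 2) * exp (r * \<bar>t j\<bar> / 2)"
          using r by (simp add: exp_add[symmetric] divide_right_mono)
        then have "1 \<le> ennreal (exp (- r * R / 2)) * ennreal (exp (r * \<bar>t j\<bar> / 2))"
          by (subst ennreal_mult[symmetric]) auto
        moreover have "(\<Prod>i\<in>S. g i (t i)) = (\<Prod>i\<in>S. ennreal (laplace r (t i))) * ennreal (exp (r * \<bar>t j\<bar> / 2))"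
          using True S r by (simp add: prod.remove[of S j] g_def ennreal_mult laplace_nonneg mult_ac)
        ultimately show ?thesis
          using t mult_left_mono[of 1 "ennreal (exp (- r * R / 2)) * ennreal (exp (r * \<bar>t j\<bar> / 2))" "\<Prod>i\<in>S. ennreal (laplace r (t i))"]
          by (simp add: mult_ac)
      qed simp
    qed
    also have "\<dots> = ennreal (exp (- r * R / 2)) * (\<Prod>i\<in>S. \<integral>\<^sup>+x. g i x \<partial>lborel)"
      using S by (subst nn_integral_cmult) (auto intro!: borel_measurable_prod_coordinates simp: nn_integral_prod_coordinates)
    also have "(\<Prod>i\<in>S. \<integral>\<^sup>+x. g i x \<partial>lborel) = 2"
      using True S laplace_exp_moment[OF r] laplace_integral[OF r] by (simp add: prod.remove[of S j] g_def)
    also have "ennreal (exp (- r * R / 2)) * 2 = ennreal (2 * exp (- r * R / 2))"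
      by (simp add: ennreal_mult mult.commute)
    finally show ?thesis .
  qed
  have "{\<theta> \<in> space ?B. \<exists>j<p. R < \<bar>\<theta> j\<bar>} = (\<Union>j\<in>{..<p}. A j)" by (auto simp: A_def)
  then have "emeasure (slab_measure p r S) {\<theta> \<in> space ?B. \<exists>j<p. R < \<bar>\<theta> j\<bar>} \<le> (\<Sum>j<p. emeasure (slab_measure p r S) (A j))"
    using A by (simp only:) (intro emeasure_subadditive_finite, auto)
  also have "\<dots> \<le> (\<Sum>j<p. ennreal (2 * exp (- r * R / 2)))" using one by (intro sum_mono) auto
  also have "\<dots> = ennreal (real p * (2 * exp (- r * R / 2)))" by (simp add: ennreal_mult ennreal_of_nat_eq_real_of_nat)
  finally show ?thesis .
qed

text \<open>On the box each factor of the density is at least r/2 exp(-r (|\<theta>0 j| +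
  \<delta>)), over an interval of length 2\<delta>. Coordinates outside the support of \<theta>0 are
  exactly 0 under this slab and cost nothing.\<close>

lemma slab_box:
  fixes p :: nat and \<theta>0 :: "nat \<Rightarrow> real"
  assumes r: "0 < r" and \<delta>: "0 < \<delta>"
  defines "S \<equiv> {j. j < p \<and> \<theta>0 j \<noteq> 0}"
  shows "ennreal ((r * \<delta>) ^ card S * exp (- r * (\<Sum>j\<in>S. \<bar>\<theta>0 j\<bar>) - r * \<delta> * real (card S)))
    \<le> emeasure (slab_measure p r S) {\<theta> \<in> space (Pi\<^sub>M {..<p} (\<lambda>_. borel)).
        (\<forall>j<p. \<theta>0 j \<noteq> 0 \<longrightarrow> \<bar>\<theta> j - \<theta>0 j\<bar> \<le> \<delta>) \<and> (\<forall>j<p. \<theta>0 j = 0 \<longrightarrow> \<theta> j = 0)}" (is "_ \<le> emeasure _ ?A")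
proof -
  let ?B = "Pi\<^sub>M {..<p} (\<lambda>_. borel :: real measure)"
  have S: "finite S" by (simp add: S_def)
  have A: "?A \<in> sets ?B" by (rule sets_box)
  define I where "I j = {\<theta>0 j - \<delta>..\<theta>0 j + \<delta>}" for j
  have "ennreal ((r * \<delta>) ^ card S * exp (- r * (\<Sum>j\<in>S. \<bar>\<theta>0 j\<bar>) - r * \<delta> * real (card S)))
     = ennreal (\<Prod>j\<in>S. (r / 2 * exp (- r * (\<bar>\<theta>0 j\<bar> + \<delta>))) * (2 * \<delta>))"
  proof -
    have "(\<Prod>j\<in>S. (r / 2 * exp (- r * (\<bar>\<theta>0 j\<bar> + \<delta>))) * (2 * \<delta>)) = (\<Prod>j\<in>S. (r * \<delta>) * exp (- r * \<bar>\<theta>0 j\<bar> - r * \<delta>))"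
      by (intro prod.cong refl) (simp add: algebra_simps)
    also have "\<dots> = (r * \<delta>) ^ card S * exp (\<Sum>j\<in>S. - r * \<bar>\<theta>0 j\<bar> - r * \<delta>)"
      by (simp add: prod.distrib power_mult_distrib exp_sum[OF S])
    also have "(\<Sum>j\<in>S. - r * \<bar>\<theta>0 j\<bar> - r * \<delta>) = - r * (\<Sum>j\<in>S. \<bar>\<theta>0 j\<bar>) - r * \<delta> * real (card S)"
      by (simp add: sum_subtractf sum_negf sum_distrib_left)
    finally show ?thesis by simp
  qed
  also have "\<dots> = (\<Prod>j\<in>S. ennreal (r / 2 * exp (- r * (\<bar>\<theta>0 j\<bar> + \<delta>))) * ennreal (2 * \<delta>))"
  proof -
    have "ennreal (\<Prod>j\<in>S. (r / 2 * exp (- r * (\<bar>\<theta>0 j\<bar> + \<delta>))) * (2 * \<delta>))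
      = (\<Prod>j\<in>S. ennreal ((r / 2 * exp (- r * (\<bar>\<theta>0 j\<bar> + \<delta>))) * (2 * \<delta>)))"
      using r \<delta> by (intro prod_ennreal[symmetric]) auto
    also have "\<dots> = (\<Prod>j\<in>S. ennreal (r / 2 * exp (- r * (\<bar>\<theta>0 j\<bar> + \<delta>))) * ennreal (2 * \<delta>))"
      using r \<delta> by (intro prod.cong refl ennreal_mult) auto
    finally show ?thesis .
  qed
  also have "\<dots> \<le> (\<Prod>j\<in>S. \<integral>\<^sup>+x. ennreal (laplace r x) * indicator (I j) x \<partial>lborel)"
  proof (rule prod_mono_ennreal)
    fix j
    have "ennreal (r / 2 * exp (- r * (\<bar>\<theta>0 j\<bar> + \<delta>))) * ennreal (2 * \<delta>)
       = (\<integral>\<^sup>+x. ennreal (r / 2 * exp (- r * (\<bar>\<theta>0 j\<bar> + \<delta>))) * indicator (I j) x \<partial>lborel)"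
      using \<delta> by (subst nn_integral_cmult_indicator) (auto simp: I_def)
    also have "\<dots> \<le> (\<integral>\<^sup>+x. ennreal (laplace r x) * indicator (I j) x \<partial>lborel)"
    proof (rule nn_integral_mono)
      fix x :: real
      show "ennreal (r / 2 * exp (- r * (\<bar>\<theta>0 j\<bar> + \<delta>))) * indicator (I j) x \<le> ennreal (laplace r x) * indicator (I j) x"
      proof (cases "x \<in> I j")
        case True
        then have "\<bar>x\<bar> \<le> \<bar>\<theta>0 j\<bar> + \<delta>" by (auto simp: I_def)
        then have "r / 2 * exp (- r * (\<bar>\<theta>0 j\<bar> + \<delta>)) \<le> laplace r x"
          using r unfolding laplace_def by (intro mult_left_mono) auto
        then show ?thesis by (simp add: True ennreal_leI)
      qed simp
    qed
    finally show "ennreal (r / 2 * exp (- r * (\<bar>\<theta>0 j\<bar> + \<delta>))) * ennreal (2 * \<delta>) \<le> (\<integral>\<^sup>+x. ennreal (laplace r x) * indicator (I j) x \<partial>lborel)" .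
  qed
  also have "\<dots> = (\<integral>\<^sup>+t. (\<Prod>j\<in>S. ennreal (laplace r (t j)) * indicator (I j) (t j)) \<partial>Pi\<^sub>M S (\<lambda>_. lborel))"
    using S by (intro nn_integral_prod_coordinates[symmetric]) (auto simp: I_def)
  also have "\<dots> \<le> emeasure (slab_measure p r S) ?A"
    unfolding emeasure_slab[OF r A]
  proof (rule nn_integral_mono)
    fix t
    show "(\<Prod>j\<in>S. ennreal (laplace r (t j)) * indicator (I j) (t j)) \<le> (\<Prod>j\<in>S. ennreal (laplace r (t j))) * indicator ?A (zero_extend p S t)"
    proof (cases "\<forall>j\<in>S. t j \<in> I j")
      case True
      then have "zero_extend p S t \<in> ?A"
        by (auto simp: zero_extend_def S_def I_def space_PiM abs_le_iff)
      then show ?thesis using True by (simp add: prod.distrib)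
    next
      case False
      then obtain j where "j \<in> S" "t j \<notin> I j" by auto
      then have "(\<Prod>j\<in>S. ennreal (laplace r (t j)) * indicator (I j) (t j)) = 0"
        using S by (intro prod_zero bexI[of _ j]) auto
      then show ?thesis by (simp only: zero_le)
    qed
  qed
  finally show ?thesis .
qed

section \<open>The mixture over supports\<close>

context
  fixes M :: "'h model"
  assumes rate: "0 < rate M" and size: "set_pmf (size_prior M) \<subseteq> {..npred M}"
begin

lemma slab_kernel: "(\<lambda>S. slab_measure (npred M) (rate M) (S \<inter> {..<npred M})) \<in>
    measurable (measure_pmf (support_prior M)) (subprob_algebra (Pi\<^sub>M {..<npred M} (\<lambda>_. borel)))"
proof -
  have "slab_measure (npred M) (rate M) (S \<inter> {..<npred M}) \<in> space (subprob_algebra (Pi\<^sub>M {..<npred M} (\<lambda>_. borel)))" for S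
    using prob_space_slab[OF rate, of "S \<inter> {..<npred M}" "npred M"]
    by (simp add: space_subprob_algebra prob_space_imp_subprob_space)
  then show ?thesis by simp
qed

lemma sets_theta_prior [measurable_cong]: "sets (theta_prior M) = sets (Pi\<^sub>M {..<npred M} (\<lambda>_. borel))"
  unfolding theta_prior_def by (rule sets_bind) auto

lemma space_theta_prior: "space (theta_prior M) = space (Pi\<^sub>M {..<npred M} (\<lambda>_. borel))"
  using sets_theta_prior by (rule sets_eq_imp_space_eq)

lemma emeasure_theta_prior:
  "A \<in> sets (Pi\<^sub>M {..<npred M} (\<lambda>_. borel)) \<Longrightarrow> emeasure (theta_prior M) A =
    (\<integral>\<^sup>+S. emeasure (slab_measure (npred M) (rate M) (S \<inter> {..<npred M})) A \<partial>measure_pmf (support_prior M))"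
  unfolding theta_prior_def by (rule emeasure_bind[OF _ slab_kernel]) auto

lemma prob_space_theta_prior: "prob_space (theta_prior M)"
proof
  have "emeasure (slab_measure (npred M) (rate M) (S \<inter> {..<npred M})) (space (Pi\<^sub>M {..<npred M} (\<lambda>_. borel))) = 1" for S
    using prob_space.emeasure_space_1[OF prob_space_slab[OF rate, of "S \<inter> {..<npred M}" "npred M"]] by simp
  then show "emeasure (theta_prior M) (space (theta_prior M)) = 1"
    unfolding space_theta_prior by (subst emeasure_theta_prior) (auto simp: measure_pmf.emeasure_space_1[simplified])
qed

lemma map_card_support_prior: "map_pmf card (support_prior M) = size_prior M"
proof -
  have "map_pmf card (support_prior M) = bind_pmf (size_prior M) (\<lambda>s. map_pmf card (pmf_of_set {S. S \<subseteq> {..<npred M} \<and> card S = s}))"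
    by (simp add: support_prior_def map_bind_pmf)
  also have "\<dots> = bind_pmf (size_prior M) return_pmf"
  proof (rule bind_pmf_cong[OF refl])
    fix s assume "s \<in> set_pmf (size_prior M)"
    then have s: "s \<le> npred M" using size by auto
    define F where "F = {S. S \<subseteq> {..<npred M} \<and> card S = s}"
    have fin: "finite F" unfolding F_def by (rule finite_subset[of _ "Pow {..<npred M}"]) auto
    \<comment> \<open>\<open>pmf_of_set\<close> is unspecified on the empty set, so a support of
      size s must be exhibited.\<close>
    have "{..<s} \<in> F" using s by (auto simp: F_def)
    then have ne: "F \<noteq> {}" by auto
    have "map_pmf card (pmf_of_set F) = map_pmf (\<lambda>_. s) (pmf_of_set F)"
      using fin ne by (intro map_pmf_cong) (auto simp: set_pmf_of_set F_def)
    then show "map_pmf card (pmf_of_set {S. S \<subseteq> {..<npred M} \<and> card S = s}) = return_pmf s"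
      by (simp add: F_def map_pmf_const)
  qed
  also have "\<dots> = size_prior M" by (rule bind_return_pmf')
  finally show ?thesis .
qed

lemma theta_prior_tail:
  assumes "0 \<le> R"
  shows "emeasure (theta_prior M) {\<theta> \<in> space (Pi\<^sub>M {..<npred M} (\<lambda>_. borel)). \<exists>j<npred M. R < \<bar>\<theta> j\<bar>}
    \<le> ennreal (real (npred M) * (2 * exp (- rate M * R / 2)))"
proof -
  have *: "{\<theta> \<in> space (Pi\<^sub>M {..<npred M} (\<lambda>_. borel :: real measure)). \<exists>j<npred M. R < \<bar>\<theta> j\<bar>} \<in> sets (Pi\<^sub>M {..<npred M} (\<lambda>_. borel))"
    by (rule sets_coordinatewise(2)[where Q = "\<lambda>_ x. R < \<bar>x\<bar>"]) measurable
  have "emeasure (theta_prior M) {\<theta> \<in> space (Pi\<^sub>M {..<npred M} (\<lambda>_. borel)). \<exists>j<npred M. R < \<bar>\<theta> j\<bar>}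
    \<le> (\<integral>\<^sup>+S. ennreal (real (npred M) * (2 * exp (- rate M * R / 2))) \<partial>measure_pmf (support_prior M))"
    unfolding emeasure_theta_prior[OF *] by (intro nn_integral_mono slab_tail rate assms) simp
  also have "\<dots> = ennreal (real (npred M) * (2 * exp (- rate M * R / 2)))"
    by (simp add: measure_pmf.emeasure_space_1[simplified])
  finally show ?thesis .
qed

lemma borel_measurable_sparsity: "(\<lambda>\<theta>. real (sparsity M \<theta>)) \<in> borel_measurable (Pi\<^sub>M {..<npred M} (\<lambda>_. borel))"
proof -
  have "(\<lambda>\<theta>. \<Sum>j<npred M. of_bool (\<theta> j \<noteq> 0) :: real) \<in> borel_measurable (Pi\<^sub>M {..<npred M} (\<lambda>_. borel :: real measure))"
  proof (rule borel_measurable_sum)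
    fix j assume "j \<in> {..<npred M}"
    then have [measurable]: "(\<lambda>\<theta>. \<theta> j) \<in> borel_measurable (Pi\<^sub>M {..<npred M} (\<lambda>_. borel :: real measure))"
      by (rule measurable_component_singleton)
    show "(\<lambda>\<theta>. of_bool (\<theta> j \<noteq> 0) :: real) \<in> borel_measurable (Pi\<^sub>M {..<npred M} (\<lambda>_. borel :: real measure))"
      unfolding of_bool_def by measurable
  qed
  moreover have "(\<Sum>j<npred M. of_bool (\<theta> j \<noteq> 0)) = real (sparsity M \<theta>)" for \<theta> :: "nat \<Rightarrow> real"
    unfolding sparsity_def by (subst sum_of_bool_eq) (auto intro!: arg_cong[of _ _ card])
  ultimately show ?thesis by simp
qed

text \<open>A draw from the slab on S vanishes off S, so its sparsity is at most
  \<open>card S\<close>, and the law of \<open>card S\<close> is the size prior.\<close>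

lemma theta_prior_sparsity:
  "emeasure (theta_prior M) {\<theta> \<in> space (Pi\<^sub>M {..<npred M} (\<lambda>_. borel)). K < real (sparsity M \<theta>)}
    \<le> emeasure (measure_pmf (size_prior M)) {s. K < real s}"
proof -
  let ?A = "{\<theta> \<in> space (Pi\<^sub>M {..<npred M} (\<lambda>_. borel :: real measure)). K < real (sparsity M \<theta>)}"
  note [measurable] = borel_measurable_sparsity
  have A: "?A \<in> sets (Pi\<^sub>M {..<npred M} (\<lambda>_. borel))" by measurable
  have "emeasure (slab_measure (npred M) (rate M) (S \<inter> {..<npred M})) ?A \<le> indicator {S. K < real (card S)} S"
    if "finite S" for S
  proof (cases "K < real (card S)")
    case True
    then show ?thesis using prob_space.emeasure_le_1[OF prob_space_slab[OF rate, of "S \<inter> {..<npred M}" "npred M"]] by simp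
  next
    case False
    have "zero_extend (npred M) (S \<inter> {..<npred M}) t \<notin> ?A" for t
    proof -
      have "sparsity M (zero_extend (npred M) (S \<inter> {..<npred M}) t) \<le> card S"
        unfolding sparsity_def using that by (intro card_mono) (auto simp: zero_extend_def split: if_splits)
      then show ?thesis using False by auto
    qed
    then show ?thesis by (simp add: emeasure_slab[OF rate A])
  qed
  moreover have "finite S" if "S \<in> set_pmf (support_prior M)" for S
  proof -
    from that obtain s where s: "s \<in> set_pmf (size_prior M)" "S \<in> set_pmf (pmf_of_set {S. S \<subseteq> {..<npred M} \<and> card S = s})"
      unfolding support_prior_def by auto
    define F where "F = {S. S \<subseteq> {..<npred M} \<and> card S = s}"
    have fin: "finite F" unfolding F_def by (rule finite_subset[of _ "Pow {..<npred M}"]) auto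
    have "{..<s} \<in> F" using s(1) size by (auto simp: F_def)
    then have ne: "F \<noteq> {}" by auto
    have "S \<in> F" using s(2) set_pmf_of_set[OF ne fin] by (simp add: F_def)
    then have "S \<subseteq> {..<npred M}" by (simp add: F_def)
    then show ?thesis by (rule finite_subset) simp
  qed
  ultimately have "emeasure (theta_prior M) ?A \<le> (\<integral>\<^sup>+S. indicator {S. K < real (card S)} S \<partial>measure_pmf (support_prior M))"
    unfolding emeasure_theta_prior[OF A] by (intro nn_integral_mono_AE) (auto simp: AE_measure_pmf_iff)
  also have "\<dots> = emeasure (measure_pmf (map_pmf card (support_prior M))) {s. K < real s}"
    by (simp add: vimage_def)
  finally show ?thesis unfolding map_card_support_prior .
qed

text \<open>Keeps a single term of the mixture, the support of \<theta>0 itself, whose probability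
  is the size prior at s divided by the binomial coefficient.\<close>

lemma theta_prior_box:
  fixes \<theta>0 :: "nat \<Rightarrow> real"
  assumes \<delta>: "0 < \<delta>"
  defines "S \<equiv> {j. j < npred M \<and> \<theta>0 j \<noteq> 0}"
  shows "ennreal (pmf (size_prior M) (card S) / real (npred M choose card S) *
      ((rate M * \<delta>) ^ card S * exp (- rate M * (\<Sum>j\<in>S. \<bar>\<theta>0 j\<bar>) - rate M * \<delta> * real (card S))))
    \<le> emeasure (theta_prior M) {\<theta> \<in> space (Pi\<^sub>M {..<npred M} (\<lambda>_. borel)).
        (\<forall>j<npred M. \<theta>0 j \<noteq> 0 \<longrightarrow> \<bar>\<theta> j - \<theta>0 j\<bar> \<le> \<delta>) \<and> (\<forall>j<npred M. \<theta>0 j = 0 \<longrightarrow> \<theta> j = 0)}" (is "_ \<le> emeasure _ ?A")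
proof -
  let ?B = "Pi\<^sub>M {..<npred M} (\<lambda>_. borel :: real measure)"
  have A: "?A \<in> sets ?B" by (rule sets_box)
  have S: "S \<subseteq> {..<npred M}" "finite S" by (auto simp: S_def)
  then have SI: "S \<inter> {..<npred M} = S" by auto
  define v where "v = (rate M * \<delta>) ^ card S * exp (- rate M * (\<Sum>j\<in>S. \<bar>\<theta>0 j\<bar>) - rate M * \<delta> * real (card S))"
  have v0: "0 \<le> v" using rate \<delta> by (simp add: v_def)
  have v: "ennreal v \<le> emeasure (slab_measure (npred M) (rate M) S) ?A"
    unfolding v_def S_def by (rule slab_box[OF rate \<delta>])
  have F: "finite {T. T \<subseteq> {..<npred M} \<and> card T = card S}" by (rule finite_subset[of _ "Pow {..<npred M}"]) auto
  have "ennreal (pmf (size_prior M) (card S) / real (npred M choose card S)) \<le> ennreal (pmf (support_prior M) S)"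
  proof -
    have "ennreal (pmf (pmf_of_set {T. T \<subseteq> {..<npred M} \<and> card T = card S}) S) = ennreal (1 / real (npred M choose card S))"
      using F S n_subsets[of "{..<npred M}" "card S"] by (subst pmf_of_set) (auto simp: indicator_def)
    then have "ennreal (pmf (size_prior M) (card S) / real (npred M choose card S))
        = ennreal (pmf (pmf_of_set {T. T \<subseteq> {..<npred M} \<and> card T = card S}) S) * ennreal (pmf (size_prior M) (card S))"
      by (simp add: ennreal_mult[symmetric])
    also have "\<dots> = (\<integral>\<^sup>+s. ennreal (pmf (pmf_of_set {T. T \<subseteq> {..<npred M} \<and> card T = card S}) S) * indicator {card S} s \<partial>measure_pmf (size_prior M))"
      by (subst nn_integral_cmult_indicator) (auto simp: emeasure_pmf_single)
    also have "\<dots> \<le> (\<integral>\<^sup>+s. ennreal (pmf (pmf_of_set {T. T \<subseteq> {..<npred M} \<and> card T = s}) S) \<partial>measure_pmf (size_prior M))"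
      by (intro nn_integral_mono) (auto simp: indicator_def)
    also have "\<dots> = ennreal (pmf (support_prior M) S)"
      unfolding support_prior_def by (simp add: ennreal_pmf_bind)
    finally show ?thesis .
  qed
  then have "ennreal (pmf (size_prior M) (card S) / real (npred M choose card S)) * ennreal v
     \<le> ennreal (pmf (support_prior M) S) * emeasure (slab_measure (npred M) (rate M) S) ?A"
    using v by (intro mult_mono) auto
  also have "\<dots> = (\<integral>\<^sup>+T. emeasure (slab_measure (npred M) (rate M) S) ?A * indicator {S} T \<partial>measure_pmf (support_prior M))"
    by (subst nn_integral_cmult_indicator) (auto simp: emeasure_pmf_single mult.commute)
  also have "\<dots> \<le> emeasure (theta_prior M) ?A"
    unfolding emeasure_theta_prior[OF A] by (intro nn_integral_mono) (auto simp: indicator_def SI)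
  finally show ?thesis unfolding v_def[symmetric] using v0 by (subst ennreal_mult) auto
qed

end

section \<open>The regression model at a fixed sample size\<close>

definition base_measure :: "'h model \<Rightarrow> (nat \<Rightarrow> nat \<Rightarrow> real) measure" where
  "base_measure M = Pi\<^sub>M {..<nobs M} (block_base M)"

definition block_mean :: "'h model \<Rightarrow> (nat \<Rightarrow> real) \<Rightarrow> 'h \<Rightarrow> nat \<Rightarrow> real vec" where
  "block_mean M \<theta> \<eta> i = design M i *\<^sub>v vec (npred M) \<theta> + xi M \<eta> i"

lemma block_density_eq:
  "block_density M (\<theta>, \<eta>) i y = mvn_density (bsize M i) (block_mean M \<theta> \<eta> i) (Delta M \<eta> i) (vec (bsize M i) y)"
  by (simp add: block_density_def block_mean_def)

locale valid_setup =
  fixes M :: "'h model"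
  assumes valid: "valid_model M" and nobs_pos: "1 \<le> nobs M"
begin

lemma sizes: "nobs M < npred M" "i < nobs M \<Longrightarrow> 1 \<le> bsize M i" "i < nobs M \<Longrightarrow> bsize M i \<le> bmax M"
  using valid by (auto simp: valid_model_def)

lemma bmax_pos: "1 \<le> bmax M"
  using sizes(2,3)[of 0] nobs_pos by linarith

lemma carriers:
  "i < nobs M \<Longrightarrow> design M i \<in> carrier_mat (bsize M i) (npred M)"
  "i < nobs M \<Longrightarrow> \<eta> \<in> nuis M \<Longrightarrow> xi M \<eta> i \<in> carrier_vec (bsize M i)"
  "i < nobs M \<Longrightarrow> \<eta> \<in> nuis M \<Longrightarrow> pos_def_mat (bsize M i) (Delta M \<eta> i)"
  "i < nobs M \<Longrightarrow> \<eta> \<in> nuis M \<Longrightarrow> block_mean M \<theta> \<eta> i \<in> carrier_vec (bsize M i)"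
proof -
  show *: "i < nobs M \<Longrightarrow> design M i \<in> carrier_mat (bsize M i) (npred M)"
  "i < nobs M \<Longrightarrow> \<eta> \<in> nuis M \<Longrightarrow> xi M \<eta> i \<in> carrier_vec (bsize M i)"
  "i < nobs M \<Longrightarrow> \<eta> \<in> nuis M \<Longrightarrow> pos_def_mat (bsize M i) (Delta M \<eta> i)"
    using valid by (auto simp: valid_model_def)
  show "i < nobs M \<Longrightarrow> \<eta> \<in> nuis M \<Longrightarrow> block_mean M \<theta> \<eta> i \<in> carrier_vec (bsize M i)"
    unfolding block_mean_def using * by (intro add_carrier_vec mult_mat_vec_carrier) auto
qed

lemma eta0: "eta0 M \<in> nuis M" and rate_pos: "0 < rate M" and size_le: "set_pmf (size_prior M) \<subseteq> {..npred M}"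
  and eta_prob: "prob_space (eta_prior M)" and eta_space: "space (eta_prior M) \<subseteq> nuis M"
  using valid by (auto simp: valid_model_def)

lemma eta_meas:
  "i < nobs M \<Longrightarrow> k < bsize M i \<Longrightarrow> (\<lambda>\<eta>. xi M \<eta> i $ k) \<in> borel_measurable (eta_prior M)"
  "i < nobs M \<Longrightarrow> k < bsize M i \<Longrightarrow> l < bsize M i \<Longrightarrow> (\<lambda>\<eta>. Delta M \<eta> i $$ (k, l)) \<in> borel_measurable (eta_prior M)"
  using valid by (auto simp: valid_model_def)

lemma space_prior: "space (prior M) = space (Pi\<^sub>M {..<npred M} (\<lambda>_. borel :: real measure)) \<times> space (eta_prior M)"
  unfolding prior_def by (simp add: space_pair_measure space_theta_prior[OF rate_pos size_le])

lemma prob_prior: "prob_space (prior M)"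
proof -
  interpret t: prob_space "theta_prior M" by (rule prob_space_theta_prior[OF rate_pos size_le])
  interpret e: prob_space "eta_prior M" by (rule eta_prob)
  interpret pair_prob_space "theta_prior M" "eta_prior M" ..
  show ?thesis unfolding prior_def by unfold_locales
qed

lemma prior_times:
  assumes "A \<in> sets (theta_prior M)" "B \<in> sets (eta_prior M)"
  shows "emeasure (prior M) (A \<times> B) = emeasure (theta_prior M) A * emeasure (eta_prior M) B"
proof -
  interpret e: prob_space "eta_prior M" by (rule eta_prob)
  show ?thesis unfolding prior_def using assms by (rule e.emeasure_pair_measure_Times)
qed

lemma sigma_finite_block: "sigma_finite_measure (block_base M i)"
proof -
  interpret product_sigma_finite "\<lambda>_::nat. lborel :: real measure" by standard
  show ?thesis unfolding block_base_def by (rule sigma_finite) simp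
qed

lemma product_block: "product_sigma_finite (block_base M)"
  by (rule product_sigma_finite.intro) (rule sigma_finite_block)

lemma sigma_finite_base: "sigma_finite_measure (base_measure M)"
  unfolding base_measure_def by (rule product_sigma_finite.sigma_finite[OF product_block]) simp

lemma base_component: "i < nobs M \<Longrightarrow> (\<lambda>Y. Y i) \<in> measurable (base_measure M) (block_base M i)"
  unfolding base_measure_def by (rule measurable_component_singleton) simp

lemma base_prod_measurable:
  assumes "\<And>i. i < nobs M \<Longrightarrow> f i \<in> borel_measurable (block_base M i)"
  shows "(\<lambda>Y. \<Prod>i<nobs M. f i (Y i) :: real) \<in> borel_measurable (base_measure M)"
  by (rule borel_measurable_prod) (use assms base_component in \<open>auto intro: measurable_compose\<close>)

lemma base_prod_integral:
  assumes "\<And>i. i < nobs M \<Longrightarrow> f i \<in> borel_measurable (block_base M i)"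
    and "\<And>i y. i < nobs M \<Longrightarrow> (0::real) \<le> f i y"
  shows "(\<integral>\<^sup>+Y. ennreal (\<Prod>i<nobs M. f i (Y i)) \<partial>base_measure M) = (\<Prod>i<nobs M. \<integral>\<^sup>+y. ennreal (f i y) \<partial>block_base M i)"
proof -
  have "(\<integral>\<^sup>+Y. ennreal (\<Prod>i<nobs M. f i (Y i)) \<partial>base_measure M) = (\<integral>\<^sup>+Y. (\<Prod>i<nobs M. ennreal (f i (Y i))) \<partial>base_measure M)"
    using assms(2) by (intro nn_integral_cong prod_ennreal[symmetric]) auto
  then show ?thesis
    unfolding base_measure_def
    using product_sigma_finite.product_nn_integral_prod[OF product_block, of "{..<nobs M}" "\<lambda>i y. ennreal (f i y)"] assms(1) by simp
qed

lemma block_density_props: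
  assumes "i < nobs M" "\<eta> \<in> nuis M"
  shows "block_density M (\<theta>, \<eta>) i \<in> borel_measurable (block_base M i)"
    "0 < block_density M (\<theta>, \<eta>) i y"
    "(\<integral>\<^sup>+y. ennreal (block_density M (\<theta>, \<eta>) i y) \<partial>block_base M i) = 1"
proof -
  have "block_density M (\<theta>, \<eta>) i = (\<lambda>y. mvn_density (bsize M i) (block_mean M \<theta> \<eta> i) (Delta M \<eta> i) (vec (bsize M i) y))"
    by (rule ext) (rule block_density_eq)
  then show "block_density M (\<theta>, \<eta>) i \<in> borel_measurable (block_base M i)"
    "0 < block_density M (\<theta>, \<eta>) i y"
    "(\<integral>\<^sup>+y. ennreal (block_density M (\<theta>, \<eta>) i y) \<partial>block_base M i) = 1"
    using borel_measurable_mvn_density_vec(1)[OF carriers(3,4)[OF assms]] mvn_density_integral[OF carriers(3,4)[OF assms]]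
      mvn_density_pos[OF carriers(3)[OF assms]]
    unfolding block_base_def by simp_all
qed

lemma joint_pos: "\<eta> \<in> nuis M \<Longrightarrow> 0 < joint_density M (\<theta>, \<eta>) Y"
  unfolding joint_density_def using block_density_props(2) by (intro prod_pos) auto

lemma joint_measurable: "\<eta> \<in> nuis M \<Longrightarrow> joint_density M (\<theta>, \<eta>) \<in> borel_measurable (base_measure M)"
  unfolding joint_density_def[abs_def] using block_density_props(1) by (intro base_prod_measurable) auto

lemma joint_integral: "\<eta> \<in> nuis M \<Longrightarrow> (\<integral>\<^sup>+Y. ennreal (joint_density M (\<theta>, \<eta>) Y) \<partial>base_measure M) = 1"
  unfolding joint_density_def using block_density_props
  by (subst base_prod_integral) (auto intro: less_imp_le)

text \<open>Joint measurability in parameter and data is what Fubini needs; it reduces to measurable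
  entries of means and covariances.\<close>

lemma joint_measurable_pair:
  "(\<lambda>x. joint_density M (fst x) (snd x)) \<in> borel_measurable (prior M \<Otimes>\<^sub>M base_measure M)"
  unfolding joint_density_def
proof (rule borel_measurable_prod)
  fix i assume "i \<in> {..<nobs M}"
  then have i: "i < nobs M" by simp
  let ?N = "prior M \<Otimes>\<^sub>M base_measure M"
  have f1: "(\<lambda>x. fst (fst x)) \<in> measurable ?N (theta_prior M)"
    unfolding prior_def by measurable
  have f2: "(\<lambda>x. snd (fst x)) \<in> measurable ?N (eta_prior M)"
    unfolding prior_def by measurable
  have th: "(\<lambda>x. fst (fst x) j) \<in> borel_measurable ?N" if "j < npred M" for j
  proof (rule measurable_compose[OF f1])
    show "(\<lambda>\<theta>. \<theta> j) \<in> borel_measurable (theta_prior M)"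
      unfolding measurable_cong_sets[OF sets_theta_prior[OF rate_pos size_le] refl]
      using that by (intro measurable_component_singleton) auto
  qed
  have sp: "snd (fst x) \<in> nuis M" if "x \<in> space ?N" for x
    using that eta_space by (auto simp: space_pair_measure space_prior)
  have "(\<lambda>x. mvn_density (bsize M i) (block_mean M (fst (fst x)) (snd (fst x)) i) (Delta M (snd (fst x)) i) (vec (bsize M i) (snd x i)))
    \<in> borel_measurable ?N"
  proof (rule borel_measurable_mvn_density(1))
    fix k assume k: "k < bsize M i"
    have "(\<lambda>x. (\<Sum>j<npred M. design M i $$ (k, j) * fst (fst x) j) + xi M (snd (fst x)) i $ k) \<in> borel_measurable ?N"
      using th measurable_compose[OF f2 eta_meas(1)[OF i k]]
      by (intro borel_measurable_add borel_measurable_sum borel_measurable_times) auto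
    then show "(\<lambda>x. block_mean M (fst (fst x)) (snd (fst x)) i $ k) \<in> borel_measurable ?N"
    proof (rule measurable_cong[THEN iffD1, rotated])
      fix x assume "x \<in> space ?N"
      show "(\<Sum>j<npred M. design M i $$ (k, j) * fst (fst x) j) + xi M (snd (fst x)) i $ k = block_mean M (fst (fst x)) (snd (fst x)) i $ k"
        using carriers(1)[OF i] carriers(2)[OF i sp[OF \<open>x \<in> space ?N\<close>]] k
        by (simp add: block_mean_def scalar_prod_def lessThan_atLeast0)
    qed
    have "(\<lambda>x. snd x i k) \<in> borel_measurable ?N"
    proof -
      have 1: "(\<lambda>x. snd x i) \<in> measurable ?N (block_base M i)"
        using base_component[OF i] by (intro measurable_compose[OF measurable_snd])
      have "(\<lambda>y. y k) \<in> borel_measurable (block_base M i)"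
        unfolding block_base_def using k by (intro borel_measurable_coordinate) auto
      from measurable_compose[OF 1 this] show ?thesis .
    qed
    then show "(\<lambda>x. vec (bsize M i) (snd x i) $ k) \<in> borel_measurable ?N" using k by simp
    fix l assume l: "l < bsize M i"
    show "(\<lambda>x. Delta M (snd (fst x)) i $$ (k, l)) \<in> borel_measurable ?N"
      by (rule measurable_compose[OF f2 eta_meas(2)[OF i k l]])
  qed (use carriers(3,4)[OF i sp] in auto)
  then show "(\<lambda>x. block_density M (fst x) i (snd x i)) \<in> borel_measurable ?N"
    by (simp add: block_density_eq[symmetric])
qed

abbreviation "z0 \<equiv> (theta0 M, eta0 M)"

sublocale bayes: dominated_bayes "prior M" "base_measure M" "joint_density M" "joint_density M z0"
proof (intro dominated_bayes.intro dominated_bayes_axioms.intro prob_prior sigma_finite_base joint_measurable_pair joint_measurable eta0 joint_pos)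
  fix z Y assume "z \<in> space (prior M)"
  then obtain \<theta> \<eta> where z: "z = (\<theta>, \<eta>)" "\<eta> \<in> nuis M" using eta_space by (auto simp: space_prior)
  show "0 < joint_density M z Y" unfolding z(1) by (rule joint_pos[OF z(2)])
  show "(\<integral>\<^sup>+Y. ennreal (joint_density M z Y) \<partial>base_measure M) \<le> 1" unfolding z(1) joint_integral[OF z(2)] by simp
qed

lemma expected_posterior_eq:
  assumes A: "A \<in> sets (prior M)"
  shows "expected_posterior M A = bayes.post_mass A"
proof -
  have meas: "(\<lambda>Y. bayes.mass A Y / bayes.evid Y) \<in> borel_measurable (base_measure M)"
    using bayes.mass_meas[OF A] bayes.evid_meas by measurable
  have "expected_posterior M A = (\<integral>\<^sup>+Y. bayes.mass A Y / bayes.evid Y \<partial>data_dist M z0)"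
    unfolding expected_posterior_def
  proof (rule nn_integral_cong)
    fix Y assume "Y \<in> space (data_dist M z0)"
    then have Y: "Y \<in> space (base_measure M)" by (simp add: data_dist_def base_measure_def)
    have [measurable]: "(\<lambda>z. joint_density M z Y) \<in> borel_measurable (prior M)" by (rule bayes.p_sec[OF Y])
    have "emeasure (posterior M Y) A = (\<integral>\<^sup>+z. ennreal (joint_density M z Y) / bayes.evid Y * indicator A z \<partial>prior M)"
      unfolding posterior_def bayes.evid_def[symmetric] using A by (intro emeasure_density) measurable
    also have "\<dots> = (\<integral>\<^sup>+z. (ennreal (joint_density M z Y) * indicator A z) / bayes.evid Y \<partial>prior M)"
      by (intro nn_integral_cong) (simp add: indicator_def)
    also have "\<dots> = bayes.mass A Y / bayes.evid Y"
      unfolding bayes.mass_def using A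
      by (intro nn_integral_divide borel_measurable_times_ennreal borel_measurable_indicator
          measurable_compose[OF bayes.p_sec[OF Y] measurable_ennreal])
    finally show "emeasure (posterior M Y) A = bayes.mass A Y / bayes.evid Y" .
  qed
  also have "\<dots> = bayes.post_mass A"
    unfolding data_dist_def bayes.post_mass_def base_measure_def[symmetric]
    using meas bayes.p0_meas by (subst nn_integral_density) auto
  finally show ?thesis .
qed

text \<open>\<open>emeasure\<close> vanishes off the sigma-algebra. This settles the case of a
  non-measurable Renyi set, since measurability of the divergence in the parameter is not
  established.\<close>

lemma expected_posterior_nonmeasurable:
  assumes "A \<notin> sets (prior M)"
  shows "expected_posterior M A = 0"
  unfolding expected_posterior_def posterior_def using assms by (simp add: emeasure_notin_sets)

text \<open>Blocks are independent, so the affinity of the samples is the product of the block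
  affinities, which the average divergence turns into exp(-n R_n). Each block affinity has to be
  positive and finite before its logarithm can be undone.\<close>

lemma affinity_le:
  assumes \<eta>: "\<eta> \<in> nuis M" and gt: "K < renyi_div M (\<theta>, \<eta>) z0"
  shows "(\<integral>\<^sup>+Y. ennreal (sqrt (joint_density M z0 Y * joint_density M (\<theta>, \<eta>) Y)) \<partial>base_measure M) \<le> ennreal (exp (- real (nobs M) * K))"
proof -
  define f where "f i y = sqrt (block_density M (\<theta>, \<eta>) i y * block_density M z0 i y)" for i y
  define a where "a i = (\<integral>y. f i y \<partial>block_base M i)" for i
  have f: "f i \<in> borel_measurable (block_base M i)" "0 < f i y" if "i < nobs M" for i y
    using block_density_props(1,2)[OF that \<eta>] block_density_props(1,2)[OF that eta0]
    by (auto simp: f_def[abs_def])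
  have f_int: "(\<integral>\<^sup>+y. ennreal (f i y) \<partial>block_base M i) = ennreal (a i)" "0 < a i" if i: "i < nobs M" for i
  proof -
    note b1 = block_density_props[OF i \<eta>, of \<theta>] and b2 = block_density_props[OF i eta0, of "theta0 M"]
    have "(\<integral>\<^sup>+y. ennreal (f i y) \<partial>block_base M i) \<le> (\<integral>\<^sup>+y. ennreal (block_density M (\<theta>, \<eta>) i y) + ennreal (block_density M z0 i y) \<partial>block_base M i)"
    proof (rule nn_integral_mono)
      fix y
      define s where "s = block_density M (\<theta>, \<eta>) i y"
      define t where "t = block_density M z0 i y"
      have st: "0 < s" "0 < t" using b1(2) b2(2) by (auto simp: s_def t_def)
      \<comment> \<open>Crude bound by a sum of two probability densities; it serves finiteness
        only.\<close>
      have "sqrt (s * t) \<le> s + t"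
        using st arith_geo_mean_sqrt[of s t] by simp
      then show "ennreal (f i y) \<le> ennreal (block_density M (\<theta>, \<eta>) i y) + ennreal (block_density M z0 i y)"
        using st by (simp add: f_def s_def t_def ennreal_plus[symmetric] ennreal_leI del: ennreal_plus)
    qed
    also have "\<dots> = 2" using b1 b2 by (simp add: nn_integral_add)
    finally have fin: "(\<integral>\<^sup>+y. ennreal (f i y) \<partial>block_base M i) < \<infinity>" by (rule le_less_trans) simp
    have int: "integrable (block_base M i) (f i)"
      using f[OF i] fin by (intro integrableI_nonneg) (auto intro: less_imp_le)
    show eq: "(\<integral>\<^sup>+y. ennreal (f i y) \<partial>block_base M i) = ennreal (a i)"
      unfolding a_def using int f(2)[OF i] by (intro nn_integral_eq_integral) (auto intro: less_imp_le)
    have "(\<integral>\<^sup>+y. ennreal (f i y) \<partial>block_base M i) \<noteq> 0"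
    proof
      assume "(\<integral>\<^sup>+y. ennreal (f i y) \<partial>block_base M i) = 0"
      then have "AE y in block_base M i. ennreal (f i y) = 0"
        using f(1)[OF i] by (subst (asm) nn_integral_0_iff_AE) auto
      then have "AE y in block_base M i. False"
        using f(2)[OF i] by (auto simp: ennreal_eq_0_iff not_le[symmetric])
      then have "(\<integral>\<^sup>+y. ennreal (block_density M z0 i y) \<partial>block_base M i) = (\<integral>\<^sup>+y. 0 \<partial>block_base M i)"
        by (intro nn_integral_cong_AE) auto
      then show False using b2(3) by simp
    qed
    then have "0 < ennreal (a i)" unfolding eq by (simp add: zero_less_iff_neq_zero)
    then show "0 < a i" by (simp add: ennreal_less_zero_iff)
  qed
  have "(\<integral>\<^sup>+Y. ennreal (sqrt (joint_density M z0 Y * joint_density M (\<theta>, \<eta>) Y)) \<partial>base_measure M)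
     = (\<integral>\<^sup>+Y. ennreal (\<Prod>i<nobs M. f i (Y i)) \<partial>base_measure M)"
  proof (rule nn_integral_cong, rule arg_cong[of _ _ ennreal])
    fix Y
    have rt: "sqrt (\<Prod>i<m. g i) = (\<Prod>i<m. sqrt (g i))" for g :: "nat \<Rightarrow> real" and m
      by (induction m) (auto simp: real_sqrt_mult)
    then show "sqrt (joint_density M z0 Y * joint_density M (\<theta>, \<eta>) Y) = (\<Prod>i<nobs M. f i (Y i))"
      unfolding joint_density_def f_def rt[symmetric] prod.distrib by (simp only: mult.commute)
  qed
  also have "\<dots> = (\<Prod>i<nobs M. ennreal (a i))"
    using f f_int(1) by (subst base_prod_integral) (auto intro: less_imp_le)
  also have "\<dots> = ennreal (\<Prod>i<nobs M. a i)" using f_int(2) by (intro prod_ennreal) (auto intro: less_imp_le)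
  also have "(\<Prod>i<nobs M. a i) = exp (\<Sum>i<nobs M. ln (a i))" using f_int(2) by (simp add: exp_sum)
  also have "(\<Sum>i<nobs M. ln (a i)) = - real (nobs M) * renyi_div M (\<theta>, \<eta>) z0"
    using nobs_pos by (simp add: renyi_div_def avg_renyi_def a_def f_def)
  also have "ennreal (exp (- real (nobs M) * renyi_div M (\<theta>, \<eta>) z0)) \<le> ennreal (exp (- real (nobs M) * K))"
    using gt by (intro ennreal_leI) (simp add: mult_left_mono)
  finally show ?thesis .
qed

end

section \<open>Squared distances and the design\<close>

lemma sq_diff_le: "(a - b)\<^sup>2 \<le> 2 * (a - c)\<^sup>2 + 2 * (c - b)\<^sup>2" for a b c :: real
proof -
  have "0 \<le> ((a - c) - (c - b))\<^sup>2" by simp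
  then show ?thesis by (simp add: power2_eq_square algebra_simps)
qed

lemma frob_norm_diff_sq_le:
  assumes "A \<in> carrier_mat m k" "B \<in> carrier_mat m k" "C \<in> carrier_mat m k"
  shows "(frob_norm (A - B))\<^sup>2 \<le> 2 * (frob_norm (A - C))\<^sup>2 + 2 * (frob_norm (C - B))\<^sup>2"
proof -
  have "(\<Sum>i<m. \<Sum>j<k. (A $$ (i,j) - B $$ (i,j))\<^sup>2) \<le> (\<Sum>i<m. \<Sum>j<k. 2 * (A $$ (i,j) - C $$ (i,j))\<^sup>2 + 2 * (C $$ (i,j) - B $$ (i,j))\<^sup>2)"
    by (intro sum_mono sq_diff_le)
  then show ?thesis
    using assms by (simp add: frob_norm_sq[of _ m k] minus_carrier_mat sum.distrib sum_distrib_left)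
qed

lemma frob_norm_commute:
  assumes "A \<in> carrier_mat m k" "B \<in> carrier_mat m k"
  shows "frob_norm (A - B) = frob_norm (B - A)"
proof -
  have "(frob_norm (A - B))\<^sup>2 = (frob_norm (B - A))\<^sup>2"
    using assms by (simp add: frob_norm_sq[of _ m k] minus_carrier_mat power2_commute)
  then show ?thesis using frob_norm_nonneg by (metis power2_eq_iff_nonneg)
qed

lemma scalar_prod_diff_sq_le:
  fixes u v w :: "real vec"
  assumes "u \<in> carrier_vec k" "v \<in> carrier_vec k" "w \<in> carrier_vec k"
  shows "(u - v) \<bullet> (u - v) \<le> 2 * ((u - w) \<bullet> (u - w)) + 2 * ((w - v) \<bullet> (w - v))"
proof -
  have "(\<Sum>i<k. (u $ i - v $ i)\<^sup>2) \<le> (\<Sum>i<k. 2 * (u $ i - w $ i)\<^sup>2 + 2 * (w $ i - v $ i)\<^sup>2)"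
    by (intro sum_mono sq_diff_le)
  then show ?thesis
    using assms by (simp add: scalar_prod_self_sum[of _ k] sum.distrib sum_distrib_left)
qed

lemma norm2_vec_sq: "(norm2_vec v)\<^sup>2 = v \<bullet> v"
  by (simp add: norm2_vec_def scalar_prod_self_nonneg)

context valid_setup
begin

lemma n_pos: "0 < real (nobs M)"
  using nobs_pos by simp

lemma p_ge_2: "2 \<le> npred M"
  using sizes(1) nobs_pos by linarith

lemma dA_sq: "(\<Sum>i<nobs M. (xi M \<eta>1 i - xi M \<eta>2 i) \<bullet> (xi M \<eta>1 i - xi M \<eta>2 i)) = real (nobs M) * (dA M \<eta>1 \<eta>2)\<^sup>2"
  using n_pos by (simp add: dA_def norm2_vec_sq sum_nonneg scalar_prod_self_nonneg)

lemma dB_sq: "(\<Sum>i<nobs M. (frob_norm (Delta M \<eta>1 i - Delta M \<eta>2 i))\<^sup>2) = real (nobs M) * (dB M \<eta>1 \<eta>2)\<^sup>2"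
  using n_pos by (simp add: dB_def sum_nonneg)

lemma dn_sq: "(dn M \<eta>1 \<eta>2)\<^sup>2 = (dA M \<eta>1 \<eta>2)\<^sup>2 + (dB M \<eta>1 \<eta>2)\<^sup>2"
  by (simp add: dn_def)

lemma dn_nonneg: "0 \<le> dn M \<eta>1 \<eta>2"
  by (simp add: dn_def)

lemma dn_le_imp:
  assumes "dn M \<eta>1 \<eta>2 \<le> r"
  shows "(dA M \<eta>1 \<eta>2)\<^sup>2 \<le> r\<^sup>2" "(dB M \<eta>1 \<eta>2)\<^sup>2 \<le> r\<^sup>2"
proof -
  have "(dn M \<eta>1 \<eta>2)\<^sup>2 \<le> r\<^sup>2" using assms dn_nonneg by (intro power_mono)
  then show "(dA M \<eta>1 \<eta>2)\<^sup>2 \<le> r\<^sup>2" "(dB M \<eta>1 \<eta>2)\<^sup>2 \<le> r\<^sup>2"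
    unfolding dn_sq by (smt (verit) zero_le_power2)+
qed

lemma dB_sq_le:
  assumes "\<eta>1 \<in> nuis M" "\<eta>2 \<in> nuis M" "\<eta>3 \<in> nuis M"
  shows "(dB M \<eta>1 \<eta>2)\<^sup>2 \<le> 2 * (dB M \<eta>1 \<eta>3)\<^sup>2 + 2 * (dB M \<eta>3 \<eta>2)\<^sup>2"
proof -
  have "(\<Sum>i<nobs M. (frob_norm (Delta M \<eta>1 i - Delta M \<eta>2 i))\<^sup>2)
    \<le> (\<Sum>i<nobs M. 2 * (frob_norm (Delta M \<eta>1 i - Delta M \<eta>3 i))\<^sup>2 + 2 * (frob_norm (Delta M \<eta>3 i - Delta M \<eta>2 i))\<^sup>2)"
  proof (rule sum_mono)
    fix i assume "i \<in> {..<nobs M}"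
    then have i: "i < nobs M" by simp
    show "(frob_norm (Delta M \<eta>1 i - Delta M \<eta>2 i))\<^sup>2
      \<le> 2 * (frob_norm (Delta M \<eta>1 i - Delta M \<eta>3 i))\<^sup>2 + 2 * (frob_norm (Delta M \<eta>3 i - Delta M \<eta>2 i))\<^sup>2"
      using assms pos_def_matD(1)[OF carriers(3)[OF i]]
      by (intro frob_norm_diff_sq_le[of _ "bsize M i" "bsize M i"]) auto
  qed
  then have "real (nobs M) * (dB M \<eta>1 \<eta>2)\<^sup>2 \<le> real (nobs M) * (2 * (dB M \<eta>1 \<eta>3)\<^sup>2 + 2 * (dB M \<eta>3 \<eta>2)\<^sup>2)"
    by (simp add: sum.distrib sum_distrib_left[symmetric] dB_sq algebra_simps)
  then show ?thesis using n_pos by simp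
qed

lemma frob_le_dB: "i < nobs M \<Longrightarrow> (frob_norm (Delta M \<eta>1 i - Delta M \<eta>2 i))\<^sup>2 \<le> real (nobs M) * (dB M \<eta>1 \<eta>2)\<^sup>2"
  unfolding dB_sq[symmetric] by (intro member_le_sum) auto

lemma frob_le_max: "i < nobs M \<Longrightarrow> (frob_norm (Delta M \<eta>1 i - Delta M \<eta>2 i))\<^sup>2 \<le> max_Delta_dist2 M \<eta>1 \<eta>2"
  unfolding max_Delta_dist2_def by (intro Max_ge) auto

lemma dB_le_max: "(dB M \<eta>1 \<eta>2)\<^sup>2 \<le> max_Delta_dist2 M \<eta>1 \<eta>2"
proof -
  have "real (nobs M) * (dB M \<eta>1 \<eta>2)\<^sup>2 \<le> (\<Sum>i<nobs M. max_Delta_dist2 M \<eta>1 \<eta>2)"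
    unfolding dB_sq[symmetric] using frob_le_max by (intro sum_mono) auto
  then show ?thesis using n_pos by simp
qed

lemma design_norm_nonneg: "0 \<le> design_norm M"
proof -
  have "sqrt (\<Sum>i<nobs M. \<Sum>k<bsize M i. (design M i $$ (k, 0))\<^sup>2) \<le> design_norm M"
    unfolding design_norm_def using p_ge_2 by (intro Max_ge) auto
  moreover have "0 \<le> sqrt (\<Sum>i<nobs M. \<Sum>k<bsize M i. (design M i $$ (k, 0))\<^sup>2)" by (simp add: sum_nonneg)
  ultimately show ?thesis by linarith
qed

lemma design_column_le:
  assumes "j < npred M"
  shows "(\<Sum>i<nobs M. \<Sum>k<bsize M i. (design M i $$ (k, j))\<^sup>2) \<le> (design_norm M)\<^sup>2"
proof -
  have "sqrt (\<Sum>i<nobs M. \<Sum>k<bsize M i. (design M i $$ (k, j))\<^sup>2) \<le> design_norm M"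
    unfolding design_norm_def using assms by (intro Max_ge) auto
  then show ?thesis by (rule sqrt_le_D)
qed

text \<open>The stacked design maps the l1 norm to the Euclidean norm with constant
  \<open>design_norm M\<close>: Cauchy--Schwarz with weights |\<delta> j| in each row, then the
  column bound after exchanging the sums.\<close>

lemma design_mult_le:
  "(\<Sum>i<nobs M. (design M i *\<^sub>v vec (npred M) \<delta>) \<bullet> (design M i *\<^sub>v vec (npred M) \<delta>)) \<le> (design_norm M * (\<Sum>j<npred M. \<bar>\<delta> j\<bar>))\<^sup>2"
proof -
  define T where "T = (\<Sum>j<npred M. \<bar>\<delta> j\<bar>)"
  have "(design M i *\<^sub>v vec (npred M) \<delta>) \<bullet> (design M i *\<^sub>v vec (npred M) \<delta>)
      \<le> (\<Sum>k<bsize M i. \<Sum>j<npred M. \<bar>\<delta> j\<bar> * T * (design M i $$ (k, j))\<^sup>2)" if i: "i < nobs M" for i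
  proof -
    have "(design M i *\<^sub>v vec (npred M) \<delta>) \<bullet> (design M i *\<^sub>v vec (npred M) \<delta>)
      = (\<Sum>k<bsize M i. (\<Sum>j<npred M. design M i $$ (k, j) * \<delta> j)\<^sup>2)"
      using carriers(1)[OF i] by (subst scalar_prod_self_sum[of _ "bsize M i"])
        (auto simp: scalar_prod_def lessThan_atLeast0 intro!: sum.cong)
    also have "\<dots> \<le> (\<Sum>k<bsize M i. \<Sum>j<npred M. \<bar>\<delta> j\<bar> * T * (design M i $$ (k, j))\<^sup>2)"
    proof (rule sum_mono)
      fix k
      have "(\<Sum>j<npred M. design M i $$ (k, j) * \<delta> j)\<^sup>2
        = (\<Sum>j<npred M. (design M i $$ (k, j) * sgn (\<delta> j) * sqrt \<bar>\<delta> j\<bar>) * sqrt \<bar>\<delta> j\<bar>)\<^sup>2"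
        by (intro arg_cong[of _ _ "\<lambda>x. x\<^sup>2"] sum.cong refl) (simp add: mult.assoc sgn_mult_abs)
      also have "\<dots> \<le> (\<Sum>j<npred M. (design M i $$ (k, j) * sgn (\<delta> j) * sqrt \<bar>\<delta> j\<bar>)\<^sup>2) * (\<Sum>j<npred M. (sqrt \<bar>\<delta> j\<bar>)\<^sup>2)"
        by (rule Cauchy_Schwarz_ineq_sum)
      also have "(\<Sum>j<npred M. (sqrt \<bar>\<delta> j\<bar>)\<^sup>2) = T" by (simp add: T_def)
      also have "(\<Sum>j<npred M. (design M i $$ (k, j) * sgn (\<delta> j) * sqrt \<bar>\<delta> j\<bar>)\<^sup>2) = (\<Sum>j<npred M. \<bar>\<delta> j\<bar> * (design M i $$ (k, j))\<^sup>2)"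
        by (intro sum.cong refl) (auto simp: power_mult_distrib sgn_if)
      also have "(\<Sum>j<npred M. \<bar>\<delta> j\<bar> * (design M i $$ (k, j))\<^sup>2) * T = (\<Sum>j<npred M. \<bar>\<delta> j\<bar> * T * (design M i $$ (k, j))\<^sup>2)"
        by (subst sum_distrib_right) (simp add: mult_ac)
      finally show "(\<Sum>j<npred M. design M i $$ (k, j) * \<delta> j)\<^sup>2 \<le> (\<Sum>j<npred M. \<bar>\<delta> j\<bar> * T * (design M i $$ (k, j))\<^sup>2)" .
    qed
    finally show ?thesis .
  qed
  then have "(\<Sum>i<nobs M. (design M i *\<^sub>v vec (npred M) \<delta>) \<bullet> (design M i *\<^sub>v vec (npred M) \<delta>))
    \<le> (\<Sum>i<nobs M. \<Sum>k<bsize M i. \<Sum>j<npred M. \<bar>\<delta> j\<bar> * T * (design M i $$ (k, j))\<^sup>2)"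
    by (intro sum_mono) auto
  also have "\<dots> = (\<Sum>j<npred M. \<Sum>i<nobs M. \<Sum>k<bsize M i. \<bar>\<delta> j\<bar> * T * (design M i $$ (k, j))\<^sup>2)"
    by (subst sum.swap[of _ "{..<npred M}"]) (intro sum.cong refl sum.swap)
  also have "\<dots> = (\<Sum>j<npred M. \<bar>\<delta> j\<bar> * T * (\<Sum>i<nobs M. \<Sum>k<bsize M i. (design M i $$ (k, j))\<^sup>2))"
    by (simp add: sum_distrib_left)
  also have "\<dots> \<le> (\<Sum>j<npred M. \<bar>\<delta> j\<bar> * T * (design_norm M)\<^sup>2)"
    by (intro sum_mono mult_left_mono design_column_le) (auto simp: T_def sum_nonneg)
  also have "\<dots> = (design_norm M * T)\<^sup>2"
    by (simp add: sum_distrib_right[symmetric] T_def power2_eq_square)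
  finally show ?thesis unfolding T_def .
qed

lemma mean_diff_le:
  assumes \<eta>: "\<eta>1 \<in> nuis M" "\<eta>2 \<in> nuis M"
  shows "(\<Sum>i<nobs M. (block_mean M \<theta>1 \<eta>1 i - block_mean M \<theta>2 \<eta>2 i) \<bullet> (block_mean M \<theta>1 \<eta>1 i - block_mean M \<theta>2 \<eta>2 i))
    \<le> 2 * (design_norm M * (\<Sum>j<npred M. \<bar>\<theta>1 j - \<theta>2 j\<bar>))\<^sup>2 + 2 * (real (nobs M) * (dA M \<eta>1 \<eta>2)\<^sup>2)"
proof -
  define \<delta> where "\<delta> j = \<theta>1 j - \<theta>2 j" for j
  define f where "f i = design M i *\<^sub>v vec (npred M) \<delta>" for i
  define g where "g i = xi M \<eta>1 i - xi M \<eta>2 i" for i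
  have "(block_mean M \<theta>1 \<eta>1 i - block_mean M \<theta>2 \<eta>2 i) \<bullet> (block_mean M \<theta>1 \<eta>1 i - block_mean M \<theta>2 \<eta>2 i)
     \<le> 2 * (f i \<bullet> f i) + 2 * (g i \<bullet> g i)" if i: "i < nobs M" for i
  proof -
    let ?m = "bsize M i"
    note c = carriers(1)[OF i] carriers(2)[OF i \<eta>(1)] carriers(2)[OF i \<eta>(2)]
    have fc: "f i \<in> carrier_vec ?m" "g i \<in> carrier_vec ?m"
      unfolding f_def g_def using c by (auto intro!: mult_mat_vec_carrier)
    have vd: "vec (npred M) \<delta> = vec (npred M) \<theta>1 - vec (npred M) \<theta>2" by (intro eq_vecI) (auto simp: \<delta>_def)
    have "f i = design M i *\<^sub>v vec (npred M) \<theta>1 - design M i *\<^sub>v vec (npred M) \<theta>2"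
      unfolding f_def vd using c by (intro mult_minus_distrib_mat_vec) auto
    then have eq: "block_mean M \<theta>1 \<eta>1 i - block_mean M \<theta>2 \<eta>2 i = f i - (- g i)"
      unfolding block_mean_def g_def using c by (intro eq_vecI) auto
    have "(f i - (- g i)) \<bullet> (f i - (- g i)) \<le> 2 * ((f i - 0\<^sub>v ?m) \<bullet> (f i - 0\<^sub>v ?m)) + 2 * ((0\<^sub>v ?m - (- g i)) \<bullet> (0\<^sub>v ?m - (- g i)))"
      using fc by (intro scalar_prod_diff_sq_le) auto
    moreover have "f i - 0\<^sub>v ?m = f i" "0\<^sub>v ?m - (- g i) = g i" using fc by (auto intro!: eq_vecI)
    ultimately show ?thesis unfolding eq by simp
  qed
  then have "(\<Sum>i<nobs M. (block_mean M \<theta>1 \<eta>1 i - block_mean M \<theta>2 \<eta>2 i) \<bullet> (block_mean M \<theta>1 \<eta>1 i - block_mean M \<theta>2 \<eta>2 i))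
    \<le> (\<Sum>i<nobs M. 2 * (f i \<bullet> f i) + 2 * (g i \<bullet> g i))" by (intro sum_mono) auto
  also have "\<dots> = 2 * (\<Sum>i<nobs M. f i \<bullet> f i) + 2 * (\<Sum>i<nobs M. g i \<bullet> g i)"
    by (simp add: sum.distrib sum_distrib_left)
  also have "(\<Sum>i<nobs M. g i \<bullet> g i) = real (nobs M) * (dA M \<eta>1 \<eta>2)\<^sup>2" unfolding g_def by (rule dA_sq)
  also have "2 * (\<Sum>i<nobs M. f i \<bullet> f i) \<le> 2 * (design_norm M * (\<Sum>j<npred M. \<bar>\<theta>1 j - \<theta>2 j\<bar>))\<^sup>2"
    unfolding f_def using design_mult_le[of \<delta>] by (simp add: \<delta>_def)
  finally show ?thesis by simp
qed

section \<open>Likelihood ratios of the whole sample\<close>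

lemma chi_joint:
  assumes c: "0 < c" and C: "0 < C" and \<eta>: "\<eta> \<in> nuis M"
    and ge: "\<And>i v. i < nobs M \<Longrightarrow> v \<in> carrier_vec (bsize M i) \<Longrightarrow> c * (v \<bullet> v) \<le> v \<bullet> (Delta M (eta0 M) i *\<^sub>v v)"
    and le: "\<And>i v. i < nobs M \<Longrightarrow> v \<in> carrier_vec (bsize M i) \<Longrightarrow> v \<bullet> (Delta M (eta0 M) i *\<^sub>v v) \<le> C * (v \<bullet> v)"
    and near: "\<And>i. i < nobs M \<Longrightarrow> frob_norm (Delta M \<eta> i - Delta M (eta0 M) i) \<le> c / 4"
  shows "(\<integral>\<^sup>+Y. ennreal ((joint_density M z0 Y)\<^sup>2 / joint_density M (\<theta>, \<eta>) Y) \<partial>base_measure M)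
    \<le> ennreal (exp (2 * C / c^3 * (real (nobs M) * (dB M \<eta> (eta0 M))\<^sup>2) + ((3*C/2) * (4/(3*c))\<^sup>2 / 2 + (4/(3*c)) / 2) *
       (\<Sum>i<nobs M. (block_mean M \<theta> \<eta> i - block_mean M (theta0 M) (eta0 M) i) \<bullet> (block_mean M \<theta> \<eta> i - block_mean M (theta0 M) (eta0 M) i))))"
proof -
  define f where "f i y = (block_density M z0 i y)\<^sup>2 / block_density M (\<theta>, \<eta>) i y" for i y
  define K where "K = (3*C/2) * (4/(3*c))\<^sup>2 / 2 + (4/(3*c)) / 2"
  define h where "h i = block_mean M \<theta> \<eta> i - block_mean M (theta0 M) (eta0 M) i" for i
  define e where "e i = 2 * C / c^3 * (frob_norm (Delta M \<eta> i - Delta M (eta0 M) i))\<^sup>2 + K * (h i \<bullet> h i)" for i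
  have f: "f i \<in> borel_measurable (block_base M i)" "0 \<le> f i y" if i: "i < nobs M" for i y
    using block_density_props(1,2)[OF i \<eta>] block_density_props(1,2)[OF i eta0]
    by (auto simp: f_def[abs_def] intro!: divide_nonneg_pos)
  have fi: "(\<integral>\<^sup>+y. ennreal (f i y) \<partial>block_base M i) \<le> ennreal (exp (e i))" if i: "i < nobs M" for i
  proof -
    interpret perturbed_cov "bsize M i" "Delta M (eta0 M) i" "Delta M \<eta> i" c C
      using carriers(3)[OF i eta0] carriers(3)[OF i \<eta>] c C ge[OF i] le[OF i] near[OF i] by unfold_locales
    show ?thesis
      unfolding f_def block_density_eq block_base_def e_def h_def K_def
      using chi_square_bound[OF carriers(4)[OF i eta0] carriers(4)[OF i \<eta>]] unfolding K\<chi>_def D_def .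
  qed
  have "(\<integral>\<^sup>+Y. ennreal ((joint_density M z0 Y)\<^sup>2 / joint_density M (\<theta>, \<eta>) Y) \<partial>base_measure M)
     = (\<integral>\<^sup>+Y. ennreal (\<Prod>i<nobs M. f i (Y i)) \<partial>base_measure M)"
    by (simp add: joint_density_def f_def prod_dividef prod_power_distrib)
  also have "\<dots> = (\<Prod>i<nobs M. \<integral>\<^sup>+y. ennreal (f i y) \<partial>block_base M i)"
    using f by (rule base_prod_integral)
  also have "\<dots> \<le> (\<Prod>i<nobs M. ennreal (exp (e i)))" using fi by (intro prod_mono_ennreal) auto
  also have "\<dots> = ennreal (exp (\<Sum>i<nobs M. e i))" by (simp add: prod_ennreal exp_sum)
  also have "(\<Sum>i<nobs M. e i) = 2 * C / c^3 * (real (nobs M) * (dB M \<eta> (eta0 M))\<^sup>2) + K * (\<Sum>i<nobs M. h i \<bullet> h i)"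
    unfolding e_def dB_sq[symmetric] by (simp add: sum.distrib sum_distrib_left)
  finally show ?thesis unfolding K_def h_def .
qed

text \<open>Majorant attached to the representative of a cell; \<open>\<kappa>\<close> collects the
  multiplicative losses of all blocks.\<close>

definition bracket :: "real \<Rightarrow> real \<Rightarrow> (nat \<Rightarrow> real) \<times> 'h \<Rightarrow> (nat \<Rightarrow> nat \<Rightarrow> real) \<Rightarrow> real" where
  "bracket \<beta> \<kappa> = (\<lambda>(\<theta>, \<eta>) Y. exp \<kappa> * (\<Prod>i<nobs M. tilted_density \<beta> (bsize M i) (block_mean M \<theta> \<eta> i) (Delta M \<eta> i) (vec (bsize M i) (Y i))))"

lemma bracket_props:
  assumes "\<eta> \<in> nuis M"
  shows "bracket \<beta> \<kappa> (\<theta>, \<eta>) \<in> borel_measurable (base_measure M)" "0 \<le> bracket \<beta> \<kappa> (\<theta>, \<eta>) Y"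
proof -
  have "(\<lambda>Y. \<Prod>i<nobs M. tilted_density \<beta> (bsize M i) (block_mean M \<theta> \<eta> i) (Delta M \<eta> i) (vec (bsize M i) (Y i))) \<in> borel_measurable (base_measure M)"
    using borel_measurable_tilted_density_vec[OF carriers(3,4)[OF _ assms]]
    by (intro base_prod_measurable) (simp add: block_base_def)
  then show "bracket \<beta> \<kappa> (\<theta>, \<eta>) \<in> borel_measurable (base_measure M)" unfolding bracket_def by simp
  show "0 \<le> bracket \<beta> \<kappa> (\<theta>, \<eta>) Y"
    using tilted_density_pos[OF carriers(3)[OF _ assms]] unfolding bracket_def prod.case
    by (intro mult_nonneg_nonneg prod_nonneg) (auto intro: less_imp_le)
qed

lemma sum_bsize_le: "(\<Sum>i<nobs M. real (bsize M i)) \<le> real (nobs M) * real (bmax M)"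
proof -
  have "(\<Sum>i<nobs M. real (bsize M i)) \<le> (\<Sum>i<nobs M. real (bmax M))" using sizes(3) by (intro sum_mono) auto
  then show ?thesis by simp
qed

text \<open>The losses exp(\<beta> k / 2) multiply to at most exp(\<beta> n mbar / 2), and the mean
  shifts enter only through their sum over the blocks, which \<open>mean_diff_le\<close>
  controls.\<close>

lemma joint_le_bracket:
  assumes \<eta>: "\<eta> \<in> nuis M" and \<eta>': "\<eta>' \<in> nuis M" and \<gamma>: "0 < \<gamma>" and \<beta>: "0 < \<beta>"
    and ge: "\<And>i v. i < nobs M \<Longrightarrow> v \<in> carrier_vec (bsize M i) \<Longrightarrow> v \<bullet> v \<le> \<gamma> * (v \<bullet> (Delta M \<eta> i *\<^sub>v v))"
    and ge': "\<And>i v. i < nobs M \<Longrightarrow> v \<in> carrier_vec (bsize M i) \<Longrightarrow> v \<bullet> v \<le> \<gamma> * (v \<bullet> (Delta M \<eta>' i *\<^sub>v v))"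
    and near: "\<And>i. i < nobs M \<Longrightarrow> \<gamma> * frob_norm (Delta M \<eta>' i - Delta M \<eta> i) \<le> \<beta>"
    and mean: "\<gamma> * (\<Sum>i<nobs M. (block_mean M \<theta>' \<eta>' i - block_mean M \<theta> \<eta> i) \<bullet> (block_mean M \<theta>' \<eta>' i - block_mean M \<theta> \<eta> i)) / (2 * \<beta>) \<le> \<Gamma>"
  shows "joint_density M (\<theta>, \<eta>) Y \<le> bracket \<beta> (\<beta> * (real (nobs M) * real (bmax M)) / 2 + \<Gamma>) (\<theta>', \<eta>') Y"
proof -
  define h where "h i = block_mean M \<theta>' \<eta>' i - block_mean M \<theta> \<eta> i" for i
  define t where "t i = tilted_density \<beta> (bsize M i) (block_mean M \<theta>' \<eta>' i) (Delta M \<eta>' i) (vec (bsize M i) (Y i))" for i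
  have t0: "0 < t i" if "i < nobs M" for i unfolding t_def by (rule tilted_density_pos[OF carriers(3)[OF that \<eta>']])
  have "joint_density M (\<theta>, \<eta>) Y \<le> (\<Prod>i<nobs M. exp (\<beta> * real (bsize M i) / 2 + \<gamma> * (h i \<bullet> h i) / (2 * \<beta>)) * t i)"
    unfolding joint_density_def
  proof (intro prod_mono conjI)
    fix i assume "i \<in> {..<nobs M}"
    then have i: "i < nobs M" by simp
    show "0 \<le> block_density M (\<theta>, \<eta>) i (Y i)" using block_density_props(2)[OF i \<eta>] by (simp add: less_imp_le)
    show "block_density M (\<theta>, \<eta>) i (Y i) \<le> exp (\<beta> * real (bsize M i) / 2 + \<gamma> * (h i \<bullet> h i) / (2 * \<beta>)) * t i"
      unfolding block_density_eq h_def t_def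
      by (rule mvn_density_le_tilted[OF carriers(3)[OF i \<eta>] carriers(3)[OF i \<eta>'] \<gamma> \<beta> ge[OF i] ge'[OF i] near[OF i] carriers(4)[OF i \<eta>] carriers(4)[OF i \<eta>']]) auto
  qed
  also have "\<dots> = exp (\<Sum>i<nobs M. \<beta> * real (bsize M i) / 2 + \<gamma> * (h i \<bullet> h i) / (2 * \<beta>)) * (\<Prod>i<nobs M. t i)"
    by (simp only: prod.distrib exp_sum[OF finite_lessThan])
  also have "\<dots> \<le> exp (\<beta> * (real (nobs M) * real (bmax M)) / 2 + \<Gamma>) * (\<Prod>i<nobs M. t i)"
  proof (intro mult_right_mono prod_nonneg)
    have "(\<Sum>i<nobs M. \<beta> * real (bsize M i) / 2 + \<gamma> * (h i \<bullet> h i) / (2 * \<beta>))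
       = \<beta> / 2 * (\<Sum>i<nobs M. real (bsize M i)) + \<gamma> * (\<Sum>i<nobs M. h i \<bullet> h i) / (2 * \<beta>)"
      by (simp add: sum.distrib sum_distrib_left sum_divide_distrib)
    also have "\<dots> \<le> \<beta> / 2 * (real (nobs M) * real (bmax M)) + \<Gamma>"
      using mean \<beta> unfolding h_def by (intro add_mono mult_left_mono sum_bsize_le) auto
    finally show "exp (\<Sum>i<nobs M. \<beta> * real (bsize M i) / 2 + \<gamma> * (h i \<bullet> h i) / (2 * \<beta>)) \<le> exp (\<beta> * (real (nobs M) * real (bmax M)) / 2 + \<Gamma>)"
      by simp
  qed (use t0 in \<open>auto intro: less_imp_le\<close>)
  finally show ?thesis by (simp add: bracket_def t_def)
qed

lemma bracket_ratio:
  assumes \<eta>: "\<eta> \<in> nuis M" and \<beta>: "0 < \<beta>" "\<beta> \<le> 1 / 8"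
  shows "(\<integral>\<^sup>+Y. ennreal ((bracket \<beta> \<kappa> (\<theta>, \<eta>) Y)\<^sup>2 / joint_density M (\<theta>, \<eta>) Y) \<partial>base_measure M)
    \<le> ennreal (exp (2 * \<kappa> + 4 * \<beta> * (real (nobs M) * real (bmax M))))"
proof -
  define t where "t i y = tilted_density \<beta> (bsize M i) (block_mean M \<theta> \<eta> i) (Delta M \<eta> i) (vec (bsize M i) y)" for i y
  define f where "f i y = (t i y)\<^sup>2 / block_density M (\<theta>, \<eta>) i y" for i y
  have t_meas: "t i \<in> borel_measurable (block_base M i)" if i: "i < nobs M" for i
    unfolding t_def[abs_def] block_base_def by (rule borel_measurable_tilted_density_vec[OF carriers(3,4)[OF i \<eta>]])
  have f: "f i \<in> borel_measurable (block_base M i)" "0 \<le> f i y" if i: "i < nobs M" for i y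
    using block_density_props(1,2)[OF i \<eta>] t_meas[OF i]
    by (auto simp: f_def[abs_def] intro!: divide_nonneg_pos)
  have "(\<integral>\<^sup>+Y. ennreal ((bracket \<beta> \<kappa> (\<theta>, \<eta>) Y)\<^sup>2 / joint_density M (\<theta>, \<eta>) Y) \<partial>base_measure M)
    = (\<integral>\<^sup>+Y. ennreal ((exp \<kappa>)\<^sup>2) * ennreal (\<Prod>i<nobs M. f i (Y i)) \<partial>base_measure M)"
    by (simp add: bracket_def joint_density_def f_def t_def prod_dividef prod_power_distrib power_mult_distrib ennreal_mult'[symmetric])
  also have "\<dots> = ennreal ((exp \<kappa>)\<^sup>2) * (\<integral>\<^sup>+Y. ennreal (\<Prod>i<nobs M. f i (Y i)) \<partial>base_measure M)"
    using base_prod_measurable[of f] f(1) by (intro nn_integral_cmult) auto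
  also have "(\<integral>\<^sup>+Y. ennreal (\<Prod>i<nobs M. f i (Y i)) \<partial>base_measure M) = (\<Prod>i<nobs M. \<integral>\<^sup>+y. ennreal (f i y) \<partial>block_base M i)"
    using f by (rule base_prod_integral)
  also have "\<dots> \<le> (\<Prod>i<nobs M. ennreal (exp (4 * \<beta> * real (bsize M i))))"
  proof (rule prod_mono_ennreal)
    fix i assume "i \<in> {..<nobs M}"
    then have i: "i < nobs M" by simp
    show "(\<integral>\<^sup>+y. ennreal (f i y) \<partial>block_base M i) \<le> ennreal (exp (4 * \<beta> * real (bsize M i)))"
      unfolding f_def t_def block_density_eq block_base_def by (rule tilted_ratio_integral[OF carriers(3,4)[OF i \<eta>] \<beta>])
  qed
  also have "\<dots> = ennreal (exp (4 * \<beta> * (\<Sum>i<nobs M. real (bsize M i))))"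
    by (simp add: prod_ennreal exp_sum[symmetric] sum_distrib_left)
  also have "\<dots> \<le> ennreal (exp (4 * \<beta> * (real (nobs M) * real (bmax M))))"
    using \<beta> by (intro ennreal_leI) (simp add: sum_bsize_le)
  finally have "(\<integral>\<^sup>+Y. ennreal ((bracket \<beta> \<kappa> (\<theta>, \<eta>) Y)\<^sup>2 / joint_density M (\<theta>, \<eta>) Y) \<partial>base_measure M)
    \<le> ennreal ((exp \<kappa>)\<^sup>2) * ennreal (exp (4 * \<beta> * (real (nobs M) * real (bmax M))))"
    by (simp add: mult_left_mono)
  also have "\<dots> = ennreal (exp (2 * \<kappa> + 4 * \<beta> * (real (nobs M) * real (bmax M))))"
    by (simp add: ennreal_mult[symmetric] exp_add[symmetric] power2_eq_square)
  finally show ?thesis .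
qed

end

section \<open>Counting cells\<close>

lemma card_small_subsets_le:
  assumes D: "finite D"
  shows "finite {X. X \<subseteq> D \<and> card X \<le> t} \<and> card {X. X \<subseteq> D \<and> card X \<le> t} \<le> (card D + 1) ^ t"
proof (induction t)
  case 0
  have "{X. X \<subseteq> D \<and> card X \<le> 0} = {{}}" using D by (auto dest: finite_subset)
  then show ?case by simp
next
  case (Suc t)
  let ?F = "\<lambda>t. {X. X \<subseteq> D \<and> card X \<le> t}"
  let ?g = "\<lambda>(x, X). case x of None \<Rightarrow> X | Some d \<Rightarrow> insert d X"
  \<comment> \<open>A set of size at most t + 1 arises from one of size at most t by adding at most
    one element; \<open>None\<close> stands for adding nothing.\<close>
  have sub: "?F (Suc t) \<subseteq> ?g ` (insert None (Some ` D) \<times> ?F t)"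
  proof
    fix X assume "X \<in> ?F (Suc t)"
    then have X: "X \<subseteq> D" "card X \<le> Suc t" by auto
    show "X \<in> ?g ` (insert None (Some ` D) \<times> ?F t)"
    proof (cases "X = {}")
      case True
      then show ?thesis by (intro image_eqI[of _ _ "(None, {})"]) auto
    next
      case False
      then obtain x where x: "x \<in> X" by auto
      have "card (X - {x}) \<le> t" using X x finite_subset[OF X(1) D] by simp
      then show ?thesis using X x by (intro image_eqI[of _ _ "(Some x, X - {x})"]) auto
    qed
  qed
  have fin: "finite (insert None (Some ` D) \<times> ?F t)" using D Suc by simp
  have "card (?F (Suc t)) \<le> card (insert None (Some ` D) \<times> ?F t)"
    using sub fin by (meson card_image_le card_mono finite_imageI le_trans)
  also have "\<dots> = (card D + 1) * card (?F t)"
    using D by (simp add: card_cartesian_product card_image card_insert_disjoint)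
  also have "\<dots> \<le> (card D + 1) * (card D + 1) ^ t" using Suc by (intro mult_left_mono) auto
  finally show ?case using finite_subset[OF sub finite_imageI[OF fin]] by simp
qed

text \<open>Cell indices for the coefficients: integer parts of the coordinates in units of the mesh
  width. Requiring 0 from p on makes the set of functions finite.\<close>

definition sparse_grid :: "nat \<Rightarrow> nat \<Rightarrow> nat \<Rightarrow> (nat \<Rightarrow> int) set" where
  "sparse_grid p t G = {k. (\<forall>j\<ge>p. k j = 0) \<and> card {j. j < p \<and> k j \<noteq> 0} \<le> t \<and> (\<forall>j. \<bar>k j\<bar> \<le> int G)}"

text \<open>A grid point is determined by its graph over its support, a set of at most t pairs from
  {..<p} times [-G, G].\<close>

lemma sparse_grid_card: "finite (sparse_grid p t G)" "card (sparse_grid p t G) \<le> (p * (2 * G + 1) + 1) ^ t"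
proof -
  define D where "D = {..<p} \<times> {- int G..int G}"
  define \<phi> where "\<phi> k = (\<lambda>j. (j, k j)) ` {j. j < p \<and> k j \<noteq> 0}" for k :: "nat \<Rightarrow> int"
  have "card {- int G..int G} = 2 * G + 1" by simp
  then have D: "finite D" "card D = p * (2 * G + 1)" unfolding D_def card_cartesian_product by simp_all
  have inj: "inj_on \<phi> (sparse_grid p t G)"
  proof (rule inj_onI, rule ext)
    fix k k' j assume k: "k \<in> sparse_grid p t G" "k' \<in> sparse_grid p t G" "\<phi> k = \<phi> k'"
    have iff: "(j, x) \<in> \<phi> k \<longleftrightarrow> j < p \<and> k j = x \<and> x \<noteq> 0" for k x by (auto simp: \<phi>_def)
    show "k j = k' j"
    proof (cases "j < p")
      case True
      have "k j = x \<longleftrightarrow> k' j = x" if "x \<noteq> 0" for x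
        using iff[of x k] iff[of x k'] k(3) True that by simp
      then show ?thesis by metis
    qed (use k in \<open>auto simp: sparse_grid_def\<close>)
  qed
  have sub: "\<phi> ` sparse_grid p t G \<subseteq> {X. X \<subseteq> D \<and> card X \<le> t}"
  proof
    fix X assume "X \<in> \<phi> ` sparse_grid p t G"
    then obtain k where k: "k \<in> sparse_grid p t G" "X = \<phi> k" by auto
    have "card X \<le> card {j. j < p \<and> k j \<noteq> 0}" unfolding k(2) \<phi>_def by (rule card_image_le) simp
    moreover have "X \<subseteq> D" using k by (auto simp: \<phi>_def D_def sparse_grid_def abs_le_iff minus_le_iff)
    ultimately show "X \<in> {X. X \<subseteq> D \<and> card X \<le> t}" using k(1) by (auto simp: sparse_grid_def)
  qed
  note c = card_small_subsets_le[OF D(1), of t]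
  show "finite (sparse_grid p t G)" using sub c inj finite_imageD finite_subset by blast
  have "card (sparse_grid p t G) = card (\<phi> ` sparse_grid p t G)" using inj by (simp add: card_image)
  also have "\<dots> \<le> card {X. X \<subseteq> D \<and> card X \<le> t}" using sub c by (intro card_mono) auto
  also have "\<dots> \<le> (p * (2 * G + 1) + 1) ^ t" using c D(2) by simp
  finally show "card (sparse_grid p t G) \<le> (p * (2 * G + 1) + 1) ^ t" .
qed

lemma covering_number_obtain:
  assumes "covering_number U r F d = enat N"
  obtains C where "finite C" "C \<subseteq> U" "F \<subseteq> (\<Union>c\<in>C. {x. d c x \<le> r})" "card C = N"
proof -
  define S where "S = {C. finite C \<and> C \<subseteq> U \<and> F \<subseteq> (\<Union>c\<in>C. {x. d c x \<le> r})}"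
  define X where "X = (\<lambda>C. enat (card C)) ` S"
  have inf: "Inf X = enat N" using assms by (simp add: covering_number_def X_def S_def)
  then have "X \<noteq> {}" by (auto simp: Inf_enat_def)
  then obtain x where x: "x \<in> X" by blast
  \<comment> \<open>The infimum of a nonempty set of extended naturals is attained, so some cover
    has exactly N balls.\<close>
  have "Inf X = (LEAST x. x \<in> X)" using x by (auto simp: Inf_enat_def)
  then have "enat N \<in> X" using LeastI[of "\<lambda>x. x \<in> X" x] x inf by simp
  then obtain C where "C \<in> S" "enat (card C) = enat N" unfolding X_def by force
  then show ?thesis using that[of C] by (simp add: S_def)
qed

section \<open>Evidence and cells for one sample size\<close>

context valid_setup
begin

text \<open>The neighbourhood of the truth is a product: coefficients supported where \<theta>0 is
  and within \<delta> of it, and a \<open>dn\<close> ball of nuisances. The condition on \<delta>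
  keeps the coefficient part of the mean shift at most 1, so that, up to a constant, only n times
  the squared radius remains in the exponent.\<close>

lemma inv_evid_bound:
  fixes \<epsilon>b \<delta> c C :: real
  defines "S0 \<equiv> {j. j < npred M \<and> theta0 M j \<noteq> 0}"
  defines "\<pi>\<theta> \<equiv> pmf (size_prior M) (card S0) / real (npred M choose card S0) *
      ((rate M * \<delta>) ^ card S0 * exp (- rate M * (\<Sum>j\<in>S0. \<bar>theta0 M j\<bar>) - rate M * \<delta> * real (card S0)))"
  defines "\<pi>\<eta> \<equiv> measure (eta_prior M) {\<eta> \<in> space (eta_prior M). dn M \<eta> (eta0 M) \<le> \<epsilon>b}"
  defines "K \<equiv> (3*C/2) * (4/(3*c))\<^sup>2 / 2 + (4/(3*c)) / 2"
  assumes c: "0 < c" and C: "0 < C" and \<delta>: "0 < \<delta>" and \<delta>1: "design_norm M * (real (card S0) * \<delta>) \<le> 1"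
    and ge: "\<And>i v. i < nobs M \<Longrightarrow> v \<in> carrier_vec (bsize M i) \<Longrightarrow> c * (v \<bullet> v) \<le> v \<bullet> (Delta M (eta0 M) i *\<^sub>v v)"
    and le: "\<And>i v. i < nobs M \<Longrightarrow> v \<in> carrier_vec (bsize M i) \<Longrightarrow> v \<bullet> (Delta M (eta0 M) i *\<^sub>v v) \<le> C * (v \<bullet> v)"
    and near: "\<And>\<eta> i. \<eta> \<in> space (eta_prior M) \<Longrightarrow> dn M \<eta> (eta0 M) \<le> \<epsilon>b \<Longrightarrow> i < nobs M \<Longrightarrow> frob_norm (Delta M \<eta> i - Delta M (eta0 M) i) \<le> c / 4"
    and pos: "0 < pmf (size_prior M) (card S0)" "0 < \<pi>\<eta>"
  shows "bayes.inv_evid \<le> ennreal (exp (2 * C / c^3 * (real (nobs M) * \<epsilon>b\<^sup>2) + K * (2 + 2 * (real (nobs M) * \<epsilon>b\<^sup>2))) / (\<pi>\<theta> * \<pi>\<eta>))"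
proof -
  let ?B = "Pi\<^sub>M {..<npred M} (\<lambda>_. borel :: real measure)"
  define T where "T = {\<theta> \<in> space ?B. (\<forall>j<npred M. theta0 M j \<noteq> 0 \<longrightarrow> \<bar>\<theta> j - theta0 M j\<bar> \<le> \<delta>) \<and> (\<forall>j<npred M. theta0 M j = 0 \<longrightarrow> \<theta> j = 0)}"
  define E where "E = {\<eta> \<in> space (eta_prior M). dn M \<eta> (eta0 M) \<le> \<epsilon>b}"
  define V where "V = exp (2 * C / c^3 * (real (nobs M) * \<epsilon>b\<^sup>2) + K * (2 + 2 * (real (nobs M) * \<epsilon>b\<^sup>2)))"
  interpret e: prob_space "eta_prior M" by (rule eta_prob)
  interpret t: prob_space "theta_prior M" by (rule prob_space_theta_prior[OF rate_pos size_le])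
  have S0: "card S0 \<le> npred M" unfolding S0_def using card_mono[of "{..<npred M}" "{j. j < npred M \<and> theta0 M j \<noteq> 0}"] by auto
  have K0: "0 < K" using c C by (simp add: K_def add_pos_pos)
  have \<pi>\<theta>: "0 < \<pi>\<theta>" unfolding \<pi>\<theta>_def using pos(1) S0 rate_pos \<delta> by (intro mult_pos_pos divide_pos_pos zero_less_power) auto
  have Tle: "ennreal \<pi>\<theta> \<le> emeasure (theta_prior M) T"
    unfolding \<pi>\<theta>_def T_def S0_def by (rule theta_prior_box[OF rate_pos size_le \<delta>])
  \<comment> \<open>Non-measurable sets have measure 0, so positive mass already yields
    measurability, here and for E.\<close>
  then have "emeasure (theta_prior M) T \<noteq> 0" using \<pi>\<theta> by (auto simp: ennreal_eq_0_iff)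
  then have T: "T \<in> sets (theta_prior M)" using emeasure_notin_sets by blast
  have Em: "measure (eta_prior M) E = \<pi>\<eta>" by (simp add: E_def \<pi>\<eta>_def)
  then have E: "E \<in> sets (eta_prior M)" using pos(2) measure_notin_sets by fastforce
  have TE: "T \<times> E \<in> sets (prior M)" unfolding prior_def using T E by simp
  have "ennreal (\<pi>\<theta> * \<pi>\<eta>) \<le> emeasure (theta_prior M) T * emeasure (eta_prior M) E"
    unfolding e.emeasure_eq_measure Em using Tle \<pi>\<theta> pos(2) by (simp add: ennreal_mult mult_right_mono)
  also have "\<dots> = emeasure (prior M) (T \<times> E)" using prior_times[OF T E] by simp
  also have "\<dots> = ennreal (bayes.prob (T \<times> E))" by (rule bayes.emeasure_eq_measure)
  finally have mass: "\<pi>\<theta> * \<pi>\<eta> \<le> bayes.prob (T \<times> E)" by (simp add: ennreal_le_iff)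
  have mp: "0 < \<pi>\<theta> * \<pi>\<eta>" using \<pi>\<theta> pos(2) by simp
  have "bayes.inv_evid \<le> ennreal (V / bayes.prob (T \<times> E))"
  proof (rule bayes.inv_evid_le[OF TE])
    show "0 < bayes.prob (T \<times> E)" using mass mp by linarith
    show "0 \<le> V" by (simp add: V_def)
    fix z assume "z \<in> T \<times> E"
    then obtain \<theta> \<eta> where z: "z = (\<theta>, \<eta>)" "\<theta> \<in> T" "\<eta> \<in> E" by auto
    have \<eta>: "\<eta> \<in> nuis M" "\<eta> \<in> space (eta_prior M)" "dn M \<eta> (eta0 M) \<le> \<epsilon>b" using z(3) eta_space by (auto simp: E_def)
    note d = dn_le_imp[OF \<eta>(3)]
    have "(\<Sum>j<npred M. \<bar>\<theta> j - theta0 M j\<bar>) = (\<Sum>j\<in>S0. \<bar>\<theta> j - theta0 M j\<bar>)"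
      using z(2) by (intro sum.mono_neutral_right) (auto simp: S0_def T_def)
    also have "\<dots> \<le> (\<Sum>j\<in>S0. \<delta>)" using z(2) by (intro sum_mono) (auto simp: S0_def T_def)
    finally have l1: "(\<Sum>j<npred M. \<bar>\<theta> j - theta0 M j\<bar>) \<le> real (card S0) * \<delta>" by simp
    have "design_norm M * (\<Sum>j<npred M. \<bar>\<theta> j - theta0 M j\<bar>) \<le> 1"
      using mult_left_mono[OF l1 design_norm_nonneg] \<delta>1 by linarith
    then have "(design_norm M * (\<Sum>j<npred M. \<bar>\<theta> j - theta0 M j\<bar>))\<^sup>2 \<le> 1"
      using design_norm_nonneg by (intro power_le_one mult_nonneg_nonneg sum_nonneg) auto
    then have mean: "(\<Sum>i<nobs M. (block_mean M \<theta> \<eta> i - block_mean M (theta0 M) (eta0 M) i) \<bullet> (block_mean M \<theta> \<eta> i - block_mean M (theta0 M) (eta0 M) i))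
       \<le> 2 + 2 * (real (nobs M) * \<epsilon>b\<^sup>2)"
      using mean_diff_le[OF \<eta>(1) eta0, of \<theta> "theta0 M"] mult_left_mono[OF d(1), of "real (nobs M)"] by simp
    have "(\<integral>\<^sup>+Y. ennreal ((joint_density M z0 Y)\<^sup>2 / joint_density M (\<theta>, \<eta>) Y) \<partial>base_measure M)
    \<le> ennreal (exp (2 * C / c^3 * (real (nobs M) * (dB M \<eta> (eta0 M))\<^sup>2) + K *
       (\<Sum>i<nobs M. (block_mean M \<theta> \<eta> i - block_mean M (theta0 M) (eta0 M) i) \<bullet> (block_mean M \<theta> \<eta> i - block_mean M (theta0 M) (eta0 M) i))))"
      unfolding K_def by (rule chi_joint[OF c C \<eta>(1) ge le near[OF \<eta>(2,3)]])
    also have "\<dots> \<le> ennreal V"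
      unfolding V_def using K0 c C d(2) mean
      by (intro ennreal_leI exp_le_cancel_iff[THEN iffD2] add_mono mult_left_mono) auto
    finally show "(\<integral>\<^sup>+Y. ennreal ((joint_density M z0 Y)\<^sup>2 / joint_density M z Y) \<partial>base_measure M) \<le> ennreal V" unfolding z(1) .
  qed
  also have "\<dots> \<le> ennreal (V / (\<pi>\<theta> * \<pi>\<eta>))"
    using mass mp by (intro ennreal_leI divide_left_mono) (auto simp: V_def)
  finally show ?thesis by (simp add: V_def)
qed

lemma dA_sq_le:
  assumes "\<eta>1 \<in> nuis M" "\<eta>2 \<in> nuis M" "\<eta>3 \<in> nuis M"
  shows "(dA M \<eta>1 \<eta>2)\<^sup>2 \<le> 2 * (dA M \<eta>1 \<eta>3)\<^sup>2 + 2 * (dA M \<eta>3 \<eta>2)\<^sup>2"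
proof -
  have "(\<Sum>i<nobs M. (xi M \<eta>1 i - xi M \<eta>2 i) \<bullet> (xi M \<eta>1 i - xi M \<eta>2 i))
    \<le> (\<Sum>i<nobs M. 2 * ((xi M \<eta>1 i - xi M \<eta>3 i) \<bullet> (xi M \<eta>1 i - xi M \<eta>3 i)) + 2 * ((xi M \<eta>3 i - xi M \<eta>2 i) \<bullet> (xi M \<eta>3 i - xi M \<eta>2 i)))"
    using assms carriers(2) by (intro sum_mono scalar_prod_diff_sq_le) auto
  then have "real (nobs M) * (dA M \<eta>1 \<eta>2)\<^sup>2 \<le> real (nobs M) * (2 * (dA M \<eta>1 \<eta>3)\<^sup>2 + 2 * (dA M \<eta>3 \<eta>2)\<^sup>2)"
    by (simp add: sum.distrib sum_distrib_left[symmetric] dA_sq algebra_simps)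
  then show ?thesis using n_pos by simp
qed

lemma dA_commute:
  assumes "\<eta>1 \<in> nuis M" "\<eta>2 \<in> nuis M"
  shows "dA M \<eta>1 \<eta>2 = dA M \<eta>2 \<eta>1"
proof -
  have "(xi M \<eta>1 i - xi M \<eta>2 i) \<bullet> (xi M \<eta>1 i - xi M \<eta>2 i) = (xi M \<eta>2 i - xi M \<eta>1 i) \<bullet> (xi M \<eta>2 i - xi M \<eta>1 i)"
    if "i < nobs M" for i
    using carriers(2)[OF that assms(1)] carriers(2)[OF that assms(2)]
    by (simp add: scalar_prod_self_sum[of _ "bsize M i"] power2_commute)
  then show ?thesis unfolding dA_def norm2_vec_sq by simp
qed

lemma dB_commute: "\<eta>1 \<in> nuis M \<Longrightarrow> \<eta>2 \<in> nuis M \<Longrightarrow> dB M \<eta>1 \<eta>2 = dB M \<eta>2 \<eta>1"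
  unfolding dB_def
  by (intro arg_cong[of _ _ sqrt] arg_cong2[of _ _ _ _ "(/)"] sum.cong refl)
    (metis carriers(3) frob_norm_commute lessThan_iff pos_def_matD(1))


text \<open>A cell fixes the grid point of \<theta> and a covering ball for \<eta>. The centre of
  the ball need not belong to \<open>Hs\<close>, so q is a member of the cell: it inherits the
  eigenvalue and Renyi bounds. Two members are within 2r of each other, hence the factor 4 in 4
  r^2.\<close>

lemma post_mass_cells:
  fixes \<gamma> R K g0 \<tau> \<sigma> :: real and t G N :: nat
  assumes A: "A \<in> sets (prior M)" and n3: "3 \<le> nobs M" and \<gamma>: "0 < \<gamma>" and g0: "1 / \<gamma> \<le> g0"
    and AH: "\<And>\<theta> \<eta>. (\<theta>, \<eta>) \<in> A \<Longrightarrow> \<eta> \<in> Hs" "\<And>\<theta> \<eta>. (\<theta>, \<eta>) \<in> A \<Longrightarrow> sparsity M \<theta> \<le> t"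
      "\<And>\<theta> \<eta> j. (\<theta>, \<eta>) \<in> A \<Longrightarrow> j < npred M \<Longrightarrow> \<bar>\<theta> j\<bar> \<le> R" "\<And>\<theta> \<eta>. (\<theta>, \<eta>) \<in> A \<Longrightarrow> K < renyi_div M (\<theta>, \<eta>) z0"
    and Hs: "Hs \<subseteq> nuis M" and rho: "\<And>\<eta> i. \<eta> \<in> Hs \<Longrightarrow> i < nobs M \<Longrightarrow> 1 / \<gamma> \<le> rho_min (Delta M \<eta> i)"
    and cov: "covering_number (nuis M) (1 / (6 * real (bmax M) * \<gamma> * real (nobs M) powr (3/2))) Hs (dn M) = enat N"
    and G: "R * (design_norm M * real (npred M) * (3 * real (nobs M) * real (bmax M) * max \<gamma> 1)) + 1 \<le> real G"
    and dpos: "0 < design_norm M" and \<sigma>: "0 < \<sigma>" and \<tau>: "0 < \<tau>"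
  shows "bayes.post_mass A \<le> of_nat ((npred M * (2 * G + 1) + 1) ^ t * N) *
    (ennreal \<tau> * bayes.inv_evid + ennreal (sqrt (\<sigma> / \<tau>)) * ennreal (exp (- real (nobs M) * K)) + ennreal (1 / (\<sigma> * \<tau>)) * ennreal (exp (4 + 2 * g0)))"
proof -
  define n where "n = real (nobs M)"
  define m where "m = real (bmax M)"
  define r where "r = 1 / (6 * m * \<gamma> * n powr (3/2))"
  have n: "3 \<le> n" and m: "1 \<le> m" using n3 bmax_pos by (auto simp: n_def m_def)
  have mn: "3 \<le> m * n" using mult_mono[of 1 m 3 n] n m by simp
  \<comment> \<open>The sample has at most n mbar real coordinates, so tempering by this \<beta>
    costs a constant factor overall; \<beta> \<le> 1/8 follows from n \<ge> 3.\<close>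
  define \<beta> where "\<beta> = 1 / (3 * m * n)"
  have \<beta>: "0 < \<beta>" "\<beta> \<le> 1 / 8" using mn m n by (auto simp: \<beta>_def field_simps)
  have g0': "0 < g0" using g0 \<gamma> by (smt (verit) divide_pos_pos)
  \<comment> \<open>The maximum with 1 keeps L at least 3 when \<gamma> is small; with it the
    coefficient part of the mean loss is at most 1/3.\<close>
  define L where "L = 3 * n * m * max \<gamma> 1"
  have L: "0 < L" using n m by (simp add: L_def)
  have p: "0 < real (npred M)" using p_ge_2 by simp
  define w where "w = 1 / (design_norm M * real (npred M) * L)"
  have w: "0 < w" using dpos p L by (simp add: w_def)
  define key where "key \<theta> j = (if j < npred M then \<lfloor>\<theta> j / w\<rfloor> else 0)" for \<theta> :: "nat \<Rightarrow> real" and j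
  obtain Cs where Cs: "finite Cs" "Cs \<subseteq> nuis M" "Hs \<subseteq> (\<Union>c\<in>Cs. {x. dn M c x \<le> r})" "card Cs = N"
    using covering_number_obtain[OF cov] unfolding r_def m_def n_def by metis
  define cell where "cell = (\<lambda>(k, c). {z \<in> A. key (fst z) = k \<and> dn M c (snd z) \<le> r})"
  define J where "J = {j \<in> sparse_grid (npred M) t G \<times> Cs. cell j \<noteq> {}}"
  define rep where "rep j = (SOME z. z \<in> cell j)" for j
  have rep: "rep j \<in> cell j" if "j \<in> J" for j
    using that unfolding J_def rep_def by (auto intro: someI_ex)
  have AS: "snd z \<in> nuis M" "snd z \<in> Hs" if "z \<in> A" for z using that AH(1)[of "fst z" "snd z"] Hs by auto
  have Jfin: "finite J" using sparse_grid_card(1) Cs(1) by (auto simp: J_def)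
  have "card J \<le> card (sparse_grid (npred M) t G \<times> Cs)"
    using sparse_grid_card(1) Cs(1) by (intro card_mono) (auto simp: J_def)
  also have "\<dots> \<le> (npred M * (2 * G + 1) + 1) ^ t * N"
    unfolding card_cartesian_product Cs(4) by (intro mult_right_mono sparse_grid_card(2)) simp
  finally have Jcard: "card J \<le> (npred M * (2 * G + 1) + 1) ^ t * N" .
  have keyA: "key \<theta> \<in> sparse_grid (npred M) t G" if z: "(\<theta>, \<eta>) \<in> A" for \<theta> \<eta>
  proof -
    have "card {j. j < npred M \<and> key \<theta> j \<noteq> 0} \<le> sparsity M \<theta>"
      unfolding sparsity_def by (intro card_mono) (auto simp: key_def)
    moreover have "\<bar>key \<theta> j\<bar> \<le> int G" for j
    proof (cases "j < npred M")
      case True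
      have "\<bar>\<theta> j / w\<bar> \<le> R / w" using AH(3)[OF z True] w by (simp add: divide_right_mono)
      \<comment> \<open>The floor of a negative quotient can exceed R / w in absolute value by up to
        1, hence the +1 in the condition on G.\<close>
      also have "R / w + 1 \<le> real G" using G by (simp add: w_def L_def n_def m_def)
      finally have "\<bar>\<theta> j / w\<bar> + 1 \<le> real G" by simp
      then have "\<bar>real_of_int \<lfloor>\<theta> j / w\<rfloor>\<bar> \<le> real G" by linarith
      then show ?thesis using True by (simp add: key_def)
    qed (simp add: key_def)
    ultimately show ?thesis using AH(2)[OF z] by (auto simp: sparse_grid_def key_def)
  qed
  define \<Gamma> where "\<Gamma> = 1 / 3 + g0 / 3"
  define \<kappa> where "\<kappa> = \<beta> * (n * m) / 2 + \<Gamma>"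
  \<comment> \<open>The covering radius at work: the factor n turns the average in \<open>dB\<close>
    into a bound for one block, and \<gamma> times the root of the right side is exactly
    \<beta>.\<close>
  have nr: "n * (4 * r\<^sup>2) = (1 / (3 * m * \<gamma> * n))\<^sup>2"
  proof -
    have "(n powr (3/2))\<^sup>2 = n powr 3" by (simp add: power2_eq_square powr_add[symmetric])
    also have "\<dots> = n ^ 3" using n by (simp add: powr_numeral)
    finally have "r\<^sup>2 = 1 / (36 * m\<^sup>2 * \<gamma>\<^sup>2 * n ^ 3)" by (simp add: r_def power_divide power_mult_distrib)
    then have "n * (4 * r\<^sup>2) = n * (4 * (1 / (36 * m\<^sup>2 * \<gamma>\<^sup>2 * n ^ 3)))" by simp
    also have "\<dots> = 1 / (9 * m\<^sup>2 * \<gamma>\<^sup>2 * n\<^sup>2)" using n by (simp add: power2_eq_square power3_eq_cube)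
    also have "\<dots> = (1 / (3 * m * \<gamma> * n))\<^sup>2" by (simp add: power_divide power_mult_distrib)
    finally show ?thesis .
  qed
  have form: "v \<bullet> v \<le> \<gamma> * (v \<bullet> (Delta M \<eta> i *\<^sub>v v))" if "\<eta> \<in> Hs" "i < nobs M" "v \<in> carrier_vec (bsize M i)" for \<eta> i v
  proof -
    have \<eta>: "\<eta> \<in> nuis M" using that(1) Hs by auto
    note pd = pos_def_matD(1,2)[OF carriers(3)[OF that(2) \<eta>]]
    have "1 / \<gamma> * (v \<bullet> v) \<le> rho_min (Delta M \<eta> i) * (v \<bullet> v)"
      by (intro mult_right_mono rho that scalar_prod_self_nonneg)
    also have "\<dots> \<le> v \<bullet> (Delta M \<eta> i *\<^sub>v v)"
      using sizes(2)[OF that(2)] by (intro rho_min_le_form[OF pd _ that(3)]) simp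
    finally show ?thesis using \<gamma> by (simp add: field_simps)
  qed
  have bracket: "joint_density M z Y \<le> bracket \<beta> \<kappa> z' Y"
    if z: "z \<in> A" and z': "z' \<in> A" and keys: "key (fst z) = key (fst z')" and c: "c \<in> nuis M" "dn M c (snd z) \<le> r" "dn M c (snd z') \<le> r" for z z' c Y
  proof -
    obtain \<theta> \<eta> where ze: "z = (\<theta>, \<eta>)" by (cases z)
    obtain \<theta>' \<eta>' where ze': "z' = (\<theta>', \<eta>')" by (cases z')
    have \<eta>: "\<eta> \<in> nuis M" "\<eta> \<in> Hs" using AS[OF z] ze by auto
    have \<eta>': "\<eta>' \<in> nuis M" "\<eta>' \<in> Hs" using AS[OF z'] ze' by auto
    have d: "(dA M c \<eta>)\<^sup>2 \<le> r\<^sup>2" "(dB M c \<eta>)\<^sup>2 \<le> r\<^sup>2" "(dA M c \<eta>')\<^sup>2 \<le> r\<^sup>2" "(dB M c \<eta>')\<^sup>2 \<le> r\<^sup>2"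
      using dn_le_imp c ze ze' by auto
    have dA: "(dA M \<eta>' \<eta>)\<^sup>2 \<le> 4 * r\<^sup>2"
      using dA_sq_le[OF \<eta>'(1) \<eta>(1) c(1)] d dA_commute[OF \<eta>'(1) c(1)] by simp
    have dB: "(dB M \<eta>' \<eta>)\<^sup>2 \<le> 4 * r\<^sup>2"
      using dB_sq_le[OF \<eta>'(1) \<eta>(1) c(1)] d dB_commute[OF \<eta>'(1) c(1)] by simp
    have near: "\<gamma> * frob_norm (Delta M \<eta>' i - Delta M \<eta> i) \<le> \<beta>" if i: "i < nobs M" for i
    proof -
      have "(frob_norm (Delta M \<eta>' i - Delta M \<eta> i))\<^sup>2 \<le> n * (dB M \<eta>' \<eta>)\<^sup>2" unfolding n_def by (rule frob_le_dB[OF i])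
      also have "\<dots> \<le> n * (4 * r\<^sup>2)" using dB n by (intro mult_left_mono) auto
      finally have "(frob_norm (Delta M \<eta>' i - Delta M \<eta> i))\<^sup>2 \<le> (1 / (3 * m * \<gamma> * n))\<^sup>2" unfolding nr .
      then have "frob_norm (Delta M \<eta>' i - Delta M \<eta> i) \<le> 1 / (3 * m * \<gamma> * n)"
        by (rule power2_le_imp_le) (use m n \<gamma> in simp)
      then have "\<gamma> * frob_norm (Delta M \<eta>' i - Delta M \<eta> i) \<le> \<gamma> * (1 / (3 * m * \<gamma> * n))" using \<gamma> by (intro mult_left_mono) auto
      then show ?thesis using \<gamma> by (simp add: \<beta>_def)
    qed
    have diff: "\<bar>\<theta>' j - \<theta> j\<bar> \<le> w" if "j < npred M" for j
    proof -
      have "\<lfloor>\<theta> j / w\<rfloor> = \<lfloor>\<theta>' j / w\<rfloor>" using fun_cong[OF keys, of j] that by (simp add: key_def ze ze')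
      then have "\<bar>\<theta>' j / w - \<theta> j / w\<bar> \<le> 1" by linarith
      then have "\<bar>(\<theta>' j - \<theta> j) / w\<bar> \<le> 1" by (simp add: diff_divide_distrib)
      then show ?thesis using w by (simp add: abs_divide)
    qed
    have "(\<Sum>j<npred M. \<bar>\<theta>' j - \<theta> j\<bar>) \<le> (\<Sum>j<npred M. w)" using diff by (intro sum_mono) auto
    then have "design_norm M * (\<Sum>j<npred M. \<bar>\<theta>' j - \<theta> j\<bar>) \<le> design_norm M * (real (npred M) * w)"
      using design_norm_nonneg by (intro mult_left_mono) auto
    also have "\<dots> = 1 / L" using dpos p by (simp add: w_def)
    finally have dl: "(design_norm M * (\<Sum>j<npred M. \<bar>\<theta>' j - \<theta> j\<bar>))\<^sup>2 \<le> (1 / L)\<^sup>2"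
      using design_norm_nonneg by (intro power_mono mult_nonneg_nonneg sum_nonneg) auto
    have "(\<Sum>i<nobs M. (block_mean M \<theta>' \<eta>' i - block_mean M \<theta> \<eta> i) \<bullet> (block_mean M \<theta>' \<eta>' i - block_mean M \<theta> \<eta> i))
      \<le> 2 * (1 / L)\<^sup>2 + 2 * (1 / (3 * m * \<gamma> * n))\<^sup>2"
      using mean_diff_le[OF \<eta>'(1) \<eta>(1), of \<theta>' \<theta>] dl mult_left_mono[OF dA, of n] n unfolding nr by (simp add: n_def)
    then have "\<gamma> * (\<Sum>i<nobs M. (block_mean M \<theta>' \<eta>' i - block_mean M \<theta> \<eta> i) \<bullet> (block_mean M \<theta>' \<eta>' i - block_mean M \<theta> \<eta> i)) / (2 * \<beta>)
       \<le> \<gamma> * (2 * (1 / L)\<^sup>2 + 2 * (1 / (3 * m * \<gamma> * n))\<^sup>2) / (2 * \<beta>)"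
      using \<gamma> \<beta> by (intro divide_right_mono mult_left_mono) auto
    \<comment> \<open>The first summand comes from the mesh of the grid, the second from the
      nuisance means; g0 controls the 1/\<gamma> of the latter when \<gamma> is small.\<close>
    also have "\<dots> = (3 * m * n) * \<gamma> / L\<^sup>2 + (1 / \<gamma>) / (3 * (m * n))"
      using \<gamma> m n by (simp add: \<beta>_def power2_eq_square field_simps)
    also have "\<dots> \<le> 1 / 3 + g0 / 3"
    proof (rule add_mono)
      have "(3 * m * n) * \<gamma> \<le> L" unfolding L_def using m n by (simp add: mult_ac mult_left_mono)
      moreover have "3 \<le> L" unfolding L_def using mn mult_mono[of 1 "m * n" 1 "max \<gamma> 1"] by (simp add: mult_ac)
      ultimately have "(3 * m * n) * \<gamma> * 3 \<le> L * L" using L by (intro mult_mono) auto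
      then show "(3 * m * n) * \<gamma> / L\<^sup>2 \<le> 1 / 3" using L by (simp add: power2_eq_square field_simps)
      have "(1 / \<gamma>) / (3 * (m * n)) \<le> g0 / 3" using g0 g0' mn \<gamma> by (intro frac_le) auto
      then show "(1 / \<gamma>) / (3 * (m * n)) \<le> g0 / 3" .
    qed
    finally have mean: "\<gamma> * (\<Sum>i<nobs M. (block_mean M \<theta>' \<eta>' i - block_mean M \<theta> \<eta> i) \<bullet> (block_mean M \<theta>' \<eta>' i - block_mean M \<theta> \<eta> i)) / (2 * \<beta>) \<le> \<Gamma>"
      by (simp add: \<Gamma>_def)
    show ?thesis
      unfolding ze ze' \<kappa>_def n_def m_def
      by (rule joint_le_bracket[OF \<eta>(1) \<eta>'(1) \<gamma> \<beta>(1) form[OF \<eta>(2)] form[OF \<eta>'(2)] near mean])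
  qed
  \<comment> \<open>The left side equals 7/3 + 2 g0 / 3; the right side is rounded up.\<close>
  have \<kappa>4: "2 * \<kappa> + 4 * \<beta> * (n * m) \<le> 4 + 2 * g0"
    using m n g0' by (simp add: \<kappa>_def \<Gamma>_def \<beta>_def)
  have "bayes.post_mass A \<le> of_nat (card J) *
    (ennreal \<tau> * bayes.inv_evid + ennreal (sqrt (\<sigma> / \<tau>)) * ennreal (exp (- real (nobs M) * K)) + ennreal (1 / (\<sigma> * \<tau>)) * ennreal (exp (4 + 2 * g0)))"
  proof (rule bayes.post_mass_le_brackets[OF A Jfin \<sigma> \<tau>, where u = "\<lambda>j. bracket \<beta> \<kappa> (rep j)" and q = "\<lambda>j. joint_density M (rep j)"])
    fix j assume j: "j \<in> J"
    obtain \<theta> \<eta> where re: "rep j = (\<theta>, \<eta>)" by (cases "rep j")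
    have rA: "(\<theta>, \<eta>) \<in> A" using rep[OF j] re by (auto simp: cell_def split: prod.splits)
    have \<eta>: "\<eta> \<in> nuis M" using AS(1)[OF rA] by simp
    show "bracket \<beta> \<kappa> (rep j) \<in> borel_measurable (base_measure M)" unfolding re by (rule bracket_props(1)[OF \<eta>])
    show "joint_density M (rep j) \<in> borel_measurable (base_measure M)" unfolding re by (rule joint_measurable[OF \<eta>])
    show "0 \<le> bracket \<beta> \<kappa> (rep j) Y" for Y unfolding re by (rule bracket_props(2)[OF \<eta>])
    show "0 < joint_density M (rep j) Y" for Y unfolding re by (rule joint_pos[OF \<eta>])
    show "(\<integral>\<^sup>+Y. ennreal (sqrt (joint_density M z0 Y * joint_density M (rep j) Y)) \<partial>base_measure M) \<le> ennreal (exp (- real (nobs M) * K))"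
      unfolding re by (rule affinity_le[OF \<eta> AH(4)[OF rA]])
    have "(\<integral>\<^sup>+Y. ennreal ((bracket \<beta> \<kappa> (rep j) Y)\<^sup>2 / joint_density M (rep j) Y) \<partial>base_measure M) \<le> ennreal (exp (2 * \<kappa> + 4 * \<beta> * (n * m)))"
      unfolding re n_def m_def by (rule bracket_ratio[OF \<eta> \<beta>])
    also have "\<dots> \<le> ennreal (exp (4 + 2 * g0))" using \<kappa>4 by (intro ennreal_leI) simp
    finally show "(\<integral>\<^sup>+Y. ennreal ((bracket \<beta> \<kappa> (rep j) Y)\<^sup>2 / joint_density M (rep j) Y) \<partial>base_measure M) \<le> ennreal (exp (4 + 2 * g0))" .
  next
    fix z Y assume z: "z \<in> A"
    obtain c where c: "c \<in> Cs" "dn M c (snd z) \<le> r" using AS(2)[OF z] Cs(3) by auto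
    define j where "j = (key (fst z), c)"
    have zc: "z \<in> cell j" using z c by (simp add: cell_def j_def)
    have jJ: "j \<in> J" using zc c keyA[of "fst z" "snd z"] z by (auto simp: J_def j_def)
    have "rep j \<in> cell j" by (rule rep[OF jJ])
    then have r: "rep j \<in> A" "key (fst (rep j)) = key (fst z)" "dn M c (snd (rep j)) \<le> r" by (auto simp: cell_def j_def)
    show "\<exists>j\<in>J. joint_density M z Y \<le> bracket \<beta> \<kappa> (rep j) Y"
      using bracket[OF z r(1) r(2)[symmetric] _ c(2) r(3)] c(1) Cs(2) jJ by blast
  qed
  also have "\<dots> \<le> of_nat ((npred M * (2 * G + 1) + 1) ^ t * N) *
    (ennreal \<tau> * bayes.inv_evid + ennreal (sqrt (\<sigma> / \<tau>)) * ennreal (exp (- real (nobs M) * K)) + ennreal (1 / (\<sigma> * \<tau>)) * ennreal (exp (4 + 2 * g0)))"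
    using Jcard by (intro mult_right_mono) (simp_all add: of_nat_mono del: of_nat_mult of_nat_power)
  finally show ?thesis .
qed

end

section \<open>Geometric bounds for the size prior\<close>

lemma sum_half_powers_le: "0 \<le> q \<Longrightarrow> q \<le> 1 / 2 \<Longrightarrow> (\<Sum>i<m. q ^ i) \<le> (2::real)"
proof -
  assume q: "0 \<le> q" "q \<le> 1 / 2"
  have "(\<Sum>i<m. q ^ i) \<le> (\<Sum>i<m. (1 / 2) ^ i)" using q by (intro sum_mono power_mono)
  also have "\<dots> = 2 - 2 * (1 / 2) ^ m" by (induction m) (auto simp: field_simps)
  also have "\<dots> \<le> 2" by simp
  finally show ?thesis .
qed

context
  fixes P :: "nat pmf" and p :: nat and q l :: real
  assumes sp: "set_pmf P \<subseteq> {..p}" and q: "0 \<le> q" "q \<le> 1 / 2" and l: "0 \<le> l"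
    and up: "\<And>s. s \<in> {1..p} \<Longrightarrow> pmf P s \<le> q * pmf P (s - 1)"
    and lo: "\<And>s. s \<in> {1..p} \<Longrightarrow> l * pmf P (s - 1) \<le> pmf P s"
begin

lemma pmf_le_geometric: "pmf P s \<le> q ^ s * pmf P 0"
proof (induction s)
  case (Suc s)
  show ?case
  proof (cases "Suc s \<le> p")
    case True
    then have "pmf P (Suc s) \<le> q * pmf P s" using up[of "Suc s"] by simp
    also have "\<dots> \<le> q * (q ^ s * pmf P 0)" using Suc q by (intro mult_left_mono) auto
    finally show ?thesis by simp
  next
    case False
    then have "pmf P (Suc s) = 0" using sp by (auto simp: set_pmf_iff)
    then show ?thesis using q by simp
  qed
qed simp

lemma pmf_ge_geometric: "s \<le> p \<Longrightarrow> l ^ s * pmf P 0 \<le> pmf P s"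
proof (induction s)
  case (Suc s)
  have "l ^ Suc s * pmf P 0 = l * (l ^ s * pmf P 0)" by simp
  also have "\<dots> \<le> l * pmf P s" using Suc l by (intro mult_left_mono) auto
  also have "\<dots> \<le> pmf P (Suc s)" using lo[of "Suc s"] Suc.prems by simp
  finally show ?case .
qed simp

text \<open>The masses sum to one and are dominated by the mass at 0 times a geometric series of sum
  at most 2.\<close>

lemma pmf_0_ge: "1 / 2 \<le> pmf P 0"
proof -
  have "1 = (\<Sum>s\<in>{..p}. pmf P s)" using sum_pmf_eq_1[OF _ sp] by simp
  also have "\<dots> \<le> (\<Sum>s<Suc p. q ^ s * pmf P 0)"
    unfolding lessThan_Suc_atMost by (intro sum_mono pmf_le_geometric)
  also have "\<dots> = (\<Sum>s<Suc p. q ^ s) * pmf P 0" by (rule sum_distrib_right[symmetric])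
  also have "\<dots> \<le> 2 * pmf P 0" by (intro mult_right_mono sum_half_powers_le q) simp
  finally show ?thesis by simp
qed

lemma pmf_tail_le: "measure (measure_pmf P) {s. t < s} \<le> 2 * q ^ Suc t"
proof -
  have "measure (measure_pmf P) {s. t < s} = measure (measure_pmf P) ({s. t < s} \<inter> set_pmf P)"
    by (rule measure_Int_set_pmf[symmetric])
  \<comment> \<open>Sizes above p have no mass, so the p values after t suffice.\<close>
  also have "\<dots> \<le> measure (measure_pmf P) {Suc t..<Suc t + p}"
    using sp by (intro measure_pmf.finite_measure_mono) auto
  also have "\<dots> = (\<Sum>s\<in>{Suc t..<Suc t + p}. pmf P s)" by (rule measure_measure_pmf_finite) simp
  also have "\<dots> \<le> (\<Sum>s\<in>{Suc t..<Suc t + p}. q ^ s * 1)"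
    using q by (intro sum_mono order_trans[OF pmf_le_geometric] mult_left_mono pmf_le_1) auto
  also have "\<dots> = (\<Sum>i<p. q ^ (Suc t + i))"
    by (rule sum.reindex_bij_witness[of _ "\<lambda>i. Suc t + i" "\<lambda>s. s - Suc t"]) auto
  also have "\<dots> = q ^ Suc t * (\<Sum>i<p. q ^ i)" by (simp add: power_add sum_distrib_left mult_ac)
  also have "\<dots> \<le> q ^ Suc t * 2" using q by (intro mult_left_mono sum_half_powers_le) auto
  finally show ?thesis by simp
qed

end

section \<open>Posterior bound with a sieve at one sample size\<close>

context valid_setup
begin

definition sieve :: "nat \<Rightarrow> real \<Rightarrow> 'h set \<Rightarrow> ((nat \<Rightarrow> real) \<times> 'h) set" where
  "sieve t R H = {\<theta> \<in> space (Pi\<^sub>M {..<npred M} (\<lambda>_. borel)). sparsity M \<theta> \<le> t \<and> (\<forall>j<npred M. \<bar>\<theta> j\<bar> \<le> R)} \<times> H"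

lemma sieve_complement:
  assumes H: "H \<in> sets (eta_prior M)" and R: "0 \<le> R"
  shows "sieve t R H \<in> sets (prior M)"
    and "emeasure (prior M) (space (prior M) - sieve t R H) \<le>
      ennreal (measure (measure_pmf (size_prior M)) {s. t < s} + real (npred M) * (2 * exp (- rate M * R / 2))
        + measure (eta_prior M) (space (eta_prior M) - H))"
proof -
  let ?B = "Pi\<^sub>M {..<npred M} (\<lambda>_. borel :: real measure)"
  interpret e: prob_space "eta_prior M" by (rule eta_prob)
  interpret t: prob_space "theta_prior M" by (rule prob_space_theta_prior[OF rate_pos size_le])
  note sB = sets_theta_prior[OF rate_pos size_le]
  define T1 where "T1 = {\<theta> \<in> space ?B. real t < real (sparsity M \<theta>)}"
  define T2 where "T2 = {\<theta> \<in> space ?B. \<exists>j<npred M. R < \<bar>\<theta> j\<bar>}"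
  note [measurable] = borel_measurable_sparsity[OF rate_pos size_le]
  have T1: "T1 \<in> sets (theta_prior M)" unfolding sB T1_def by measurable
  have T2: "T2 \<in> sets (theta_prior M)" unfolding sB T2_def by (rule sets_coordinatewise(2)[where Q = "\<lambda>_ x. R < \<bar>x\<bar>"]) measurable
  have sT: "space ?B \<in> sets (theta_prior M)" unfolding sB by simp
  have spc: "space (theta_prior M) = space ?B" by (rule space_theta_prior[OF rate_pos size_le])
  have eq: "sieve t R H = (space ?B - (T1 \<union> T2)) \<times> H"
    unfolding sieve_def T1_def T2_def by (auto simp: not_less)
  have "space ?B - (T1 \<union> T2) \<in> sets (theta_prior M)" using T1 T2 sT by auto
  then show "sieve t R H \<in> sets (prior M)" unfolding eq prior_def using H by simp
  have sub: "space (prior M) - sieve t R H \<subseteq> (T1 \<times> space (eta_prior M)) \<union> (T2 \<times> space (eta_prior M)) \<union> (space ?B \<times> (space (eta_prior M) - H))"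
    unfolding eq space_prior by auto
  have s1: "T1 \<times> space (eta_prior M) \<in> sets (prior M)" "T2 \<times> space (eta_prior M) \<in> sets (prior M)" "space ?B \<times> (space (eta_prior M) - H) \<in> sets (prior M)"
    unfolding prior_def using T1 T2 sT H by (auto intro!: pair_measureI)
  have "emeasure (prior M) (space (prior M) - sieve t R H) \<le> emeasure (prior M) ((T1 \<times> space (eta_prior M)) \<union> (T2 \<times> space (eta_prior M)) \<union> (space ?B \<times> (space (eta_prior M) - H)))"
    using sub s1 by (intro emeasure_mono) auto
  also have "\<dots> \<le> emeasure (prior M) (T1 \<times> space (eta_prior M)) + emeasure (prior M) (T2 \<times> space (eta_prior M)) + emeasure (prior M) (space ?B \<times> (space (eta_prior M) - H))"
    using s1 by (intro order_trans[OF emeasure_subadditive] add_mono emeasure_subadditive order_refl) auto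
  also have "\<dots> = emeasure (theta_prior M) T1 + emeasure (theta_prior M) T2 + emeasure (eta_prior M) (space (eta_prior M) - H)"
    using prior_times[OF T1 sets.top[of "eta_prior M"]] prior_times[OF T2 sets.top[of "eta_prior M"]] prior_times[OF sT, of "space (eta_prior M) - H"] H
      t.emeasure_space_1 e.emeasure_space_1 unfolding spc by auto
  also have "\<dots> \<le> ennreal (measure (measure_pmf (size_prior M)) {s. t < s}) + ennreal (real (npred M) * (2 * exp (- rate M * R / 2)))
     + ennreal (measure (eta_prior M) (space (eta_prior M) - H))"
    using theta_prior_sparsity[OF rate_pos size_le, of "real t"] theta_prior_tail[OF rate_pos size_le R]
    unfolding T1_def[symmetric] T2_def[symmetric] e.emeasure_eq_measure measure_pmf.emeasure_eq_measure
    by (intro add_mono) auto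
  finally show "emeasure (prior M) (space (prior M) - sieve t R H) \<le>
      ennreal (measure (measure_pmf (size_prior M)) {s. t < s} + real (npred M) * (2 * exp (- rate M * R / 2))
        + measure (eta_prior M) (space (eta_prior M) - H))" by simp
qed

text \<open>The weights \<tau>1 and \<tau> are chosen separately: outside the sieve \<tau>1 balances
  V against the prior mass, inside it \<tau> and \<sigma> balance V against the affinity and the
  majorants, all multiplied by the number of cells.\<close>

lemma expected_posterior_bound:
  fixes \<gamma> R K g0 \<tau> \<tau>1 \<sigma> V :: real and t G N :: nat
  assumes V: "bayes.inv_evid \<le> ennreal V" "0 \<le> V"
    and n3: "3 \<le> nobs M" and \<gamma>: "0 < \<gamma>" and g0: "1 / \<gamma> \<le> g0" and R: "0 \<le> R"
    and H: "H \<in> sets (eta_prior M)" and rho: "\<And>\<eta> i. \<eta> \<in> H \<Longrightarrow> i < nobs M \<Longrightarrow> 1 / \<gamma> \<le> rho_min (Delta M \<eta> i)"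
    and cov: "covering_number (nuis M) (1 / (6 * real (bmax M) * \<gamma> * real (nobs M) powr (3/2))) H (dn M) = enat N"
    and G: "R * (design_norm M * real (npred M) * (3 * real (nobs M) * real (bmax M) * max \<gamma> 1)) + 1 \<le> real G"
    and dpos: "0 < design_norm M" and \<sigma>: "0 < \<sigma>" and \<tau>: "0 < \<tau>" and \<tau>1: "0 < \<tau>1"
  shows "expected_posterior M {z \<in> space (prior M). renyi_div M z z0 > K} \<le> ennreal (
      (\<tau>1 * V + (measure (measure_pmf (size_prior M)) {s. t < s} + real (npred M) * (2 * exp (- rate M * R / 2))
        + measure (eta_prior M) (space (eta_prior M) - H)) / \<tau>1)
      + real ((npred M * (2 * G + 1) + 1) ^ t * N) * (\<tau> * V + sqrt (\<sigma> / \<tau>) * exp (- real (nobs M) * K) + 1 / (\<sigma> * \<tau>) * exp (4 + 2 * g0)))"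
    (is "expected_posterior M ?A \<le> ennreal (?x + ?y)")
proof (cases "?A \<in> sets (prior M)")
  case False
  then show ?thesis by (simp add: expected_posterior_nonmeasurable)
next
  case True
  let ?w = "measure (measure_pmf (size_prior M)) {s. t < s} + real (npred M) * (2 * exp (- rate M * R / 2)) + measure (eta_prior M) (space (eta_prior M) - H)"
  let ?F = "sieve t R H"
  note F = sieve_complement[OF H R, of t]
  have w0: "0 \<le> ?w" by (intro add_nonneg_nonneg) auto
  have HS: "H \<subseteq> nuis M" using sets.sets_into_space[OF H] eta_space by blast
  have AF: "?A \<inter> ?F \<in> sets (prior M)" using True F(1) by auto
  have "bayes.post_mass (space (prior M) - ?F) \<le> ennreal \<tau>1 * bayes.inv_evid + emeasure (prior M) (space (prior M) - ?F) / ennreal \<tau>1"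
    using F(1) \<tau>1 by (intro bayes.post_mass_le_prior) auto
  also have "\<dots> \<le> ennreal \<tau>1 * ennreal V + ennreal ?w / ennreal \<tau>1"
    by (intro add_mono mult_left_mono V(1) divide_right_mono_ennreal F(2)) simp
  also have "\<dots> = ennreal ?x"
    using \<tau>1 V(2) w0 by (simp only: divide_ennreal[OF w0 \<tau>1] ennreal_mult[OF less_imp_le[OF \<tau>1] V(2), symmetric])
      (intro ennreal_plus[symmetric], auto)
  finally have 1: "bayes.post_mass (space (prior M) - ?F) \<le> ennreal ?x" .
  have "bayes.post_mass (?A \<inter> ?F) \<le> of_nat ((npred M * (2 * G + 1) + 1) ^ t * N) *
    (ennreal \<tau> * bayes.inv_evid + ennreal (sqrt (\<sigma> / \<tau>)) * ennreal (exp (- real (nobs M) * K)) + ennreal (1 / (\<sigma> * \<tau>)) * ennreal (exp (4 + 2 * g0)))"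
    by (rule post_mass_cells[OF AF n3 \<gamma> g0 _ _ _ _ HS rho cov G dpos \<sigma> \<tau>]) (auto simp: sieve_def)
  also have "\<dots> \<le> of_nat ((npred M * (2 * G + 1) + 1) ^ t * N) *
    (ennreal \<tau> * ennreal V + ennreal (sqrt (\<sigma> / \<tau>)) * ennreal (exp (- real (nobs M) * K)) + ennreal (1 / (\<sigma> * \<tau>)) * ennreal (exp (4 + 2 * g0)))"
    by (intro add_mono mult_left_mono V(1) order_refl) auto
  also have "\<dots> = ennreal ?y"
    using V(2) \<sigma> \<tau> by (simp add: ennreal_mult[symmetric] ennreal_plus[symmetric] ennreal_of_nat_eq_real_of_nat del: ennreal_plus of_nat_mult of_nat_power)
  finally have 2: "bayes.post_mass (?A \<inter> ?F) \<le> ennreal ?y" .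
  have "expected_posterior M ?A = bayes.post_mass ?A" by (rule expected_posterior_eq[OF True])
  also have "\<dots> \<le> bayes.post_mass (?A \<inter> ?F) + bayes.post_mass (space (prior M) - ?F)"
    by (rule bayes.post_mass_split[OF True F(1)])
  also have "\<dots> \<le> ennreal ?y + ennreal ?x" by (intro add_mono 1 2)
  also have "\<dots> = ennreal (?x + ?y)"
    using V(2) \<sigma> \<tau> \<tau>1 w0 by (subst ennreal_plus[symmetric]) (auto simp: add.commute intro!: add_nonneg_nonneg mult_nonneg_nonneg)
  finally show ?thesis .
qed

end

section \<open>Asymptotics\<close>

definition chi_const :: "real \<Rightarrow> real \<Rightarrow> real" where
  "chi_const c C = (3*C/2) * (4/(3*c))\<^sup>2 / 2 + (4/(3*c)) / 2"

text \<open>Exponent of the inverse evidence per unit of \<open>s_star\<close> times log p, and the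
  threshold for B. The \<chi>-square integral contributes 2C/c^3 + 2 \<open>chi_const\<close>, the
  coefficient box A3 + L2 + Ciii + 5, the nuisance ball Cii, and the final 1 absorbs an additive
  constant.\<close>

definition evid_const :: "real \<Rightarrow> real \<Rightarrow> real \<Rightarrow> real \<Rightarrow> real \<Rightarrow> real \<Rightarrow> real" where
  "evid_const A3 L2 Cii Ciii c C = 2 * C / c^3 + 2 * chi_const c C + (A3 + L2 + Ciii + 5) + Cii + 1"

text \<open>Powers of 1/p per coordinate of the support: A3 from the size prior, 1 from the binomial
  coefficient, L2 + 2 from rate times \<delta>, Ciii from the density at \<theta>0, and 1 to absorb
  ln L1 - ln A1. The total is A3 + L2 + Ciii + 4.\<close>

lemma (in valid_setup) theta_mass_ge:
  fixes A1 A3 L1 L2 L3 Ciii :: real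
  defines "S0 \<equiv> {j. j < npred M \<and> theta0 M j \<noteq> 0}"
  defines "\<delta> \<equiv> 1 / ((real (card S0) + 1) * design_norm M)"
  defines "\<l> \<equiv> ln (real (npred M))"
  assumes pos: "0 < A1" "0 < A3" "0 < L1" "0 < L2" "0 < L3" "0 < Ciii" and dpos: "0 < design_norm M"
    and pm: "(A1 * real (npred M) powr (- A3)) ^ card S0 * (1 / 2) \<le> pmf (size_prior M) (card S0)"
    and rl: "design_norm M / (L1 * real (npred M) powr L2) \<le> rate M" and ru: "rate M \<le> L3 * design_norm M"
    and th: "\<And>j. j < npred M \<Longrightarrow> \<bar>theta0 M j\<bar> \<le> Ciii * (\<l> / rate M)"
    and big: "ln L1 - ln A1 \<le> \<l>"
  shows "exp (- (real (card S0) * \<l> * (A3 + L2 + Ciii + 4)) - L3) / 2 \<le>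
    pmf (size_prior M) (card S0) / real (npred M choose card S0) *
      ((rate M * \<delta>) ^ card S0 * exp (- rate M * (\<Sum>j\<in>S0. \<bar>theta0 M j\<bar>) - rate M * \<delta> * real (card S0)))"
proof -
  define p where "p = real (npred M)"
  define s where "s = card S0"
  have p: "2 \<le> p" using p_ge_2 by (simp add: p_def)
  have p0: "0 < p" using p by simp
  have lp: "exp \<l> = p" using p0 by (simp add: \<l>_def p_def)
  have pw: "p powr x = exp (x * \<l>)" for x using p0 by (simp add: powr_def \<l>_def p_def)
  have sp: "s \<le> npred M" unfolding s_def S0_def using card_mono[of "{..<npred M}" "{j. j < npred M \<and> theta0 M j \<noteq> 0}"] by auto
  have r: "0 < rate M" by (rule rate_pos)
  have f1: "exp (real s * (ln A1 - A3 * \<l>)) / 2 \<le> pmf (size_prior M) s"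
  proof -
    have "A1 * p powr (- A3) = exp (ln A1 - A3 * \<l>)" using pos(1) by (simp add: pw exp_diff exp_minus field_simps)
    then have "(A1 * p powr (- A3)) ^ s = exp (real s * (ln A1 - A3 * \<l>))" by (simp add: exp_of_nat_mult)
    then show ?thesis using pm by (simp add: p_def s_def)
  qed
  have f2: "exp (- (real s * \<l>)) \<le> 1 / real (npred M choose s)"
  proof -
    have "real (npred M choose s) \<le> p ^ s" using binomial_le_pow[OF sp] unfolding p_def by (metis of_nat_le_iff of_nat_power)
    moreover have "0 < real (npred M choose s)" using sp by simp
    ultimately have "1 / p ^ s \<le> 1 / real (npred M choose s)" using p0 by (intro divide_left_mono) auto
    moreover have "1 / p ^ s = exp (- (real s * \<l>))" by (simp add: exp_minus exp_of_nat_mult lp inverse_eq_divide)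
    ultimately show ?thesis by simp
  qed
  have rd: "rate M * \<delta> = (rate M / design_norm M) / (real s + 1)" by (simp add: \<delta>_def s_def)
  have f3: "exp (real s * (- ln L1 - (L2 + 2) * \<l>)) \<le> (rate M * \<delta>) ^ s"
  proof -
    \<comment> \<open>Bounding s + 1 by p^2 accounts for the 2 in L2 + 2.\<close>
    have "real s + 1 \<le> 2 * p" using sp p by (simp add: p_def)
    also have "\<dots> \<le> p * p" using p by (intro mult_right_mono) auto
    finally have "real s + 1 \<le> p * p" .
    have pp: "p * p = exp (2 * \<l>)" by (simp only: mult_2 exp_add lp)
    have Lpp: "L1 * (p powr L2 * (p * p)) = exp (ln L1 + (L2 * \<l> + 2 * \<l>))"
      unfolding pw pp exp_add using pos(3) by simp
    have "exp (- ln L1 - (L2 + 2) * \<l>) = exp (- (ln L1 + (L2 * \<l> + 2 * \<l>)))" by (simp add: algebra_simps)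
    also have "\<dots> = 1 / (L1 * (p powr L2 * (p * p)))" unfolding Lpp by (simp only: exp_minus inverse_eq_divide)
    also have "\<dots> = (1 / (L1 * p powr L2)) / (p * p)" by simp
    also have "\<dots> \<le> (rate M / design_norm M) / (real s + 1)"
    proof (rule frac_le)
      show "1 / (L1 * p powr L2) \<le> rate M / design_norm M" using rl dpos pos(3) p0 by (simp add: p_def field_simps)
    qed (use \<open>real s + 1 \<le> p * p\<close> r dpos in auto)
    finally have "exp (- ln L1 - (L2 + 2) * \<l>) \<le> rate M * \<delta>" by (simp add: rd)
    then have "exp (- ln L1 - (L2 + 2) * \<l>) ^ s \<le> (rate M * \<delta>) ^ s" by (rule power_mono) simp
    then show ?thesis by (simp add: exp_of_nat_mult)
  qed
  have f4: "exp (- (real s * (Ciii * \<l>)) - L3) \<le> exp (- rate M * (\<Sum>j\<in>S0. \<bar>theta0 M j\<bar>) - rate M * \<delta> * real s)"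
  proof -
    have "(\<Sum>j\<in>S0. \<bar>theta0 M j\<bar>) \<le> (\<Sum>j\<in>S0. Ciii * (\<l> / rate M))" using th by (intro sum_mono) (auto simp: S0_def)
    then have "(\<Sum>j\<in>S0. \<bar>theta0 M j\<bar>) \<le> real s * (Ciii * (\<l> / rate M))" by (simp only: sum_constant s_def)
    then have "rate M * (\<Sum>j\<in>S0. \<bar>theta0 M j\<bar>) \<le> rate M * (real s * (Ciii * (\<l> / rate M)))" using r by (intro mult_left_mono) auto
    also have "\<dots> = real s * (Ciii * \<l>)" using r by simp
    finally have 1: "rate M * (\<Sum>j\<in>S0. \<bar>theta0 M j\<bar>) \<le> real s * (Ciii * \<l>)" .
    have "rate M * \<delta> * real s = (rate M / design_norm M) * (real s / (real s + 1))" by (simp add: rd)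
    also have "\<dots> \<le> (rate M / design_norm M) * 1" using r dpos by (intro mult_left_mono) auto
    also have "\<dots> \<le> L3" using ru dpos by (simp add: field_simps)
    finally show ?thesis using 1 by simp
  qed
  have "exp (- (real s * \<l> * (A3 + L2 + Ciii + 4)) - L3) / 2 \<le>
     exp (real s * (ln A1 - A3 * \<l>) + (- (real s * \<l>)) + (real s * (- ln L1 - (L2 + 2) * \<l>)) + (- (real s * (Ciii * \<l>)) - L3)) / 2"
  proof -
    have "real s * (ln L1 - ln A1) \<le> real s * \<l>" using big by (rule mult_left_mono) simp
    then show ?thesis by (simp add: algebra_simps)
  qed
  also have "\<dots> = (exp (real s * (ln A1 - A3 * \<l>)) / 2 * exp (- (real s * \<l>))) * (exp (real s * (- ln L1 - (L2 + 2) * \<l>)) * exp (- (real s * (Ciii * \<l>)) - L3))"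
    unfolding exp_add by (simp add: mult_ac)
  also have "\<dots> \<le> (pmf (size_prior M) s * (1 / real (npred M choose s))) * ((rate M * \<delta>) ^ s * exp (- rate M * (\<Sum>j\<in>S0. \<bar>theta0 M j\<bar>) - rate M * \<delta> * real s))"
    using f1 f2 f3 f4 r dpos by (intro mult_mono) (auto simp: \<delta>_def)
  finally show ?thesis by (simp add: s_def)
qed

text \<open>The hypotheses with their constants named. B above \<open>evid_const\<close> is what
  makes prior masses of order exp(-B sl) negligible against the inverse evidence.\<close>

locale contraction_setting =
  fixes A1 A2 A3 A4 L1 L2 L3 Cii Ciii c C B Cv :: real
    and M :: "nat \<Rightarrow> 'h model" and a :: "nat \<Rightarrow> real" and \<eta>' :: "nat \<Rightarrow> 'h"
    and \<epsilon>b \<gamma> \<epsilon> :: "nat \<Rightarrow> real" and Hs :: "nat \<Rightarrow> 'h set"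
  assumes const_pos: "0 < A1" "0 < A2" "0 < A3" "0 < A4" "0 < L1" "0 < L2" "0 < L3" "0 < Cii" "0 < Ciii" "0 < c" "0 < C" "0 < Cv"
    and B: "evid_const A3 L2 Cii Ciii c C < B"
    and model: "\<And>n. 1 \<le> n \<Longrightarrow> nobs (M n) = n" "\<And>n. 1 \<le> n \<Longrightarrow> valid_model (M n)"
    and size_lo: "\<And>n s. 1 \<le> n \<Longrightarrow> s \<in> {1..npred (M n)} \<Longrightarrow> A1 * real (npred (M n)) powr (- A3) * pmf (size_prior (M n)) (s - 1) \<le> pmf (size_prior (M n)) s"
    and size_up: "\<And>n s. 1 \<le> n \<Longrightarrow> s \<in> {1..npred (M n)} \<Longrightarrow> pmf (size_prior (M n)) s \<le> A2 * real (npred (M n)) powr (- A4) * pmf (size_prior (M n)) (s - 1)"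
    and rate_lo: "\<And>n. 1 \<le> n \<Longrightarrow> design_norm (M n) / (L1 * real (npred (M n)) powr L2) \<le> rate (M n)"
    and rate_up: "\<And>n. 1 \<le> n \<Longrightarrow> rate (M n) \<le> L3 * design_norm (M n) / sqrt (real n)"
    and a_pos: "\<And>n. 1 \<le> n \<Longrightarrow> 0 < a n" and a_mono: "mono_on {1..} a"
    and \<eta>'_space: "\<And>n. 1 \<le> n \<Longrightarrow> \<eta>' n \<in> space (eta_prior (M n))"
    and e_lim: "(\<lambda>n. a n * max_Delta_dist2 (M n) (\<eta>' n) (eta0 (M n))) \<longlonglongrightarrow> 0"
    and max_le: "\<And>n \<eta>1 \<eta>2. 1 \<le> n \<Longrightarrow> \<eta>1 \<in> space (eta_prior (M n)) \<Longrightarrow> \<eta>2 \<in> space (eta_prior (M n)) \<Longrightarrow> max_Delta_dist2 (M n) \<eta>1 \<eta>2 \<le> a n * (dB (M n) \<eta>1 \<eta>2)\<^sup>2"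
    and ae_lim: "(\<lambda>n. a n * (\<epsilon>b n)\<^sup>2) \<longlonglongrightarrow> 0"
    and ne_top: "filterlim (\<lambda>n. real n * (\<epsilon>b n)\<^sup>2) at_top sequentially"
    and ball_pos: "\<And>n. 1 \<le> n \<Longrightarrow> 0 < measure (eta_prior (M n)) {\<eta> \<in> space (eta_prior (M n)). dn (M n) \<eta> (eta0 (M n)) \<le> \<epsilon>b n}"
    and ball_ln: "\<And>n. 1 \<le> n \<Longrightarrow> - Cii * (real n * (\<epsilon>b n)\<^sup>2) \<le> ln (measure (eta_prior (M n)) {\<eta> \<in> space (eta_prior (M n)). dn (M n) \<eta> (eta0 (M n)) \<le> \<epsilon>b n})"
    and theta0_le: "\<And>n. 1 \<le> n \<Longrightarrow> Max ((\<lambda>j. \<bar>theta0 (M n) j\<bar>) ` {..<npred (M n)}) \<le> Ciii * (ln (real (npred (M n))) / rate (M n))"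
    and rho_lo: "\<And>n. 1 \<le> n \<Longrightarrow> c \<le> Min ((\<lambda>i. rho_min (Delta (M n) (eta0 (M n)) i)) ` {..<n})"
    and rho_up: "\<And>n. 1 \<le> n \<Longrightarrow> Max ((\<lambda>i. rho_max (Delta (M n) (eta0 (M n)) i)) ` {..<n}) \<le> C"
    and \<gamma>_pos: "\<And>n. 1 \<le> n \<Longrightarrow> 0 < \<gamma> n"
    and \<epsilon>_ge: "\<And>n. 1 \<le> n \<Longrightarrow> sqrt (s_star (M n) (\<epsilon>b n) * ln (max (real (npred (M n))) (max (real (bmax (M n))) (\<gamma> n))) / real n) \<le> \<epsilon> n"
    and Hs_sets: "\<And>n. 1 \<le> n \<Longrightarrow> Hs n \<in> sets (eta_prior (M n))"
    and Hs_rho: "\<And>n i \<eta>. 1 \<le> n \<Longrightarrow> i < n \<Longrightarrow> \<eta> \<in> Hs n \<Longrightarrow> 1 / \<gamma> n \<le> rho_min (Delta (M n) \<eta> i)"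
    and cover: "\<And>n. 1 \<le> n \<Longrightarrow> \<exists>N. covering_number (nuis (M n)) (1 / (6 * real (bmax (M n)) * \<gamma> n * real n powr (3 / 2))) (Hs n) (dn (M n)) = enat N \<and>
       ln (real N) \<le> Cv * (real n * (\<epsilon> n)\<^sup>2)"
    and Hs_mass: "(\<lambda>n. exp (B * s_star (M n) (\<epsilon>b n) * ln (real (npred (M n)))) * measure (eta_prior (M n)) (space (eta_prior (M n)) - Hs n)) \<longlonglongrightarrow> 0"
begin

text \<open>\<open>c0\<close> is the exponent of the inverse evidence in units of \<open>sl\<close>;
  \<open>E\<close> is the exponent available to pay for cells; \<open>X\<close> is the argument of
  the logarithm in the lower bound for \<epsilon>.\<close>

definition "c0 = evid_const A3 L2 Cii Ciii c C"
definition "p n = real (npred (M n))"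
definition "\<l> n = ln (p n)"
definition "S n = s_star (M n) (\<epsilon>b n)"
definition "sl n = S n * \<l> n"
definition "E n = real n * (\<epsilon> n)\<^sup>2"
definition "X n = max (p n) (max (real (bmax (M n))) (\<gamma> n))"

section \<open>Consequences of the rate conditions for large n\<close>

lemma vs: "1 \<le> n \<Longrightarrow> valid_setup (M n)"
  using model by unfold_locales auto

lemma chi_pos: "0 < chi_const c C"
  unfolding chi_const_def using const_pos by (intro add_pos_pos) auto

lemma c0_pos: "Cii + 1 \<le> c0" "0 < c0"
  using const_pos chi_pos by (auto simp: c0_def evid_const_def intro!: add_nonneg_pos)

lemma p_gt: "1 \<le> n \<Longrightarrow> real n < p n" "1 \<le> n \<Longrightarrow> 2 \<le> p n"
  using valid_setup.sizes(1)[OF vs] valid_setup.p_ge_2[OF vs] model(1) by (auto simp: p_def)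

lemma p_top: "filterlim p at_top sequentially"
  by (rule filterlim_at_top_mono[OF filterlim_real_sequentially])
    (auto intro!: eventually_sequentiallyI[of 1] less_imp_le p_gt)

lemma ell_top: "filterlim \<l> at_top sequentially"
  unfolding \<l>_def by (rule filterlim_compose[OF ln_at_top p_top])

lemma ell_pos: "1 \<le> n \<Longrightarrow> 0 < \<l> n"
  using p_gt(2)[of n] by (simp add: \<l>_def)

lemma S_nonneg: "0 \<le> S n"
  by (simp add: S_def s_star_def)

lemma sl_ge: assumes n: "1 \<le> n" shows "real n * (\<epsilon>b n)\<^sup>2 \<le> sl n" "real (sparsity (M n) (theta0 (M n))) * \<l> n \<le> sl n"
proof -
  note l = ell_pos[OF n]
  have "real n * (\<epsilon>b n)\<^sup>2 / \<l> n \<le> S n" "real (sparsity (M n) (theta0 (M n))) \<le> S n"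
    using model(1)[OF n] by (auto simp: S_def s_star_def \<l>_def p_def)
  then show "real n * (\<epsilon>b n)\<^sup>2 \<le> sl n" "real (sparsity (M n) (theta0 (M n))) * \<l> n \<le> sl n"
    using l by (auto simp: sl_def pos_divide_le_eq mult_right_mono)
qed

lemma sl_top: "filterlim sl at_top sequentially"
  by (rule filterlim_at_top_mono[OF ne_top]) (auto intro!: eventually_sequentiallyI[of 1] sl_ge)

lemma E_ge: assumes n: "1 \<le> n" shows "S n * ln (X n) \<le> E n" "sl n \<le> E n"
proof -
  have lX: "\<l> n \<le> ln (X n)" using p_gt(2)[OF n] by (auto simp: \<l>_def X_def intro!: ln_mono)
  have nn: "0 \<le> S n * ln (X n) / real n" using S_nonneg[of n] lX ell_pos[OF n] by (intro divide_nonneg_nonneg mult_nonneg_nonneg) auto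
  have "S n * ln (X n) / real n \<le> (\<epsilon> n)\<^sup>2"
    using \<epsilon>_ge[OF n] unfolding S_def[symmetric] p_def[symmetric] X_def[symmetric] by (rule sqrt_le_D)
  then show 1: "S n * ln (X n) \<le> E n" using n by (simp add: E_def pos_divide_le_eq mult.commute)
  have "sl n \<le> S n * ln (X n)" unfolding sl_def by (intro mult_left_mono lX S_nonneg)
  with 1 show "sl n \<le> E n" by simp
qed

lemma E_top: "filterlim E at_top sequentially"
  by (rule filterlim_at_top_mono[OF sl_top]) (auto intro!: eventually_sequentiallyI[of 1] E_ge)

lemma a1_le: "1 \<le> n \<Longrightarrow> a 1 \<le> a n"
  using a_mono by (auto simp: mono_on_def)

text \<open>A positive nondecreasing sequence stays above a 1 > 0, so convergence of the product
  forces that of the second factor.\<close>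

lemma \<epsilon>b_lim: "(\<lambda>n. (\<epsilon>b n)\<^sup>2) \<longlonglongrightarrow> 0"
proof (rule tendsto_sandwich[OF _ _ tendsto_const])
  have "(\<lambda>n. a n * (\<epsilon>b n)\<^sup>2 / a 1) \<longlonglongrightarrow> 0 / a 1" using a_pos[of 1] by (intro tendsto_intros ae_lim) auto
  then show "(\<lambda>n. a n * (\<epsilon>b n)\<^sup>2 / a 1) \<longlonglongrightarrow> 0" by simp
  show "\<forall>\<^sub>F n in sequentially. (\<epsilon>b n)\<^sup>2 \<le> a n * (\<epsilon>b n)\<^sup>2 / a 1"
  proof (rule eventually_sequentiallyI[of 1])
    fix n :: nat assume "1 \<le> n"
    then show "(\<epsilon>b n)\<^sup>2 \<le> a n * (\<epsilon>b n)\<^sup>2 / a 1"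
      using a_pos[of 1] a1_le[of n] mult_right_mono[of "a 1" "a n" "(\<epsilon>b n)\<^sup>2"] by (simp add: field_simps)
  qed
qed auto

lemma max_lim: "(\<lambda>n. max_Delta_dist2 (M n) (\<eta>' n) (eta0 (M n))) \<longlonglongrightarrow> 0"
proof (rule tendsto_sandwich[OF _ _ tendsto_const])
  have "(\<lambda>n. a n * max_Delta_dist2 (M n) (\<eta>' n) (eta0 (M n)) / a 1) \<longlonglongrightarrow> 0 / a 1" using a_pos[of 1] by (intro tendsto_intros e_lim) auto
  then show "(\<lambda>n. a n * max_Delta_dist2 (M n) (\<eta>' n) (eta0 (M n)) / a 1) \<longlonglongrightarrow> 0" by simp
  have nn: "0 \<le> max_Delta_dist2 (M n) (\<eta>' n) (eta0 (M n))" if "1 \<le> n" for n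
    using valid_setup.dB_le_max[OF vs[OF that], of "\<eta>' n" "eta0 (M n)"] zero_le_power2 order_trans by blast
  then show "\<forall>\<^sub>F n in sequentially. 0 \<le> max_Delta_dist2 (M n) (\<eta>' n) (eta0 (M n))" by (auto intro!: eventually_sequentiallyI[of 1])
  show "\<forall>\<^sub>F n in sequentially. max_Delta_dist2 (M n) (\<eta>' n) (eta0 (M n)) \<le> a n * max_Delta_dist2 (M n) (\<eta>' n) (eta0 (M n)) / a 1"
  proof (rule eventually_sequentiallyI[of 1])
    fix n :: nat assume "1 \<le> n"
    then show "max_Delta_dist2 (M n) (\<eta>' n) (eta0 (M n)) \<le> a n * max_Delta_dist2 (M n) (\<eta>' n) (eta0 (M n)) / a 1"
      using a_pos[of 1] mult_right_mono[OF a1_le nn, of n n] by (simp add: field_simps)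
  qed
qed

text \<open>The comparison of the maximum with \<open>dB\<close> is available only inside the space
  of the prior, which need not contain \<eta>0. The detour through \<eta>' costs its own distance to
  \<eta>0, also after multiplication by a n; both vanish.\<close>

lemma near_ev: "\<forall>\<^sub>F n in sequentially. \<forall>\<eta> i. \<eta> \<in> space (eta_prior (M n)) \<longrightarrow> dn (M n) \<eta> (eta0 (M n)) \<le> \<epsilon>b n \<longrightarrow> i < n \<longrightarrow>
    frob_norm (Delta (M n) \<eta> i - Delta (M n) (eta0 (M n)) i) \<le> c / 4"
proof -
  define mx where "mx n = max_Delta_dist2 (M n) (\<eta>' n) (eta0 (M n))" for n
  \<comment> \<open>The coefficients come from two squared triangle inequalities: blockwise through
    \<eta>', and inside \<open>dB\<close> through \<eta>0.\<close>
  have "(\<lambda>n. 4 * (a n * (\<epsilon>b n)\<^sup>2) + 4 * (a n * mx n) + 2 * mx n) \<longlonglongrightarrow> 4 * 0 + 4 * 0 + 2 * 0"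
    unfolding mx_def by (intro tendsto_intros ae_lim e_lim max_lim)
  then have "\<forall>\<^sub>F n in sequentially. 4 * (a n * (\<epsilon>b n)\<^sup>2) + 4 * (a n * mx n) + 2 * mx n < (c / 4)\<^sup>2"
    using const_pos(10) by (intro order_tendstoD(2)) auto
  moreover have "\<forall>\<^sub>F n in sequentially. 1 \<le> (n::nat)" by (rule eventually_ge_at_top)
  ultimately show ?thesis
  proof eventually_elim
    fix n assume small: "4 * (a n * (\<epsilon>b n)\<^sup>2) + 4 * (a n * mx n) + 2 * mx n < (c / 4)\<^sup>2" and n: "1 \<le> n"
    interpret valid_setup "M n" by (rule vs[OF n])
    show "\<forall>\<eta> i. \<eta> \<in> space (eta_prior (M n)) \<longrightarrow> dn (M n) \<eta> (eta0 (M n)) \<le> \<epsilon>b n \<longrightarrow> i < n \<longrightarrow>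
       frob_norm (Delta (M n) \<eta> i - Delta (M n) (eta0 (M n)) i) \<le> c / 4"
    proof (intro allI impI)
      fix \<eta> i assume \<eta>: "\<eta> \<in> space (eta_prior (M n))" "dn (M n) \<eta> (eta0 (M n)) \<le> \<epsilon>b n" and "i < n"
      then have i: "i < nobs (M n)" using model(1)[OF n] by simp
      have \<eta>n: "\<eta> \<in> nuis (M n)" "\<eta>' n \<in> nuis (M n)" using \<eta>(1) \<eta>'_space[OF n] eta_space by auto
      note c = pos_def_matD(1)[OF carriers(3)[OF i]]
      have "(dB (M n) \<eta> (\<eta>' n))\<^sup>2 \<le> 2 * (dB (M n) \<eta> (eta0 (M n)))\<^sup>2 + 2 * (dB (M n) (eta0 (M n)) (\<eta>' n))\<^sup>2"
        by (rule dB_sq_le[OF \<eta>n(1) \<eta>n(2) eta0])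
      also have "\<dots> \<le> 2 * (\<epsilon>b n)\<^sup>2 + 2 * mx n"
        using dn_le_imp(2)[OF \<eta>(2)] dB_le_max[of "\<eta>' n" "eta0 (M n)"] dB_commute[OF eta0 \<eta>n(2)] by (simp add: mx_def)
      finally have dB: "(dB (M n) \<eta> (\<eta>' n))\<^sup>2 \<le> 2 * (\<epsilon>b n)\<^sup>2 + 2 * mx n" .
      have "(frob_norm (Delta (M n) \<eta> i - Delta (M n) (\<eta>' n) i))\<^sup>2 \<le> a n * (dB (M n) \<eta> (\<eta>' n))\<^sup>2"
        using frob_le_max[OF i] max_le[OF n \<eta>(1) \<eta>'_space[OF n]] order_trans by blast
      also have "\<dots> \<le> a n * (2 * (\<epsilon>b n)\<^sup>2 + 2 * mx n)" using dB a_pos[OF n] by (intro mult_left_mono) auto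
      finally have f1: "(frob_norm (Delta (M n) \<eta> i - Delta (M n) (\<eta>' n) i))\<^sup>2 \<le> a n * (2 * (\<epsilon>b n)\<^sup>2 + 2 * mx n)" .
      have f2: "(frob_norm (Delta (M n) (\<eta>' n) i - Delta (M n) (eta0 (M n)) i))\<^sup>2 \<le> mx n"
        unfolding mx_def by (rule frob_le_max[OF i])
      have "(frob_norm (Delta (M n) \<eta> i - Delta (M n) (eta0 (M n)) i))\<^sup>2
         \<le> 2 * (frob_norm (Delta (M n) \<eta> i - Delta (M n) (\<eta>' n) i))\<^sup>2 + 2 * (frob_norm (Delta (M n) (\<eta>' n) i - Delta (M n) (eta0 (M n)) i))\<^sup>2"
        by (rule frob_norm_diff_sq_le[OF c[OF \<eta>n(1)] c[OF eta0] c[OF \<eta>n(2)]])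
      also have "\<dots> \<le> (c / 4)\<^sup>2" using f1 f2 small by (simp add: algebra_simps)
      finally show "frob_norm (Delta (M n) \<eta> i - Delta (M n) (eta0 (M n)) i) \<le> c / 4"
        by (rule power2_le_imp_le) (use const_pos(10) in simp)
    qed
  qed
qed

lemma form_bounds:
  assumes n: "1 \<le> n" and i: "i < n" and v: "v \<in> carrier_vec (bsize (M n) i)"
  shows "c * (v \<bullet> v) \<le> v \<bullet> (Delta (M n) (eta0 (M n)) i *\<^sub>v v)" "v \<bullet> (Delta (M n) (eta0 (M n)) i *\<^sub>v v) \<le> C * (v \<bullet> v)"
proof -
  interpret valid_setup "M n" by (rule vs[OF n])
  have i': "i < nobs (M n)" using i model(1)[OF n] by simp
  note pd = pos_def_matD(1,2)[OF carriers(3)[OF i' eta0]]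
  have k: "0 < bsize (M n) i" using sizes(2)[OF i'] by simp
  have "c \<le> rho_min (Delta (M n) (eta0 (M n)) i)"
    using rho_lo[OF n] i by (intro order_trans[OF rho_lo[OF n]] Min_le) auto
  then show "c * (v \<bullet> v) \<le> v \<bullet> (Delta (M n) (eta0 (M n)) i *\<^sub>v v)"
    using rho_min_le_form[OF pd k v] mult_right_mono[OF _ scalar_prod_self_nonneg[of v]] order_trans by blast
  have "rho_max (Delta (M n) (eta0 (M n)) i) \<le> C"
    using i by (intro order_trans[OF _ rho_up[OF n]] Max_ge) auto
  then show "v \<bullet> (Delta (M n) (eta0 (M n)) i *\<^sub>v v) \<le> C * (v \<bullet> v)"
    using form_le_rho_max[OF pd k v] mult_right_mono[OF _ scalar_prod_self_nonneg[of v]] order_trans by blast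
qed

text \<open>The sieve \<open>Hs\<close> meets every shrinking \<open>dn\<close>-ball around \<open>eta0\<close>, so the lower eigenvalue bound on it
  cannot blow up.\<close>

lemma gamma_ev: "\<forall>\<^sub>F n in sequentially. 1 / \<gamma> n \<le> C + 1"
proof -
  have "\<forall>\<^sub>F n in sequentially. exp (B * s_star (M n) (\<epsilon>b n) * ln (real (npred (M n)))) * measure (eta_prior (M n)) (space (eta_prior (M n)) - Hs n) < 1"
    using Hs_mass by (rule order_tendstoD(2)) simp
  moreover have "\<forall>\<^sub>F n in sequentially. (\<epsilon>b n)\<^sup>2 < 1" using \<epsilon>b_lim by (rule order_tendstoD(2)) simp
  moreover have "\<forall>\<^sub>F n in sequentially. 1 \<le> (n::nat)" by (rule eventually_ge_at_top)
  ultimately show ?thesis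
  proof eventually_elim
    fix n assume small: "exp (B * s_star (M n) (\<epsilon>b n) * ln (real (npred (M n)))) * measure (eta_prior (M n)) (space (eta_prior (M n)) - Hs n) < 1"
      and eb: "(\<epsilon>b n)\<^sup>2 < 1" and n: "1 \<le> n"
    interpret valid_setup "M n" by (rule vs[OF n])
    interpret e: prob_space "eta_prior (M n)" by (rule eta_prob)
    let ?ball = "{\<eta> \<in> space (eta_prior (M n)). dn (M n) \<eta> (eta0 (M n)) \<le> \<epsilon>b n}"
    have "exp (B * sl n) * e.prob (space (eta_prior (M n)) - Hs n) < 1"
      using small by (simp add: sl_def S_def \<l>_def p_def mult.assoc)
    then have "e.prob (space (eta_prior (M n)) - Hs n) < exp (- (B * sl n))"
      by (simp add: exp_minus field_simps)
    also have "\<dots> \<le> exp (- Cii * (real n * (\<epsilon>b n)\<^sup>2))"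
    proof -
      \<comment> \<open>\<open>c0\<close> contains Cii + 1, so B exceeds Cii and the ball outweighs
        the complement of the sieve.\<close>
      have "Cii * (real n * (\<epsilon>b n)\<^sup>2) \<le> B * sl n"
        using sl_ge(1)[OF n] c0_pos B const_pos(8) by (intro mult_mono) (auto simp: c0_def)
      then show ?thesis by simp
    qed
    also have "\<dots> \<le> exp (ln (e.prob ?ball))" using ball_ln[OF n] by simp
    also have "\<dots> = e.prob ?ball" using ball_pos[OF n] by simp
    finally have lt: "e.prob (space (eta_prior (M n)) - Hs n) < e.prob ?ball" .
    have "\<not> ?ball \<subseteq> space (eta_prior (M n)) - Hs n"
    proof
      assume "?ball \<subseteq> space (eta_prior (M n)) - Hs n"
      then have "e.prob ?ball \<le> e.prob (space (eta_prior (M n)) - Hs n)"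
        using Hs_sets[OF n] by (intro e.finite_measure_mono) auto
      then show False using lt by simp
    qed
    then obtain \<eta> where \<eta>: "\<eta> \<in> space (eta_prior (M n))" "dn (M n) \<eta> (eta0 (M n)) \<le> \<epsilon>b n" "\<eta> \<in> Hs n" by auto
    have \<eta>n: "\<eta> \<in> nuis (M n)" using \<eta>(1) eta_space by auto
    \<comment> \<open>Some block is no further away than the average. One block is enough, since the
      eigenvalue bound on \<open>Hs\<close> holds for all of them.\<close>
    have "\<exists>i<n. (frob_norm (Delta (M n) \<eta> i - Delta (M n) (eta0 (M n)) i))\<^sup>2 \<le> (dB (M n) \<eta> (eta0 (M n)))\<^sup>2"
    proof (rule ccontr)
      assume "\<not> ?thesis"
      then have "\<And>i. i \<in> {..<n} \<Longrightarrow> (dB (M n) \<eta> (eta0 (M n)))\<^sup>2 < (frob_norm (Delta (M n) \<eta> i - Delta (M n) (eta0 (M n)) i))\<^sup>2" by auto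
      then have "(\<Sum>i<n. (dB (M n) \<eta> (eta0 (M n)))\<^sup>2) < (\<Sum>i<n. (frob_norm (Delta (M n) \<eta> i - Delta (M n) (eta0 (M n)) i))\<^sup>2)"
        using n by (intro sum_strict_mono) (auto simp: lessThan_empty_iff)
      then show False using dB_sq[of \<eta> "eta0 (M n)"] model(1)[OF n] by simp
    qed
    then obtain i where i: "i < n" "(frob_norm (Delta (M n) \<eta> i - Delta (M n) (eta0 (M n)) i))\<^sup>2 \<le> (dB (M n) \<eta> (eta0 (M n)))\<^sup>2" by blast
    have i': "i < nobs (M n)" using i(1) model(1)[OF n] by simp
    have "(frob_norm (Delta (M n) \<eta> i - Delta (M n) (eta0 (M n)) i))\<^sup>2 \<le> 1\<^sup>2"
      using i(2) dn_le_imp(2)[OF \<eta>(2)] eb by simp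
    then have fr: "frob_norm (Delta (M n) \<eta> i - Delta (M n) (eta0 (M n)) i) \<le> 1" by (rule power2_le_imp_le) simp
    have k: "0 < bsize (M n) i" using sizes(2)[OF i'] by simp
    define v :: "real vec" where "v = unit_vec (bsize (M n) i) 0"
    have v: "v \<in> carrier_vec (bsize (M n) i)" "v \<bullet> v = 1" using k by (simp_all add: v_def)
    note pd = pos_def_matD(1,2)[OF carriers(3)[OF i' \<eta>n]]
    have "1 / \<gamma> n \<le> rho_min (Delta (M n) \<eta> i) * (v \<bullet> v)" using Hs_rho[OF n i(1) \<eta>(3)] v(2) by simp
    also have "\<dots> \<le> v \<bullet> (Delta (M n) \<eta> i *\<^sub>v v)" by (rule rho_min_le_form[OF pd k v(1)])
    also have "\<dots> \<le> v \<bullet> (Delta (M n) (eta0 (M n)) i *\<^sub>v v) + 1"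
      using form_le_frob_diff[OF pos_def_matD(1)[OF carriers(3)[OF i' eta0]] pd(1) v(1)] fr v(2) by simp
    also have "\<dots> \<le> C + 1" using form_bounds(2)[OF n i(1) v(1)] v(2) by simp
    finally show "1 / \<gamma> n \<le> C + 1" .
  qed
qed

text \<open>Conditions valid for large n. The two lower bounds on p^(A4/2) make the ratios of the
  size prior at most 1/2 in spite of A2; the last three absorb additive constants into
  \<open>\<l>\<close> and \<open>sl\<close>.\<close>

definition regular :: "nat \<Rightarrow> bool" where
  "regular n \<longleftrightarrow> 3 \<le> n \<and> (\<epsilon>b n)\<^sup>2 \<le> 1 \<and> 1 / \<gamma> n \<le> C + 1 \<and>
    (\<forall>\<eta> i. \<eta> \<in> space (eta_prior (M n)) \<longrightarrow> dn (M n) \<eta> (eta0 (M n)) \<le> \<epsilon>b n \<longrightarrow> i < n \<longrightarrow>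
      frob_norm (Delta (M n) \<eta> i - Delta (M n) (eta0 (M n)) i) \<le> c / 4) \<and>
    A2 \<le> p n powr (A4 / 2) \<and> 2 \<le> p n powr (A4 / 2) \<and> ln L1 - ln A1 \<le> \<l> n \<and> L3 + ln 2 \<le> sl n \<and> 2 * chi_const c C \<le> sl n"

lemma regular_ev: "\<forall>\<^sub>F n in sequentially. regular n"
proof -
  have pA: "filterlim (\<lambda>n. p n powr (A4 / 2)) at_top sequentially"
    using const_pos(4) by (intro filterlim_compose[OF _ p_top] real_powr_at_top) auto
  show ?thesis
    unfolding regular_def
    using eventually_ge_at_top[of "3::nat"] order_tendstoD(2)[OF \<epsilon>b_lim, of 1] gamma_ev near_ev
      eventually_compose_filterlim[OF eventually_ge_at_top[of A2] pA] eventually_compose_filterlim[OF eventually_ge_at_top[of 2] pA]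
      eventually_compose_filterlim[OF eventually_ge_at_top[of "ln L1 - ln A1"] ell_top]
      eventually_compose_filterlim[OF eventually_ge_at_top[of "L3 + ln 2"] sl_top]
      eventually_compose_filterlim[OF eventually_ge_at_top[of "2 * chi_const c C"] sl_top]
    by (intro eventually_conj) (auto elim: eventually_mono)
qed

end

section \<open>Choice of the constants and passage to the limit\<close>

context contraction_setting
begin

text \<open>\<open>K1 * S n\<close> is the sparsity level of the sieve and \<open>exp (Dc * E n)\<close> bounds the number of its cells.\<close>

definition "K1 = 2 * B / A4"
definition "Dc = K1 * (L2 + 11) + Cv"
text \<open>The 3 collects one term from \<tau>1 V and two from the size tail. Then come the Laplace
  tail, the nuisance mass outside \<open>Hs\<close>, and the cells inside the sieve.\<close>

definition "bnd n = 3 * exp (- ((B - c0) / 2 * sl n)) + 2 * (p n * exp (B * (p n * ln (p n) + p n) - (p n)\<^sup>2 / (2 * L1)))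
   + exp (B * sl n) * measure (eta_prior (M n)) (space (eta_prior (M n)) - Hs n) + (2 + exp (4 + 2 * (C + 1))) * exp (- E n)"

lemma B_gt: "c0 < B" "0 < B" "0 < K1" "0 < Dc"
proof -
  show "c0 < B" using B by (simp add: c0_def)
  then show "0 < B" using c0_pos by linarith
  then show "0 < K1" using const_pos by (simp add: K1_def)
  then show "0 < Dc" using const_pos unfolding Dc_def by (intro add_nonneg_pos mult_nonneg_nonneg) auto
qed

lemma bnd_lim: "bnd \<longlonglongrightarrow> 0"
proof -
  have 1: "(\<lambda>n. exp (- ((B - c0) / 2 * sl n))) \<longlonglongrightarrow> 0"
  proof -
    have "filterlim (\<lambda>n. (B - c0) / 2 * sl n) at_top sequentially"
      using B_gt by (intro filterlim_tendsto_pos_mult_at_top[OF tendsto_const _ sl_top]) auto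
    then show ?thesis by (intro filterlim_compose[OF exp_at_bot]) (simp add: filterlim_uminus_at_top)
  qed
  have 2: "(\<lambda>n. p n * exp (B * (p n * ln (p n) + p n) - (p n)\<^sup>2 / (2 * L1))) \<longlonglongrightarrow> 0"
  proof (rule filterlim_compose[OF _ p_top])
    \<comment> \<open>p^2 dominates p log p, so the coefficient tail vanishes whatever B is.\<close>
    show "((\<lambda>x::real. x * exp (B * (x * ln x + x) - x\<^sup>2 / (2 * L1))) \<longlongrightarrow> 0) at_top"
      using B_gt(2) const_pos(5) by real_asymp
  qed
  have 3: "(\<lambda>n. exp (B * sl n) * measure (eta_prior (M n)) (space (eta_prior (M n)) - Hs n)) \<longlonglongrightarrow> 0"
    using Hs_mass by (simp add: sl_def S_def \<l>_def p_def mult.assoc)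
  have 4: "(\<lambda>n. exp (- E n)) \<longlonglongrightarrow> 0"
    using E_top by (intro filterlim_compose[OF exp_at_bot]) (simp add: filterlim_uminus_at_top)
  have "bnd \<longlonglongrightarrow> 3 * 0 + 2 * 0 + 0 + (2 + exp (4 + 2 * (C + 1))) * 0"
    unfolding bnd_def by (intro tendsto_intros 1 2 3 4)
  then show ?thesis by simp
qed

text \<open>A zero design would force \<open>rate\<close> to be at most 0.\<close>

lemma design_norm_pos: assumes n: "1 \<le> n" shows "0 < design_norm (M n)"
proof -
  interpret valid_setup "M n" by (rule vs[OF n])
  have "0 < L3 * design_norm (M n) / sqrt (real n)" using rate_pos rate_up[OF n] by linarith
  then show ?thesis using n const_pos(7) by (simp add: zero_less_divide_iff zero_less_mult_iff)
qed

lemma inv_evid_le_exp: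
  assumes reg: "regular n"
  shows "dominated_bayes.inv_evid (prior (M n)) (base_measure (M n)) (joint_density (M n)) (joint_density (M n) (theta0 (M n), eta0 (M n)))
    \<le> ennreal (exp (c0 * sl n))"
proof -
  have n: "1 \<le> n" "3 \<le> n" using reg by (auto simp: regular_def)
  interpret valid_setup "M n" by (rule vs[OF n(1)])
  have nn: "nobs (M n) = n" by (rule model(1)[OF n(1)])
  define s where "s = card {j. j < npred (M n) \<and> theta0 (M n) j \<noteq> 0}"
  \<comment> \<open>The +1 covers s = 0. An l1 perturbation of size s \<delta> moves the stacked
    mean by at most 1.\<close>
  define \<delta> where "\<delta> = 1 / ((real s + 1) * design_norm (M n))"
  note dpos = design_norm_pos[OF n(1)]
  have \<delta>: "0 < \<delta>" using dpos by (simp add: \<delta>_def)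
  have \<delta>1: "design_norm (M n) * (real s * \<delta>) \<le> 1" using dpos by (simp add: \<delta>_def)
  have sparse: "sparsity (M n) (theta0 (M n)) = s" by (simp add: sparsity_def s_def)
  have sp: "s \<le> npred (M n)" unfolding s_def using card_mono[of "{..<npred (M n)}" "{j. j < npred (M n) \<and> theta0 (M n) j \<noteq> 0}"] by auto
  define q where "q = A2 * p n powr (- A4)"
  have q: "0 \<le> q" "q \<le> 1 / 2"
  proof -
    show "0 \<le> q" using const_pos(2) by (simp add: q_def)
    \<comment> \<open>One half of the power A4 absorbs A2, the other half provides the factor
      1/2.\<close>
    have "p n powr (- A4) = 1 / (p n powr (A4 / 2) * p n powr (A4 / 2))"
      using p_gt[OF n(1)] by (simp add: powr_add[symmetric] powr_minus inverse_eq_divide)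
    then have "q = A2 / (p n powr (A4 / 2) * p n powr (A4 / 2))" by (simp add: q_def)
    moreover have "A2 * 2 \<le> p n powr (A4 / 2) * p n powr (A4 / 2)" using reg const_pos(2) by (intro mult_mono) (auto simp: regular_def)
    moreover have "0 < p n powr (A4 / 2) * p n powr (A4 / 2)" using p_gt(2)[OF n(1)] by simp
    ultimately show "q \<le> 1 / 2" by (simp only: pos_divide_le_eq)
  qed
  define l where "l = A1 * p n powr (- A3)"
  have l: "0 < l" using const_pos(1) p_gt(2)[OF n(1)] by (simp add: l_def)
  have up: "pmf (size_prior (M n)) s \<le> q * pmf (size_prior (M n)) (s - 1)" if "s \<in> {1..npred (M n)}" for s
    using size_up[OF n(1) that] by (simp add: q_def p_def)
  have lo: "l * pmf (size_prior (M n)) (s - 1) \<le> pmf (size_prior (M n)) s" if "s \<in> {1..npred (M n)}" for s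
    using size_lo[OF n(1) that] by (simp add: l_def p_def)
  have pm0: "1 / 2 \<le> pmf (size_prior (M n)) 0" by (rule pmf_0_ge[OF size_le q less_imp_le[OF l] up lo])
  have "l ^ s * (1 / 2) \<le> l ^ s * pmf (size_prior (M n)) 0" using pm0 l by (intro mult_left_mono) auto
  also have "\<dots> \<le> pmf (size_prior (M n)) s" by (rule pmf_ge_geometric[OF size_le q less_imp_le[OF l] up lo sp])
  finally have pms: "l ^ s * (1 / 2) \<le> pmf (size_prior (M n)) s" .
  then have pmpos: "0 < pmf (size_prior (M n)) s" using l by (smt (verit) mult_pos_pos zero_less_power divide_pos_pos)
  define \<pi>\<theta> where "\<pi>\<theta> = pmf (size_prior (M n)) s / real (npred (M n) choose s) *
      ((rate (M n) * \<delta>) ^ s * exp (- rate (M n) * (\<Sum>j\<in>{j. j < npred (M n) \<and> theta0 (M n) j \<noteq> 0}. \<bar>theta0 (M n) j\<bar>) - rate (M n) * \<delta> * real s))"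
  define \<pi>\<eta> where "\<pi>\<eta> = measure (eta_prior (M n)) {\<eta> \<in> space (eta_prior (M n)). dn (M n) \<eta> (eta0 (M n)) \<le> \<epsilon>b n}"
  have \<pi>\<eta>: "exp (- (Cii * sl n)) \<le> \<pi>\<eta>" "0 < \<pi>\<eta>"
  proof -
    show "0 < \<pi>\<eta>" unfolding \<pi>\<eta>_def by (rule ball_pos[OF n(1)])
    have "exp (- (Cii * sl n)) \<le> exp (- Cii * (real n * (\<epsilon>b n)\<^sup>2))" using sl_ge(1)[OF n(1)] const_pos(8) by simp
    also have "\<dots> \<le> exp (ln \<pi>\<eta>)" unfolding \<pi>\<eta>_def using ball_ln[OF n(1)] by simp
    finally show "exp (- (Cii * sl n)) \<le> \<pi>\<eta>" using \<open>0 < \<pi>\<eta>\<close> by simp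
  qed
  have ru: "rate (M n) \<le> L3 * design_norm (M n)"
  proof -
    have "L3 * design_norm (M n) / sqrt (real n) \<le> L3 * design_norm (M n) / 1"
      using dpos const_pos(7) n by (intro divide_left_mono) auto
    then show ?thesis using rate_up[OF n(1)] by linarith
  qed
  have th: "\<bar>theta0 (M n) j\<bar> \<le> Ciii * (ln (real (npred (M n))) / rate (M n))" if "j < npred (M n)" for j
    using that by (intro order_trans[OF Max_ge theta0_le[OF n(1)]]) auto
  have "exp (- (real s * \<l> n * (A3 + L2 + Ciii + 4)) - L3) / 2 \<le> \<pi>\<theta>"
    unfolding \<pi>\<theta>_def \<delta>_def s_def \<l>_def p_def
  proof (rule theta_mass_ge[OF const_pos(1,3,5,6,7,9) dpos _ rate_lo[OF n(1)] ru th])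
    show "(A1 * real (npred (M n)) powr - A3) ^ card {j. j < npred (M n) \<and> theta0 (M n) j \<noteq> 0} * (1 / 2) \<le> pmf (size_prior (M n)) (card {j. j < npred (M n) \<and> theta0 (M n) j \<noteq> 0})"
      using pms by (simp add: s_def l_def p_def)
    show "ln L1 - ln A1 \<le> ln (real (npred (M n)))" using reg by (simp add: regular_def \<l>_def p_def)
  qed
  moreover have "exp (- ((A3 + L2 + Ciii + 5) * sl n)) \<le> exp (- (real s * \<l> n * (A3 + L2 + Ciii + 4)) - L3) / 2"
  proof -
    have "real s * \<l> n * (A3 + L2 + Ciii + 4) \<le> sl n * (A3 + L2 + Ciii + 4)"
      using sl_ge(2)[OF n(1)] const_pos unfolding sparse by (intro mult_right_mono) auto
    moreover have "L3 + ln 2 \<le> sl n" using reg by (simp add: regular_def)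
    ultimately have "- ((A3 + L2 + Ciii + 5) * sl n) \<le> - (real s * \<l> n * (A3 + L2 + Ciii + 4)) - L3 - ln 2"
      by (simp add: algebra_simps)
    then have "exp (- ((A3 + L2 + Ciii + 5) * sl n)) \<le> exp (- (real s * \<l> n * (A3 + L2 + Ciii + 4)) - L3 - ln 2)" by simp
    also have "\<dots> = exp (- (real s * \<l> n * (A3 + L2 + Ciii + 4)) - L3) / 2" by (simp add: exp_diff)
    finally show ?thesis .
  qed
  ultimately have \<pi>\<theta>: "exp (- ((A3 + L2 + Ciii + 5) * sl n)) \<le> \<pi>\<theta>" by linarith
  define V where "V = exp (2 * C / c^3 * (real (nobs (M n)) * (\<epsilon>b n)\<^sup>2) + chi_const c C * (2 + 2 * (real (nobs (M n)) * (\<epsilon>b n)\<^sup>2)))"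
  have "bayes.inv_evid \<le> ennreal (V / (\<pi>\<theta> * \<pi>\<eta>))"
    unfolding V_def \<pi>\<theta>_def \<pi>\<eta>_def chi_const_def s_def
  proof (rule inv_evid_bound[OF const_pos(10,11) \<delta>])
    show "design_norm (M n) * (real (card {j. j < npred (M n) \<and> theta0 (M n) j \<noteq> 0}) * \<delta>) \<le> 1" using \<delta>1 by (simp add: s_def)
    show "0 < pmf (size_prior (M n)) (card {j. j < npred (M n) \<and> theta0 (M n) j \<noteq> 0})" using pmpos by (simp add: s_def)
    show "0 < measure (eta_prior (M n)) {\<eta> \<in> space (eta_prior (M n)). dn (M n) \<eta> (eta0 (M n)) \<le> \<epsilon>b n}" by (rule ball_pos[OF n(1)])
  qed (use form_bounds[OF n(1)] reg nn in \<open>auto simp: regular_def\<close>)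
  also have "\<dots> \<le> ennreal (exp (c0 * sl n))"
  proof (rule ennreal_leI)
    have V: "V \<le> exp ((2 * C / c^3 + 2 * chi_const c C + 1) * sl n)"
    proof -
      have "(2 * C / c^3 + 2 * chi_const c C) * (real n * (\<epsilon>b n)\<^sup>2) \<le> (2 * C / c^3 + 2 * chi_const c C) * sl n"
        using sl_ge(1)[OF n(1)] const_pos chi_pos by (intro mult_left_mono) auto
      moreover have "2 * chi_const c C \<le> sl n" using reg by (simp add: regular_def)
      ultimately show ?thesis unfolding V_def nn by (simp add: algebra_simps)
    qed
    have m: "exp (- ((A3 + L2 + Ciii + 5) * sl n)) * exp (- (Cii * sl n)) \<le> \<pi>\<theta> * \<pi>\<eta>"
      using \<pi>\<theta> \<pi>\<eta> by (intro mult_mono) (auto intro: order_trans[OF exp_ge_zero])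
    then have mp: "0 < \<pi>\<theta> * \<pi>\<eta>" by (smt (verit) exp_gt_zero mult_pos_pos)
    have "V / (\<pi>\<theta> * \<pi>\<eta>) \<le> exp ((2 * C / c^3 + 2 * chi_const c C + 1) * sl n) / (exp (- ((A3 + L2 + Ciii + 5) * sl n)) * exp (- (Cii * sl n)))"
      using V m mp by (intro frac_le) auto
    also have "\<dots> = exp (c0 * sl n)"
      unfolding exp_add[symmetric] exp_diff[symmetric] by (simp add: c0_def evid_const_def algebra_simps)
    finally show "V / (\<pi>\<theta> * \<pi>\<eta>) \<le> exp (c0 * sl n)" .
  qed
  finally show ?thesis .
qed

text \<open>With ratio p^(-A4/2) the tail beyond K1 S is of order p^(-A4 K1 S / 2), and K1 = 2B/A4
  turns this into exp(-B sl).\<close>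

lemma size_tail:
  assumes reg: "regular n"
  shows "measure (measure_pmf (size_prior (M n))) {s. nat \<lfloor>K1 * S n\<rfloor> < s} \<le> 2 * exp (- (B * sl n))"
proof -
  have n: "1 \<le> n" "3 \<le> n" using reg by (auto simp: regular_def)
  interpret valid_setup "M n" by (rule vs[OF n(1)])
  define q where "q = p n powr (- A4 / 2)"
  have p1: "1 \<le> p n" using p_gt(2)[OF n(1)] by simp
  have q1: "A2 * p n powr (- A4) \<le> q"
  proof -
    have "A2 * p n powr (- A4) \<le> p n powr (A4 / 2) * p n powr (- A4)" using reg by (intro mult_right_mono) (auto simp: regular_def)
    also have "\<dots> = q" using p1 by (simp add: powr_add[symmetric] q_def)
    finally show ?thesis .
  qed
  have q: "0 \<le> q" "q \<le> 1 / 2"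
    using reg p1 by (auto simp: q_def regular_def powr_minus field_simps)
  have up: "pmf (size_prior (M n)) s \<le> q * pmf (size_prior (M n)) (s - 1)" if "s \<in> {1..npred (M n)}" for s
    using size_up[OF n(1) that] mult_right_mono[OF q1 pmf_nonneg[of "size_prior (M n)" "s - 1"]] unfolding p_def by linarith
  have "measure (measure_pmf (size_prior (M n))) {s. nat \<lfloor>K1 * S n\<rfloor> < s} \<le> 2 * q ^ Suc (nat \<lfloor>K1 * S n\<rfloor>)"
    by (rule pmf_tail_le[OF size_le q order_refl up]) simp_all
  also have "q ^ Suc (nat \<lfloor>K1 * S n\<rfloor>) = exp (- (real (Suc (nat \<lfloor>K1 * S n\<rfloor>)) * (A4 / 2 * \<l> n)))"
  proof -
    have qe: "q = exp (- (A4 / 2 * \<l> n))" using p1 by (simp add: q_def powr_def \<l>_def)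
    show ?thesis unfolding qe by (simp only: exp_of_nat_mult[symmetric] mult_minus_right)
  qed
  also have "\<dots> \<le> exp (- (K1 * S n * (A4 / 2 * \<l> n)))"
  proof -
    \<comment> \<open>The successor, present because the tail is strict, compensates the rounding
      down.\<close>
    have "K1 * S n \<le> real (Suc (nat \<lfloor>K1 * S n\<rfloor>))" using B_gt(3) S_nonneg[of n] by (simp add: of_nat_nat) linarith
    then have "K1 * S n * (A4 / 2 * \<l> n) \<le> real (Suc (nat \<lfloor>K1 * S n\<rfloor>)) * (A4 / 2 * \<l> n)"
      using ell_pos[OF n(1)] const_pos(4) by (intro mult_right_mono) auto
    then show ?thesis by simp
  qed
  also have "K1 * S n * (A4 / 2 * \<l> n) = B * sl n" using const_pos(4) by (simp add: K1_def sl_def)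
  finally show ?thesis by simp
qed

text \<open>Powers of X in the base of the count: one from p, L2 + 6 from the grid size G, and four
  because the numerical factor 12 is at most 2^4. The sum is L2 + 11.\<close>

lemma cell_count:
  fixes X T :: real and q G t :: nat
  assumes "2 \<le> X" "real q \<le> X" "real G \<le> 3 * X powr (L2 + 6) + 2" "real t \<le> T" "0 \<le> T" "1 \<le> q"
  shows "real ((q * (2 * G + 1) + 1) ^ t) \<le> exp ((L2 + 11) * (T * ln X))"
proof -
  have L2: "0 < L2" by (rule const_pos(6))
  have Y: "1 \<le> X powr (L2 + 6)" using assms L2 by (intro ge_one_powr_ge_zero) auto
  have "real (q * (2 * G + 1) + 1) = real q * (2 * real G + 1) + 1" by (simp add: algebra_simps)
  also have "\<dots> \<le> X * (2 * (3 * X powr (L2 + 6) + 2) + 1) + 1"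
    using assms by (intro add_mono mult_mono order_refl) auto
  also have "\<dots> \<le> X * (11 * X powr (L2 + 6)) + X * X powr (L2 + 6)"
    using assms Y mult_mono[of 1 X 1 "X powr (L2 + 6)"] by (intro add_mono mult_left_mono) auto
  also have "\<dots> = 12 * (X * X powr (L2 + 6))" by simp
  also have "\<dots> \<le> X ^ 4 * (X * X powr (L2 + 6))"
  proof (rule mult_right_mono)
    have "(2::real) ^ 4 \<le> X ^ 4" using assms by (intro power_mono) auto
    then show "12 \<le> X ^ 4" by simp
  qed (use assms in auto)
  also have "\<dots> = X powr 4 * (X powr 1 * X powr (L2 + 6))" using assms by (simp add: powr_numeral)
  also have "\<dots> = X powr (L2 + 11)" unfolding powr_add[symmetric] by (simp add: add.commute)
  finally have "real (q * (2 * G + 1) + 1) \<le> X powr (L2 + 11)" .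
  then have "real ((q * (2 * G + 1) + 1) ^ t) \<le> (X powr (L2 + 11)) ^ t"
    unfolding of_nat_power by (intro power_mono) auto
  also have "\<dots> = exp (real t * ((L2 + 11) * ln X))" using assms by (simp add: powr_def exp_of_nat_mult)
  also have "\<dots> \<le> exp ((L2 + 11) * (T * ln X))"
    using assms L2 mult_right_mono[of "real t" T "(L2 + 11) * ln X"] by (simp add: mult_ac)
  finally show ?thesis .
qed

text \<open>All free parameters are fixed here. Each of the three terms paid per cell has to be of
  order exp(-(Dc + 1) E), so that exp(-E) is left after multiplication by exp(Dc E) cells.\<close>

lemma expected_posterior_le_bnd:
  assumes reg: "regular n"
  shows "expected_posterior (M n) {z \<in> space (prior (M n)). renyi_div (M n) z (theta0 (M n), eta0 (M n)) > (4 * Dc + 2 * c0 + 4) * (\<epsilon> n)\<^sup>2}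
    \<le> ennreal (bnd n)"
proof -
  have n: "1 \<le> n" "3 \<le> n" using reg by (auto simp: regular_def)
  interpret valid_setup "M n" by (rule vs[OF n(1)])
  have nn: "nobs (M n) = n" by (rule model(1)[OF n(1)])
  note dpos = design_norm_pos[OF n(1)]
  define t where "t = nat \<lfloor>K1 * S n\<rfloor>"
  \<comment> \<open>The lower bound on the rate gives rate times R at least p^2 / L1, while B sl is
    at most B (p log p + p).\<close>
  define R where "R = p n powr (L2 + 2) / design_norm (M n)"
  \<comment> \<open>Any K2 with 2 K2 \<ge> (3 Dc + 2 c0 + 3) + 2 (Dc + 1) works: the first bracket
    is twice the exponent of sqrt(\<sigma>/\<tau>), the second pays for the cells.\<close>
  define K2 where "K2 = 4 * Dc + 2 * c0 + 4"
  define x where "x = sl n"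
  define e where "e = E n"
  \<comment> \<open>Midpoint of c0 and B: \<tau>1 beats V, and 1/\<tau>1 is beaten by the size tail,
    with the same margin (B - c0)/2.\<close>
  define b where "b = (B + c0) / 2"
  define \<tau>1 where "\<tau>1 = exp (- (b * x))"
  \<comment> \<open>Chosen so that \<tau> V is at most exp(-(Dc + 1) e); \<sigma> is then set so
    that \<sigma> \<tau> equals exp((Dc + 1) e).\<close>
  define \<tau> where "\<tau> = exp (- ((Dc + c0 + 1) * e))"
  define \<sigma> where "\<sigma> = exp ((2 * Dc + c0 + 2) * e)"
  have p2: "2 \<le> p n" by (rule p_gt(2)[OF n(1)])
  have m1: "1 \<le> real (bmax (M n))" using bmax_pos by simp
  have x0: "0 \<le> x" unfolding x_def sl_def using S_nonneg ell_pos[OF n(1)] by (intro mult_nonneg_nonneg) auto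
  have xe: "x \<le> e" unfolding x_def e_def by (rule E_ge(2)[OF n(1)])
  have X2: "2 \<le> X n" "p n \<le> X n" "real (bmax (M n)) \<le> X n" "max (\<gamma> n) 1 \<le> X n" "real n \<le> X n"
    using p2 p_gt(1)[OF n(1)] by (auto simp: X_def)
  obtain N where N: "covering_number (nuis (M n)) (1 / (6 * real (bmax (M n)) * \<gamma> n * real n powr (3 / 2))) (Hs n) (dn (M n)) = enat N"
    "ln (real N) \<le> Cv * e" using cover[OF n(1)] unfolding e_def E_def by blast
  have Nle: "real N \<le> exp (Cv * e)"
  \<comment> \<open>N = 0 is separate because \<open>exp (ln N)\<close> recovers N only for positive
    N.\<close>
  proof (cases "N = 0")
    case False
    then have "real N = exp (ln (real N))" by simp
    also have "\<dots> \<le> exp (Cv * e)" using N(2) by simp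
    finally show ?thesis .
  qed simp
  define G where "G = nat \<lceil>R * (design_norm (M n) * p n * (3 * real n * real (bmax (M n)) * max (\<gamma> n) 1)) + 1\<rceil>"
  define gg where "gg = R * (design_norm (M n) * p n * (3 * real n * real (bmax (M n)) * max (\<gamma> n) 1))"
  have gg: "gg = 3 * (p n powr (L2 + 2) * (p n * (real n * (real (bmax (M n)) * max (\<gamma> n) 1))))"
    using dpos by (simp add: gg_def R_def mult_ac)
  have gg0: "0 \<le> gg" unfolding gg using p2 by (intro mult_nonneg_nonneg) auto
  \<comment> \<open>Each of the four factors p, n, mbar and max \<gamma> 1 is at most X, which
    raises the power L2 + 2 to L2 + 6.\<close>
  have ggX: "gg \<le> 3 * X n powr (L2 + 6)"
  proof -
    have "p n powr (L2 + 2) * (p n * (real n * (real (bmax (M n)) * max (\<gamma> n) 1))) \<le> X n powr (L2 + 2) * (X n * (X n * (X n * X n)))"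
      using X2 p2 const_pos(6) by (intro mult_mono powr_mono2 mult_nonneg_nonneg) auto
    also have "\<dots> = X n powr (L2 + 2) * X n powr 4" using X2 by (simp add: powr_numeral power4_eq_xxxx mult.assoc)
    also have "\<dots> = X n powr (L2 + 6)" unfolding powr_add[symmetric] by (simp add: add.commute)
    finally show ?thesis unfolding gg by simp
  qed
  have G: "gg + 1 \<le> real G" "real G \<le> 3 * X n powr (L2 + 6) + 2"
  proof -
    have Gd: "G = nat \<lceil>gg + 1\<rceil>" by (simp add: G_def gg_def)
    show "gg + 1 \<le> real G" unfolding Gd by (rule real_nat_ceiling_ge)
    have "real G < gg + 2" unfolding Gd using gg0 by linarith
    then show "real G \<le> 3 * X n powr (L2 + 6) + 2" using ggX by linarith
  qed
  have cnt: "real ((npred (M n) * (2 * G + 1) + 1) ^ t * N) \<le> exp (Dc * e)"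
  proof -
    have "real ((npred (M n) * (2 * G + 1) + 1) ^ t) \<le> exp ((L2 + 11) * ((K1 * S n) * ln (X n)))"
    proof (rule cell_count)
      show "real t \<le> K1 * S n" unfolding t_def using B_gt(3) S_nonneg[of n] by (simp add: of_nat_nat)
      show "0 \<le> K1 * S n" using B_gt(3) S_nonneg[of n] by simp
      show "1 \<le> npred (M n)" using p_ge_2 by simp
    qed (use X2 G in \<open>auto simp: p_def\<close>)
    also have "\<dots> \<le> exp (K1 * (L2 + 11) * e)"
    proof -
      have "K1 * (L2 + 11) * (S n * ln (X n)) \<le> K1 * (L2 + 11) * e"
        unfolding e_def using B_gt(3) const_pos(6) by (intro mult_left_mono E_ge(1)[OF n(1)]) auto
      moreover have "(L2 + 11) * ((K1 * S n) * ln (X n)) = K1 * (L2 + 11) * (S n * ln (X n))" by (simp only: mult_ac)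
      ultimately show ?thesis by (simp only: exp_le_cancel_iff)
    qed
    finally have "real ((npred (M n) * (2 * G + 1) + 1) ^ t) * real N \<le> exp (K1 * (L2 + 11) * e) * exp (Cv * e)"
      using Nle by (intro mult_mono) auto
    then show ?thesis by (simp add: Dc_def exp_add[symmetric] algebra_simps)
  qed
  define tail where "tail = measure (measure_pmf (size_prior (M n))) {s. t < s} + p n * (2 * exp (- rate (M n) * R / 2))
        + measure (eta_prior (M n)) (space (eta_prior (M n)) - Hs n)"
  have bound: "expected_posterior (M n) {z \<in> space (prior (M n)). renyi_div (M n) z z0 > K2 * (\<epsilon> n)\<^sup>2} \<le> ennreal (
      (\<tau>1 * exp (c0 * x) + tail / \<tau>1)
      + real ((npred (M n) * (2 * G + 1) + 1) ^ t * N) * (\<tau> * exp (c0 * x) + sqrt (\<sigma> / \<tau>) * exp (- real (nobs (M n)) * (K2 * (\<epsilon> n)\<^sup>2)) + 1 / (\<sigma> * \<tau>) * exp (4 + 2 * (C + 1))))"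
    unfolding tail_def p_def
  proof (rule expected_posterior_bound[OF _ _ _ \<gamma>_pos[OF n(1)] _ _ Hs_sets[OF n(1)]])
    show "bayes.inv_evid \<le> ennreal (exp (c0 * x))" unfolding x_def by (rule inv_evid_le_exp[OF reg])
    show "R * (design_norm (M n) * real (npred (M n)) * (3 * real (nobs (M n)) * real (bmax (M n)) * max (\<gamma> n) 1)) + 1 \<le> real G"
      using G(1) by (simp add: gg_def p_def nn)
    show "covering_number (nuis (M n)) (1 / (6 * real (bmax (M n)) * \<gamma> n * real (nobs (M n)) powr (3 / 2))) (Hs n) (dn (M n)) = enat N"
      using N(1) by (simp add: nn)
  qed (use n nn reg dpos p2 Hs_rho[OF n(1)] in \<open>auto simp: \<sigma>_def \<tau>_def \<tau>1_def R_def regular_def\<close>)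
  have first: "\<tau>1 * exp (c0 * x) + tail / \<tau>1 \<le> 3 * exp (- ((B - c0) / 2 * x)) + 2 * (p n * exp (B * (p n * ln (p n) + p n) - (p n)\<^sup>2 / (2 * L1)))
      + exp (B * x) * measure (eta_prior (M n)) (space (eta_prior (M n)) - Hs n)"
  proof -
    have t1: "\<tau>1 * exp (c0 * x) = exp (- ((B - c0) / 2 * x))"
      by (simp add: \<tau>1_def b_def exp_add[symmetric] field_simps)
    have inv: "1 / \<tau>1 = exp (b * x)" by (simp add: \<tau>1_def exp_minus field_simps)
    have "b \<le> B" using B_gt(1) by (simp add: b_def)
    then have bx: "b * x \<le> B * x" using x0 by (rule mult_right_mono)
    then have bB: "exp (b * x) \<le> exp (B * x)" by simp
    have i1: "measure (measure_pmf (size_prior (M n))) {s. t < s} * exp (b * x) \<le> 2 * exp (- ((B - c0) / 2 * x))"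
    proof -
      have "measure (measure_pmf (size_prior (M n))) {s. t < s} * exp (b * x) \<le> 2 * exp (- (B * x)) * exp (b * x)"
        unfolding t_def x_def by (intro mult_right_mono size_tail[OF reg]) simp
      also have "\<dots> = 2 * exp (- ((B - c0) / 2 * x))"
        by (simp add: b_def exp_add[symmetric] field_simps)
      finally show ?thesis .
    qed
    have i2: "p n * (2 * exp (- rate (M n) * R / 2)) * exp (b * x) \<le> 2 * (p n * exp (B * (p n * ln (p n) + p n) - (p n)\<^sup>2 / (2 * L1)))"
    proof -
      have "(p n)\<^sup>2 / L1 \<le> rate (M n) * R"
      proof -
        have "(p n)\<^sup>2 / L1 = design_norm (M n) / (L1 * p n powr L2) * R"
          using dpos p2 const_pos(5) by (simp add: R_def powr_add powr_numeral)
        also have "\<dots> \<le> rate (M n) * R"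
          using rate_lo[OF n(1)] dpos unfolding p_def[symmetric] by (intro mult_right_mono) (auto simp: R_def)
        finally show ?thesis .
      qed
      moreover have "b * x \<le> B * (p n * ln (p n) + p n)"
      proof -
        have s: "real (sparsity (M n) (theta0 (M n))) \<le> p n"
          unfolding sparsity_def p_def using card_mono[of "{..<npred (M n)}" "{j. j < npred (M n) \<and> theta0 (M n) j \<noteq> 0}"] by auto
        \<comment> \<open>The crude bounds s0 \<le> p and n \<epsilon>bar^2 \<le> p suffice, because
          R was chosen to produce p^2.\<close>
        have "x = max (real (sparsity (M n) (theta0 (M n)))) (real n * (\<epsilon>b n)\<^sup>2 / \<l> n) * \<l> n"
          by (simp add: x_def sl_def S_def s_star_def nn \<l>_def p_def)
        also have "\<dots> \<le> (real (sparsity (M n) (theta0 (M n))) + real n * (\<epsilon>b n)\<^sup>2 / \<l> n) * \<l> n"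
          using ell_pos[OF n(1)] by (intro mult_right_mono) auto
        also have "\<dots> = real (sparsity (M n) (theta0 (M n))) * \<l> n + real n * (\<epsilon>b n)\<^sup>2" using ell_pos[OF n(1)] by (simp add: field_simps)
        also have "\<dots> \<le> p n * \<l> n + p n * 1"
          using s ell_pos[OF n(1)] reg p_gt[OF n(1)] by (intro add_mono mult_mono) (auto simp: regular_def)
        finally have xp: "x \<le> p n * ln (p n) + p n" by (simp add: \<l>_def)
        have "b * x \<le> B * x" by (rule bx)
        also have "\<dots> \<le> B * (p n * ln (p n) + p n)" using xp B_gt(2) by (intro mult_left_mono) auto
        finally show ?thesis .
      qed
      ultimately have "- rate (M n) * R / 2 + b * x \<le> B * (p n * ln (p n) + p n) - (p n)\<^sup>2 / (2 * L1)" by simp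
      then have "exp (- rate (M n) * R / 2 + b * x) \<le> exp (B * (p n * ln (p n) + p n) - (p n)\<^sup>2 / (2 * L1))" by simp
      then have "2 * p n * exp (- rate (M n) * R / 2 + b * x) \<le> 2 * p n * exp (B * (p n * ln (p n) + p n) - (p n)\<^sup>2 / (2 * L1))"
        using p2 by (intro mult_left_mono) auto
      moreover have "p n * (2 * exp (- rate (M n) * R / 2)) * exp (b * x) = 2 * p n * exp (- rate (M n) * R / 2 + b * x)"
        by (simp only: exp_add mult_ac)
      ultimately show ?thesis by (simp only: mult.assoc)
    qed
    have i3: "measure (eta_prior (M n)) (space (eta_prior (M n)) - Hs n) * exp (b * x) \<le> exp (B * x) * measure (eta_prior (M n)) (space (eta_prior (M n)) - Hs n)"
      using mult_left_mono[OF bB, of "measure (eta_prior (M n)) (space (eta_prior (M n)) - Hs n)"] by (simp add: mult.commute)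
    have "tail / \<tau>1 = tail * exp (b * x)" unfolding inv[symmetric] by simp
    also have "\<dots> = measure (measure_pmf (size_prior (M n))) {s. t < s} * exp (b * x) + p n * (2 * exp (- rate (M n) * R / 2)) * exp (b * x)
      + measure (eta_prior (M n)) (space (eta_prior (M n)) - Hs n) * exp (b * x)"
      by (simp only: tail_def distrib_right)
    finally show ?thesis using t1 i1 i2 i3 by linarith
  qed
  have second: "real ((npred (M n) * (2 * G + 1) + 1) ^ t * N) * (\<tau> * exp (c0 * x) + sqrt (\<sigma> / \<tau>) * exp (- real (nobs (M n)) * (K2 * (\<epsilon> n)\<^sup>2)) + 1 / (\<sigma> * \<tau>) * exp (4 + 2 * (C + 1)))
     \<le> (2 + exp (4 + 2 * (C + 1))) * exp (- e)"
  proof -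
    have j1: "\<tau> * exp (c0 * x) \<le> exp (- ((Dc + 1) * e))"
    proof -
      have "c0 * x \<le> c0 * e" using xe c0_pos by (intro mult_left_mono) auto
      then show ?thesis unfolding \<tau>_def exp_add[symmetric] by (simp add: algebra_simps)
    qed
    have j2: "sqrt (\<sigma> / \<tau>) * exp (- real (nobs (M n)) * (K2 * (\<epsilon> n)\<^sup>2)) \<le> exp (- ((Dc + 1) * e))"
    proof -
      have s1: "sqrt (\<sigma> / \<tau>) = exp ((3 * Dc + 2 * c0 + 3) * e / 2)"
        unfolding \<sigma>_def \<tau>_def exp_diff[symmetric]
        by (rule real_sqrt_unique) (simp_all add: power2_eq_square exp_add[symmetric] algebra_simps)
      have s2: "- real (nobs (M n)) * (K2 * (\<epsilon> n)\<^sup>2) = - (K2 * e)" by (simp add: nn e_def E_def)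
      have s3: "(3 * Dc + 2 * c0 + 3) * e / 2 - K2 * e \<le> - ((Dc + 1) * e)"
      proof -
        have e0: "0 \<le> e" using x0 xe by linarith
        have "(3 * Dc + 2 * c0 + 3) + 2 * (Dc + 1) \<le> 2 * K2" using B_gt(4) c0_pos(2) by (simp add: K2_def)
        from mult_right_mono[OF this e0] show ?thesis by (simp add: field_simps)
      qed
      show ?thesis unfolding s1 s2 exp_add[symmetric] exp_le_cancel_iff using s3 by simp
    qed
    have j3: "1 / (\<sigma> * \<tau>) = exp (- ((Dc + 1) * e))"
    proof -
      have "\<sigma> * \<tau> = exp ((Dc + 1) * e)" unfolding \<sigma>_def \<tau>_def exp_add[symmetric] by (simp add: algebra_simps)
      then show ?thesis by (simp add: exp_minus inverse_eq_divide)
    qed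
    have lin: "u + u + u * w = (2 + w) * u" for u w :: real by (simp add: algebra_simps)
    have "\<tau> * exp (c0 * x) + sqrt (\<sigma> / \<tau>) * exp (- real (nobs (M n)) * (K2 * (\<epsilon> n)\<^sup>2)) + 1 / (\<sigma> * \<tau>) * exp (4 + 2 * (C + 1))
      \<le> exp (- ((Dc + 1) * e)) + exp (- ((Dc + 1) * e)) + exp (- ((Dc + 1) * e)) * exp (4 + 2 * (C + 1))"
      unfolding j3 by (intro add_mono j1 j2 order_refl)
    also have "\<dots> = (2 + exp (4 + 2 * (C + 1))) * exp (- ((Dc + 1) * e))" by (rule lin)
    finally have "\<tau> * exp (c0 * x) + sqrt (\<sigma> / \<tau>) * exp (- real (nobs (M n)) * (K2 * (\<epsilon> n)\<^sup>2)) + 1 / (\<sigma> * \<tau>) * exp (4 + 2 * (C + 1))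
      \<le> (2 + exp (4 + 2 * (C + 1))) * exp (- ((Dc + 1) * e))" .
    then have "real ((npred (M n) * (2 * G + 1) + 1) ^ t * N) * (\<tau> * exp (c0 * x) + sqrt (\<sigma> / \<tau>) * exp (- real (nobs (M n)) * (K2 * (\<epsilon> n)\<^sup>2)) + 1 / (\<sigma> * \<tau>) * exp (4 + 2 * (C + 1)))
      \<le> exp (Dc * e) * ((2 + exp (4 + 2 * (C + 1))) * exp (- ((Dc + 1) * e)))"
      using cnt by (intro mult_mono) (auto simp: \<tau>_def \<sigma>_def intro!: add_nonneg_nonneg)
    also have "\<dots> = (2 + exp (4 + 2 * (C + 1))) * (exp (Dc * e) * exp (- ((Dc + 1) * e)))" by simp
    also have "exp (Dc * e) * exp (- ((Dc + 1) * e)) = exp (- e)" unfolding exp_add[symmetric] by (simp add: algebra_simps)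
    finally show ?thesis .
  qed
  show ?thesis
    unfolding K2_def[symmetric] using first second
    by (intro order_trans[OF bound] ennreal_leI) (simp add: bnd_def x_def e_def)
qed

theorem contraction:
  "\<exists>K2>0. (\<lambda>n. expected_posterior (M n) {z \<in> space (prior (M n)). renyi_div (M n) z (theta0 (M n), eta0 (M n)) > K2 * (\<epsilon> n)\<^sup>2}) \<longlonglongrightarrow> 0"
proof (intro exI conjI)
  show "0 < 4 * Dc + 2 * c0 + 4" using B_gt(4) c0_pos(2) by simp
  show "(\<lambda>n. expected_posterior (M n) {z \<in> space (prior (M n)). renyi_div (M n) z (theta0 (M n), eta0 (M n)) > (4 * Dc + 2 * c0 + 4) * (\<epsilon> n)\<^sup>2}) \<longlonglongrightarrow> 0"
  proof (rule tendsto_sandwich[OF _ _ tendsto_const])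
    show "\<forall>\<^sub>F n in sequentially. expected_posterior (M n) {z \<in> space (prior (M n)). renyi_div (M n) z (theta0 (M n), eta0 (M n)) > (4 * Dc + 2 * c0 + 4) * (\<epsilon> n)\<^sup>2} \<le> ennreal (bnd n)"
      using regular_ev by (rule eventually_mono) (rule expected_posterior_le_bnd)
    show "(\<lambda>n. ennreal (bnd n)) \<longlonglongrightarrow> 0" using tendsto_ennrealI[OF bnd_lim] by simp
  qed auto
qed

end

section \<open>The contraction theorem\<close>

theorem theorem2:
  fixes A1 A2 A3 A4 L1 L2 L3 C_ii C_iii c_iv C_iv :: real
  assumes "0 < A1" "0 < A2" "0 < A3" "0 < A4" "0 < L1" "0 < L2" "0 < L3"
    and "0 < C_ii" "0 < C_iii" "0 < c_iv" "0 < C_iv"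
  shows "\<exists>B0>0. \<forall>B>B0. \<forall>(M :: nat \<Rightarrow> 'h model) (a :: nat \<Rightarrow> real) (\<eta>' :: nat \<Rightarrow> 'h)
      (\<epsilon>bar :: nat \<Rightarrow> real) (\<gamma> :: nat \<Rightarrow> real) (\<epsilon> :: nat \<Rightarrow> real) (Hs :: nat \<Rightarrow> 'h set).
    \<comment> \<open>model and prior\<close>
    (\<forall>n\<ge>1. nobs (M n) = n \<and> valid_model (M n)) \<and>
    (\<forall>n\<ge>1. \<forall>s\<in>{1..npred (M n)}.
       A1 * real (npred (M n)) powr (- A3) * pmf (size_prior (M n)) (s - 1)
         \<le> pmf (size_prior (M n)) s \<and>
       pmf (size_prior (M n)) s
         \<le> A2 * real (npred (M n)) powr (- A4) * pmf (size_prior (M n)) (s - 1)) \<and>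
    (\<forall>n\<ge>1. design_norm (M n) / (L1 * real (npred (M n)) powr L2) \<le> rate (M n) \<and>
       rate (M n) \<le> L3 * design_norm (M n) / sqrt (real n)) \<and>
    \<comment> \<open>(i)\<close>
    (\<forall>n\<ge>1. 0 < a n) \<and> mono_on {1..} a \<and> a \<in> o(\<lambda>n. real n) \<and>
    (\<forall>n\<ge>1. \<eta>' n \<in> space (eta_prior (M n))) \<and>
    (\<lambda>n. a n * max_Delta_dist2 (M n) (\<eta>' n) (eta0 (M n))) \<longlonglongrightarrow> 0 \<and>
    (\<forall>n\<ge>1. \<forall>\<eta>1\<in>space (eta_prior (M n)). \<forall>\<eta>2\<in>space (eta_prior (M n)).
       max_Delta_dist2 (M n) \<eta>1 \<eta>2 \<le> a n * (dB (M n) \<eta>1 \<eta>2)\<^sup>2) \<and>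
    \<comment> \<open>(ii)\<close>
    (\<forall>n\<ge>1. 0 < \<epsilon>bar n) \<and>
    (\<lambda>n. a n * (\<epsilon>bar n)\<^sup>2) \<longlonglongrightarrow> 0 \<and>
    filterlim (\<lambda>n. real n * (\<epsilon>bar n)\<^sup>2) at_top sequentially \<and>
    (\<forall>n\<ge>1. let P = measure (eta_prior (M n))
                     {\<eta> \<in> space (eta_prior (M n)). dn (M n) \<eta> (eta0 (M n)) \<le> \<epsilon>bar n}
            in 0 < P \<and> ln P \<ge> - C_ii * (real n * (\<epsilon>bar n)\<^sup>2)) \<and>
    \<comment> \<open>(iii)\<close>
    (\<forall>n\<ge>1. Max ((\<lambda>j. \<bar>theta0 (M n) j\<bar>) ` {..<npred (M n)})
              \<le> C_iii * (ln (real (npred (M n))) / rate (M n))) \<and>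
    \<comment> \<open>(iv)\<close>
    (\<forall>n\<ge>1. c_iv \<le> Min ((\<lambda>i. rho_min (Delta (M n) (eta0 (M n)) i)) ` {..<n}) \<and>
            Max ((\<lambda>i. rho_max (Delta (M n) (eta0 (M n)) i)) ` {..<n}) \<le> C_iv) \<and>
    \<comment> \<open>(v)\<close>
    (\<forall>n\<ge>1. 0 < \<gamma> n) \<and>
    (\<forall>n\<ge>1. \<epsilon> n \<ge> sqrt (s_star (M n) (\<epsilon>bar n) *
       ln (max (real (npred (M n))) (max (real (bmax (M n))) (\<gamma> n))) / real n)) \<and>
    (\<lambda>n. (\<epsilon> n)\<^sup>2 / real (bmax (M n))) \<longlonglongrightarrow> 0 \<and>
    (\<forall>n\<ge>1. Hs n \<in> sets (eta_prior (M n))) \<and>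
    (\<forall>n\<ge>1. \<forall>i<n. \<forall>\<eta>\<in>Hs n. rho_min (Delta (M n) \<eta> i) \<ge> 1 / \<gamma> n) \<and>
    (\<exists>C_v>0. \<forall>n\<ge>1. \<exists>N.
       covering_number (nuis (M n)) (1 / (6 * real (bmax (M n)) * \<gamma> n * real n powr (3 / 2)))
         (Hs n) (dn (M n)) = enat N \<and>
       ln (real N) \<le> C_v * (real n * (\<epsilon> n)\<^sup>2)) \<and>
    (\<lambda>n. exp (B * s_star (M n) (\<epsilon>bar n) * ln (real (npred (M n)))) *
           measure (eta_prior (M n)) (space (eta_prior (M n)) - Hs n)) \<longlonglongrightarrow> 0
    \<longrightarrow>
    (\<exists>K2>0. (\<lambda>n. expected_posterior (M n)
        {z \<in> space (prior (M n)). renyi_div (M n) z (theta0 (M n), eta0 (M n)) > K2 * (\<epsilon> n)\<^sup>2})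
      \<longlonglongrightarrow> 0)"
\<comment> \<open>The threshold is explicit and free of C_v, which is obtained only after B and
  enters through Dc, hence K2.\<close>
proof (rule exI[of _ "evid_const A3 L2 C_ii C_iii c_iv C_iv"], intro conjI allI impI, goal_cases)
  case 1
  show ?case
    unfolding evid_const_def chi_const_def using assms by (intro add_pos_pos mult_pos_pos divide_pos_pos) auto
next
  case (2 B M a \<eta>' \<epsilon>bar \<gamma> \<epsilon> Hs)
  note h1 = conjunct1[OF 2(2), rule_format] and r1 = conjunct2[OF 2(2)]
  note h2 = conjunct1[OF r1, unfolded Let_def, rule_format] and r2 = conjunct2[OF r1]
  note h3 = conjunct1[OF r2, unfolded Let_def, rule_format] and r3 = conjunct2[OF r2]
  note h4 = conjunct1[OF r3, unfolded Let_def, rule_format] and r4 = conjunct2[OF r3]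
  note h5 = conjunct1[OF r4, unfolded Let_def, rule_format] and r5 = conjunct2[OF r4]
  note h6 = conjunct1[OF r5, unfolded Let_def, rule_format] and r6 = conjunct2[OF r5]
  note h7 = conjunct1[OF r6, unfolded Let_def, rule_format] and r7 = conjunct2[OF r6]
  note h8 = conjunct1[OF r7, unfolded Let_def, rule_format] and r8 = conjunct2[OF r7]
  note h9 = conjunct1[OF r8, unfolded Let_def, rule_format] and r9 = conjunct2[OF r8]
  note h10 = conjunct1[OF r9, unfolded Let_def, rule_format] and r10 = conjunct2[OF r9]
  note h11 = conjunct1[OF r10, unfolded Let_def, rule_format] and r11 = conjunct2[OF r10]
  note h12 = conjunct1[OF r11, unfolded Let_def, rule_format] and r12 = conjunct2[OF r11]
  note h13 = conjunct1[OF r12, unfolded Let_def, rule_format] and r13 = conjunct2[OF r12]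
  note h14 = conjunct1[OF r13, unfolded Let_def, rule_format] and r14 = conjunct2[OF r13]
  note h15 = conjunct1[OF r14, unfolded Let_def, rule_format] and r15 = conjunct2[OF r14]
  note h16 = conjunct1[OF r15, unfolded Let_def, rule_format] and r16 = conjunct2[OF r15]
  note h17 = conjunct1[OF r16, unfolded Let_def, rule_format] and r17 = conjunct2[OF r16]
  note h18 = conjunct1[OF r17, unfolded Let_def, rule_format] and r18 = conjunct2[OF r17]
  note h19 = conjunct1[OF r18, unfolded Let_def, rule_format] and r19 = conjunct2[OF r18]
  note h20 = conjunct1[OF r19, unfolded Let_def, rule_format] and r20 = conjunct2[OF r19]
  note h21 = conjunct1[OF r20, unfolded Let_def, rule_format] and r21 = conjunct2[OF r20]
  obtain C_v where Cv: "0 < C_v" and cov: "\<And>n. 1 \<le> n \<Longrightarrow> \<exists>N.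
      covering_number (nuis (M n)) (1 / (6 * real (bmax (M n)) * \<gamma> n * real n powr (3 / 2))) (Hs n) (dn (M n)) = enat N \<and>
       ln (real N) \<le> C_v * (real n * (\<epsilon> n)\<^sup>2)"
    using h21 by blast
  interpret contraction_setting A1 A2 A3 A4 L1 L2 L3 C_ii C_iii c_iv C_iv B C_v M a \<eta>' \<epsilon>bar \<gamma> \<epsilon> Hs
    by (rule contraction_setting.intro)
      (fact assms Cv 2(1) conjunct1[OF h1] conjunct2[OF h1] conjunct1[OF h2] conjunct2[OF h2] conjunct1[OF h3] conjunct2[OF h3]
        h4 h5 h7 h8 h9 h11 h12 conjunct1[OF h13] conjunct2[OF h13] h14 conjunct1[OF h15] conjunct2[OF h15] h16 h17 h19 h20 cov r21)+
  show ?case by (rule contraction)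
qed

end
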